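(* Let $(\mathcal J,\mathcal M,\mathcal J_0)$ be a differential Lie algebra, with $\mathcal M=W_k^0(V_k^0)=V_{-1}\oplus V_0\oplus\cdots\oplus V_{k-1}\oplus V_k^0$. Let $G$ be a Lie group with Lie algebra $\mathcal J$, let $\theta$ be the Maurer–Cartan form of $G$, and let $\omega$ be the $\mathcal M$-component of $\theta$ with respect to the decomposition $\mathcal J=\mathcal M\oplus\mathcal J_0$. Then $\omega$ determines locally a local differential equation. Explicitly: for every $g\in G$ there exist an open neighborhood $U$ of $g$, a differentiable manifold $R_k$ with $\dim R_k=\dim W_k^0(V_k^0)$, and a fibering (surjective submersion) $\pi:U\to R_k$ that admits a differentiable cross section and each of whose fibers is a maximal integral manifold of the Pfaffian system $\omega|_U=0$, such that for every differentiable cross section $\sigma:R_k\to U$ of $\pi$ there is a differentiable mapping $T:R_k\to\mathrm{Hom}(V_{-1}\times V_k^0:V_{k-1})$ for which $(R_k,W_k^0(V_k^0),T,\sigma^*\omega)$ is a local differential equation of order $k$.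
   Context: Everything is $C^\infty$, and Lie algebras are finite dimensional and real. **The spaces.** For finite dimensional real vector spaces $V_{-1},V_0$, put $V_1=\mathrm{Hom}(V_{-1},V_0)$ and for $j\ge 2$, $V_j=\{X\in\mathrm{Hom}(V_{-1},V_{j-1}) : X(u)(v)=X(v)(u)\ \text{for all } u,v\in V_{-1}\}$. For $k\ge 1$ and a linear subspace $V_k^0\subset V_k$, let $W_k^0=W_k^0(V_k^0)=V_{-1}\oplus V_0\oplus\cdots\oplus V_{k-1}\oplus V_k^0$, with the natural bracket $[\,,\,]_0$ determined by $[X_p,X_{-1}]_0=-[X_{-1},X_p]_0=X_p(X_{-1})$ for $X_{-1}\in V_{-1}$ and $X_p\in V_p$ ($1\le p\le k-1$) or $X_p\in V_k^0$ ($p=k$), and zero for all other combinations of homogeneous elements. Put $D^p=V_p\oplus V_{p+1}\oplus\cdots\oplus V_k^0$ for $0\le p\le k$ (so $D^k=V_k^0$). **The Lie algebra $\mathcal J_k(W_k^0)$.** $\mathcal J_k(W_k^0)=\{X\in\mathrm{gl}(W_k^0) : X(V_{-1}\oplus V_k^0)\subset V_{-1}\oplus V_k^0,\ X(D^p)\subset D^p\ (0\le p\le k)\}$. For $S\in\mathrm{Hom}(W_k^0,\mathcal J_k(W_k^0))$ define $\partial S\in \mathrm{Hom}(W_k^0\wedge W_k^0,W_k^0)$ by $(\partial S)(X\wedge Y)=S(X)(Y)-S(Y)(X)$. **Differential Lie algebra.** Let $\mathcal J$ be a Lie algebra. $(\mathcal J,\mathcal M,\mathcal J_0)$ is a *differential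 Lie algebra* (of order $k$) if: (1) $\mathcal J_0$ is a Lie subalgebra of $\mathcal J$ and $\mathcal M$ is a vector subspace with $\mathcal J=\mathcal M\oplus\mathcal J_0$; (2) for some $V_{-1},V_0$ and $V_k^0$ (subspaces of $\mathcal M$), $\mathcal M=W_k^0(V_k^0)$ (identified as vector spaces, with $V_k^0$ regarded as a subspace of $V_k$); (3) the linear map $\rho:\mathcal J_0\to\mathrm{gl}(\mathcal M)$, $\rho(X_0)(X)=$ the $\mathcal M$-component of $[X_0,X]$, takes values in $\mathcal J_k(W_k^0)$; (4) with $\alpha(X\wedge Y)=$ the $\mathcal M$-component of $[X,Y]$ for $X,Y\in\mathcal M$, there is $S\in\mathrm{Hom}(\mathcal M,\mathcal J_k(W_k^0))$ such that $\alpha(X\wedge Y)=[X,Y]_0+(\partial S)(X\wedge Y)$ for all $X,Y\in\mathcal M$. Here $\mathcal J_k(W_k^0)$ is the Lie algebra of those $X\in\mathrm{gl}(W_k^0)$ with $X(V_{-1}\oplus V_k^0)\subset V_{-1}\oplus V_k^0$ and $X(D^p)\subset D^p$ for $0\le p\le k$, and is unrelated to $\mathcal J,\mathcal J_0$. **Local differential equation.** A system $(R_k,W_k^0,T,\omega)$ is a *local differential equation of order $k$* if $R_k$ is a manifold with $\dim R_k=\dim W_k^0$, $\omega=\omega^{-1}+\omega^0+\cdots+\omega^k$ is a $W_k^0$-valued absolute parallelism on $R_k$ (a $W_k^0$-valued 1-form that is an isomorphism $T_xR_k\to W_k^0$ at each $x$; $\omega^p$ is its $V_p$-component, and $\omega^k$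 its $V_k^0$-component), and $T:R_k\to\mathrm{Hom}(V_{-1}\times V_k^0:V_{k-1})$ (bilinear maps) is differentiable, such that: (C$_1$) for each $x\in R_k$ and $X_k\in V_k^0$, if $T_x(X_{-1},X_k)=0$ for all $X_{-1}\in V_{-1}$ then $X_k=0$; (C$_2$) (i) $d\omega^{-1}\equiv 0 \pmod{\omega^{-1}}$; (ii) (if $k\ge2$) for $0\le p\le k-2$, $d\omega^p+[\omega^{-1}\wedge\omega^{p+1}]_0\equiv 0\pmod{\omega^0,\dots,\omega^p}$; (iii) $d\omega^{k-1}+T(\omega^{-1}\wedge\omega^k)\equiv 0\pmod{\omega^{-1}\wedge\omega^{-1},\omega^0,\dots,\omega^{k-1}}$. **Conventions on forms.** $[\omega^{-1}\wedge\omega^{q}]_0(X,Y)=[\omega^{-1}(X),\omega^{q}(Y)]_0-[\omega^{-1}(Y),\omega^{q}(X)]_0$, and similarly $T(\omega^{-1}\wedge\omega^k)(X,Y)=T(\omega^{-1}(X),\omega^k(Y))-T(\omega^{-1}(Y),\omega^k(X))$. Congruences of vector-valued 2-forms mean that the scalar components of the difference lie in the ideal of differential forms generated by the scalar components of the listed forms (for $\omega^{-1}\wedge\omega^{-1}$: by all products of two scalar components of $\omega^{-1}$). *)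

theory Defs
  imports "HOL-Analysis.Analysis" "HOL-Algebra.Group"
begin

section \<open>Smooth maps on relatively open subsets of a linear subspace\<close>

text \<open>
  Manifolds are modelled on a linear subspace \<open>E\<close> of a Euclidean space, so that the
  dimension (zero included) is \<open>dim E\<close> and is not tied to a type.  For \<open>y\<close> in a
  relatively open subset of \<open>E\<close>, the value at \<open>v \<in> E\<close> of a derivative within \<open>E\<close> is
  uniquely determined; the operator below is only used for such \<open>v\<close>.
\<close>

definition deriv_in ::
  "'e::euclidean_space set \<Rightarrow> ('e \<Rightarrow> 'b::real_normed_vector) \<Rightarrow> 'e \<Rightarrow> 'e \<Rightarrow> 'b" where
  "deriv_in E f y v = frechet_derivative f (at y within E) v"

primrec Ck_in ::
  "'e::euclidean_space set \<Rightarrow> nat \<Rightarrow> ('e \<Rightarrow> 'b::real_normed_vector) \<Rightarrow> 'e set \<Rightarrow> bool" where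
  "Ck_in E 0 f S = continuous_on S f"
| "Ck_in E (Suc n) f S =
     ((\<forall>y\<in>S. f differentiable (at y within E)) \<and>
      (\<forall>v\<in>E. Ck_in E n (\<lambda>y. deriv_in E f y v) S))"

definition smooth_in ::
  "'e::euclidean_space set \<Rightarrow> ('e \<Rightarrow> 'b::real_normed_vector) \<Rightarrow> 'e set \<Rightarrow> bool" where
  "smooth_in E f S \<longleftrightarrow> (\<forall>n. Ck_in E n f S)"


section \<open>Manifolds\<close>

type_synonym ('p, 'e) chart = "'p set \<times> ('p \<Rightarrow> 'e)"

definition chart_inv :: "('p, 'e) chart \<Rightarrow> 'e \<Rightarrow> 'p" where
  "chart_inv c = inv_into (fst c) (snd c)"

record ('p, 'e) manifold =
  mtop :: "'p topology"
  model :: "'e set"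
  atlas :: "('p, 'e) chart set"

abbreviation points :: "('p, 'e) manifold \<Rightarrow> 'p set" where
  "points M \<equiv> topspace (mtop M)"

definition smooth_manifold :: "('p, 'e::euclidean_space) manifold \<Rightarrow> bool" where
  "smooth_manifold M \<longleftrightarrow>
     Hausdorff_space (mtop M) \<and> second_countable (mtop M) \<and> subspace (model M) \<and>
     (\<Union>c\<in>atlas M. fst c) = points M \<and>
     (\<forall>c\<in>atlas M.
        openin (mtop M) (fst c) \<and>
        openin (top_of_set (model M)) (snd c ` fst c) \<and>
        homeomorphic_map (subtopology (mtop M) (fst c)) (top_of_set (snd c ` fst c)) (snd c)) \<and>
     (\<forall>c\<in>atlas M. \<forall>d\<in>atlas M.
        smooth_in (model M) (snd d \<circ> chart_inv c) (snd c ` (fst c \<inter> fst d)))"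

definition mdim :: "('p, 'e::euclidean_space) manifold \<Rightarrow> nat" where
  "mdim M = dim (model M)"

definition open_submanifold :: "('p, 'e) manifold \<Rightarrow> 'p set \<Rightarrow> ('p, 'e) manifold" where
  "open_submanifold M U =
     \<lparr>mtop = subtopology (mtop M) U, model = model M,
      atlas = {(fst c \<inter> U, snd c) | c. c \<in> atlas M}\<rparr>"

definition prod_manifold ::
  "('p, 'e) manifold \<Rightarrow> ('q, 'f) manifold \<Rightarrow> ('p \<times> 'q, 'e \<times> 'f) manifold" where
  "prod_manifold M N =
     \<lparr>mtop = prod_topology (mtop M) (mtop N), model = model M \<times> model N,
      atlas = {(fst c \<times> fst d, map_prod (snd c) (snd d)) | c d. c \<in> atlas M \<and> d \<in> atlas N}\<rparr>"

definition smooth_map ::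
  "('p, 'e::euclidean_space) manifold \<Rightarrow> ('q, 'f::euclidean_space) manifold \<Rightarrow> ('p \<Rightarrow> 'q) \<Rightarrow> bool"
  where
  "smooth_map M N f \<longleftrightarrow>
     continuous_map (mtop M) (mtop N) f \<and>
     (\<forall>c\<in>atlas M. \<forall>d\<in>atlas N.
        smooth_in (model M) (snd d \<circ> f \<circ> chart_inv c) (snd c ` (fst c \<inter> f -` fst d)))"

definition smooth_fun ::
  "('p, 'e::euclidean_space) manifold \<Rightarrow> ('p \<Rightarrow> 'b::real_normed_vector) \<Rightarrow> bool" where
  "smooth_fun M f \<longleftrightarrow> (\<forall>c\<in>atlas M. smooth_in (model M) (f \<circ> chart_inv c) (snd c ` fst c))"


section \<open>Tangent vectors\<close>

text \<open>
  A tangent vector at \<open>x\<close> is a family of coordinate vectors, one for each chart around \<open>x\<close>,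
  which is compatible with the changes of charts; it is \<open>0\<close> at all other charts, so that the
  vector space operations of the tangent space are the pointwise ones.
\<close>

type_synonym ('p, 'e) tvec = "('p, 'e) chart \<Rightarrow> 'e"

definition charts_at :: "('p, 'e) manifold \<Rightarrow> 'p \<Rightarrow> ('p, 'e) chart set" where
  "charts_at M x = {c \<in> atlas M. x \<in> fst c}"

definition some_chart :: "('p, 'e) manifold \<Rightarrow> 'p \<Rightarrow> ('p, 'e) chart" where
  "some_chart M x = (SOME c. c \<in> charts_at M x)"

definition tangent_space :: "('p, 'e::euclidean_space) manifold \<Rightarrow> 'p \<Rightarrow> ('p, 'e) tvec set" where
  "tangent_space M x =
     {t. (\<forall>c. c \<notin> charts_at M x \<longrightarrow> t c = 0) \<and>
         (\<forall>c\<in>charts_at M x. t c \<in> model M) \<and>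
         (\<forall>c\<in>charts_at M x. \<forall>d\<in>charts_at M x.
            t d = deriv_in (model M) (snd d \<circ> chart_inv c) (snd c x) (t c))}"

text \<open>The tangent vector at \<open>x\<close> with coordinates \<open>v\<close> in the chart \<open>c\<close>.\<close>

definition tvec_of ::
  "('p, 'e::euclidean_space) manifold \<Rightarrow> 'p \<Rightarrow> ('p, 'e) chart \<Rightarrow> 'e \<Rightarrow> ('p, 'e) tvec" where
  "tvec_of M x c v =
     (\<lambda>d. if d \<in> charts_at M x
          then deriv_in (model M) (snd d \<circ> chart_inv c) (snd c x) v else 0)"

definition linear_on_tangent ::
  "('p, 'e::euclidean_space) manifold \<Rightarrow> 'p \<Rightarrow> (('p, 'e) tvec \<Rightarrow> 'b::real_vector) \<Rightarrow> bool" where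
  "linear_on_tangent M x h \<longleftrightarrow>
     (\<forall>s\<in>tangent_space M x. \<forall>t\<in>tangent_space M x. h (\<lambda>c. s c + t c) = h s + h t) \<and>
     (\<forall>r. \<forall>t\<in>tangent_space M x. h (\<lambda>c. r *\<^sub>R t c) = r *\<^sub>R h t)"

text \<open>The differential of \<open>f : M \<rightarrow> N\<close> at \<open>x\<close> (the choice of the chart is immaterial).\<close>

definition pushforward ::
  "('p, 'e::euclidean_space) manifold \<Rightarrow> ('q, 'f::euclidean_space) manifold \<Rightarrow> ('p \<Rightarrow> 'q) \<Rightarrow>
   'p \<Rightarrow> ('p, 'e) tvec \<Rightarrow> ('q, 'f) tvec" where
  "pushforward M N f x t =
     (let c = some_chart M x in
      (\<lambda>d. if d \<in> charts_at N (f x)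
           then deriv_in (model M) (snd d \<circ> f \<circ> chart_inv c) (snd c x) (t c) else 0))"

text \<open>The commutator of vector fields, \<open>DY(X) - DX(Y)\<close> in coordinates.\<close>

definition lie_bracket ::
  "('p, 'e::euclidean_space) manifold \<Rightarrow> ('p \<Rightarrow> ('p, 'e) tvec) \<Rightarrow> ('p \<Rightarrow> ('p, 'e) tvec) \<Rightarrow>
   'p \<Rightarrow> ('p, 'e) tvec" where
  "lie_bracket M X Y x =
     (let c = some_chart M x; y = snd c x in
      tvec_of M x c
        (deriv_in (model M) (\<lambda>z. Y (chart_inv c z) c) y (X x c)
         - deriv_in (model M) (\<lambda>z. X (chart_inv c z) c) y (Y x c)))"


section \<open>Differential forms of degree one and two\<close>

type_synonym ('p, 'e, 'b) form1 = "'p \<Rightarrow> ('p, 'e) tvec \<Rightarrow> 'b"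
type_synonym ('p, 'e, 'b) form2 = "'p \<Rightarrow> ('p, 'e) tvec \<Rightarrow> ('p, 'e) tvec \<Rightarrow> 'b"

definition smooth_form1 ::
  "('p, 'e::euclidean_space) manifold \<Rightarrow> ('p, 'e, 'b::real_normed_vector) form1 \<Rightarrow> bool" where
  "smooth_form1 M \<omega> \<longleftrightarrow>
     (\<forall>x\<in>points M. linear_on_tangent M x (\<omega> x)) \<and>
     (\<forall>c\<in>atlas M. \<forall>v\<in>model M.
        smooth_in (model M) (\<lambda>y. \<omega> (chart_inv c y) (tvec_of M (chart_inv c y) c v)) (snd c ` fst c))"

definition pullback ::
  "('p, 'e::euclidean_space) manifold \<Rightarrow> ('q, 'f::euclidean_space) manifold \<Rightarrow> ('p \<Rightarrow> 'q) \<Rightarrow>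
   ('q, 'f, 'b) form1 \<Rightarrow> ('p, 'e, 'b) form1" where
  "pullback M N f \<omega> = (\<lambda>x t. \<omega> (f x) (pushforward M N f x t))"

text \<open>
  The exterior derivative, normalised by \<open>d\<omega>(X,Y) = X(\<omega>(Y)) - Y(\<omega>(X)) - \<omega>([X,Y])\<close>
  (no factor one half, as for the wedge products below), evaluated on the commuting
  coordinate fields which extend the two vectors.
\<close>

definition ext_deriv ::
  "('p, 'e::euclidean_space) manifold \<Rightarrow> ('p, 'e, 'b::real_normed_vector) form1 \<Rightarrow>
   ('p, 'e, 'b) form2" where
  "ext_deriv M \<omega> x s t =
     (let c = some_chart M x; y = snd c x;
          \<omega>c = (\<lambda>v z. \<omega> (chart_inv c z) (tvec_of M (chart_inv c z) c v)) in
      deriv_in (model M) (\<omega>c (t c)) y (s c) - deriv_in (model M) (\<omega>c (s c)) y (t c))"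

definition wedge11 ::
  "('p, 'e, real) form1 \<Rightarrow> ('p, 'e, real) form1 \<Rightarrow> ('p, 'e, real) form2" where
  "wedge11 \<beta> \<alpha> = (\<lambda>x s t. \<beta> x s * \<alpha> x t - \<beta> x t * \<alpha> x s)"

text \<open>The part of degree two of the ideal generated by the 1-forms \<open>A\<close> and the 2-forms \<open>B\<close>.\<close>

inductive_set ideal2 ::
  "('p, 'e::euclidean_space) manifold \<Rightarrow> ('p, 'e, real) form1 set \<Rightarrow> ('p, 'e, real) form2 set \<Rightarrow>
   ('p, 'e, real) form2 set"
  for M A B where
  zero: "(\<lambda>x s t. 0) \<in> ideal2 M A B"
| add: "\<Omega> \<in> ideal2 M A B \<Longrightarrow> \<Omega>' \<in> ideal2 M A B \<Longrightarrow> (\<lambda>x s t. \<Omega> x s t + \<Omega>' x s t) \<in> ideal2 M A B"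
| gen1: "smooth_form1 M \<beta> \<Longrightarrow> \<alpha> \<in> A \<Longrightarrow> wedge11 \<beta> \<alpha> \<in> ideal2 M A B"
| gen2: "smooth_fun M f \<Longrightarrow> \<gamma> \<in> B \<Longrightarrow> (\<lambda>x s t. f x * \<gamma> x s t) \<in> ideal2 M A B"

text \<open>
  \<open>\<tau> \<equiv> 0\<close> modulo the ideal, for a vector valued 2-form; the scalar components of \<open>\<tau>\<close> are its
  compositions with linear functionals.
\<close>

definition cong_zero ::
  "('p, 'e::euclidean_space) manifold \<Rightarrow> ('p, 'e, 'w::euclidean_space) form2 \<Rightarrow>
   ('p, 'e, real) form1 set \<Rightarrow> ('p, 'e, real) form2 set \<Rightarrow> bool" where
  "cong_zero M \<tau> A B \<longleftrightarrow>
     (\<forall>l :: 'w \<Rightarrow> real. linear l \<longrightarrow>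
        (\<exists>\<Omega>\<in>ideal2 M A B. \<forall>x\<in>points M. \<forall>s\<in>tangent_space M x. \<forall>t\<in>tangent_space M x.
           l (\<tau> x s t) = \<Omega> x s t))"


section \<open>Fiberings and maximal integral manifolds\<close>

definition fibering ::
  "('p, 'e::euclidean_space) manifold \<Rightarrow> ('q, 'f::euclidean_space) manifold \<Rightarrow> ('p \<Rightarrow> 'q) \<Rightarrow> bool"
  where
  "fibering M N f \<longleftrightarrow>
     smooth_map M N f \<and> f ` points M = points N \<and>
     (\<forall>x\<in>points M. pushforward M N f x ` tangent_space M x = tangent_space N (f x))"

definition cross_section ::
  "('p, 'e::euclidean_space) manifold \<Rightarrow> ('q, 'f::euclidean_space) manifold \<Rightarrow> ('p \<Rightarrow> 'q) \<Rightarrow>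
   ('q \<Rightarrow> 'p) \<Rightarrow> bool" where
  "cross_section M N f \<sigma> \<longleftrightarrow> smooth_map N M \<sigma> \<and> (\<forall>y\<in>points N. f (\<sigma> y) = y)"

text \<open>
  A connected integral manifold of \<open>\<omega> = 0\<close>: an immersed submanifold \<open>N\<close> of \<open>M\<close> (a set of points
  of \<open>M\<close> with a manifold structure of its own, whose topology may be finer than the induced
  one) whose tangent spaces are the kernels of \<open>\<omega>\<close>.
\<close>

definition integral_manifold ::
  "('p, 'e::euclidean_space) manifold \<Rightarrow> ('p, 'e, 'b::real_normed_vector) form1 \<Rightarrow>
   ('p, 'e) manifold \<Rightarrow> bool" where
  "integral_manifold M \<omega> N \<longleftrightarrow>
     smooth_manifold N \<and> points N \<subseteq> points M \<and> points N \<noteq> {} \<and> connected_space (mtop N) \<and>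
     smooth_map N M (\<lambda>x. x) \<and>
     (\<forall>x\<in>points N.
        inj_on (pushforward N M (\<lambda>x. x) x) (tangent_space N x) \<and>
        pushforward N M (\<lambda>x. x) x ` tangent_space N x = {t \<in> tangent_space M x. \<omega> x t = 0})"

definition maximal_integral_manifold ::
  "('p, 'e::euclidean_space) manifold \<Rightarrow> ('p, 'e, 'b::real_normed_vector) form1 \<Rightarrow>
   ('p, 'e) manifold \<Rightarrow> bool" where
  "maximal_integral_manifold M \<omega> N \<longleftrightarrow>
     integral_manifold M \<omega> N \<and>
     (\<forall>N'. integral_manifold M \<omega> N' \<and> points N \<subseteq> points N' \<longrightarrow> points N' = points N)"


section \<open>Lie algebras and Lie groups\<close>

text \<open>A finite dimensional real Lie algebra is realised on a subspace of a Euclidean space.\<close>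

definition lie_algebra ::
  "'j::euclidean_space set \<Rightarrow> ('j \<Rightarrow> 'j \<Rightarrow> 'j) \<Rightarrow> bool" where
  "lie_algebra J br \<longleftrightarrow>
     subspace J \<and>
     (\<forall>x\<in>J. \<forall>y\<in>J. br x y \<in> J) \<and>
     (\<forall>x\<in>J. \<forall>y\<in>J. \<forall>z\<in>J. br (x + y) z = br x z + br y z \<and> br z (x + y) = br z x + br z y) \<and>
     (\<forall>r. \<forall>x\<in>J. \<forall>y\<in>J. br (r *\<^sub>R x) y = r *\<^sub>R br x y \<and> br x (r *\<^sub>R y) = r *\<^sub>R br x y) \<and>
     (\<forall>x\<in>J. br x x = 0) \<and>
     (\<forall>x\<in>J. \<forall>y\<in>J. \<forall>z\<in>J. br x (br y z) + br y (br z x) + br z (br x y) = 0)"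

text \<open>The \<open>M\<close>-component with respect to a decomposition \<open>M \<oplus> J\<^sub>0\<close>.\<close>

definition proj_along :: "'j::real_vector set \<Rightarrow> 'j set \<Rightarrow> 'j \<Rightarrow> 'j" where
  "proj_along M J0 x = (THE m. m \<in> M \<and> (\<exists>a\<in>J0. x = m + a))"

definition lie_group :: "'g monoid \<Rightarrow> ('g, 'e::euclidean_space) manifold \<Rightarrow> bool" where
  "lie_group G MG \<longleftrightarrow>
     group G \<and> smooth_manifold MG \<and> points MG = carrier G \<and>
     smooth_map (prod_manifold MG MG) MG (\<lambda>(x, y). x \<otimes>\<^bsub>G\<^esub> y) \<and>
     smooth_map MG MG (\<lambda>x. inv\<^bsub>G\<^esub> x)"

definition left_invariant_field ::
  "'g monoid \<Rightarrow> ('g, 'e::euclidean_space) manifold \<Rightarrow> ('g, 'e) tvec \<Rightarrow> 'g \<Rightarrow> ('g, 'e) tvec" where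
  "left_invariant_field G MG t = (\<lambda>g. pushforward MG MG (\<lambda>h. g \<otimes>\<^bsub>G\<^esub> h) \<one>\<^bsub>G\<^esub> t)"

text \<open>
  \<open>\<kappa>\<close> identifies the Lie algebra of the Lie group (the tangent space at the identity, with the
  bracket of left invariant vector fields) with \<open>(J, br)\<close>.
\<close>

definition lie_algebra_identification ::
  "'g monoid \<Rightarrow> ('g, 'e::euclidean_space) manifold \<Rightarrow> 'j::euclidean_space set \<Rightarrow>
   ('j \<Rightarrow> 'j \<Rightarrow> 'j) \<Rightarrow> (('g, 'e) tvec \<Rightarrow> 'j) \<Rightarrow> bool" where
  "lie_algebra_identification G MG J br \<kappa> \<longleftrightarrow>
     linear_on_tangent MG \<one>\<^bsub>G\<^esub> \<kappa> \<and>
     bij_betw \<kappa> (tangent_space MG \<one>\<^bsub>G\<^esub>) J \<and>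
     (\<forall>s\<in>tangent_space MG \<one>\<^bsub>G\<^esub>. \<forall>t\<in>tangent_space MG \<one>\<^bsub>G\<^esub>.
        \<kappa> (lie_bracket MG (left_invariant_field G MG s) (left_invariant_field G MG t) \<one>\<^bsub>G\<^esub>)
        = br (\<kappa> s) (\<kappa> t))"

definition maurer_cartan ::
  "'g monoid \<Rightarrow> ('g, 'e::euclidean_space) manifold \<Rightarrow> (('g, 'e) tvec \<Rightarrow> 'j) \<Rightarrow> ('g, 'e, 'j) form1"
  where
  "maurer_cartan G MG \<kappa> = (\<lambda>g t. \<kappa> (pushforward MG MG (\<lambda>h. inv\<^bsub>G\<^esub> g \<otimes>\<^bsub>G\<^esub> h) g t))"


section \<open>The spaces \<open>W\<^sub>k\<^sup>0\<close>\<close>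

text \<open>
  A space \<open>W\<^sub>k\<^sup>0\<close> is realised inside a Euclidean space by subspaces \<open>V (-1), V 0, \<dots>, V k\<close> in
  direct sum, where \<open>V k\<close> stands for the space \<open>V\<^sub>k\<^sup>0\<close>.  The nested spaces of homomorphisms
  cannot literally be values of one typed function, hence the operation \<open>app X u\<close>, to be read as
  \<open>X(u)\<close>: it identifies \<open>V p\<close> linearly with all of the space of homomorphisms which defines
  \<open>V\<^sub>p\<close> if \<open>1 \<le> p < k\<close>, and with a subspace of it if \<open>p = k\<close>.
\<close>

definition Hom_set :: "'v::real_vector set \<Rightarrow> 'w::real_vector set \<Rightarrow> ('v \<Rightarrow> 'w) set" where
  "Hom_set A B =
     {f. f \<in> A \<rightarrow>\<^sub>E B \<and> (\<forall>u\<in>A. \<forall>v\<in>A. f (u + v) = f u + f v) \<and> (\<forall>r. \<forall>u\<in>A. f (r *\<^sub>R u) = r *\<^sub>R f u)}"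

definition jet_hom :: "(int \<Rightarrow> 'w::real_vector set) \<Rightarrow> ('w \<Rightarrow> 'w \<Rightarrow> 'w) \<Rightarrow> int \<Rightarrow> ('w \<Rightarrow> 'w) set" where
  "jet_hom V app p =
     {f \<in> Hom_set (V (-1)) (V (p - 1)).
        p \<ge> 2 \<longrightarrow> (\<forall>u\<in>V (-1). \<forall>v\<in>V (-1). app (f u) v = app (f v) u)}"

definition jet_space ::
  "nat \<Rightarrow> (int \<Rightarrow> 'w::real_vector set) \<Rightarrow> ('w \<Rightarrow> 'w \<Rightarrow> 'w) \<Rightarrow> bool" where
  "jet_space k V app \<longleftrightarrow>
     k \<ge> 1 \<and>
     (\<forall>p\<in>{-1..int k}. subspace (V p)) \<and>
     (\<forall>f. (\<forall>p\<in>{-1..int k}. f p \<in> V p) \<and> (\<Sum>p\<in>{-1..int k}. f p) = 0 \<longrightarrow>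
          (\<forall>p\<in>{-1..int k}. f p = 0)) \<and>
     (\<forall>p\<in>{1..int k}. \<forall>u\<in>V (-1). \<forall>X\<in>V p. \<forall>Y\<in>V p. \<forall>r.
        app (X + Y) u = app X u + app Y u \<and> app (r *\<^sub>R X) u = r *\<^sub>R app X u) \<and>
     (\<forall>p\<in>{1..<int k}. bij_betw (\<lambda>X. restrict (app X) (V (-1))) (V p) (jet_hom V app p)) \<and>
     inj_on (\<lambda>X. restrict (app X) (V (-1))) (V (int k)) \<and>
     (\<lambda>X. restrict (app X) (V (-1))) ` V (int k) \<subseteq> jet_hom V app (int k)"

definition jet_carrier :: "nat \<Rightarrow> (int \<Rightarrow> 'w::real_vector set) \<Rightarrow> 'w set" where
  "jet_carrier k V = span (\<Union>p\<in>{-1..int k}. V p)"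

definition jet_filt :: "nat \<Rightarrow> (int \<Rightarrow> 'w::real_vector set) \<Rightarrow> int \<Rightarrow> 'w set" where
  "jet_filt k V p = span (\<Union>q\<in>{p..int k}. V q)"

text \<open>The component in \<open>V p\<close> of an element of \<open>W\<^sub>k\<^sup>0\<close>.\<close>

definition jet_comp :: "nat \<Rightarrow> (int \<Rightarrow> 'w::real_vector set) \<Rightarrow> int \<Rightarrow> 'w \<Rightarrow> 'w" where
  "jet_comp k V p X = (SOME f. (\<forall>q\<in>{-1..int k}. f q \<in> V q) \<and> (\<Sum>q\<in>{-1..int k}. f q) = X) p"

definition bracket0 ::
  "nat \<Rightarrow> (int \<Rightarrow> 'w::real_vector set) \<Rightarrow> ('w \<Rightarrow> 'w \<Rightarrow> 'w) \<Rightarrow> 'w \<Rightarrow> 'w \<Rightarrow> 'w" where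
  "bracket0 k V app X Y =
     (\<Sum>p\<in>{1..int k}. app (jet_comp k V p X) (jet_comp k V (-1) Y) - app (jet_comp k V p Y) (jet_comp k V (-1) X))"

text \<open>Endomorphisms of \<open>W\<^sub>k\<^sup>0\<close> are represented as extensional functions.\<close>

definition jet_endos :: "nat \<Rightarrow> (int \<Rightarrow> 'w::real_vector set) \<Rightarrow> ('w \<Rightarrow> 'w) set" where
  "jet_endos k V =
     {A \<in> Hom_set (jet_carrier k V) (jet_carrier k V).
        A ` span (V (-1) \<union> V (int k)) \<subseteq> span (V (-1) \<union> V (int k)) \<and>
        (\<forall>p\<in>{0..int k}. A ` jet_filt k V p \<subseteq> jet_filt k V p)}"

definition differential_lie_algebra ::
  "nat \<Rightarrow> (int \<Rightarrow> 'j::euclidean_space set) \<Rightarrow> ('j \<Rightarrow> 'j \<Rightarrow> 'j) \<Rightarrow>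
   'j set \<Rightarrow> ('j \<Rightarrow> 'j \<Rightarrow> 'j) \<Rightarrow> 'j set \<Rightarrow> 'j set \<Rightarrow> bool" where
  "differential_lie_algebra k V app J br M J0 \<longleftrightarrow>
     lie_algebra J br \<and>
     subspace J0 \<and> (\<forall>x\<in>J0. \<forall>y\<in>J0. br x y \<in> J0) \<and>
     subspace M \<and> {m + a | m a. m \<in> M \<and> a \<in> J0} = J \<and> M \<inter> J0 = {0} \<and>
     jet_space k V app \<and> M = jet_carrier k V \<and>
     (\<forall>a\<in>J0. (\<lambda>x\<in>M. proj_along M J0 (br a x)) \<in> jet_endos k V) \<and>
     (\<exists>S. (\<forall>x\<in>M. S x \<in> jet_endos k V) \<and>
          (\<forall>x\<in>M. \<forall>y\<in>M. \<forall>z\<in>M. S (x + y) z = S x z + S y z) \<and>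
          (\<forall>r. \<forall>x\<in>M. \<forall>z\<in>M. S (r *\<^sub>R x) z = r *\<^sub>R S x z) \<and>
          (\<forall>x\<in>M. \<forall>y\<in>M.
             proj_along M J0 (br x y) = bracket0 k V app x y + (S x y - S y x)))"


section \<open>Local differential equations\<close>

definition absolute_parallelism ::
  "('p, 'e::euclidean_space) manifold \<Rightarrow> 'w::euclidean_space set \<Rightarrow> ('p, 'e, 'w) form1 \<Rightarrow> bool" where
  "absolute_parallelism R W \<omega> \<longleftrightarrow>
     smooth_form1 R \<omega> \<and> (\<forall>x\<in>points R. bij_betw (\<omega> x) (tangent_space R x) W)"

text \<open>The scalar components of the forms \<open>\<omega>\<^sup>q\<close>, \<open>q \<in> Q\<close>.\<close>

definition scalar_comps ::
  "nat \<Rightarrow> (int \<Rightarrow> 'w::euclidean_space set) \<Rightarrow> ('p, 'e, 'w) form1 \<Rightarrow> int set \<Rightarrow>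
   ('p, 'e, real) form1 set" where
  "scalar_comps k V \<omega> Q =
     {(\<lambda>x t. l (jet_comp k V q (\<omega> x t))) | (l :: 'w \<Rightarrow> real) q. linear l \<and> q \<in> Q}"

text \<open>\<open>B(\<alpha> \<and> \<beta>)\<close> for vector valued 1-forms and a pairing \<open>B\<close> depending on the point.\<close>

definition wedge_pair ::
  "('p \<Rightarrow> 'a \<Rightarrow> 'b \<Rightarrow> 'w::ab_group_add) \<Rightarrow> ('p, 'e, 'a) form1 \<Rightarrow> ('p, 'e, 'b) form1 \<Rightarrow>
   ('p, 'e, 'w) form2" where
  "wedge_pair B \<alpha> \<beta> = (\<lambda>x s t. B x (\<alpha> x s) (\<beta> x t) - B x (\<alpha> x t) (\<beta> x s))"

definition local_differential_equation ::
  "nat \<Rightarrow> (int \<Rightarrow> 'w::euclidean_space set) \<Rightarrow> ('w \<Rightarrow> 'w \<Rightarrow> 'w) \<Rightarrow>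
   ('p, 'e::euclidean_space) manifold \<Rightarrow> ('p \<Rightarrow> 'w \<Rightarrow> 'w \<Rightarrow> 'w) \<Rightarrow> ('p, 'e, 'w) form1 \<Rightarrow> bool" where
  "local_differential_equation k V app R T \<omega> \<longleftrightarrow>
     (let K = int k;
          \<omega>c = (\<lambda>p x t. jet_comp k V p (\<omega> x t));
          d = ext_deriv R in
      jet_space k V app \<and> smooth_manifold R \<and> mdim R = dim (jet_carrier k V) \<and>
      absolute_parallelism R (jet_carrier k V) \<omega> \<and>
      (\<forall>x\<in>points R.
         (\<forall>u\<in>V (-1). restrict (T x u) (V K) \<in> Hom_set (V K) (V (K - 1))) \<and>
         (\<forall>X\<in>V K. (\<lambda>u\<in>V (-1). T x u X) \<in> Hom_set (V (-1)) (V (K - 1)))) \<and>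
      (\<forall>u\<in>V (-1). \<forall>X\<in>V K. smooth_fun R (\<lambda>x. T x u X)) \<and>
      (\<forall>x\<in>points R. \<forall>X\<in>V K. (\<forall>u\<in>V (-1). T x u X = 0) \<longrightarrow> X = 0) \<and>
      cong_zero R (d (\<omega>c (-1))) (scalar_comps k V \<omega> {-1}) {} \<and>
      (\<forall>p. 0 \<le> p \<and> p \<le> K - 2 \<longrightarrow>
         cong_zero R
           (\<lambda>x s t. d (\<omega>c p) x s t
                    + wedge_pair (\<lambda>x. bracket0 k V app) (\<omega>c (-1)) (\<omega>c (p + 1)) x s t)
           (scalar_comps k V \<omega> {0..p}) {}) \<and>
      cong_zero R
        (\<lambda>x s t. d (\<omega>c (K - 1)) x s t + wedge_pair T (\<omega>c (-1)) (\<omega>c K) x s t)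
        (scalar_comps k V \<omega> {0..K - 1})
        {wedge11 \<alpha> \<beta> | \<alpha> \<beta>. \<alpha> \<in> scalar_comps k V \<omega> {-1} \<and> \<beta> \<in> scalar_comps k V \<omega> {-1}})"

end

theory Submission
  imports Defs
begin

text \<open>
  For a map \<open>h\<close> from an open piece of a vector space to \<open>G\<close>, the pullback of the Maurer--Cartan form
  is the logarithmic derivative of \<open>h\<close>.  The kernel of \<open>\<omega>\<close> consists of the left translates of \<open>J0\<close>.
  To straighten it near \<open>g\<close>, take a submanifold transverse to \<open>J0\<close> and multiply it from the right by
  one-parameter groups in the directions of a basis of \<open>J0\<close>.  Since \<open>J0\<close> is a subalgebra, linear
  differential equations show that the logarithmic derivative of the resulting parametrisation takes
  values in \<open>J0\<close> exactly in the directions of \<open>J0\<close>.  So \<open>\<pi>\<close> can be the linear projection along \<open>J0\<close>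
  in this chart; it is constant on connected integral manifolds, because its differential vanishes there.

  Along a cross section, the structure equation \<open>d\<theta>(X, Y) = - [\<theta>(X), \<theta>(Y)]\<close> and the definition of a
  differential Lie algebra give \<open>d\<omega>(X, Y) = - [\<omega>(X), \<omega>(Y)]\<^sub>0 - \<Phi>(X)(\<omega>(Y)) + \<Phi>(Y)(\<omega>(X))\<close>, where \<open>\<Phi>\<close> is the
  sum of \<open>S(\<omega>)\<close> and of the action \<open>\<rho>\<close> of the \<open>J0\<close>-component of \<open>\<theta>\<close>.  As \<open>\<Phi>\<close> takes values in the
  endomorphisms preserving the \<open>D\<^sup>p\<close> and the sum of \<open>V\<^sub>-\<^sub>1\<close> and \<open>V\<^sub>k\<^sup>0\<close>, its contribution vanishes modulo the
  given ideals, and \<open>T\<close> can be the constant \<open>[ , ]\<^sub>0\<close>.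
\<close>

section \<open>Calculus along a subspace\<close>

text \<open>Smooth dependence of solutions on initial values is supplied by the group: each
  one-parameter group is a curve of one real variable, and the smoothness of the multiplication
  carries the dependence on all other coordinates. The Lie algebra is represented on the model space
  \<open>E\<close> by the chart \<open>c0\<close> at the identity, where the Maurer--Cartan form
  becomes \<open>logd\<close> and the bracket becomes \<open>cbr\<close>. Manifolds are modelled on
  subspaces, so derivatives are taken within a subspace and are meaningful only in its directions.
  Linear maps given on a subspace (components, brackets, the identification \<kappa>) are therefore
  extended to the ambient space before they are differentiated through. The base is an open piece of
  \<open>M\<close>, parametrised through the orthogonal complement of \<open>E0\<close> in
  \<open>E\<close>. With a ball as domain of the chart every fibre is a convex slice, hence
  connected. The pulled back form is an absolute parallelism by transversality: a vector whose image
  under a section is vertical is killed by the projection after the section, which is the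
  identity.\<close>

definition rel_open :: "'a::euclidean_space set \<Rightarrow> 'a set \<Rightarrow> bool" where
  "rel_open E S \<longleftrightarrow> subspace E \<and> openin (top_of_set E) S"

lemma rel_openD:
  assumes "rel_open E S"
  shows "subspace E" "openin (top_of_set E) S" "S \<subseteq> E"
  using assms openin_imp_subset by (auto simp: rel_open_def)

lemma rel_open_space: "subspace E \<Longrightarrow> rel_open E E"
  by (auto simp: rel_open_def)

lemma rel_open_UNIV: "rel_open UNIV S \<longleftrightarrow> open S"
  by (auto simp: rel_open_def)

lemma rel_open_Times: "rel_open E S \<Longrightarrow> rel_open F T \<Longrightarrow> rel_open (E \<times> F) (S \<times> T)"
  by (auto simp: rel_open_def openin_Times subspace_Times)

lemma rel_open_preimage:
  assumes "rel_open E S" "continuous_on S f" "openin (top_of_set F) T" "f ` S \<subseteq> F"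
  shows "rel_open E {x\<in>S. f x \<in> T}"
proof -
  have "openin (top_of_set S) (S \<inter> f -` T)"
    using assms by (intro continuous_openin_preimage[of S f F]) auto
  then have "openin (top_of_set E) (S \<inter> f -` T)"
    using assms(1) openin_trans unfolding rel_open_def by blast
  moreover have "S \<inter> f -` T = {x\<in>S. f x \<in> T}" by auto
  ultimately show ?thesis using assms by (simp add: rel_open_def)
qed

lemma rel_open_preimage_open:
  assumes "rel_open E S" "continuous_on S f" "open T"
  shows "rel_open E {x\<in>S. f x \<in> T}"
  using rel_open_preimage[of E S f UNIV T] assms by auto

lemma rel_open_ball: "subspace E \<Longrightarrow> rel_open E (E \<inter> ball x r)"
  by (auto simp: rel_open_def)

lemma rel_open_ballE:
  assumes "rel_open E S" "y \<in> S"
  obtains r where "r > 0" "E \<inter> ball y r \<subseteq> S"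
proof -
  obtain e where "e>0" "ball y e \<inter> E \<subseteq> S"
    using assms unfolding rel_open_def openin_contains_ball by blast
  then show thesis using that by blast
qed

text \<open>The derivatives in \<open>deriv_in\<close> are taken within the whole of E, while
  congruence and composition rules live on the domain S. As S is E intersected with an open set, the
  two filters coincide at points of S.\<close>

lemma at_within_rel_open:
  assumes "rel_open E S" "y \<in> S"
  shows "at y within E = at y within S"
proof -
  obtain T where T: "open T" "S = E \<inter> T"
    using assms(1) by (auto simp: rel_open_def openin_open)
  show ?thesis
    using assms(2) T by (intro at_within_nhd[of y T]) auto
qed

subsection \<open>Derivatives along a subspace\<close>

text \<open>A derivative within E is not unique as a linear map on the ambient space, since nothing
  constrains it off E. Its value at v in E is unique: along the line through y in the direction v it
  is the derivative of a function of one real variable.\<close>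

lemma deriv_in_eq:
  fixes f :: "'a::euclidean_space \<Rightarrow> 'b::real_normed_vector"
  assumes "subspace E" "y \<in> E" "v \<in> E" and f: "(f has_derivative f') (at y within E)"
  shows "deriv_in E f y v = f' v"
proof -
  have un: "((\<lambda>t. f (y + t *\<^sub>R v)) has_derivative (\<lambda>t. g (t *\<^sub>R v))) (at (0::real))"
    if "(f has_derivative g) (at y within E)" for g
  proof -
    have d: "((\<lambda>t. y + t *\<^sub>R v) has_derivative (\<lambda>t. t *\<^sub>R v)) (at (0::real))"
      by (auto intro!: derivative_eq_intros)
    have "(f has_derivative g) (at (y + 0 *\<^sub>R v) within (\<lambda>t::real. y + t *\<^sub>R v) ` UNIV)"
      using that assms(1-3)
      by (auto intro!: has_derivative_subset[OF that] subspace_add subspace_scale)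
    from has_derivative_in_compose[OF d this] show ?thesis by simp
  qed
  have "f differentiable (at y within E)" using f differentiable_def by blast
  then have "(f has_derivative frechet_derivative f (at y within E)) (at y within E)"
    by (simp add: frechet_derivative_works)
  from has_derivative_unique[OF un[OF this] un[OF f]]
  have "frechet_derivative f (at y within E) (1 *\<^sub>R v) = f' (1 *\<^sub>R v)" by metis
  then show ?thesis by (simp add: deriv_in_def)
qed

lemma deriv_in_works:
  assumes "f differentiable (at y within E)"
  shows "(f has_derivative deriv_in E f y) (at y within E)"
proof -
  have "deriv_in E f y = frechet_derivative f (at y within E)"
    by (simp add: deriv_in_def fun_eq_iff)
  then show ?thesis using assms frechet_derivative_works by metis
qed

lemma has_derivative_rel_open_cong:
  assumes "rel_open E S" "y \<in> S" "\<And>z. z \<in> S \<Longrightarrow> f z = g z"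
  shows "(f has_derivative f') (at y within E) \<longleftrightarrow> (g has_derivative f') (at y within E)"
  unfolding at_within_rel_open[OF assms(1,2)]
  using has_derivative_transform[OF assms(2)] assms(3) by metis

lemma differentiable_rel_open_cong:
  assumes "rel_open E S" "y \<in> S" "\<And>z. z \<in> S \<Longrightarrow> f z = g z"
  shows "f differentiable (at y within E) \<longleftrightarrow> g differentiable (at y within E)"
  unfolding differentiable_def
  using has_derivative_rel_open_cong[where f=f and g=g, OF assms] by metis

text \<open>The two functions have literally the same derivatives, so the choice inside
  \<open>frechet_derivative\<close> yields the same map; hence v may be any vector here, in contrast
  to \<open>deriv_in_eq\<close>.\<close>

lemma deriv_in_cong:
  assumes "rel_open E S" "y \<in> S" "\<And>z. z \<in> S \<Longrightarrow> f z = g z"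
  shows "deriv_in E f y v = deriv_in E g y v"
  unfolding deriv_in_def frechet_derivative_def
  using has_derivative_rel_open_cong[where f=f and g=g, OF assms] by simp

lemma deriv_in_chain:
  assumes S: "rel_open E S" "y \<in> S" and T: "rel_open F T" "h ` S \<subseteq> T"
    and f: "f differentiable (at (h y) within F)" and h: "h differentiable (at y within E)"
  shows "((\<lambda>z. f (h z)) has_derivative (\<lambda>v. deriv_in F f (h y) (deriv_in E h y v))) (at y within E)"
proof -
  have "(h has_derivative deriv_in E h y) (at y within S)"
    using deriv_in_works[OF h] at_within_rel_open[OF S] by simp
  moreover have "(f has_derivative deriv_in F f (h y)) (at (h y) within h ` S)"
    using has_derivative_subset[OF deriv_in_works[OF f]] T rel_openD(3)[OF T(1)] by blast
  ultimately show ?thesis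
    unfolding at_within_rel_open[OF S] using has_derivative_in_compose by fastforce
qed

text \<open>\<open>Ck_in\<close> differentiates in fixed directions only. Expanding a varying
  direction in a fixed finite set, with inner products as coefficients, is the standard way below to
  return to fixed directions.\<close>

lemma orthonormal_expansion:
  fixes E :: "'a::euclidean_space set"
  assumes "subspace E"
  obtains B where "finite B" "B \<subseteq> E" "\<And>v. v \<in> E \<Longrightarrow> (\<Sum>b\<in>B. (v \<bullet> b) *\<^sub>R b) = v"
proof -
  obtain B where B: "B \<subseteq> E" "pairwise orthogonal B" "\<And>x. x \<in> B \<Longrightarrow> norm x = 1"
      "independent B" "span B = E"
    using orthonormal_basis_subspace[OF assms] by metis
  show thesis
  proof
    show "finite B" using B(4) by (rule independent_imp_finite)
    then show "(\<Sum>b\<in>B. (v \<bullet> b) *\<^sub>R b) = v" if "v \<in> E" for v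
      using orthonormal_basis_expand[of B v] B that by (simp add: inner_commute)
  qed (use B in auto)
qed

lemma obtain_projection:
  fixes E :: "'a::euclidean_space set"
  assumes "subspace E"
  obtains P where "bounded_linear P" "\<And>x. P x \<in> E" "\<And>x. x \<in> E \<Longrightarrow> P x = x"
    "\<And>x. norm (P x) \<le> norm x" "\<And>x y. y \<in> E \<Longrightarrow> (x - P x) \<bullet> y = 0"
proof -
  obtain B where B: "B \<subseteq> E" "pairwise orthogonal B" "\<And>x. x \<in> B \<Longrightarrow> norm x = 1"
      "independent B" "span B = E"
    using orthonormal_basis_subspace[OF assms] by metis
  have fin: "finite B" using B(4) by (rule independent_imp_finite)
  define P where "P x = (\<Sum>b\<in>B. (x \<bullet> b) *\<^sub>R b)" for x
  have inE: "P x \<in> E" for x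
    unfolding P_def using B assms by (intro subspace_sum subspace_scale) auto
  have bb: "(x - P x) \<bullet> b = 0" if "b \<in> B" for x b
  proof -
    have "P x \<bullet> b = (\<Sum>c\<in>B. (x \<bullet> c) * (c \<bullet> b))" by (simp add: P_def inner_sum_left)
    also have "\<dots> = (\<Sum>c\<in>B. if c = b then x \<bullet> b else 0)"
      using B(2,3) that
      by (intro sum.cong) (auto simp: pairwise_def orthogonal_def norm_eq_1)
    finally show ?thesis using that fin by (simp add: inner_diff_left)
  qed
  have orth: "(x - P x) \<bullet> y = 0" if "y \<in> E" for x y
  proof -
    have "y \<in> span B" using that B by simp
    then show ?thesis
      by (induction rule: span_induct_alt) (auto simp: inner_add_right bb)
  qed
  have "norm (P x) \<le> norm x" for x
  proof -
    define r where "r = x - P x"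
    have "r \<bullet> P x = 0" "x = P x + r" using orth[OF inE, of x x] by (auto simp: r_def)
    then have "x \<bullet> x = P x \<bullet> P x + r \<bullet> r"
      by (metis add.right_neutral add_0 inner_add_left inner_add_right inner_commute)
    then show ?thesis by (simp add: norm_le)
  qed
  moreover have "bounded_linear P"
    unfolding P_def by (intro bounded_linear_sum bounded_linear_scaleR_const bounded_linear_inner_left)
  moreover have "P x = x" if "x \<in> E" for x
    using orthonormal_basis_expand[of B x] B that fin by (simp add: P_def inner_commute)
  ultimately show thesis using that inE orth by blast
qed

text \<open>Membership in F is the equation P z = z for a bounded linear projection P, and an
  equation of this kind can be differentiated.\<close>

lemma deriv_in_closed:
  fixes f :: "'a::euclidean_space \<Rightarrow> 'b::euclidean_space"
  assumes "rel_open E S" "y \<in> S" "f differentiable (at y within E)" "subspace F"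
    and "\<And>z. z \<in> S \<Longrightarrow> f z \<in> F" "v \<in> E"
  shows "deriv_in E f y v \<in> F"
proof -
  obtain P where P: "bounded_linear P" "\<And>x. P x \<in> F" "\<And>x. x \<in> F \<Longrightarrow> P x = x"
    using obtain_projection[OF assms(4)] by metis
  have "((\<lambda>z. P (f z)) has_derivative (\<lambda>v. P (deriv_in E f y v))) (at y within E)"
    using bounded_linear.has_derivative[OF P(1) deriv_in_works[OF assms(3)]] .
  then have "deriv_in E (\<lambda>z. P (f z)) y v = P (deriv_in E f y v)"
    using deriv_in_eq rel_openD assms by (metis subsetD)
  moreover have "deriv_in E (\<lambda>z. P (f z)) y v = deriv_in E f y v"
    using deriv_in_cong[OF assms(1,2)] P(3) assms(5) by metis
  ultimately show ?thesis using P(2) by metis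
qed

lemma deriv_in_linear:
  assumes "f differentiable (at y within E)"
  shows "linear (deriv_in E f y)"
  using deriv_in_works[OF assms] has_derivative_linear by blast

lemma linear_expansion:
  assumes "linear f" "(\<Sum>b\<in>B. c b *\<^sub>R b) = v"
  shows "f v = (\<Sum>b\<in>B. c b *\<^sub>R f b)"
  using assms by (metis (no_types, lifting) linear_sum linear_scale sum.cong)

subsection \<open>Functions of class \<open>C\<^sup>n\<close>\<close>

lemma Ck_in_cong:
  assumes "rel_open E S" "\<And>z. z \<in> S \<Longrightarrow> f z = g z"
  shows "Ck_in E n f S \<longleftrightarrow> Ck_in E n g S"
  using assms(2)
proof (induction n arbitrary: f g)
  case 0
  then show ?case using continuous_on_cong by force
next
  case (Suc n)
  have "Ck_in E n (\<lambda>y. deriv_in E f y v) S \<longleftrightarrow> Ck_in E n (\<lambda>y. deriv_in E g y v) S" for v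
    using Suc.prems deriv_in_cong[OF assms(1)] by (intro Suc.IH) blast
  moreover have "f differentiable at y within E \<longleftrightarrow> g differentiable at y within E" if "y \<in> S" for y
    using differentiable_rel_open_cong[OF assms(1) that] Suc.prems by blast
  ultimately show ?case by simp
qed

lemma Ck_in_congI:
  assumes "rel_open E S" "Ck_in E n g S" "\<And>z. z \<in> S \<Longrightarrow> f z = g z"
  shows "Ck_in E n f S"
  using Ck_in_cong[of E S f g n] assms by blast

lemma Ck_in_subset: "Ck_in E n f S \<Longrightarrow> S' \<subseteq> S \<Longrightarrow> Ck_in E n f S'"
  by (induction n arbitrary: f) (auto intro: continuous_on_subset)

lemma Ck_in_Suc_continuous:
  assumes "rel_open E S" "\<And>y. y\<in>S \<Longrightarrow> f differentiable at y within E"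
  shows "continuous_on S f"
  using assms differentiable_imp_continuous_within at_within_rel_open
  unfolding continuous_on_eq_continuous_within by metis

lemma Ck_in_Suc_le:
  assumes "rel_open E S"
  shows "Ck_in E (Suc n) f S \<Longrightarrow> Ck_in E n f S"
  by (induction n arbitrary: f) (use Ck_in_Suc_continuous[OF assms] in auto)

lemma Ck_in_local:
  assumes "\<And>y. y\<in>S \<Longrightarrow> \<exists>S'. rel_open E S' \<and> y \<in> S' \<and> Ck_in E n f S'" "S \<subseteq> E"
  shows "Ck_in E n f S"
  using assms(1)
proof (induction n arbitrary: f)
  case 0
  show ?case unfolding Ck_in.simps continuous_on_eq_continuous_within
  proof
    fix y assume "y \<in> S"
    then obtain S' where S': "rel_open E S'" "y \<in> S'" "continuous_on S' f" using 0 by auto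
    then have "continuous (at y within E) f"
      using at_within_rel_open continuous_on_eq_continuous_within by metis
    then show "continuous (at y within S) f" using assms(2) continuous_within_subset by blast
  qed
next
  case (Suc n)
  have "Ck_in E n (\<lambda>y. deriv_in E f y v) S" if "v \<in> E" for v
    using Suc.prems that by (intro Suc.IH) fastforce
  then show ?case using Suc.prems by fastforce
qed

lemma Ck_in_SucI:
  assumes "rel_open E S" "\<And>y. y\<in>S \<Longrightarrow> (f has_derivative f' y) (at y within E)"
    and "\<And>v. v\<in>E \<Longrightarrow> Ck_in E n (\<lambda>y. f' y v) S"
  shows "Ck_in E (Suc n) f S"
proof -
  have "Ck_in E n (\<lambda>y. deriv_in E f y v) S" if "v \<in> E" for v
  proof -
    have eq: "deriv_in E f y v = f' y v" if "y \<in> S" for y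
      using deriv_in_eq assms rel_openD[OF assms(1)] \<open>v\<in>E\<close> that by (metis subsetD)
    show ?thesis by (rule Ck_in_congI[OF assms(1) assms(3)[OF that]]) (rule eq)
  qed
  moreover have "f differentiable at y within E" if "y \<in> S" for y
    using assms(2)[OF that] unfolding differentiable_def by blast
  ultimately show ?thesis by simp
qed

lemma Ck_in_const: assumes "rel_open E S" shows "Ck_in E n (\<lambda>x. c) S"
proof (induction n arbitrary: c)
  case (Suc n)
  show ?case using assms
    by (rule Ck_in_SucI[where f'="\<lambda>_ _. 0"]) (auto simp: Suc)
next
  case 0 show ?case by (simp add: continuous_on_const)
qed

lemma Ck_in_bounded_linear:
  assumes S: "rel_open E S" and h: "bounded_linear h" shows "Ck_in E n h S"
proof (cases n)
  case 0
  show ?thesis unfolding 0 Ck_in.simps by (rule linear_continuous_on[OF h])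
next
  case (Suc m)
  have "(h has_derivative h) (at y within E)" for y
    by (rule bounded_linear_imp_has_derivative[OF h])
  then show ?thesis unfolding Suc
    by (rule Ck_in_SucI[OF S _ Ck_in_const[OF S]])
qed

lemma Ck_in_add:
  assumes "rel_open E S"
  shows "Ck_in E n f S \<Longrightarrow> Ck_in E n g S \<Longrightarrow> Ck_in E n (\<lambda>x. f x + g x) S"
proof (induction n arbitrary: f g)
  case 0 then show ?case by (auto intro: continuous_intros)
next
  case (Suc n)
  show ?case
  proof (rule Ck_in_SucI[OF assms(1), where f'="\<lambda>y v. deriv_in E f y v + deriv_in E g y v"])
    show "((\<lambda>y. f y + g y) has_derivative (\<lambda>v. deriv_in E f y v + deriv_in E g y v)) (at y within E)"
      if "y \<in> S" for y
      using that Suc.prems by (intro has_derivative_add deriv_in_works) auto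
    fix v assume "v \<in> E"
    then have "Ck_in E n (\<lambda>y. deriv_in E f y v) S" "Ck_in E n (\<lambda>y. deriv_in E g y v) S"
      using Suc.prems by auto
    then show "Ck_in E n (\<lambda>y. deriv_in E f y v + deriv_in E g y v) S" by (rule Suc.IH)
  qed
qed

lemma Ck_in_bilinear:
  assumes "rel_open E S" and bl: "bounded_bilinear pr"
  shows "Ck_in E n f S \<Longrightarrow> Ck_in E n g S \<Longrightarrow> Ck_in E n (\<lambda>x. pr (f x) (g x)) S"
proof (induction n arbitrary: f g)
  case 0
  then show ?case by (simp add: bounded_bilinear.continuous_on[OF bl])
next
  case (Suc n)
  show ?case
  proof (rule Ck_in_SucI[OF assms(1), where f'="\<lambda>y v. pr (f y) (deriv_in E g y v) + pr (deriv_in E f y v) (g y)"])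
    show "((\<lambda>y. pr (f y) (g y)) has_derivative (\<lambda>v. pr (f y) (deriv_in E g y v) + pr (deriv_in E f y v) (g y))) (at y within E)"
      if "y \<in> S" for y
      using that Suc.prems by (intro bounded_bilinear.FDERIV[OF bl] deriv_in_works) auto
    fix v assume "v \<in> E"
    then have d: "Ck_in E n (\<lambda>y. deriv_in E f y v) S" "Ck_in E n (\<lambda>y. deriv_in E g y v) S"
      using Suc.prems by auto
    show "Ck_in E n (\<lambda>y. pr (f y) (deriv_in E g y v) + pr (deriv_in E f y v) (g y)) S"
      by (intro Ck_in_add[OF assms(1)] Suc.IH Ck_in_Suc_le[OF assms(1) Suc.prems(1)]
          Ck_in_Suc_le[OF assms(1) Suc.prems(2)] d)
  qed
qed

lemma Ck_in_sum:
  assumes "rel_open E S" "\<And>i. i \<in> I \<Longrightarrow> Ck_in E n (f i) S"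
  shows "Ck_in E n (\<lambda>x. \<Sum>i\<in>I. f i x) S"
  using assms(2)
  by (induction I rule: infinite_finite_induct) (auto intro: Ck_in_const[OF assms(1)] Ck_in_add[OF assms(1)])

text \<open>The chain rule gives the derivative of g in the direction of the derivative of f, which
  varies with the point. After expansion in a basis of F only derivatives of g in fixed directions
  remain, and the induction hypothesis applies to them; this is why g is generalised and f is
  not.\<close>

lemma Ck_in_compose:
  fixes f :: "'a::euclidean_space \<Rightarrow> 'b::euclidean_space"
  assumes S: "rel_open E S" and T: "rel_open F T" and fST: "f ` S \<subseteq> T"
  shows "Ck_in E n f S \<Longrightarrow> Ck_in F n g T \<Longrightarrow> Ck_in E n (\<lambda>x. g (f x)) S"
proof (induction n arbitrary: g)
  case 0
  then show ?case using continuous_on_compose2 fST by auto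
next
  case (Suc n)
  obtain B where B: "finite B" "B \<subseteq> F" "\<And>v. v \<in> F \<Longrightarrow> (\<Sum>b\<in>B. (v \<bullet> b) *\<^sub>R b) = v"
    using orthonormal_expansion rel_openD(1)[OF T] by blast
  have df: "f differentiable at y within E" and dg: "g differentiable at (f y) within F" if "y \<in> S" for y
    using that Suc.prems fST by auto
  show ?case
  proof (rule Ck_in_SucI[OF S])
    show "((\<lambda>x. g (f x)) has_derivative (\<lambda>v. deriv_in F g (f y) (deriv_in E f y v))) (at y within E)"
      if "y \<in> S" for y using deriv_in_chain[OF S that T fST dg[OF that] df[OF that]] .
    show "Ck_in E n (\<lambda>y. deriv_in F g (f y) (deriv_in E f y v)) S" if v: "v \<in> E" for v
    proof -
      have eq: "deriv_in F g (f y) (deriv_in E f y v) =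
          (\<Sum>b\<in>B. (deriv_in E f y v \<bullet> b) *\<^sub>R deriv_in F g (f y) b)" if "y \<in> S" for y
      proof -
        have "deriv_in E f y v \<in> F"
          using deriv_in_closed[OF S that df[OF that] rel_openD(1)[OF T] _ v] fST rel_openD(3)[OF T] by blast
        from linear_expansion[OF deriv_in_linear[OF dg[OF that]] B(3)[OF this]] show ?thesis .
      qed
      have "Ck_in E n (\<lambda>y. (\<Sum>b\<in>B. (deriv_in E f y v \<bullet> b) *\<^sub>R deriv_in F g (f y) b)) S"
      proof (intro Ck_in_sum[OF S] Ck_in_bilinear[OF S bounded_bilinear_scaleR])
        fix b assume "b \<in> B"
        have "Ck_in E n (\<lambda>y. deriv_in E f y v) S" using Suc.prems v by auto
        from Ck_in_bilinear[OF S bounded_bilinear_inner this Ck_in_const[OF S]]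
        show "Ck_in E n (\<lambda>x. deriv_in E f x v \<bullet> b) S" .
        show "Ck_in E n (\<lambda>x. deriv_in F g (f x) b) S"
          using Suc.prems \<open>b\<in>B\<close> B(2) Ck_in_Suc_le[OF S] by (intro Suc.IH) auto
      qed
      then show ?thesis by (rule Ck_in_congI[OF S]) (rule eq)
    qed
  qed
qed

subsection \<open>Smooth functions\<close>

lemma smooth_in_cong:
  "rel_open E S \<Longrightarrow> (\<And>z. z \<in> S \<Longrightarrow> f z = g z) \<Longrightarrow> smooth_in E f S \<longleftrightarrow> smooth_in E g S"
  unfolding smooth_in_def using Ck_in_cong by metis

lemma smooth_in_congI:
  assumes "rel_open E S" "smooth_in E g S" "\<And>z. z \<in> S \<Longrightarrow> f z = g z"
  shows "smooth_in E f S"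
  using smooth_in_cong[of E S f g] assms by blast

lemma smooth_in_subset: "smooth_in E f S \<Longrightarrow> S' \<subseteq> S \<Longrightarrow> smooth_in E f S'"
  unfolding smooth_in_def using Ck_in_subset by metis

lemma smooth_in_continuous: "smooth_in E f S \<Longrightarrow> continuous_on S f"
  unfolding smooth_in_def using Ck_in.simps(1) by metis

lemma smooth_in_differentiable: "smooth_in E f S \<Longrightarrow> y \<in> S \<Longrightarrow> f differentiable at y within E"
  unfolding smooth_in_def using Ck_in.simps(2) by metis

lemma smooth_in_local:
  assumes "\<And>y. y\<in>S \<Longrightarrow> \<exists>S'. rel_open E S' \<and> y \<in> S' \<and> smooth_in E f S'" "S \<subseteq> E"
  shows "smooth_in E f S"
  unfolding smooth_in_def
proof
  fix n show "Ck_in E n f S"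
    using assms by (intro Ck_in_local) (auto simp: smooth_in_def, metis)
qed

lemma smooth_in_deriv: "smooth_in E f S \<Longrightarrow> v \<in> E \<Longrightarrow> smooth_in E (\<lambda>y. deriv_in E f y v) S"
  unfolding smooth_in_def by (metis Ck_in.simps(2))

lemma smooth_in_const: "rel_open E S \<Longrightarrow> smooth_in E (\<lambda>x. c) S"
  and smooth_in_bounded_linear: "rel_open E S \<Longrightarrow> bounded_linear h \<Longrightarrow> smooth_in E h S"
  and smooth_in_add:
    "rel_open E S \<Longrightarrow> smooth_in E f S \<Longrightarrow> smooth_in E g S \<Longrightarrow> smooth_in E (\<lambda>x. f x + g x) S"
  and smooth_in_bilinear:
    "rel_open E S \<Longrightarrow> bounded_bilinear pr \<Longrightarrow> smooth_in E a S \<Longrightarrow> smooth_in E b S \<Longrightarrow>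
      smooth_in E (\<lambda>x. pr (a x) (b x)) S"
  and smooth_in_sum:
    "rel_open E S \<Longrightarrow> (\<And>i. i \<in> I \<Longrightarrow> smooth_in E (F i) S) \<Longrightarrow> smooth_in E (\<lambda>x. \<Sum>i\<in>I. F i x) S"
  by (simp_all add: smooth_in_def Ck_in_const Ck_in_bounded_linear Ck_in_add Ck_in_bilinear Ck_in_sum)

lemma smooth_in_compose:
  fixes f :: "'a::euclidean_space \<Rightarrow> 'b::euclidean_space"
  assumes "rel_open E S" "rel_open F T" "f ` S \<subseteq> T" "smooth_in E f S" "smooth_in F g T"
  shows "smooth_in E (\<lambda>x. g (f x)) S"
  using assms unfolding smooth_in_def using Ck_in_compose by metis

lemma smooth_in_id: "rel_open E S \<Longrightarrow> smooth_in E (\<lambda>x. x) S"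
  by (rule smooth_in_bounded_linear[OF _ bounded_linear_ident])

lemma smooth_in_linear_image:
  assumes "rel_open E S" "bounded_linear h" "smooth_in E f S"
  shows "smooth_in E (\<lambda>x. h (f x)) S"
proof -
  have "Ck_in E n f S \<Longrightarrow> Ck_in E n (\<lambda>x. h (f x)) S" for n f
  proof (induction n arbitrary: f)
    case 0
    then show ?case using bounded_linear.continuous_on[OF assms(2)] by auto
  next
    case (Suc n)
    show ?case
    proof (rule Ck_in_SucI[OF assms(1), where f'="\<lambda>y v. h (deriv_in E f y v)"])
      show "((\<lambda>x. h (f x)) has_derivative (\<lambda>v. h (deriv_in E f y v))) (at y within E)" if "y \<in> S" for y
        using that Suc.prems
        by (intro bounded_linear.has_derivative[OF assms(2)] deriv_in_works) simp
      fix v assume "v \<in> E"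
      then have "Ck_in E n (\<lambda>y. deriv_in E f y v) S" using Suc.prems by simp
      then show "Ck_in E n (\<lambda>y. h (deriv_in E f y v)) S" by (rule Suc.IH)
    qed
  qed
  then show ?thesis using assms(3) unfolding smooth_in_def by simp
qed

lemma smooth_in_Pair:
  assumes "rel_open E S" "smooth_in E f S" "smooth_in E g S"
  shows "smooth_in E (\<lambda>x. (f x, g x)) S"
proof -
  have "smooth_in E (\<lambda>x. (f x, 0) + (0, g x)) S"
    by (intro smooth_in_add assms smooth_in_linear_image[OF assms(1) _ assms(2), of "\<lambda>x. (x, 0)"]
        smooth_in_linear_image[OF assms(1) _ assms(3), of "\<lambda>x. (0, x)"]
        bounded_linear_Pair bounded_linear_ident bounded_linear_zero)
  then show ?thesis by simp
qed

lemma smooth_in_has_deriv: "smooth_in E f S \<Longrightarrow> y \<in> S \<Longrightarrow> (f has_derivative deriv_in E f y) (at y within E)"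
  by (simp add: deriv_in_works smooth_in_differentiable)

lemma smooth_in_deriv_closed:
  fixes f :: "'a::euclidean_space \<Rightarrow> 'b::euclidean_space"
  assumes "rel_open E S" "smooth_in E f S" "y \<in> S" "subspace F" "f ` S \<subseteq> F" "v \<in> E"
  shows "deriv_in E f y v \<in> F"
  using deriv_in_closed[of E S y f F v] assms smooth_in_differentiable by blast

lemma smooth_in_deriv_chain:
  fixes f :: "'a::euclidean_space \<Rightarrow> 'b::euclidean_space"
  assumes "rel_open E S" "rel_open F T" "f ` S \<subseteq> T" "smooth_in E f S" "smooth_in F g T" "y \<in> S" "v \<in> E"
  shows "deriv_in E (\<lambda>x. g (f x)) y v = deriv_in F g (f y) (deriv_in E f y v)"
proof (rule deriv_in_eq)
  show "((\<lambda>x. g (f x)) has_derivative (\<lambda>v. deriv_in F g (f y) (deriv_in E f y v))) (at y within E)"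
    using assms(3,6) smooth_in_differentiable[OF assms(5)] smooth_in_differentiable[OF assms(4,6)]
    by (intro deriv_in_chain[OF assms(1,6,2,3)]) auto
qed (use assms rel_openD[OF assms(1)] in auto)

text \<open>Linearity reduces a varying direction to fixed ones, and a varying base point is a
  composition. The applications in \<open>smooth_logd\<close> and \<open>smooth_lcoord\<close>
  evaluate the derivative of a function of two group variables at points (y, y) or (a, org).\<close>

lemma smooth_in_deriv_apply:
  fixes h :: "'a::euclidean_space \<Rightarrow> 'b::euclidean_space"
  assumes S: "rel_open E S" and T: "rel_open F T" and h: "h ` S \<subseteq> T" "smooth_in E h S"
    and f: "smooth_in F f T" and w: "w ` S \<subseteq> F" "smooth_in E w S"
  shows "smooth_in E (\<lambda>y. deriv_in F f (h y) (w y)) S"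
proof -
  obtain B where B: "finite B" "B \<subseteq> F" "\<And>v. v \<in> F \<Longrightarrow> (\<Sum>b\<in>B. (v \<bullet> b) *\<^sub>R b) = v"
    using orthonormal_expansion rel_openD(1)[OF T] by blast
  have "deriv_in F f (h y) (w y) = (\<Sum>b\<in>B. (w y \<bullet> b) *\<^sub>R deriv_in F f (h y) b)" if "y \<in> S" for y
    using that w(1) h(1)
    by (intro linear_expansion[OF deriv_in_linear B(3)] smooth_in_differentiable[OF f]) auto
  then have eq: "\<And>y. y \<in> S \<Longrightarrow> deriv_in F f (h y) (w y) = (\<Sum>b\<in>B. (w y \<bullet> b) *\<^sub>R deriv_in F f (h y) b)" .
  have "smooth_in E (\<lambda>y. (\<Sum>b\<in>B. (w y \<bullet> b) *\<^sub>R deriv_in F f (h y) b)) S"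
    using B(2)
    by (intro smooth_in_sum[OF S] smooth_in_bilinear[OF S bounded_bilinear_scaleR]
        smooth_in_bilinear[OF S bounded_bilinear_inner w(2) smooth_in_const[OF S]]
        smooth_in_compose[OF S T h] smooth_in_deriv[OF f]) auto
  then show ?thesis by (rule smooth_in_congI[OF S]) (rule eq)
qed


section \<open>Symmetry of second derivatives along a subspace\<close>

lemma has_vector_derivative_line:
  assumes "subspace E" "p \<in> E" "w \<in> E" "f differentiable at (p + s *\<^sub>R w) within E"
  shows "((\<lambda>s. f (p + s *\<^sub>R w)) has_vector_derivative deriv_in E f (p + s *\<^sub>R w) w) (at s)"
proof -
  have d: "((\<lambda>t. p + t *\<^sub>R w) has_derivative (\<lambda>t. t *\<^sub>R w)) (at s)"
    by (auto intro!: derivative_eq_intros)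
  have "(f has_derivative deriv_in E f (p + s *\<^sub>R w)) (at (p + s *\<^sub>R w) within (\<lambda>t::real. p + t *\<^sub>R w) ` UNIV)"
    using assms(1-3) by (intro has_derivative_subset[OF deriv_in_works[OF assms(4)]])
      (auto intro!: subspace_add subspace_scale)
  from has_derivative_in_compose[OF d this] show ?thesis
    by (simp add: has_vector_derivative_def linear_scale[OF deriv_in_linear[OF assms(4)]])
qed

text \<open>The mean value theorem in the direction u, applied to the difference between two
  parallel sides of a parallelogram, and then in the direction v. The second difference on the left
  is symmetric in u and v, which is the source of the symmetry proved next.\<close>

lemma mixed_difference:
  fixes f :: "'a::euclidean_space \<Rightarrow> real"
  assumes E: "subspace E" and y: "y \<in> E" and uv: "u \<in> E" "v \<in> E" and h: "0 < (h::real)"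
    and f: "\<And>s t. \<lbrakk>0 \<le> s; s \<le> h; 0 \<le> t; t \<le> h\<rbrakk> \<Longrightarrow> f differentiable at (y + s *\<^sub>R u + t *\<^sub>R v) within E"
    and fu: "\<And>s t. \<lbrakk>0 \<le> s; s \<le> h; 0 \<le> t; t \<le> h\<rbrakk> \<Longrightarrow>
       (\<lambda>z. deriv_in E f z u) differentiable at (y + s *\<^sub>R u + t *\<^sub>R v) within E"
  obtains s t where "0 < s" "s < h" "0 < t" "t < h"
    "f (y + h *\<^sub>R u + h *\<^sub>R v) - f (y + h *\<^sub>R u) - f (y + h *\<^sub>R v) + f y
      = h * h * deriv_in E (\<lambda>z. deriv_in E f z u) (y + s *\<^sub>R u + t *\<^sub>R v) v"
proof -
  have 1: "((\<lambda>s. f (y + s *\<^sub>R u + t *\<^sub>R v)) has_real_derivative deriv_in E f (y + s *\<^sub>R u + t *\<^sub>R v) u) (at s)"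
    if "0 \<le> s" "s \<le> h" "0 \<le> t" "t \<le> h" for s t
    using has_vector_derivative_line[OF E _ uv(1), of "y + t *\<^sub>R v" f s] f[OF that] E y uv
    by (simp add: has_real_derivative_iff_has_vector_derivative add_ac subspace_add subspace_scale)
  define a where "a s = f (y + s *\<^sub>R u + h *\<^sub>R v) - f (y + s *\<^sub>R u + 0 *\<^sub>R v)" for s
  have "(a has_real_derivative (deriv_in E f (y + s *\<^sub>R u + h *\<^sub>R v) u - deriv_in E f (y + s *\<^sub>R u + 0 *\<^sub>R v) u)) (at s)"
    if "0 \<le> s" "s \<le> h" for s
    unfolding a_def using that h by (intro DERIV_diff 1) auto
  from MVT2[OF h this] obtain s where s: "0 < s" "s < h"
    "a h - a 0 = (h - 0) * (deriv_in E f (y + s *\<^sub>R u + h *\<^sub>R v) u - deriv_in E f (y + s *\<^sub>R u + 0 *\<^sub>R v) u)"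
    by auto
  have "((\<lambda>t. deriv_in E f (y + s *\<^sub>R u + t *\<^sub>R v) u) has_real_derivative
      deriv_in E (\<lambda>z. deriv_in E f z u) (y + s *\<^sub>R u + t *\<^sub>R v) v) (at t)" if "0 \<le> t" "t \<le> h" for t
    using has_vector_derivative_line[OF E _ uv(2), of "y + s *\<^sub>R u" "\<lambda>z. deriv_in E f z u" t] fu[of s t] that s E y uv
    by (simp add: has_real_derivative_iff_has_vector_derivative subspace_add subspace_scale)
  from MVT2[OF h this] obtain t where t: "0 < t" "t < h"
    "deriv_in E f (y + s *\<^sub>R u + h *\<^sub>R v) u - deriv_in E f (y + s *\<^sub>R u + 0 *\<^sub>R v) u =
      (h - 0) * deriv_in E (\<lambda>z. deriv_in E f z u) (y + s *\<^sub>R u + t *\<^sub>R v) v"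
    by auto
  show thesis using that[OF s(1,2) t(1,2)] s(3) t(3) unfolding a_def by simp
qed

lemma deriv_in_commute_real:
  fixes f :: "'a::euclidean_space \<Rightarrow> real"
  assumes S: "rel_open E S" and f: "smooth_in E f S" and y: "y \<in> S" and uv: "u \<in> E" "v \<in> E"
  shows "deriv_in E (\<lambda>z. deriv_in E f z u) y v = deriv_in E (\<lambda>z. deriv_in E f z v) y u"
proof -
  define p q where "p z = deriv_in E (\<lambda>z. deriv_in E f z u) z v"
    and "q z = deriv_in E (\<lambda>z. deriv_in E f z v) z u" for z
  note E = rel_openD(1)[OF S]
  have yE: "y \<in> E" using rel_openD(3)[OF S] y by auto
  have sm: "smooth_in E (\<lambda>z. deriv_in E f z u) S" "smooth_in E (\<lambda>z. deriv_in E f z v) S"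
    using smooth_in_deriv[OF f] uv by auto
  have "continuous_on S p" "continuous_on S q"
    unfolding p_def q_def using uv sm by (auto intro!: smooth_in_continuous[OF smooth_in_deriv])
  then have cont: "\<exists>d>0. \<forall>z\<in>S. dist z y < d \<longrightarrow> dist (p z) (p y) < e"
       "\<exists>d>0. \<forall>z\<in>S. dist z y < d \<longrightarrow> dist (q z) (q y) < e" if "e > 0" for e
    using y that unfolding continuous_on_iff by auto
  have "\<bar>p y - q y\<bar> \<le> 2 * e" if "e > 0" for e
  proof -
    obtain d1 d2 where d: "d1 > 0" "d2 > 0" "\<And>z. z \<in> S \<Longrightarrow> dist z y < d1 \<Longrightarrow> dist (p z) (p y) < e"
      "\<And>z. z \<in> S \<Longrightarrow> dist z y < d2 \<Longrightarrow> dist (q z) (q y) < e"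
      using cont[OF \<open>e > 0\<close>] by blast
    obtain r where r: "r > 0" "E \<inter> ball y r \<subseteq> S" using rel_open_ballE[OF S y] by blast
    define m where "m = min r (min d1 d2)"
    \<comment> \<open>With this size the parallelogram spanned by h u and h v stays within distance
      m of y; the summand 1 keeps the denominator positive when u and v vanish.\<close>
    define h where "h = m / (norm u + norm v + 1)"
    have m: "m > 0" using d r by (simp add: m_def)
    have h0: "h > 0" using m by (simp add: h_def add_nonneg_pos)
    have near: "y + s *\<^sub>R u + t *\<^sub>R v \<in> S \<and> dist (y + s *\<^sub>R u + t *\<^sub>R v) y < m"
      if "0 \<le> s" "s \<le> h" "0 \<le> t" "t \<le> h" for s t
    proof -
      have "dist (y + s *\<^sub>R u + t *\<^sub>R v) y = norm (s *\<^sub>R u + t *\<^sub>R v)" by (simp add: dist_norm add.assoc)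
      also have "\<dots> \<le> s * norm u + t * norm v" using that by (metis abs_of_nonneg norm_scaleR norm_triangle_ineq)
      also have "\<dots> \<le> h * norm u + h * norm v" using that by (intro add_mono mult_right_mono) auto
      also have "\<dots> < h * (norm u + norm v + 1)" using h0 by (simp add: algebra_simps)
      also have "\<dots> = m" by (simp add: h_def add_nonneg_eq_0_iff)
      finally have "dist (y + s *\<^sub>R u + t *\<^sub>R v) y < m" .
      moreover have "y + s *\<^sub>R u + t *\<^sub>R v \<in> E" using E uv yE by (intro subspace_add subspace_scale)
      ultimately show ?thesis using r(2) by (auto simp: m_def dist_commute)
    qed
    obtain s t where 1: "0 < s" "s < h" "0 < t" "t < h"
      "f (y + h *\<^sub>R u + h *\<^sub>R v) - f (y + h *\<^sub>R u) - f (y + h *\<^sub>R v) + f y = h * h * p (y + s *\<^sub>R u + t *\<^sub>R v)"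
      using mixed_difference[OF E yE uv h0 smooth_in_differentiable[OF f near[THEN conjunct1]]
          smooth_in_differentiable[OF sm(1) near[THEN conjunct1]]] unfolding p_def by blast
    have near': "y + s *\<^sub>R v + t *\<^sub>R u \<in> S" if "0 \<le> s" "s \<le> h" "0 \<le> t" "t \<le> h" for s t
      using near[OF that(3,4,1,2)] by (simp add: add_ac)
    obtain s' t' where 2: "0 < s'" "s' < h" "0 < t'" "t' < h"
      "f (y + h *\<^sub>R v + h *\<^sub>R u) - f (y + h *\<^sub>R v) - f (y + h *\<^sub>R u) + f y = h * h * q (y + s' *\<^sub>R v + t' *\<^sub>R u)"
      using mixed_difference[OF E yE uv(2,1) h0 smooth_in_differentiable[OF f near']
          smooth_in_differentiable[OF sm(2) near']] unfolding q_def by blast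
    \<comment> \<open>Both mean values equal the same second difference divided by the square of h,
      so p and q agree at two points near y.\<close>
    have "p (y + s *\<^sub>R u + t *\<^sub>R v) = q (y + t' *\<^sub>R u + s' *\<^sub>R v)"
      using 1(5) 2(5) h0 by (simp add: add_ac) (smt (verit) mult_cancel_left mult_pos_pos)
    moreover have "\<bar>p (y + s *\<^sub>R u + t *\<^sub>R v) - p y\<bar> < e"
      using d(3)[of "y + s *\<^sub>R u + t *\<^sub>R v"] near[of s t] 1 by (auto simp: m_def dist_real_def)
    moreover have "\<bar>q (y + t' *\<^sub>R u + s' *\<^sub>R v) - q y\<bar> < e"
      using d(4)[of "y + t' *\<^sub>R u + s' *\<^sub>R v"] near[of t' s'] 2 by (auto simp: m_def dist_real_def)
    ultimately show ?thesis by linarith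
  qed
  note le = this
  have "\<bar>p y - q y\<bar> \<le> 0 + e" if "e > 0" for e using le[of "e / 2"] that by simp
  then have "\<bar>p y - q y\<bar> \<le> 0" by (rule field_le_epsilon)
  then show ?thesis by (simp add: p_def q_def)
qed

lemma deriv_in_commute:
  fixes f :: "'a::euclidean_space \<Rightarrow> 'b::euclidean_space"
  assumes S: "rel_open E S" and f: "smooth_in E f S" and y: "y \<in> S" and uv: "u \<in> E" "v \<in> E"
  shows "deriv_in E (\<lambda>z. deriv_in E f z u) y v = deriv_in E (\<lambda>z. deriv_in E f z v) y u"
proof (rule euclidean_eqI)
  fix b :: 'b assume "b \<in> Basis"
  have comp: "deriv_in E (\<lambda>z. g z \<bullet> b) z w = deriv_in E g z w \<bullet> b"
    if "smooth_in E g S" "z \<in> S" "w \<in> E" for g :: "'a \<Rightarrow> 'b" and z w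
    using that S by (intro deriv_in_eq[of E] has_derivative_inner_left smooth_in_has_deriv)
      (auto dest: rel_openD)
  have eq: "deriv_in E (\<lambda>z. deriv_in E f z w) y w' \<bullet> b
      = deriv_in E (\<lambda>z. deriv_in E (\<lambda>z. f z \<bullet> b) z w) y w'" if "w \<in> E" "w' \<in> E" for w w'
  proof -
    have "deriv_in E (\<lambda>z. deriv_in E f z w) y w' \<bullet> b = deriv_in E (\<lambda>z. deriv_in E f z w \<bullet> b) y w'"
      using comp[OF smooth_in_deriv[OF f that(1)] y that(2)] by simp
    also have "\<dots> = deriv_in E (\<lambda>z. deriv_in E (\<lambda>z. f z \<bullet> b) z w) y w'"
      using comp[OF f _ that(1)] by (intro deriv_in_cong[OF S y]) simp
    finally show ?thesis .
  qed
  have "smooth_in E (\<lambda>z. f z \<bullet> b) S"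
    using smooth_in_linear_image[OF S bounded_linear_inner_left f] .
  from deriv_in_commute_real[OF S this y uv]
  show "deriv_in E (\<lambda>z. deriv_in E f z u) y v \<bullet> b = deriv_in E (\<lambda>z. deriv_in E f z v) y u \<bullet> b"
    using eq uv by simp
qed

subsection \<open>Ordinary differential equations\<close>

text \<open>A Gronwall argument: by the Cauchy--Schwarz inequality the squared norm of f times exp
  (- 2 K t) does not increase. It starts at 0 and is never negative.\<close>

lemma linear_growth_zero:
  fixes f :: "real \<Rightarrow> 'b::euclidean_space"
  assumes f: "\<And>t. 0 \<le> t \<Longrightarrow> t \<le> T \<Longrightarrow> (f has_vector_derivative f' t) (at t)"
    and le: "\<And>t. 0 \<le> t \<Longrightarrow> t \<le> T \<Longrightarrow> norm (f' t) \<le> K * norm (f t)"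
    and "f 0 = 0" "0 \<le> T"
  shows "f T = 0"
proof -
  define g where "g t = (f t \<bullet> f t) * exp (- 2 * K * t)" for t
  have "g T \<le> g 0"
  proof (rule DERIV_nonpos_imp_nonincreasing[OF \<open>0 \<le> T\<close>])
    fix t assume t: "0 \<le> t" "t \<le> T"
    have "((\<lambda>t. f t \<bullet> f t) has_vector_derivative (f t \<bullet> f' t + f' t \<bullet> f t)) (at t)"
      by (rule bounded_bilinear.has_vector_derivative[OF bounded_bilinear_inner f[OF t] f[OF t]])
    then have "((\<lambda>t. f t \<bullet> f t) has_real_derivative 2 * (f t \<bullet> f' t)) (at t)"
      by (simp add: has_real_derivative_iff_has_vector_derivative inner_commute)
    moreover have "((\<lambda>t. exp (- 2 * K * t)) has_real_derivative - 2 * K * exp (- 2 * K * t)) (at t)"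
      by (auto intro!: derivative_eq_intros)
    ultimately have "(g has_real_derivative (2 * (f t \<bullet> f' t)) * exp (- 2 * K * t) + (- 2 * K * exp (- 2 * K * t)) * (f t \<bullet> f t)) (at t)"
      unfolding g_def by (rule DERIV_mult)
    moreover have "(2 * (f t \<bullet> f' t)) * exp (- 2 * K * t) + (- 2 * K * exp (- 2 * K * t)) * (f t \<bullet> f t) \<le> 0"
    proof -
      have "f t \<bullet> f' t \<le> norm (f t) * norm (f' t)" by (rule norm_cauchy_schwarz)
      also have "\<dots> \<le> norm (f t) * (K * norm (f t))" using le[OF t] by (intro mult_left_mono) auto
      also have "\<dots> = K * (f t \<bullet> f t)" by (simp add: power2_norm_eq_inner[symmetric] power2_eq_square)
      finally have "(f t \<bullet> f' t - K * (f t \<bullet> f t)) * exp (- 2 * K * t) \<le> 0"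
        by (intro mult_nonpos_nonneg) auto
      then show ?thesis by (simp add: algebra_simps)
    qed
    ultimately show "\<exists>y. (g has_real_derivative y) (at t) \<and> y \<le> 0" by blast
  qed
  then have "f T \<bullet> f T \<le> 0" using \<open>f 0 = 0\<close> by (simp add: g_def mult_le_0_iff)
  then show ?thesis by (metis inner_eq_zero_iff inner_ge_zero order_antisym)
qed

lemma has_derivative_rel_open_congI:
  assumes "rel_open E S" "y \<in> S" "(g has_derivative f') (at y within E)" "\<And>z. z \<in> S \<Longrightarrow> f z = g z"
  shows "(f has_derivative f') (at y within E)"
  using has_derivative_rel_open_cong[of E S y f g f'] assms by blast

lemma integral_in_subspace:
  fixes h :: "real \<Rightarrow> 'a::euclidean_space"
  assumes "subspace E" "continuous_on {a..b} h" "\<And>t. t \<in> {a..b} \<Longrightarrow> h t \<in> E"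
  shows "integral {a..b} h \<in> E"
proof -
  obtain P where P: "bounded_linear P" "\<And>x. P x \<in> E" "\<And>x. x \<in> E \<Longrightarrow> P x = x"
    using obtain_projection[OF assms(1)] by metis
  have "integral {a..b} h = integral {a..b} (P \<circ> h)"
    using assms(3) P(3) by (intro integral_cong) auto
  also have "\<dots> = P (integral {a..b} h)"
    by (rule integral_linear[OF integrable_continuous_real[OF assms(2)] P(1)])
  finally show ?thesis using P(2) by metis
qed

text \<open>Banach's fixed point theorem in the complete space of bounded continuous functions on
  the real line with values in a closed piece of E. As time is unrestricted there, the integral
  operator is made constant outside a short interval by means of \<open>cl\<close>.\<close>

lemma picard_lindelof:
  fixes X :: "'a::euclidean_space \<Rightarrow> 'a"
  assumes E: "subspace E" "p \<in> E" and r: "r > 0"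
    and X: "continuous_on (E \<inter> cball p r) X" "\<And>x. x \<in> E \<inter> cball p r \<Longrightarrow> X x \<in> E"
    and M: "\<And>x. x \<in> E \<inter> cball p r \<Longrightarrow> norm (X x) \<le> M"
    and L: "\<And>x y. x \<in> E \<inter> cball p r \<Longrightarrow> y \<in> E \<inter> cball p r \<Longrightarrow> norm (X x - X y) \<le> L * norm (x - y)"
    and nn: "0 \<le> M" "0 \<le> L"
  obtains \<epsilon> \<Gamma> where "\<epsilon> > 0" "\<Gamma> 0 = p" "\<And>t. \<bar>t\<bar> < \<epsilon> \<Longrightarrow> \<Gamma> t \<in> E \<inter> cball p r"
    "\<And>t::real. \<bar>t\<bar> < \<epsilon> \<Longrightarrow> (\<Gamma> has_vector_derivative X (\<Gamma> t)) (at t)"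
proof -
  define K where "K = E \<inter> cball p r"
  have K: "closed K" "p \<in> K"
    using E r by (auto simp: K_def closed_Int closed_subspace)
  \<comment> \<open>The operator integrates over a total length of at most 3 e, see
    \<open>b1\<close>. Hence 3 e M \<le> r keeps the values in the ball and 3 e L \<le> 1/2 makes
    the operator a contraction; the summands 1 avoid division by zero.\<close>
  define e where "e = min (r / (3 * (M + 1))) (1 / (6 * (L + 1)))"
  have e: "e > 0" using r nn by (simp add: e_def)
  have "e \<le> r / (3 * (M + 1))" by (simp add: e_def)
  then have "3 * e * (M + 1) \<le> r" using nn by (simp add: field_simps)
  then have eM: "3 * e * M \<le> r" using e nn by (simp add: algebra_simps)
  have "e \<le> 1 / (6 * (L + 1))" by (simp add: e_def)
  then have "6 * e * (L + 1) \<le> 1" using nn by (simp add: field_simps)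
  then have eL: "3 * e * L \<le> 1/2" using e nn by (simp add: algebra_simps)
  define cl where "cl t = max (- e) (min e t)" for t :: real
  have cl: "cl t \<in> {-e..e}" "continuous_on UNIV cl" for t
    using e by (auto simp: cl_def intro!: continuous_intros)
  \<comment> \<open>The integral from 0 to t, written as a difference of integrals starting at - e
    so that negative t are covered too. The lengths 2 e and e of the two ranges add up to the factor
    3 e.\<close>
  define I where "I \<phi> t = p + (integral {-e..cl t} (\<lambda>s. X (\<phi> s)) - integral {-e..0} (\<lambda>s. X (\<phi> s)))"
    for \<phi> :: "real \<Rightarrow> 'a" and t
  define D where "D = PiC (UNIV :: real set) (\<lambda>_. K)"
  have D: "\<phi> \<in> D \<longleftrightarrow> (\<forall>t. apply_bcontfun \<phi> t \<in> K)" for \<phi>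
    by (auto simp: D_def mem_PiC_iff)
  have cX: "continuous_on A (\<lambda>s. X (apply_bcontfun \<phi> s))" if "\<phi> \<in> D" for \<phi> A
  proof (rule continuous_on_compose2[of K X A "apply_bcontfun \<phi>"])
    show "continuous_on K X" using X(1) by (simp add: K_def)
    show "apply_bcontfun \<phi> ` A \<subseteq> K" using that by (auto simp: D)
  qed (rule continuous_on_apply_bcontfun)
  have b1: "norm (integral {-e..cl t} h - integral {-e..0} h) \<le> 3 * e * B"
    if "continuous_on {-e..e} h" "\<And>s. norm (h s) \<le> B" for h :: "real \<Rightarrow> 'a" and B t
  proof -
    have "0 \<le> B" by (rule order_trans[OF norm_ge_zero that(2)])
    have "norm (integral {-e..cl t} h) \<le> B * (cl t - (-e))"
      using that cl(1)[of t] by (intro integral_bound) (auto intro: continuous_on_subset)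
    also have "\<dots> \<le> B * (2 * e)" using cl(1)[of t] \<open>0 \<le> B\<close> by (intro mult_left_mono) auto
    finally have 1: "norm (integral {-e..cl t} h) \<le> B * (2 * e)" .
    have "norm (integral {-e..0} h) \<le> B * (0 - (-e))"
      using that e by (intro integral_bound) (auto intro: continuous_on_subset)
    with 1 show ?thesis using norm_triangle_ineq4[of "integral {-e..cl t} h" "integral {-e..0} h"]
      by (simp add: algebra_simps)
  qed
  have IK: "I (apply_bcontfun \<phi>) t \<in> K" if "\<phi> \<in> D" for \<phi> t
  proof -
    have "norm (X (apply_bcontfun \<phi> s)) \<le> M" "X (apply_bcontfun \<phi> s) \<in> E" for s
      using that M X(2) unfolding D K_def by auto
    then have "norm (I (apply_bcontfun \<phi>) t - p) \<le> 3 * e * M" "I (apply_bcontfun \<phi>) t \<in> E"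
      unfolding I_def using b1[OF cX[OF that], of M] E
      by (auto intro!: subspace_add subspace_diff integral_in_subspace cX[OF that])
    then show ?thesis using eM by (auto simp: K_def dist_norm norm_minus_commute)
  qed
  have contI: "continuous_on UNIV (I (apply_bcontfun \<phi>))" if "\<phi> \<in> D" for \<phi>
  proof -
    have "continuous_on {-e..e} (\<lambda>t. integral {-e..t} (\<lambda>s. X (apply_bcontfun \<phi> s)))"
      by (intro indefinite_integral_continuous_1 integrable_continuous_real cX[OF that])
    moreover have "range cl \<subseteq> {-e..e}" using cl(1) by blast
    ultimately have "continuous_on UNIV (\<lambda>t. integral {-e..cl t} (\<lambda>s. X (apply_bcontfun \<phi> s)))"
      by (rule continuous_on_compose2[OF _ cl(2)])
    then show ?thesis unfolding I_def by (intro continuous_intros)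
  qed
  have bcI: "I (apply_bcontfun \<phi>) \<in> bcontfun" if "\<phi> \<in> D" for \<phi>
  proof (rule bcontfun_normI[OF contI[OF that]])
    fix t
    have "norm (I (apply_bcontfun \<phi>) t - p) \<le> r"
      using IK[OF that, of t] by (simp add: K_def dist_norm norm_minus_commute)
    then show "norm (I (apply_bcontfun \<phi>) t) \<le> norm p + r"
      using norm_triangle_sub[of "I (apply_bcontfun \<phi>) t" p] by linarith
  qed
  define F where "F \<phi> = Bcontfun (I (apply_bcontfun \<phi>))" for \<phi>
  have F: "apply_bcontfun (F \<phi>) = I (apply_bcontfun \<phi>)" if "\<phi> \<in> D" for \<phi>
    unfolding F_def using bcI[OF that] by (simp add: Bcontfun_inverse)
  have "\<exists>!\<phi>\<in>D. F \<phi> = \<phi>"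
  proof (rule Banach_fix[where c="1/2"])
    show "complete D" unfolding D_def by (simp add: complete_eq_closed closed_PiC K)
    have "const_bcontfun p \<in> D" using K by (simp add: D)
    then show "D \<noteq> {}" by blast
    show "F ` D \<subseteq> D" using F IK by (auto simp: D)
    fix \<phi> \<psi> assume *: "\<phi> \<in> D" "\<psi> \<in> D"
    show "dist (F \<phi>) (F \<psi>) \<le> 1/2 * dist \<phi> \<psi>"
    proof (rule dist_bound)
      fix t
      let ?d = "\<lambda>s. X (apply_bcontfun \<phi> s) - X (apply_bcontfun \<psi> s)"
      have "norm (?d s) \<le> L * dist \<phi> \<psi>" for s
      proof -
        have "norm (?d s) \<le> L * norm (apply_bcontfun \<phi> s - apply_bcontfun \<psi> s)"
          using L * unfolding D K_def by blast
        also have "\<dots> \<le> L * dist \<phi> \<psi>"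
          using nn dist_bounded[of \<phi> s \<psi>] by (intro mult_left_mono) (auto simp: dist_norm)
        finally show ?thesis .
      qed
      moreover have "continuous_on {-e..e} ?d" by (intro continuous_intros cX *)
      ultimately have "norm (integral {-e..cl t} ?d - integral {-e..0} ?d) \<le> 3 * e * (L * dist \<phi> \<psi>)"
        by (intro b1)
      also have "\<dots> = (3 * e * L) * dist \<phi> \<psi>" by simp
      also have "\<dots> \<le> 1/2 * dist \<phi> \<psi>" using eL by (intro mult_right_mono) auto
      finally have le: "norm (integral {-e..cl t} ?d - integral {-e..0} ?d) \<le> 1/2 * dist \<phi> \<psi>" .
      have int: "integral {-e..b} ?d = integral {-e..b} (\<lambda>s. X (apply_bcontfun \<phi> s)) - integral {-e..b} (\<lambda>s. X (apply_bcontfun \<psi> s))" for b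
        by (intro integral_diff integrable_continuous_real cX *)
      have "I (apply_bcontfun \<phi>) t - I (apply_bcontfun \<psi>) t = integral {-e..cl t} ?d - integral {-e..0} ?d"
        unfolding I_def int by simp
      with le show "dist (apply_bcontfun (F \<phi>) t) (apply_bcontfun (F \<psi>) t) \<le> 1/2 * dist \<phi> \<psi>"
        by (simp add: F * dist_norm)
    qed
  qed auto
  then obtain \<phi> where \<phi>: "\<phi> \<in> D" "F \<phi> = \<phi>" by blast
  define \<Gamma> where "\<Gamma> = apply_bcontfun \<phi>"
  have G: "\<Gamma> t = I \<Gamma> t" for t unfolding \<Gamma>_def using F \<phi> by metis
  show thesis
  proof
    show "e > 0" by (rule e)
    have "cl 0 = 0" using e by (simp add: cl_def)
    then show "\<Gamma> 0 = p" by (subst G) (simp add: I_def)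
    show "\<Gamma> t \<in> E \<inter> cball p r" for t using \<phi>(1) by (simp add: D \<Gamma>_def K_def)
    fix t :: real assume t: "\<bar>t\<bar> < e"
    have "((\<lambda>u. integral {-e..u} (\<lambda>s. X (\<Gamma> s))) has_vector_derivative X (\<Gamma> t)) (at t within {-e..e})"
      unfolding \<Gamma>_def using t by (intro integral_has_vector_derivative cX \<phi>(1)) auto
    then have "((\<lambda>u. integral {-e..u} (\<lambda>s. X (\<Gamma> s))) has_vector_derivative X (\<Gamma> t)) (at t)"
      using t at_within_interior[of t "{-e..e}"] by (simp add: interior_atLeastAtMost_real abs_less_iff)
    then have d: "((\<lambda>u. p + (integral {-e..u} (\<lambda>s. X (\<Gamma> s)) - integral {-e..0} (\<lambda>s. X (\<Gamma> s)))) has_vector_derivative X (\<Gamma> t)) (at t)"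
      by (auto intro!: derivative_eq_intros)
    show "(\<Gamma> has_vector_derivative X (\<Gamma> t)) (at t)"
    proof (rule has_vector_derivative_transform_within_open[OF d, of "{-e<..<e}"])
      fix u assume u: "u \<in> {-e<..<e}"
      then have "cl u = u" by (auto simp: cl_def)
      then show "p + (integral {-e..u} (\<lambda>s. X (\<Gamma> s)) - integral {-e..0} (\<lambda>s. X (\<Gamma> s))) = \<Gamma> u"
        by (subst (3) G) (simp add: I_def)
    qed (use t in auto)
  qed
qed

text \<open>On the compact set E \<inter> cball p r the derivatives in finitely many basis
  directions are bounded, hence those in all directions; the set is convex, so the mean value
  inequality applies along segments.\<close>

lemma smooth_in_lipschitz:
  fixes X :: "'a::euclidean_space \<Rightarrow> 'b::euclidean_space"
  assumes S: "rel_open E S" and X: "smooth_in E X S" and K: "E \<inter> cball p r \<subseteq> S"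
  obtains L where "0 \<le> L" "\<And>x y. x \<in> E \<inter> cball p r \<Longrightarrow> y \<in> E \<inter> cball p r \<Longrightarrow> norm (X x - X y) \<le> L * norm (x - y)"
proof -
  note E = rel_openD(1)[OF S]
  obtain B where B: "finite B" "B \<subseteq> E" "\<And>v. v \<in> E \<Longrightarrow> (\<Sum>b\<in>B. (v \<bullet> b) *\<^sub>R b) = v"
    using orthonormal_expansion[OF E] by blast
  have comp: "compact (E \<inter> cball p r)"
    by (metis E closed_subspace compact_cball compact_Int_closed Int_commute)
  have "\<exists>C. \<forall>x \<in> E \<inter> cball p r. norm (deriv_in E X x b) \<le> C" if "b \<in> B" for b
  proof -
    have "continuous_on (E \<inter> cball p r) (\<lambda>x. deriv_in E X x b)"
      using that B(2) K smooth_in_continuous[OF smooth_in_deriv[OF X]] continuous_on_subset by blast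
    then have "bounded ((\<lambda>x. deriv_in E X x b) ` (E \<inter> cball p r))"
      using comp compact_continuous_image compact_imp_bounded by blast
    then show ?thesis by (auto simp: bounded_iff)
  qed
  then obtain C where C: "\<And>b x. b \<in> B \<Longrightarrow> x \<in> E \<inter> cball p r \<Longrightarrow> norm (deriv_in E X x b) \<le> C b" by metis
  \<comment> \<open>Absolute values, because a bound C b over an empty set may be negative while L
    has to be nonnegative in any case.\<close>
  define L where "L = (\<Sum>b\<in>B. norm b * \<bar>C b\<bar>)"
  have dX: "norm (deriv_in E X x v) \<le> L * norm v" if "x \<in> E \<inter> cball p r" "v \<in> E" for x v
  proof -
    have "deriv_in E X x v = (\<Sum>b\<in>B. (v \<bullet> b) *\<^sub>R deriv_in E X x b)"
      using K that by (intro linear_expansion[OF deriv_in_linear B(3)] smooth_in_differentiable[OF X]) auto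
    also have "norm \<dots> \<le> (\<Sum>b\<in>B. norm ((v \<bullet> b) *\<^sub>R deriv_in E X x b))" by (rule norm_sum)
    also have "\<dots> \<le> (\<Sum>b\<in>B. (norm v * norm b) * \<bar>C b\<bar>)"
      unfolding norm_scaleR using C[OF _ that(1)] Cauchy_Schwarz_ineq2[of v]
      by (intro sum_mono mult_mono) (auto intro: order_trans[OF _ abs_ge_self])
    also have "\<dots> = L * norm v" by (simp add: L_def sum_distrib_left mult_ac)
    finally show ?thesis .
  qed
  show thesis
  proof
    show "0 \<le> L" by (simp add: L_def sum_nonneg)
    fix x y assume xy: "x \<in> E \<inter> cball p r" "y \<in> E \<inter> cball p r"
    have seg: "y + s *\<^sub>R (x - y) \<in> E \<inter> cball p r" if "s \<in> {0..1}" for s :: real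
    proof -
      have "convex (E \<inter> cball p r)" using E by (intro convex_Int convex_cball subspace_imp_convex)
      then have "(1 - s) *\<^sub>R y + s *\<^sub>R x \<in> E \<inter> cball p r" using xy that unfolding convex_alt by auto
      then show ?thesis by (simp add: algebra_simps)
    qed
    have xyE: "x - y \<in> E" "y \<in> E" using xy E by (auto intro: subspace_diff)
    have "norm ((\<lambda>s. X (y + s *\<^sub>R (x - y))) 1 - (\<lambda>s. X (y + s *\<^sub>R (x - y))) 0) \<le> (L * norm (x - y)) * norm (1 - 0 :: real)"
    proof (rule differentiable_bound[of "{0..1}"])
      fix s :: real assume s: "s \<in> {0..1}"
      have "((\<lambda>s. X (y + s *\<^sub>R (x - y))) has_vector_derivative deriv_in E X (y + s *\<^sub>R (x - y)) (x - y)) (at s)"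
        using seg[OF s] K by (intro has_vector_derivative_line[OF E xyE(2,1)] smooth_in_differentiable[OF X]) auto
      then show "((\<lambda>s. X (y + s *\<^sub>R (x - y))) has_derivative (\<lambda>h. h *\<^sub>R deriv_in E X (y + s *\<^sub>R (x - y)) (x - y))) (at s within {0..1})"
        by (simp add: has_vector_derivative_def has_derivative_at_withinI)
      show "onorm (\<lambda>h. h *\<^sub>R deriv_in E X (y + s *\<^sub>R (x - y)) (x - y)) \<le> L * norm (x - y)"
        using dX[OF seg[OF s] xyE(1)] by (intro onorm_le) (simp add: mult.commute mult_left_mono)
    qed auto
    then show "norm (X x - X y) \<le> L * norm (x - y)" by simp
  qed
qed

text \<open>Smoothness by bootstrapping: if the curve is of class n, then so is X along the curve,
  and this is its derivative.\<close>

lemma smooth_integral_curve: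
  fixes X :: "'a::euclidean_space \<Rightarrow> 'a"
  assumes S: "rel_open E S" and X: "smooth_in E X S" "X ` S \<subseteq> E" and p: "p \<in> S"
  obtains \<epsilon> \<Gamma> where "\<epsilon> > 0" "\<Gamma> 0 = p" "\<Gamma> ` {-\<epsilon><..<\<epsilon>} \<subseteq> S" "smooth_in UNIV \<Gamma> {-\<epsilon><..<\<epsilon>}"
    "\<And>t::real. \<bar>t\<bar> < \<epsilon> \<Longrightarrow> (\<Gamma> has_vector_derivative X (\<Gamma> t)) (at t)"
proof -
  note E = rel_openD(1)[OF S]
  obtain r0 where r0: "r0 > 0" "E \<inter> ball p r0 \<subseteq> S" using rel_open_ballE[OF S p] by blast
  define r where "r = r0 / 2"
  have r: "r > 0" "E \<inter> cball p r \<subseteq> S" using r0 by (auto simp: r_def)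
  obtain L where L: "0 \<le> L" "\<And>x y. x \<in> E \<inter> cball p r \<Longrightarrow> y \<in> E \<inter> cball p r \<Longrightarrow> norm (X x - X y) \<le> L * norm (x - y)"
    using smooth_in_lipschitz[OF S X(1) r(2)] by blast
  have pE: "p \<in> E" using p rel_openD(3)[OF S] by blast
  have M: "norm (X x) \<le> norm (X p) + L * r" if "x \<in> E \<inter> cball p r" for x
  proof -
    have "norm (X x) \<le> norm (X p) + norm (X x - X p)" by (metis add.commute norm_triangle_sub)
    also have "norm (X x - X p) \<le> L * norm (x - p)" using L(2)[of x p] that pE r by auto
    also have "\<dots> \<le> L * r" using that L(1) by (intro mult_left_mono) (auto simp: dist_norm norm_minus_commute)
    finally show ?thesis by simp
  qed
  obtain e G where G: "e > 0" "G 0 = p" "\<And>t. \<bar>t\<bar> < e \<Longrightarrow> G t \<in> E \<inter> cball p r"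
    "\<And>t::real. \<bar>t\<bar> < e \<Longrightarrow> (G has_vector_derivative X (G t)) (at t)"
  proof (rule picard_lindelof[OF E pE r(1) _ _ M L(2)])
    show "continuous_on (E \<inter> cball p r) X"
      using smooth_in_continuous[OF X(1)] r(2) continuous_on_subset by blast
    show "X x \<in> E" if "x \<in> E \<inter> cball p r" for x using that X(2) r(2) by blast
    show "0 \<le> norm (X p) + L * r" using L r by simp
  qed (use L in auto)
  have I: "rel_open UNIV {-e<..<e}" by (simp add: rel_open_UNIV)
  have GS: "G ` {-e<..<e} \<subseteq> S" using G(3) r(2) by fastforce
  have d: "(G has_derivative (\<lambda>h. h *\<^sub>R X (G t))) (at t)" if "t \<in> {-e<..<e}" for t
    using G(4)[of t] that by (auto simp: has_vector_derivative_def)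
  have "Ck_in UNIV n G {-e<..<e}" for n
  proof (induction n)
    case 0
    have "isCont G t" if "t \<in> {-e<..<e}" for t using has_derivative_continuous[OF d[OF that]] .
    then show ?case by (simp add: continuous_at_imp_continuous_on)
  next
    case (Suc n)
    have "Ck_in UNIV n (\<lambda>t. X (G t)) {-e<..<e}"
      using X(1) by (intro Ck_in_compose[OF I S GS Suc.IH]) (simp add: smooth_in_def)
    then have "Ck_in UNIV n (\<lambda>t. h *\<^sub>R X (G t)) {-e<..<e}" for h
      by (intro Ck_in_bilinear[OF I bounded_bilinear_scaleR] Ck_in_const[OF I])
    then show ?case by (intro Ck_in_SucI[OF I d]) auto
  qed
  then show thesis using that[OF G(1,2) GS _ G(4)] by (auto simp: smooth_in_def)
qed

subsection \<open>The inverse function theorem\<close>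

text \<open>A product rule at a zero of g for which c only has to be continuous: (c z - c y) g z is
  the product of a factor tending to 0 and one of order norm (z - y). Below it turns continuity of a
  solution into differentiability.\<close>

lemma has_derivative_scaleR_vanishing:
  fixes g :: "'a::euclidean_space \<Rightarrow> 'b::real_normed_vector" and c :: "'a \<Rightarrow> real"
  assumes c: "(c \<longlongrightarrow> c y) (at y within E)" and g: "(g has_derivative g') (at y within E)" "g y = 0"
  shows "((\<lambda>z. c z *\<^sub>R g z) has_derivative (\<lambda>v. c y *\<^sub>R g' v)) (at y within E)"
proof -
  have bl: "bounded_linear g'" using g(1) has_derivative_bounded_linear by blast
  have q: "((\<lambda>z. norm ((g z - g y) - g' (z - y)) / norm (z - y)) \<longlongrightarrow> 0) (at y within E)"
    using g(1) by (simp add: has_derivative_iff_norm)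
  obtain K where K: "\<And>x. norm (g' x) \<le> norm x * K" "K > 0" using bounded_linear.pos_bounded[OF bl] by blast
  have "((\<lambda>z. (c z - c y) *\<^sub>R g z) has_derivative (\<lambda>v. 0)) (at y within E)"
    unfolding has_derivative_iff_norm
  proof (intro conjI bounded_linear_zero)
    have lim: "((\<lambda>z. \<bar>c z - c y\<bar> * (norm ((g z - g y) - g' (z - y)) / norm (z - y) + K)) \<longlongrightarrow> \<bar>c y - c y\<bar> * (0 + K)) (at y within E)"
      by (intro tendsto_intros q c)
    show "((\<lambda>z. norm ((c z - c y) *\<^sub>R g z - (c y - c y) *\<^sub>R g y - 0) / norm (z - y)) \<longlongrightarrow> 0) (at y within E)"
    proof (rule Lim_null_comparison[OF _ lim[simplified]])
      show "\<forall>\<^sub>F z in at y within E. norm (norm ((c z - c y) *\<^sub>R g z - (c y - c y) *\<^sub>R g y - 0) / norm (z - y))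
          \<le> \<bar>c z - c y\<bar> * (norm (g z - g y - g' (z - y)) / norm (z - y) + K)"
        unfolding eventually_at_topological
      proof (intro exI[of _ UNIV] conjI ballI impI)
        fix z assume "z \<noteq> y"
        then have pos: "norm (z - y) > 0" by simp
        have "norm (g z) \<le> norm (g z - g y - g' (z - y)) + norm (g' (z - y))"
          using norm_triangle_ineq[of "g z - g y - g' (z - y)" "g' (z - y)"] g(2) by simp
        then have "norm (g z) \<le> norm (g z - g y - g' (z - y)) + norm (z - y) * K"
          using K(1)[of "z - y"] by linarith
        then have "norm (g z) / norm (z - y) \<le> norm (g z - g y - g' (z - y)) / norm (z - y) + K"
          using pos by (simp add: field_simps)
        then have "\<bar>c z - c y\<bar> * (norm (g z) / norm (z - y)) \<le> \<bar>c z - c y\<bar> * (norm (g z - g y - g' (z - y)) / norm (z - y) + K)"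
          by (intro mult_left_mono) auto
        then show "norm (norm ((c z - c y) *\<^sub>R g z - (c y - c y) *\<^sub>R g y - 0) / norm (z - y))
          \<le> \<bar>c z - c y\<bar> * (norm (g z - g y - g' (z - y)) / norm (z - y) + K)" by simp
      qed auto
    qed
  qed
  moreover have "((\<lambda>z. c y *\<^sub>R g z) has_derivative (\<lambda>v. c y *\<^sub>R g' v)) (at y within E)"
    using g(1) by (rule has_derivative_scaleR_right)
  ultimately have "((\<lambda>z. (c z - c y) *\<^sub>R g z + c y *\<^sub>R g z) has_derivative (\<lambda>v. 0 + c y *\<^sub>R g' v)) (at y within E)"
    by (rule has_derivative_add)
  then show ?thesis by (simp add: algebra_simps)
qed


text \<open>A linear left inverse g of A y on F is kept fixed while z varies. The increment of the
  solution w of A z (w z) = v z is then expressed by the increments of v and A, with values of w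
  entering only as coefficients.\<close>

lemma linear_solution_increment:
  fixes A :: "'a::euclidean_space \<Rightarrow> 'b::euclidean_space \<Rightarrow> 'b"
  assumes F: "subspace F" and y: "y \<in> S"
    and B: "B \<subseteq> F" "\<And>x. x \<in> F \<Longrightarrow> (\<Sum>b\<in>B. (x \<bullet> b) *\<^sub>R b) = x"
    and lin: "\<And>z. z \<in> S \<Longrightarrow> linear (A z)" and inj: "\<And>e. e \<in> F \<Longrightarrow> A y e = 0 \<Longrightarrow> e = 0"
    and w: "\<And>z. z \<in> S \<Longrightarrow> w z \<in> F" "\<And>z. z \<in> S \<Longrightarrow> A z (w z) = v z"
  obtains g where "bounded_linear g"
    "\<And>z. z \<in> S \<Longrightarrow> w z - w y = g (v z - v y - (\<Sum>b\<in>B. (w z \<bullet> b) *\<^sub>R (A z b - A y b)))"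
proof -
  have exp: "A z x = (\<Sum>b\<in>B. (x \<bullet> b) *\<^sub>R A z b)" if "x \<in> F" "z \<in> S" for x z
    by (rule linear_expansion[OF lin[OF that(2)] B(2)[OF that(1)]])
  have "inj_on (A y) F"
    using inj lin[OF y] F by (auto simp: linear_injective_on_subspace_0)
  then obtain g where g: "linear g" "range g \<subseteq> F" "\<And>x. x \<in> F \<Longrightarrow> g (A y x) = x"
    using linear_exists_left_inverse_on[OF lin[OF y] F] by blast
  have "w z - w y = g (v z - v y - (\<Sum>b\<in>B. (w z \<bullet> b) *\<^sub>R (A z b - A y b)))" if z: "z \<in> S" for z
  proof -
    have "v z - v y - (\<Sum>b\<in>B. (w z \<bullet> b) *\<^sub>R (A z b - A y b)) = A y (w z) - A y (w y)"
      using exp[OF w(1)[OF z] z] exp[OF w(1)[OF z] y] w(2)[OF z] w(2)[OF y]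
      by (simp add: scaleR_diff_right sum_subtractf)
    also have "\<dots> = A y (w z - w y)" by (simp add: linear_diff[OF lin[OF y]])
    finally show ?thesis using g(3) w(1) F z y by (simp add: subspace_diff)
  qed
  then show thesis using that g(1) linear_conv_bounded_linear by blast
qed

text \<open>The increment formula bounds norm (w z - w y) by C norm (v z - v y) + d z norm (w z)
  with d z tending to 0. As w is not yet known to be bounded near y, the factor norm (w z) has to be
  absorbed.\<close>

lemma tendsto_linear_solution:
  fixes A :: "'a::euclidean_space \<Rightarrow> 'b::euclidean_space \<Rightarrow> 'b"
  assumes S: "rel_open E S" and F: "subspace F" and y: "y \<in> S"
    and lin: "\<And>z. z \<in> S \<Longrightarrow> linear (A z)" and inj: "\<And>e. e \<in> F \<Longrightarrow> A y e = 0 \<Longrightarrow> e = 0"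
    and A: "\<And>e. e \<in> F \<Longrightarrow> ((\<lambda>z. A z e) \<longlongrightarrow> A y e) (at y within E)"
    and w: "\<And>z. z \<in> S \<Longrightarrow> w z \<in> F" "\<And>z. z \<in> S \<Longrightarrow> A z (w z) = v z"
    and vlim: "(v \<longlongrightarrow> v y) (at y within E)"
  shows "(w \<longlongrightarrow> w y) (at y within E)"
proof -
  obtain B where B: "finite B" "B \<subseteq> F" "\<And>x. x \<in> F \<Longrightarrow> (\<Sum>b\<in>B. (x \<bullet> b) *\<^sub>R b) = x"
    using orthonormal_expansion[OF F] by blast
  obtain g where bg: "bounded_linear g" and
    id: "\<And>z. z \<in> S \<Longrightarrow> w z - w y = g (v z - v y - (\<Sum>b\<in>B. (w z \<bullet> b) *\<^sub>R (A z b - A y b)))"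
    by (rule linear_solution_increment[where A=A and v=v and w=w, OF F y B(2,3) lin inj w]) (assumption+, rule that)
  obtain C where C: "C > 0" "\<And>x. norm (g x) \<le> norm x * C" using bounded_linear.pos_bounded[OF bg] by blast
  have near: "eventually (\<lambda>z. z \<in> S) (at y within E)"
    unfolding at_within_rel_open[OF S y] by (simp add: eventually_at_filter)
  define d where "d z = C * (\<Sum>b\<in>B. norm b * norm (A z b - A y b))" for z
  have "(d \<longlongrightarrow> C * (\<Sum>b\<in>B. norm b * norm (A y b - A y b))) (at y within E)"
    unfolding d_def using B(2) by (intro tendsto_intros A) auto
  then have dlim: "(d \<longlongrightarrow> 0) (at y within E)" by simp
  have key: "norm (w z - w y) \<le> C * norm (v z - v y) + d z * norm (w z)" if "z \<in> S" for z
  proof -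
    have "norm (\<Sum>b\<in>B. (w z \<bullet> b) *\<^sub>R (A z b - A y b)) \<le> (\<Sum>b\<in>B. norm ((w z \<bullet> b) *\<^sub>R (A z b - A y b)))"
      by (rule norm_sum)
    also have "\<dots> \<le> (\<Sum>b\<in>B. (norm (w z) * norm b) * norm (A z b - A y b))"
      unfolding norm_scaleR by (intro sum_mono mult_right_mono Cauchy_Schwarz_ineq2) auto
    finally have "norm (\<Sum>b\<in>B. (w z \<bullet> b) *\<^sub>R (A z b - A y b)) * C
        \<le> (\<Sum>b\<in>B. (norm (w z) * norm b) * norm (A z b - A y b)) * C"
      using C(1) by (intro mult_right_mono) auto
    also have "\<dots> = d z * norm (w z)"
      by (simp add: d_def sum_distrib_left sum_distrib_right mult_ac)
    finally have 1: "norm (\<Sum>b\<in>B. (w z \<bullet> b) *\<^sub>R (A z b - A y b)) * C \<le> d z * norm (w z)" .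
    have "norm (w z - w y) \<le> norm (v z - v y - (\<Sum>b\<in>B. (w z \<bullet> b) *\<^sub>R (A z b - A y b))) * C"
      unfolding id[OF that] by (rule C(2))
    also have "\<dots> \<le> (norm (v z - v y) + norm (\<Sum>b\<in>B. (w z \<bullet> b) *\<^sub>R (A z b - A y b))) * C"
      using C(1) by (intro mult_right_mono norm_triangle_ineq4) auto
    also have "\<dots> \<le> C * norm (v z - v y) + d z * norm (w z)"
      using 1 by (simp add: algebra_simps)
    finally show ?thesis .
  qed
  \<comment> \<open>Where d z < 1/2, estimating norm (w z) by norm (w y) + norm (w z - w y) lets
    half of the increment move to the left side; hence the factor 2 in \<open>ev\<close>.\<close>
  have "eventually (\<lambda>z. d z < 1/2) (at y within E)" using order_tendstoD(2)[OF dlim, of "1/2"] by simp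
  then have ev: "eventually (\<lambda>z. norm (w z - w y) \<le> 2 * (C * norm (v z - v y) + d z * norm (w y))) (at y within E)"
    using near
  proof eventually_elim
    case (elim z)
    have d0: "0 \<le> d z" using C(1) by (simp add: d_def sum_nonneg)
    have "norm (w z) \<le> norm (w y) + norm (w z - w y)" by (metis add.commute norm_triangle_sub)
    then have "d z * norm (w z) \<le> d z * (norm (w y) + norm (w z - w y))" using d0 by (rule mult_left_mono)
    moreover have "d z * norm (w z - w y) \<le> 1/2 * norm (w z - w y)" using elim by (intro mult_right_mono) auto
    ultimately show ?case using key[OF elim(2)] by (simp add: algebra_simps)
  qed
  have "((\<lambda>z. 2 * (C * norm (v z - v y) + d z * norm (w y))) \<longlongrightarrow> 2 * (C * norm (v y - v y) + 0 * norm (w y))) (at y within E)"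
    by (intro tendsto_intros vlim dlim)
  then have "((\<lambda>z. w z - w y) \<longlongrightarrow> 0) (at y within E)"
    by (intro Lim_null_comparison[OF ev]) simp
  then show ?thesis by (rule LIM_zero_cancel)
qed

text \<open>In the increment formula each term is the continuous function w z \<bullet> b times the
  function A z b - A y b, which vanishes at y. So its derivative exists before that of w is
  known.\<close>

lemma differentiable_linear_solution:
  fixes A :: "'a::euclidean_space \<Rightarrow> 'b::euclidean_space \<Rightarrow> 'b"
  assumes S: "rel_open E S" and F: "subspace F" and y: "y \<in> S"
    and lin: "\<And>z. z \<in> S \<Longrightarrow> linear (A z)" and inj: "\<And>e. e \<in> F \<Longrightarrow> A y e = 0 \<Longrightarrow> e = 0"
    and A: "\<And>e. e \<in> F \<Longrightarrow> (\<lambda>z. A z e) differentiable at y within E"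
    and w: "\<And>z. z \<in> S \<Longrightarrow> w z \<in> F" "\<And>z. z \<in> S \<Longrightarrow> A z (w z) = v z"
    and v: "v differentiable at y within E"
  shows "w differentiable at y within E"
proof -
  obtain B where B: "finite B" "B \<subseteq> F" "\<And>x. x \<in> F \<Longrightarrow> (\<Sum>b\<in>B. (x \<bullet> b) *\<^sub>R b) = x"
    using orthonormal_expansion[OF F] by blast
  obtain g where bg: "bounded_linear g" and
    id: "\<And>z. z \<in> S \<Longrightarrow> w z - w y = g (v z - v y - (\<Sum>b\<in>B. (w z \<bullet> b) *\<^sub>R (A z b - A y b)))"
    by (rule linear_solution_increment[where A=A and v=v and w=w, OF F y B(2,3) lin inj w]) (assumption+, rule that)
  have Alim: "((\<lambda>z. A z b) \<longlongrightarrow> A y b) (at y within E)" if "b \<in> F" for b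
    using differentiable_imp_continuous_within[OF A[OF that]] by (simp add: continuous_within)
  have vlim: "(v \<longlongrightarrow> v y) (at y within E)"
    using differentiable_imp_continuous_within[OF v] by (simp add: continuous_within)
  have wlim: "(w \<longlongrightarrow> w y) (at y within E)"
    by (rule tendsto_linear_solution[where A=A and v=v and w=w, OF S F y lin inj Alim w vlim])
  have dterm: "((\<lambda>z. (w z \<bullet> b) *\<^sub>R (A z b - A y b)) has_derivative (\<lambda>u. (w y \<bullet> b) *\<^sub>R deriv_in E (\<lambda>z. A z b) y u)) (at y within E)"
    if "b \<in> B" for b
  proof (rule has_derivative_scaleR_vanishing)
    show "((\<lambda>z. w z \<bullet> b) \<longlongrightarrow> w y \<bullet> b) (at y within E)" by (intro tendsto_intros wlim)
    show "((\<lambda>z. A z b - A y b) has_derivative deriv_in E (\<lambda>z. A z b) y) (at y within E)"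
      using has_derivative_diff[OF deriv_in_works[OF A] has_derivative_const, of b "A y b"] that B(2) by auto
  qed simp
  have "((\<lambda>z. w y + g (v z - v y - (\<Sum>b\<in>B. (w z \<bullet> b) *\<^sub>R (A z b - A y b)))) has_derivative
      (\<lambda>u. 0 + g (deriv_in E v y u - 0 - (\<Sum>b\<in>B. (w y \<bullet> b) *\<^sub>R deriv_in E (\<lambda>z. A z b) y u)))) (at y within E)"
    by (intro has_derivative_add has_derivative_const bounded_linear.has_derivative[OF bg]
        has_derivative_diff has_derivative_sum deriv_in_works v dterm)
  then show ?thesis unfolding differentiable_def
    by (intro exI) (erule has_derivative_rel_open_congI[OF S y], simp flip: id)
qed

text \<open>Differentiating A z (w z) = v z shows that the derivative of w solves a system with the
  same A and the right side \<open>v1\<close>, in which w occurs undifferentiated. So one more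
  derivative of the data gives one more derivative of the solution. The derivative of an inverse map
  will be such a w.\<close>

lemma Ck_in_linear_solution:
  fixes A :: "'a::euclidean_space \<Rightarrow> 'b::euclidean_space \<Rightarrow> 'b"
  assumes S: "rel_open E S" and F: "subspace F"
    and lin: "\<And>z. z \<in> S \<Longrightarrow> linear (A z)" and inj: "\<And>z e. z \<in> S \<Longrightarrow> e \<in> F \<Longrightarrow> A z e = 0 \<Longrightarrow> e = 0"
  shows "(\<And>e. e \<in> F \<Longrightarrow> Ck_in E n (\<lambda>z. A z e) S) \<Longrightarrow> (\<And>z. z \<in> S \<Longrightarrow> w z \<in> F) \<Longrightarrow>
    (\<And>z. z \<in> S \<Longrightarrow> A z (w z) = v z) \<Longrightarrow> Ck_in E n v S \<Longrightarrow> Ck_in E n w S"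
proof (induction n arbitrary: v w)
  case 0
  have cont: "(f \<longlongrightarrow> f y) (at y within E)" if "y \<in> S" "Ck_in E 0 f S" for f y
    using that at_within_rel_open[OF S that(1)] by (auto simp: continuous_on_def)
  have "(w \<longlongrightarrow> w y) (at y within E)" if "y \<in> S" for y
    by (rule tendsto_linear_solution[OF S F that lin inj[OF that] cont[OF that "0"(1)] "0"(2,3) cont[OF that "0"(4)]])
  then show ?case
    using at_within_rel_open[OF S] by (simp add: continuous_on_def)
next
  case (Suc n)
  obtain B where B: "finite B" "B \<subseteq> F" "\<And>x. x \<in> F \<Longrightarrow> (\<Sum>b\<in>B. (x \<bullet> b) *\<^sub>R b) = x"
    using orthonormal_expansion[OF F] by blast
  have dA: "(\<lambda>z. A z e) differentiable at y within E" if "e \<in> F" "y \<in> S" for e y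
    using Suc.prems(1)[OF that(1)] that(2) by simp
  have dv: "v differentiable at y within E" if "y \<in> S" for y using Suc.prems(4) that by simp
  have dw: "w differentiable at y within E" if "y \<in> S" for y
    by (rule differentiable_linear_solution[OF S F that lin inj[OF that] dA[OF _ that] Suc.prems(2,3) dv[OF that]])
  have A': "Ck_in E n (\<lambda>z. A z e) S" if "e \<in> F" for e
    by (rule Ck_in_Suc_le[OF S Suc.prems(1)[OF that]])
  have w': "Ck_in E n w S"
    by (rule Suc.IH[OF A' Suc.prems(2,3) Ck_in_Suc_le[OF S Suc.prems(4)]])
  show ?case
  proof (rule Ck_in_SucI[OF S deriv_in_works[OF dw]])
    fix u assume u: "u \<in> E"
    define v1 where "v1 y = deriv_in E v y u - (\<Sum>b\<in>B. (w y \<bullet> b) *\<^sub>R deriv_in E (\<lambda>z. A z b) y u)" for y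
    have in_F: "deriv_in E w y u \<in> F" if "y \<in> S" for y
      by (rule deriv_in_closed[OF S that dw[OF that] F Suc.prems(2) u])
    have eq: "A y (deriv_in E w y u) = v1 y" if y: "y \<in> S" for y
    proof -
      have "((\<lambda>z. \<Sum>b\<in>B. (w z \<bullet> b) *\<^sub>R A z b) has_derivative
         (\<lambda>u. \<Sum>b\<in>B. (w y \<bullet> b) *\<^sub>R deriv_in E (\<lambda>z. A z b) y u + (deriv_in E w y u \<bullet> b) *\<^sub>R A y b)) (at y within E)"
        using B(2) y
        by (intro has_derivative_sum has_derivative_scaleR has_derivative_inner_left deriv_in_works dw dA) auto
      moreover have vexp: "v z = (\<Sum>b\<in>B. (w z \<bullet> b) *\<^sub>R A z b)" if "z \<in> S" for z
        using linear_expansion[OF lin[OF that] B(3)[OF Suc.prems(2)[OF that]]] Suc.prems(3)[OF that] by simp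
      ultimately have "(v has_derivative
         (\<lambda>u. \<Sum>b\<in>B. (w y \<bullet> b) *\<^sub>R deriv_in E (\<lambda>z. A z b) y u + (deriv_in E w y u \<bullet> b) *\<^sub>R A y b)) (at y within E)"
        by (intro has_derivative_rel_open_congI[OF S y _ vexp])
      from deriv_in_eq[OF rel_openD(1)[OF S] _ u this]
      have "deriv_in E v y u = (\<Sum>b\<in>B. (w y \<bullet> b) *\<^sub>R deriv_in E (\<lambda>z. A z b) y u) + (\<Sum>b\<in>B. (deriv_in E w y u \<bullet> b) *\<^sub>R A y b)"
        using rel_openD(3)[OF S] y by (auto simp: sum.distrib)
      moreover have "(\<Sum>b\<in>B. (deriv_in E w y u \<bullet> b) *\<^sub>R A y b) = A y (deriv_in E w y u)"
        using linear_expansion[OF lin[OF y] B(3)[OF in_F[OF y]]] by simp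
      ultimately show ?thesis by (simp add: v1_def)
    qed
    have v1: "Ck_in E n v1 S"
    proof -
      have 1: "Ck_in E n (\<lambda>y. deriv_in E v y u) S" using Suc.prems(4) u by simp
      have 2: "Ck_in E n (\<lambda>y. (-1) *\<^sub>R (w y \<bullet> b) *\<^sub>R deriv_in E (\<lambda>z. A z b) y u) S" if "b \<in> B" for b
      proof -
        have "Ck_in E n (\<lambda>y. deriv_in E (\<lambda>z. A z b) y u) S" using Suc.prems(1)[of b] u B(2) that by auto
        then show ?thesis
          by (intro Ck_in_bilinear[OF S bounded_bilinear_scaleR] Ck_in_const[OF S]
              Ck_in_bilinear[OF S bounded_bilinear_inner w'])
      qed
      have "Ck_in E n (\<lambda>y. deriv_in E v y u + (\<Sum>b\<in>B. (-1) *\<^sub>R (w y \<bullet> b) *\<^sub>R deriv_in E (\<lambda>z. A z b) y u)) S"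
        by (intro Ck_in_add[OF S] 1 Ck_in_sum[OF S] 2)
      then show ?thesis by (rule Ck_in_congI[OF S]) (simp add: v1_def sum_negf)
    qed
    show "Ck_in E n (\<lambda>y. deriv_in E w y u) S"
      by (rule Suc.IH[where w="\<lambda>y. deriv_in E w y u" and v=v1, OF A' in_F eq v1])
  qed
qed

text \<open>The inverse function theorem for open subsets of the whole space is applied to
  \<open>F'\<close>, which is F after projection to E plus the remainder x - P x. It restricts to F
  on E, its derivative at p is injective, and its inverse maps E to E.\<close>

lemma smooth_in_inverse:
  fixes F :: "'a::euclidean_space \<Rightarrow> 'a"
  assumes S: "rel_open E S" and F: "smooth_in E F S" "F ` S \<subseteq> E" and p: "p \<in> S"
    and inj: "\<And>v. v \<in> E \<Longrightarrow> deriv_in E F p v = 0 \<Longrightarrow> v = 0"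
  obtains S' H where "rel_open E S'" "p \<in> S'" "S' \<subseteq> S" "rel_open E (F ` S')"
    "smooth_in E H (F ` S')" "\<And>x. x \<in> S' \<Longrightarrow> H (F x) = x"
    "\<And>x v. x \<in> S' \<Longrightarrow> v \<in> E \<Longrightarrow> deriv_in E F x v = 0 \<Longrightarrow> v = 0"
proof -
  note E = rel_openD(1)[OF S]
  obtain P where P: "bounded_linear P" "\<And>x. P x \<in> E" "\<And>x. x \<in> E \<Longrightarrow> P x = x"
    using obtain_projection[OF E] by metis
  have linP: "linear P" using P(1) bounded_linear.linear by blast
  have pE: "p \<in> E" using p rel_openD(3)[OF S] by blast
  define U where "U = P -` S"
  have contP: "continuous_on UNIV P" using P(1) linear_continuous_on by blast
  have "openin (top_of_set UNIV) (UNIV \<inter> P -` S)"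
    by (rule continuous_openin_preimage[OF contP _ rel_openD(2)[OF S]]) (use P(2) in auto)
  then have U: "open U" by (simp add: U_def)
  have [simp]: "z - P z \<in> E \<longleftrightarrow> z \<in> E" for z
    by (metis P(2) E diff_add_cancel subspace_add subspace_diff)
  define F' where "F' x = F (P x) + (x - P x)" for x
  have dF: "(F has_derivative deriv_in E F (P x)) (at (P x) within range P)" if "x \<in> U" for x
    using that P(2)
    by (intro has_derivative_subset[OF smooth_in_has_deriv[OF F(1)]]) (auto simp: U_def)
  have dFP: "((\<lambda>x. F (P x)) has_derivative (\<lambda>v. deriv_in E F (P x) (P v))) (at x)" if "x \<in> U" for x
    using has_derivative_in_compose[OF bounded_linear_imp_has_derivative[OF P(1)] dF[OF that]] .
  define D where "D x = Blinfun (\<lambda>v. deriv_in E F (P x) (P v) + (v - P v))" for x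
  have D: "blinfun_apply (D x) = (\<lambda>v. deriv_in E F (P x) (P v) + (v - P v))" if "x \<in> U" for x
    unfolding D_def using has_derivative_bounded_linear[OF dFP[OF that]]
    by (intro bounded_linear_Blinfun_apply bounded_linear_add bounded_linear_sub bounded_linear_ident P(1))
  have derF': "(F' has_derivative blinfun_apply (D x)) (at x)" if "x \<in> U" for x
    unfolding F'_def D[OF that]
    by (intro has_derivative_add has_derivative_diff dFP[OF that] has_derivative_ident
        bounded_linear_imp_has_derivative[OF P(1)])
  have contD: "continuous_on U D"
  proof (rule continuous_on_blinfun_componentwise)
    fix i :: 'a
    have "continuous_on U (\<lambda>x. deriv_in E F (P x) (P i))"
      using smooth_in_continuous[OF smooth_in_deriv[OF F(1) P(2)]] continuous_on_subset[OF contP]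
      by (rule continuous_on_compose2) (auto simp: U_def)
    then have "continuous_on U (\<lambda>x. deriv_in E F (P x) (P i) + (i - P i))" by (intro continuous_intros)
    then show "continuous_on U (\<lambda>x. blinfun_apply (D x) i)"
      by (rule continuous_on_eq) (simp add: D)
  qed
  have pU: "p \<in> U" using p P(3)[OF pE] by (simp add: U_def)
  have DE: "blinfun_apply (D x) v = deriv_in E F (P x) v" "deriv_in E F (P x) v \<in> E" if "x \<in> U" "v \<in> E" for x v
    using that P(3) smooth_in_deriv_closed[OF S F(1) _ E F(2)] by (auto simp: D U_def)
  have linD: "linear (blinfun_apply (D p))"
    by (rule bounded_linear.linear[OF blinfun.bounded_linear_right])
  have injD: "inj (blinfun_apply (D p))"
  proof (subst linear_injective_0)
    show "linear (blinfun_apply (D p))" by (rule linD)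
    show "\<forall>v. blinfun_apply (D p) v = 0 \<longrightarrow> v = 0"
    proof (intro allI impI)
      fix v assume 0: "blinfun_apply (D p) v = 0"
      have "v - P v = - deriv_in E F (P p) (P v)" using 0 unfolding D[OF pU] by (metis add.commute eq_neg_iff_add_eq_0)
      also have "\<dots> \<in> E" using DE(2)[OF pU P(2)] E subspace_neg by blast
      finally have "v \<in> E" by simp
      then show "v = 0" using 0 DE(1)[OF pU] inj P(3)[OF pE] by simp
    qed
  qed
  obtain g0 where g0: "linear g0" "g0 \<circ> blinfun_apply (D p) = id"
    using linear_injective_left_inverse[OF linD injD] by blast
  have g0b: "bounded_linear g0" using g0(1) linear_conv_bounded_linear by blast
  have "Blinfun g0 o\<^sub>L D p = id_blinfun"
    using g0(2) by (intro blinfun_eqI) (simp add: bounded_linear_Blinfun_apply[OF g0b] fun_eq_iff)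
  from inverse_function_theorem[OF U derF' contD pU this]
  obtain U' V g g' where inv: "open U'" "U' \<subseteq> U" "p \<in> U'" "open V" "F' p \<in> V" "homeomorphism U' V F' g"
    "\<And>y. y \<in> V \<Longrightarrow> (g has_derivative (g' y)) (at y)"
    "\<And>y. y \<in> V \<Longrightarrow> bij (blinfun_apply (D (g y)))" by metis
  have hom: "\<And>x. x \<in> U' \<Longrightarrow> g (F' x) = x" "\<And>y. y \<in> V \<Longrightarrow> F' (g y) = y"
    "\<And>x. x \<in> U' \<Longrightarrow> F' x \<in> V" "\<And>y. y \<in> V \<Longrightarrow> g y \<in> U'" "continuous_on V g"
    using inv(6) unfolding homeomorphism_def by blast+
  define S' where "S' = E \<inter> U'"
  have F'E: "F' x = F x" if "x \<in> E" for x using that P(3) by (simp add: F'_def)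
  have S'S: "S' \<subseteq> S" using inv(2) P(3) by (auto simp: S'_def U_def)
  \<comment> \<open>\<open>F' x\<close> and x - P x differ by an element of E, so x lies in E as
    soon as \<open>F' x\<close> does.\<close>
  have gE: "g y \<in> E" if "y \<in> V \<inter> E" for y
  proof -
    have gU: "g y \<in> U'" "F' (g y) = y" using hom that by auto
    then have "F (P (g y)) \<in> E" using inv(2) F(2) by (auto simp: U_def)
    moreover have "g y - P (g y) = y - F (P (g y))" using gU(2) by (simp add: F'_def algebra_simps)
    ultimately have "g y - P (g y) \<in> E" using that E subspace_diff by auto
    then show ?thesis by simp
  qed
  have img: "F ` S' = E \<inter> V"
  proof
    show "F ` S' \<subseteq> E \<inter> V"
    proof
      fix y assume "y \<in> F ` S'"
      then obtain x where x: "x \<in> S'" "y = F x" by blast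
      then have "F' x \<in> V" "F' x = y" "x \<in> S" using hom(3)[of x] F'E[of x] S'S by (auto simp: S'_def)
      then show "y \<in> E \<inter> V" using F(2) x(2) by blast
    qed
    show "E \<inter> V \<subseteq> F ` S'"
    proof
      fix y assume y: "y \<in> E \<inter> V"
      then have "g y \<in> S'" "F (g y) = y" using gE[of y] F'E[of "g y", symmetric] hom(2,4)[of y] by (auto simp: S'_def)
      then show "y \<in> F ` S'" by (metis imageI)
    qed
  qed
  have injF: "v = 0" if "x \<in> S'" "v \<in> E" "deriv_in E F x v = 0" for x v
  proof -
    have "x \<in> U'" "x \<in> E" using that by (auto simp: S'_def)
    then have "bij (blinfun_apply (D x))" using inv(8)[of "F' x"] hom(1,3)[of x] by auto
    moreover have "blinfun_apply (D x) v = 0" using DE(1)[of x v] that \<open>x \<in> U'\<close> \<open>x \<in> E\<close> inv(2) P(3)[of x] by auto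
    ultimately show ?thesis using blinfun.zero_right[of "D x"] using inj_eq[OF bij_is_inj] by metis
  qed
  have T: "rel_open E (E \<inter> V)" using E inv(4) by (auto simp: rel_open_def)
  have S'o: "rel_open E S'" using E inv(1) by (auto simp: rel_open_def S'_def)
  have gT: "g ` (E \<inter> V) \<subseteq> S'" using gE hom by (auto simp: S'_def)
  have Fg: "F (g y) = y" if "y \<in> E \<inter> V" for y using gE[of y] F'E[of "g y", symmetric] hom(2)[of y] that by auto
  have dg: "g differentiable at y within E" if "y \<in> E \<inter> V" for y
    using has_derivative_at_withinI[OF inv(7)] that unfolding differentiable_def by blast
  have eq: "deriv_in E F (g y) (deriv_in E g y v) = v" if "y \<in> E \<inter> V" "v \<in> E" for y v
  proof -
    have gy: "g y \<in> S" using gT S'S that(1) by blast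
    have "((\<lambda>z. F (g z)) has_derivative (\<lambda>v. deriv_in E F (g y) (deriv_in E g y v))) (at y within E)"
      using gT S'S by (intro deriv_in_chain[OF T that(1) S] smooth_in_differentiable[OF F(1) gy] dg[OF that(1)]) blast
    then have "((\<lambda>z. z) has_derivative (\<lambda>v. deriv_in E F (g y) (deriv_in E g y v))) (at y within E)"
      using has_derivative_rel_open_cong[OF T that(1), of "\<lambda>z. F (g z)" "\<lambda>z. z"] Fg by blast
    moreover have "((\<lambda>z. z) has_derivative (\<lambda>v. v)) (at y within E)" by (rule has_derivative_ident)
    ultimately show ?thesis using deriv_in_eq[OF E _ that(2)] that(1) by (metis IntD1)
  qed
  \<comment> \<open>By \<open>eq\<close>, the derivative of the inverse solves a linear system whose
    coefficients are the derivatives of F along g. If g is of class n, then so are the coefficients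
    and hence the solution.\<close>
  have "Ck_in E n g (E \<inter> V)" for n
  proof (induction n)
    case 0
    show ?case using continuous_on_subset[OF hom(5)] by simp
  next
    case (Suc n)
    show ?case
    proof (rule Ck_in_SucI[OF T deriv_in_works[OF dg]])
      fix v assume v: "v \<in> E"
      show "Ck_in E n (\<lambda>y. deriv_in E g y v) (E \<inter> V)"
      proof (rule Ck_in_linear_solution[where A="\<lambda>y. deriv_in E F (g y)" and v="\<lambda>_. v"
            and w="\<lambda>y. deriv_in E g y v", OF T E _ _ _ _ eq[OF _ v] Ck_in_const[OF T]])
        show "linear (deriv_in E F (g z))" if "z \<in> E \<inter> V" for z
          using gT S'S that by (intro deriv_in_linear smooth_in_differentiable[OF F(1)]) auto
        show "e = 0" if "z \<in> E \<inter> V" "e \<in> E" "deriv_in E F (g z) e = 0" for z e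
          using injF that gT by blast
        show "deriv_in E g z v \<in> E" if "z \<in> E \<inter> V" for z
          using gT by (intro deriv_in_closed[OF T that dg[OF that] E _ v]) (auto simp: S'_def)
        show "Ck_in E n (\<lambda>z. deriv_in E F (g z) e) (E \<inter> V)" if "e \<in> E" for e
          using gT S'S smooth_in_deriv[OF F(1) that] by (intro Ck_in_compose[OF T S _ Suc.IH]) (auto simp: smooth_in_def)
      qed
    qed
  qed
  then have "smooth_in E g (F ` S')" unfolding img smooth_in_def by blast
  moreover have "g (F x) = x" if "x \<in> S'" for x using that hom(1)[of x] F'E[of x] by (simp add: S'_def)
  moreover have "p \<in> S'" using pE inv(3) by (simp add: S'_def)
  moreover have "rel_open E (F ` S')" using T img by simp
  ultimately show thesis using that[OF S'o _ S'S] injF by blast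
qed

section \<open>Charts\<close>

text \<open>The part of \<open>smooth_manifold\<close> that concerns charts, separated from the
  Hausdorff and countability axioms; the calculus of maps and tangent vectors rests on it.\<close>

definition smooth_atlas :: "('p, 'e::euclidean_space) manifold \<Rightarrow> bool" where
  "smooth_atlas M \<longleftrightarrow>
     subspace (model M) \<and> (\<Union>c\<in>atlas M. fst c) = points M \<and>
     (\<forall>c\<in>atlas M.
        openin (mtop M) (fst c) \<and>
        openin (top_of_set (model M)) (snd c ` fst c) \<and>
        homeomorphic_map (subtopology (mtop M) (fst c)) (top_of_set (snd c ` fst c)) (snd c)) \<and>
     (\<forall>c\<in>atlas M. \<forall>d\<in>atlas M.
        smooth_in (model M) (snd d \<circ> chart_inv c) (snd c ` (fst c \<inter> fst d)))"

lemma smooth_manifold_iff: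
  "smooth_manifold M \<longleftrightarrow> Hausdorff_space (mtop M) \<and> second_countable (mtop M) \<and> smooth_atlas M"
  by (auto simp: smooth_manifold_def smooth_atlas_def)

lemma smooth_manifold_atlas: "smooth_manifold M \<Longrightarrow> smooth_atlas M"
  by (simp add: smooth_manifold_iff)

lemma smooth_atlas_subspace: "smooth_atlas M \<Longrightarrow> subspace (model M)"
  by (simp add: smooth_atlas_def)

lemma chart_inj: "smooth_atlas M \<Longrightarrow> c \<in> atlas M \<Longrightarrow> inj_on (snd c) (fst c)"
proof -
  assume "smooth_atlas M" "c \<in> atlas M"
  then have "openin (mtop M) (fst c)" "homeomorphic_map (subtopology (mtop M) (fst c)) (top_of_set (snd c ` fst c)) (snd c)"
    by (auto simp: smooth_atlas_def)
  then show ?thesis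
    using openin_subset by (fastforce simp: homeomorphic_map_def Int_absorb1)
qed

lemma chart_inv_eq:
  "smooth_atlas M \<Longrightarrow> c \<in> atlas M \<Longrightarrow> x \<in> fst c \<Longrightarrow> chart_inv c (snd c x) = x"
  by (simp add: chart_inv_def chart_inj)

lemma chart_inv_in: "y \<in> snd c ` A \<Longrightarrow> A \<subseteq> fst c \<Longrightarrow> smooth_atlas M \<Longrightarrow> c \<in> atlas M \<Longrightarrow> chart_inv c y \<in> A"
  using chart_inv_eq by fastforce

lemma chart_chart_inv: "y \<in> snd c ` fst c \<Longrightarrow> snd c (chart_inv c y) = y"
  by (simp add: chart_inv_def f_inv_into_f)

lemma chart_openin: "smooth_atlas M \<Longrightarrow> c \<in> atlas M \<Longrightarrow> openin (mtop M) (fst c)"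
  by (simp add: smooth_atlas_def)

lemma chart_subset: "smooth_atlas M \<Longrightarrow> c \<in> atlas M \<Longrightarrow> fst c \<subseteq> points M"
  by (meson chart_openin openin_subset)

lemma chart_image_rel_open:
  assumes M: "smooth_atlas M" "c \<in> atlas M" and W: "openin (mtop M) W"
  shows "rel_open (model M) (snd c ` (fst c \<inter> W))"
proof -
  have h: "homeomorphic_map (subtopology (mtop M) (fst c)) (top_of_set (snd c ` fst c)) (snd c)"
    and o: "openin (top_of_set (model M)) (snd c ` fst c)"
    using M by (auto simp: smooth_atlas_def)
  have "openin (subtopology (mtop M) (fst c)) (fst c \<inter> W)"
    using W by (auto simp: openin_subtopology)
  then have "openin (top_of_set (snd c ` fst c)) (snd c ` (fst c \<inter> W))"
    using homeomorphic_imp_open_map[OF h] by (simp add: open_map_def)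
  then have "openin (top_of_set (model M)) (snd c ` (fst c \<inter> W))"
    using o openin_trans by blast
  then show ?thesis using M by (simp add: rel_open_def smooth_atlas_def)
qed

lemma chart_rel_open:
  assumes "smooth_atlas M" "c \<in> atlas M"
  shows "rel_open (model M) (snd c ` fst c)"
  using chart_image_rel_open[OF assms chart_openin[OF assms]] by simp

lemma chart_in_model:
  assumes "smooth_atlas M" "c \<in> atlas M" "x \<in> fst c"
  shows "snd c x \<in> model M"
  using rel_openD(3)[OF chart_rel_open[OF assms(1,2)]] assms(3) by blast

lemma chart_continuous:
  assumes "smooth_atlas M" "c \<in> atlas M"
  shows "continuous_map (subtopology (mtop M) (fst c)) euclidean (snd c)"
proof -
  have "homeomorphic_map (subtopology (mtop M) (fst c)) (top_of_set (snd c ` fst c)) (snd c)"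
    using assms by (auto simp: smooth_atlas_def)
  from homeomorphic_imp_continuous_map[OF this] show ?thesis
    by (simp add: continuous_map_in_subtopology)
qed

lemma chart_preimage_openin:
  assumes M: "smooth_atlas M" "c \<in> atlas M" and T: "openin (top_of_set (model M)) T"
  shows "openin (mtop M) {x \<in> fst c. snd c x \<in> T}"
proof -
  obtain T' where T': "open T'" "T = model M \<inter> T'" using T by (auto simp: openin_open)
  have "openin (subtopology (mtop M) (fst c)) {x \<in> topspace (subtopology (mtop M) (fst c)). snd c x \<in> T'}"
    using chart_continuous[OF M] T'(1) by (intro openin_continuous_map_preimage) auto
  then have "openin (mtop M) {x \<in> topspace (subtopology (mtop M) (fst c)). snd c x \<in> T'}"
    using openin_trans_full[OF _ chart_openin[OF M]] by blast
  moreover have "{x \<in> topspace (subtopology (mtop M) (fst c)). snd c x \<in> T'} = {x \<in> fst c. snd c x \<in> T}"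
    using chart_subset[OF M] chart_in_model[OF M] T'(2) by auto
  ultimately show ?thesis by simp
qed

lemma chart_inv_continuous:
  assumes M: "smooth_atlas M" "c \<in> atlas M"
  shows "continuous_map (top_of_set (snd c ` fst c)) (mtop M) (chart_inv c)"
proof -
  have "openin (top_of_set (snd c ` fst c)) {y \<in> snd c ` fst c. chart_inv c y \<in> W}" if W: "openin (mtop M) W" for W
  proof -
    have "{y \<in> snd c ` fst c. chart_inv c y \<in> W} = snd c ` (fst c \<inter> W)"
      using chart_inv_eq[OF M] by auto
    moreover have "openin (top_of_set (snd c ` fst c)) (snd c ` (fst c \<inter> W))"
      using chart_image_rel_open[OF M W] rel_openD(3)[OF chart_rel_open[OF M]]
      by (intro openin_subset_trans[OF rel_openD(2)]) auto
    ultimately show ?thesis by simp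
  qed
  moreover have "chart_inv c y \<in> points M" if "y \<in> snd c ` fst c" for y
    using chart_inv_in[OF that order_refl M] chart_subset[OF M] by blast
  ultimately show ?thesis by (auto simp: continuous_map_def)
qed

lemma charts_atD: "c \<in> charts_at M x \<Longrightarrow> c \<in> atlas M" "c \<in> charts_at M x \<Longrightarrow> x \<in> fst c"
  by (auto simp: charts_at_def)

lemma some_chart_in:
  assumes "smooth_atlas M" "x \<in> points M"
  shows "some_chart M x \<in> charts_at M x"
proof -
  have "x \<in> (\<Union>c\<in>atlas M. fst c)" using assms unfolding smooth_atlas_def by blast
  then have "\<exists>c. c \<in> charts_at M x" by (auto simp: charts_at_def)
  then show ?thesis unfolding some_chart_def by (rule someI_ex)
qed

subsection \<open>Smooth maps between manifolds\<close>

lemma smooth_map_continuous: "smooth_map M N f \<Longrightarrow> continuous_map (mtop M) (mtop N) f"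
  by (simp add: smooth_map_def)

lemma smooth_map_points: "smooth_map M N f \<Longrightarrow> x \<in> points M \<Longrightarrow> f x \<in> points N"
  using continuous_map_image_subset_topspace[OF smooth_map_continuous] by blast

lemma smooth_map_preimage_openin:
  "smooth_map M N f \<Longrightarrow> smooth_atlas N \<Longrightarrow> d \<in> atlas N \<Longrightarrow> openin (mtop M) {x \<in> points M. f x \<in> fst d}"
  by (rule openin_continuous_map_preimage[OF smooth_map_continuous chart_openin])

lemma smooth_map_dom:
  assumes "smooth_map M N f" "smooth_atlas M" "smooth_atlas N" "c \<in> atlas M" "d \<in> atlas N"
  shows "rel_open (model M) (snd c ` {x \<in> fst c. f x \<in> fst d})"
    "smooth_in (model M) (\<lambda>y. snd d (f (chart_inv c y))) (snd c ` {x \<in> fst c. f x \<in> fst d})"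
proof -
  have "{x \<in> fst c. f x \<in> fst d} = fst c \<inter> {x \<in> points M. f x \<in> fst d}"
    using chart_subset[OF assms(2,4)] by auto
  then show "rel_open (model M) (snd c ` {x \<in> fst c. f x \<in> fst d})"
    using chart_image_rel_open[OF assms(2,4) smooth_map_preimage_openin[OF assms(1,3,5)]] by simp
  have eq: "fst c \<inter> f -` fst d = {x \<in> fst c. f x \<in> fst d}" by auto
  have "smooth_in (model M) (snd d \<circ> f \<circ> chart_inv c) (snd c ` (fst c \<inter> f -` fst d))"
    using assms(1,4,5) by (simp add: smooth_map_def)
  then show "smooth_in (model M) (\<lambda>y. snd d (f (chart_inv c y))) (snd c ` {x \<in> fst c. f x \<in> fst d})"
    unfolding eq comp_def .
qed

lemma smooth_map_id: "smooth_atlas M \<Longrightarrow> smooth_map M M (\<lambda>x. x)"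
  unfolding smooth_map_def smooth_atlas_def by (simp add: comp_def vimage_def)

text \<open>The definition quantifies over all pairs of charts, here one pair around each point is
  given: near the point the expression in other charts is the given one composed with changes of
  charts on both sides.\<close>

lemma smooth_mapI:
  assumes M: "smooth_atlas M" and N: "smooth_atlas N"
    and cont: "continuous_map (mtop M) (mtop N) f"
    and loc: "\<And>x. x \<in> points M \<Longrightarrow> \<exists>c\<in>charts_at M x. \<exists>d\<in>charts_at N (f x). \<exists>W. openin (mtop M) W \<and> x \<in> W \<and>
      W \<subseteq> {x \<in> fst c. f x \<in> fst d} \<and> smooth_in (model M) (\<lambda>y. snd d (f (chart_inv c y))) (snd c ` W)"
  shows "smooth_map M N f"
  unfolding smooth_map_def
proof (intro conjI cont ballI)
  fix c' d' assume c': "c' \<in> atlas M" and d': "d' \<in> atlas N"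
  show "smooth_in (model M) (snd d' \<circ> f \<circ> chart_inv c') (snd c' ` (fst c' \<inter> f -` fst d'))"
  proof (rule smooth_in_local)
    show "snd c' ` (fst c' \<inter> f -` fst d') \<subseteq> model M" using chart_in_model[OF M c'] by auto
    fix y assume "y \<in> snd c' ` (fst c' \<inter> f -` fst d')"
    then obtain x where x: "x \<in> fst c'" "f x \<in> fst d'" "y = snd c' x" by auto
    then have "x \<in> points M" using chart_subset[OF M c'] by auto
    from loc[OF this] obtain c d W where c: "c \<in> atlas M" "x \<in> fst c" and d: "d \<in> atlas N" "f x \<in> fst d"
      and W: "openin (mtop M) W" "x \<in> W" "W \<subseteq> {x \<in> fst c. f x \<in> fst d}"
      and sm: "smooth_in (model M) (\<lambda>y. snd d (f (chart_inv c y))) (snd c ` W)"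
      by (auto simp: charts_at_def)
    define W' where "W' = W \<inter> fst c' \<inter> {x \<in> points M. f x \<in> fst d'}"
    have "openin (mtop M) {x \<in> points M. f x \<in> fst d'}"
      using openin_continuous_map_preimage[OF cont chart_openin[OF N d']] .
    then have W'o: "openin (mtop M) W'" using W(1) chart_openin[OF M c'] by (auto simp: W'_def)
    have xW': "x \<in> W'" using W x \<open>x \<in> points M\<close> by (auto simp: W'_def)
    have sub: "W' \<subseteq> fst c'" "W' \<subseteq> fst c" "W' \<subseteq> W" "\<And>z. z \<in> W' \<Longrightarrow> f z \<in> fst d \<and> f z \<in> fst d'"
      using W by (auto simp: W'_def)
    have ro: "rel_open (model M) (snd c' ` W')" "rel_open (model M) (snd c ` W')"
      using chart_image_rel_open[OF M c' W'o] chart_image_rel_open[OF M c(1) W'o] sub by (simp_all add: Int_absorb1)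
    have inv: "chart_inv c' (snd c' z) = z" "chart_inv c (snd c z) = z" if "z \<in> W'" for z
      using chart_inv_eq[OF M] c' c sub that by blast+
    define h where "h y = snd c (chart_inv c' y)" for y
    have h: "smooth_in (model M) h (snd c' ` W')"
    proof -
      have "smooth_in (model M) (snd c \<circ> chart_inv c') (snd c' ` (fst c' \<inter> fst c))"
        using M c' c(1) by (simp add: smooth_atlas_def)
      then show ?thesis unfolding h_def comp_def by (rule smooth_in_subset) (use sub in auto)
    qed
    define g where "g y = snd d (f (chart_inv c y))" for y
    have g: "smooth_in (model M) g (snd c ` W')"
      unfolding g_def using sm by (rule smooth_in_subset) (use sub in auto)
    define k where "k y = snd d' (chart_inv d y)" for y
    have k: "smooth_in (model N) k (snd d ` (fst d \<inter> fst d'))"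
      using N d d' by (simp add: k_def[abs_def] smooth_atlas_def comp_def)
    have kro: "rel_open (model N) (snd d ` (fst d \<inter> fst d'))"
      using chart_image_rel_open[OF N d(1) chart_openin[OF N d']] .
    have hI: "h ` (snd c' ` W') \<subseteq> snd c ` W'" using inv by (auto simp: h_def)
    have gI: "g ` (snd c ` W') \<subseteq> snd d ` (fst d \<inter> fst d')" using inv sub by (auto simp: g_def)
    have "smooth_in (model M) (\<lambda>y. g (h y)) (snd c' ` W')"
      by (rule smooth_in_compose[OF ro hI h g])
    moreover have "(\<lambda>y. g (h y)) ` (snd c' ` W') \<subseteq> snd d ` (fst d \<inter> fst d')"
      using hI gI by blast
    ultimately have kgh: "smooth_in (model M) (\<lambda>y. k (g (h y))) (snd c' ` W')"
      by (intro smooth_in_compose[OF ro(1) kro _ _ k])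
    have eq: "(snd d' \<circ> f \<circ> chart_inv c') z = k (g (h z))" if "z \<in> snd c' ` W'" for z
      using that inv sub chart_inv_eq[OF N d(1)] by (auto simp: k_def g_def h_def)
    have "smooth_in (model M) (snd d' \<circ> f \<circ> chart_inv c') (snd c' ` W')"
      by (rule smooth_in_congI[OF ro(1) kgh eq])
    then show "\<exists>S'. rel_open (model M) S' \<and> y \<in> S' \<and> smooth_in (model M) (snd d' \<circ> f \<circ> chart_inv c') S'"
      using ro(1) xW' x(3) by blast
  qed
qed

text \<open>Smoothness of the composite and the chain rule use the same neighbourhood W, on which
  the intermediate chart d is available, so both are obtained together.\<close>

lemma chart_composite:
  assumes M: "smooth_atlas M" and N: "smooth_atlas N" and L: "smooth_atlas L"
    and f: "smooth_map M N f" and g: "smooth_map N L g"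
    and c: "c \<in> charts_at M x" and d: "d \<in> charts_at N (f x)" and e: "e \<in> charts_at L (g (f x))"
  obtains W where "openin (mtop M) W" "x \<in> W" "W \<subseteq> {z \<in> fst c. g (f z) \<in> fst e}"
    "smooth_in (model M) (\<lambda>y. snd e (g (f (chart_inv c y)))) (snd c ` W)"
    "\<And>v. v \<in> model M \<Longrightarrow> deriv_in (model M) (\<lambda>y. snd e (g (f (chart_inv c y)))) (snd c x) v =
      deriv_in (model N) (\<lambda>y. snd e (g (chart_inv d y))) (snd d (f x))
        (deriv_in (model M) (\<lambda>y. snd d (f (chart_inv c y))) (snd c x) v)"
proof -
  note cc = charts_atD[OF c] and dd = charts_atD[OF d] and ee = charts_atD[OF e]
  define A where "A = {z \<in> fst c. f z \<in> fst d}"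
  define B where "B = {z \<in> fst d. g z \<in> fst e}"
  have Bo: "openin (mtop N) B"
  proof -
    have "B = fst d \<inter> {z \<in> points N. g z \<in> fst e}" using chart_subset[OF N dd(1)] by (auto simp: B_def)
    then show ?thesis using smooth_map_preimage_openin[OF g L ee(1)] chart_openin[OF N dd(1)] by auto
  qed
  define W where "W = fst c \<inter> {z \<in> points M. f z \<in> B}"
  have Wo: "openin (mtop M) W"
    unfolding W_def using chart_openin[OF M cc(1)] openin_continuous_map_preimage[OF smooth_map_continuous[OF f] Bo] by auto
  have xW: "x \<in> W" using cc dd ee chart_subset[OF M cc(1)] by (auto simp: W_def B_def)
  have ro: "rel_open (model M) (snd c ` W)"
    using chart_image_rel_open[OF M cc(1) Wo] by (simp add: W_def Int_absorb1)
  have rB: "rel_open (model N) (snd d ` B)" and sg: "smooth_in (model N) (\<lambda>y. snd e (g (chart_inv d y))) (snd d ` B)"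
    using smooth_map_dom[OF g N L dd(1) ee(1)] by (simp_all add: B_def)
  have sf: "smooth_in (model M) (\<lambda>y. snd d (f (chart_inv c y))) (snd c ` W)"
    by (rule smooth_in_subset[OF smooth_map_dom(2)[OF f M N cc(1) dd(1)]]) (auto simp: W_def B_def)
  have inv: "chart_inv c (snd c z) = z" "chart_inv d (snd d (f z)) = f z" if "z \<in> W" for z
    using chart_inv_eq[OF M cc(1)] chart_inv_eq[OF N dd(1)] that by (auto simp: W_def B_def)
  have img: "(\<lambda>y. snd d (f (chart_inv c y))) ` (snd c ` W) \<subseteq> snd d ` B"
    using inv by (auto simp: W_def)
  define h where "h y = snd e (g (chart_inv d (snd d (f (chart_inv c y)))))" for y
  have h: "smooth_in (model M) h (snd c ` W)"
    unfolding h_def by (rule smooth_in_compose[OF ro rB img sf sg])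
  have eq: "snd e (g (f (chart_inv c y))) = h y" if "y \<in> snd c ` W" for y
    using that inv by (auto simp: h_def)
  show thesis
  proof
    show "openin (mtop M) W" "x \<in> W" by fact+
    show "W \<subseteq> {z \<in> fst c. g (f z) \<in> fst e}" by (auto simp: W_def B_def)
    show "smooth_in (model M) (\<lambda>y. snd e (g (f (chart_inv c y)))) (snd c ` W)"
      using h by (rule smooth_in_congI[OF ro]) (rule eq)
    fix v assume v: "v \<in> model M"
    have "deriv_in (model M) (\<lambda>y. snd e (g (f (chart_inv c y)))) (snd c x) v = deriv_in (model M) h (snd c x) v"
      using eq xW by (intro deriv_in_cong[OF ro]) auto
    also have "\<dots> = deriv_in (model N) (\<lambda>y. snd e (g (chart_inv d y))) (snd d (f (chart_inv c (snd c x))))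
        (deriv_in (model M) (\<lambda>y. snd d (f (chart_inv c y))) (snd c x) v)"
      unfolding h_def using xW by (intro smooth_in_deriv_chain[OF ro rB img sf sg _ v]) auto
    finally show "deriv_in (model M) (\<lambda>y. snd e (g (f (chart_inv c y)))) (snd c x) v =
      deriv_in (model N) (\<lambda>y. snd e (g (chart_inv d y))) (snd d (f x))
        (deriv_in (model M) (\<lambda>y. snd d (f (chart_inv c y))) (snd c x) v)"
      by (simp add: inv xW)
  qed
qed

lemma chart_chain_rule:
  assumes M: "smooth_atlas M" and N: "smooth_atlas N" and L: "smooth_atlas L"
    and f: "smooth_map M N f" and g: "smooth_map N L g"
    and c: "c \<in> charts_at M x" and d: "d \<in> charts_at N (f x)" and e: "e \<in> charts_at L (g (f x))"
    and v: "v \<in> model M"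
  shows "deriv_in (model M) (\<lambda>y. snd e (g (f (chart_inv c y)))) (snd c x) v =
      deriv_in (model N) (\<lambda>y. snd e (g (chart_inv d y))) (snd d (f x))
        (deriv_in (model M) (\<lambda>y. snd d (f (chart_inv c y))) (snd c x) v)"
proof (rule chart_composite[OF M N L f g c d e])
  fix W
  assume "\<And>v. v \<in> model M \<Longrightarrow> deriv_in (model M) (\<lambda>y. snd e (g (f (chart_inv c y)))) (snd c x) v =
      deriv_in (model N) (\<lambda>y. snd e (g (chart_inv d y))) (snd d (f x))
        (deriv_in (model M) (\<lambda>y. snd d (f (chart_inv c y))) (snd c x) v)"
  from this[OF v] show ?thesis .
qed

lemma smooth_map_compose:
  assumes M: "smooth_atlas M" and N: "smooth_atlas N" and L: "smooth_atlas L"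
    and f: "smooth_map M N f" and g: "smooth_map N L g"
  shows "smooth_map M L (\<lambda>x. g (f x))"
proof (rule smooth_mapI[OF M L])
  show "continuous_map (mtop M) (mtop L) (\<lambda>x. g (f x))"
    using continuous_map_compose[OF smooth_map_continuous[OF f] smooth_map_continuous[OF g]]
    by (simp add: comp_def)
  fix x assume x: "x \<in> points M"
  note fx = smooth_map_points[OF f x] and gfx = smooth_map_points[OF g smooth_map_points[OF f x]]
  have c: "some_chart M x \<in> charts_at M x" "some_chart N (f x) \<in> charts_at N (f x)"
    "some_chart L (g (f x)) \<in> charts_at L (g (f x))"
    using some_chart_in[OF M x] some_chart_in[OF N fx] some_chart_in[OF L gfx] by auto
  obtain W where W: "openin (mtop M) W" "x \<in> W" "W \<subseteq> {z \<in> fst (some_chart M x). g (f z) \<in> fst (some_chart L (g (f x)))}"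
    "smooth_in (model M) (\<lambda>y. snd (some_chart L (g (f x))) (g (f (chart_inv (some_chart M x) y)))) (snd (some_chart M x) ` W)"
    by (rule chart_composite[OF M N L f g c]) (rule that)
  show "\<exists>c\<in>charts_at M x. \<exists>d\<in>charts_at L (g (f x)). \<exists>W. openin (mtop M) W \<and> x \<in> W \<and>
      W \<subseteq> {x \<in> fst c. g (f x) \<in> fst d} \<and> smooth_in (model M) (\<lambda>y. snd d (g (f (chart_inv c y)))) (snd c ` W)"
    by (intro bexI[OF _ c(1)] bexI[OF _ c(3)] exI[of _ W] conjI W)
qed

subsection \<open>Tangent vectors\<close>

lemma tangent_space_model: "t \<in> tangent_space M x \<Longrightarrow> c \<in> charts_at M x \<Longrightarrow> t c \<in> model M"
  unfolding tangent_space_def mem_Collect_eq by (elim conjE) (erule (1) bspec)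

lemma tangent_space_outside: "t \<in> tangent_space M x \<Longrightarrow> c \<notin> charts_at M x \<Longrightarrow> t c = 0"
  unfolding tangent_space_def mem_Collect_eq by (elim conjE) (erule allE, erule (1) mp)

lemma tangent_space_change:
  "t \<in> tangent_space M x \<Longrightarrow> c \<in> charts_at M x \<Longrightarrow> d \<in> charts_at M x \<Longrightarrow>
    t d = deriv_in (model M) (\<lambda>y. snd d (chart_inv c y)) (snd c x) (t c)"
  unfolding tangent_space_def mem_Collect_eq comp_def by (elim conjE) (drule (1) bspec, erule (1) bspec)

lemma tangent_spaceI:
  assumes "\<And>c. c \<notin> charts_at M x \<Longrightarrow> t c = 0" "\<And>c. c \<in> charts_at M x \<Longrightarrow> t c \<in> model M"
    "\<And>c d. c \<in> charts_at M x \<Longrightarrow> d \<in> charts_at M x \<Longrightarrow>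
      t d = deriv_in (model M) (\<lambda>y. snd d (chart_inv c y)) (snd c x) (t c)"
  shows "t \<in> tangent_space M x"
  unfolding tangent_space_def mem_Collect_eq comp_def by (intro conjI allI impI ballI assms)

lemma deriv_in_chart_closed:
  assumes M: "smooth_atlas M" and N: "smooth_atlas N" and f: "smooth_map M N f"
    and c: "c \<in> charts_at M x" and d: "d \<in> charts_at N (f x)" and v: "v \<in> model M"
  shows "deriv_in (model M) (\<lambda>y. snd d (f (chart_inv c y))) (snd c x) v \<in> model N"
proof -
  note cc = charts_atD[OF c] and dd = charts_atD[OF d]
  have 1: "snd c x \<in> snd c ` {x \<in> fst c. f x \<in> fst d}"
    by (rule imageI) (simp add: cc dd)
  have 2: "(\<lambda>y. snd d (f (chart_inv c y))) ` (snd c ` {x \<in> fst c. f x \<in> fst d}) \<subseteq> model N"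
    by (auto simp: chart_inv_eq[OF M cc(1)] intro: chart_in_model[OF N dd(1)])
  show ?thesis
    by (rule smooth_in_deriv_closed[OF smooth_map_dom(1)[OF f M N cc(1) dd(1)]
          smooth_map_dom(2)[OF f M N cc(1) dd(1)] 1 smooth_atlas_subspace[OF N] 2 v])
qed

lemma deriv_in_chart_linear:
  assumes M: "smooth_atlas M" and N: "smooth_atlas N" and f: "smooth_map M N f"
    and c: "c \<in> charts_at M x" and d: "d \<in> charts_at N (f x)"
  shows "linear (deriv_in (model M) (\<lambda>y. snd d (f (chart_inv c y))) (snd c x))"
proof (rule deriv_in_linear[OF smooth_in_differentiable])
  show "smooth_in (model M) (\<lambda>y. snd d (f (chart_inv c y))) (snd c ` {x \<in> fst c. f x \<in> fst d})"
    using smooth_map_dom(2)[OF f M N] charts_atD[OF c] charts_atD[OF d] by blast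
  show "snd c x \<in> snd c ` {x \<in> fst c. f x \<in> fst d}"
    by (rule imageI) (simp add: charts_atD[OF c] charts_atD[OF d])
qed

lemma deriv_in_chart_self:
  assumes M: "smooth_atlas M" and c: "c \<in> charts_at M x" and v: "v \<in> model M"
  shows "deriv_in (model M) (\<lambda>y. snd c (chart_inv c y)) (snd c x) v = v"
proof -
  note cc = charts_atD[OF c]
  have "deriv_in (model M) (\<lambda>y. snd c (chart_inv c y)) (snd c x) v = deriv_in (model M) (\<lambda>y. y) (snd c x) v"
    by (rule deriv_in_cong[OF chart_rel_open[OF M cc(1)]]) (simp_all add: cc chart_chart_inv)
  also have "\<dots> = v"
    by (rule deriv_in_eq[OF smooth_atlas_subspace[OF M] chart_in_model[OF M cc] v has_derivative_ident])
  finally show ?thesis .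
qed

text \<open>The compatibility of the coordinate vectors is the chain rule for changes of charts,
  that is, \<open>chart_chain_rule\<close> for identity maps.\<close>

lemma tvec_of_tangent:
  assumes M: "smooth_atlas M" and c: "c \<in> charts_at M x" and v: "v \<in> model M"
  shows "tvec_of M x c v \<in> tangent_space M x"
proof -
  have tv: "tvec_of M x c v d = deriv_in (model M) (\<lambda>y. snd d (chart_inv c y)) (snd c x) v"
    if "d \<in> charts_at M x" for d using that by (simp add: tvec_of_def comp_def)
  show ?thesis
  proof (rule tangent_spaceI)
    show "tvec_of M x c v d = 0" if "d \<notin> charts_at M x" for d using that by (simp add: tvec_of_def)
    show "tvec_of M x c v d \<in> model M" if "d \<in> charts_at M x" for d
      unfolding tv[OF that] using deriv_in_chart_closed[OF M M smooth_map_id[OF M] c that v] .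
    show "tvec_of M x c v e = deriv_in (model M) (\<lambda>y. snd e (chart_inv d y)) (snd d x) (tvec_of M x c v d)"
      if "d \<in> charts_at M x" "e \<in> charts_at M x" for d e
      unfolding tv[OF that(1)] tv[OF that(2)]
      using chart_chain_rule[OF M M M smooth_map_id[OF M] smooth_map_id[OF M] c that v] .
  qed
qed

lemma tvec_of_self:
  assumes "smooth_atlas M" "c \<in> charts_at M x" "v \<in> model M"
  shows "tvec_of M x c v c = v"
  using deriv_in_chart_self[OF assms] assms(2) by (simp add: tvec_of_def comp_def)

lemma tangent_space_eqI:
  assumes "s \<in> tangent_space M x" "t \<in> tangent_space M x" "c \<in> charts_at M x" "s c = t c"
  shows "s = t"
proof
  fix d show "s d = t d"
  proof (cases "d \<in> charts_at M x")
    case True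
    from tangent_space_change[OF assms(1,3) this] tangent_space_change[OF assms(2,3) this] assms(4)
    show ?thesis by simp
  next
    case False
    then show ?thesis by (simp add: tangent_space_outside[OF assms(1)] tangent_space_outside[OF assms(2)])
  qed
qed

lemma tvec_of_chart:
  assumes "smooth_atlas M" "t \<in> tangent_space M x" "c \<in> charts_at M x"
  shows "tvec_of M x c (t c) = t"
  by (rule tangent_space_eqI[OF tvec_of_tangent assms(2,3)])
    (rule assms tangent_space_model[OF assms(2,3)] tvec_of_self)+

lemma tangent_space_add:
  assumes M: "smooth_atlas M" and st: "s \<in> tangent_space M x" "t \<in> tangent_space M x"
  shows "(\<lambda>c. s c + t c) \<in> tangent_space M x"
proof -
  have "deriv_in (model M) (\<lambda>y. snd d (chart_inv c y)) (snd c x) (s c + t c) = s d + t d"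
    if "c \<in> charts_at M x" "d \<in> charts_at M x" for c d
    using linear_add[OF deriv_in_chart_linear[OF M M smooth_map_id[OF M] that]]
      tangent_space_change[OF st(1) that, symmetric] tangent_space_change[OF st(2) that, symmetric] by simp
  then show ?thesis
    by (intro tangent_spaceI subspace_add[OF smooth_atlas_subspace[OF M]]
        tangent_space_model[OF st(1)] tangent_space_model[OF st(2)])
      (simp_all add: tangent_space_outside[OF st(1)] tangent_space_outside[OF st(2)])
qed

lemma tangent_space_scale:
  assumes M: "smooth_atlas M" and t: "t \<in> tangent_space M x"
  shows "(\<lambda>c. r *\<^sub>R t c) \<in> tangent_space M x"
proof -
  have "deriv_in (model M) (\<lambda>y. snd d (chart_inv c y)) (snd c x) (r *\<^sub>R t c) = r *\<^sub>R t d"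
    if "c \<in> charts_at M x" "d \<in> charts_at M x" for c d
    using linear_scale[OF deriv_in_chart_linear[OF M M smooth_map_id[OF M] that]]
      tangent_space_change[OF t that, symmetric] by simp
  then show ?thesis
    by (intro tangent_spaceI subspace_scale[OF smooth_atlas_subspace[OF M]] tangent_space_model[OF t])
      (simp_all add: tangent_space_outside[OF t])
qed

subsection \<open>The differential of a smooth map\<close>

text \<open>Removes the arbitrary \<open>some_chart\<close> of the definition: the chain rule is
  applied to the identity followed by f, which leads from the chosen chart to c.\<close>

lemma pushforward_chart:
  assumes M: "smooth_atlas M" and N: "smooth_atlas N" and f: "smooth_map M N f"
    and x: "x \<in> points M" and t: "t \<in> tangent_space M x"
    and c: "c \<in> charts_at M x" and d: "d \<in> charts_at N (f x)"
  shows "pushforward M N f x t d = deriv_in (model M) (\<lambda>y. snd d (f (chart_inv c y))) (snd c x) (t c)"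
proof -
  let ?c = "some_chart M x"
  have sc: "?c \<in> charts_at M x" using some_chart_in[OF M x] .
  have "pushforward M N f x t d = deriv_in (model M) (\<lambda>y. snd d (f (chart_inv ?c y))) (snd ?c x) (t ?c)"
    using d by (simp add: pushforward_def Let_def comp_def)
  also have "\<dots> = deriv_in (model M) (\<lambda>y. snd d (f (chart_inv c y))) (snd c x)
       (deriv_in (model M) (\<lambda>y. snd c (chart_inv ?c y)) (snd ?c x) (t ?c))"
    using chart_chain_rule[OF M M N smooth_map_id[OF M] f sc c d tangent_space_model[OF t sc]] .
  finally show ?thesis unfolding tangent_space_change[OF t sc c, symmetric] .
qed

lemma pushforward_outside: "d \<notin> charts_at N (f x) \<Longrightarrow> pushforward M N f x t d = 0"
  by (simp add: pushforward_def Let_def)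

lemma pushforward_tangent:
  assumes M: "smooth_atlas M" and N: "smooth_atlas N" and f: "smooth_map M N f"
    and x: "x \<in> points M" and t: "t \<in> tangent_space M x"
  shows "pushforward M N f x t \<in> tangent_space N (f x)"
proof -
  let ?c = "some_chart M x"
  have c: "?c \<in> charts_at M x" using some_chart_in[OF M x] .
  note pc = pushforward_chart[OF M N f x t c]
  have "pushforward M N f x t e = deriv_in (model N) (\<lambda>y. snd e (chart_inv d y)) (snd d (f x)) (pushforward M N f x t d)"
    if de: "d \<in> charts_at N (f x)" "e \<in> charts_at N (f x)" for d e
    unfolding pc[OF de(1)] pc[OF de(2)]
    using chart_chain_rule[OF M N N f smooth_map_id[OF N] c de tangent_space_model[OF t c]] .
  moreover have "pushforward M N f x t d \<in> model N" if "d \<in> charts_at N (f x)" for d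
    unfolding pc[OF that] by (rule deriv_in_chart_closed[OF M N f c that tangent_space_model[OF t c]])
  ultimately show ?thesis
    by (intro tangent_spaceI) (blast intro: pushforward_outside)+
qed

lemma pushforward_compose:
  assumes M: "smooth_atlas M" and N: "smooth_atlas N" and L: "smooth_atlas L"
    and f: "smooth_map M N f" and g: "smooth_map N L g"
    and x: "x \<in> points M" and t: "t \<in> tangent_space M x"
  shows "pushforward M L (\<lambda>x. g (f x)) x t = pushforward N L g (f x) (pushforward M N f x t)"
proof -
  let ?c = "some_chart M x" and ?d = "some_chart N (f x)" and ?e = "some_chart L (g (f x))"
  note fx = smooth_map_points[OF f x] and gfx = smooth_map_points[OF g smooth_map_points[OF f x]]
  have c: "?c \<in> charts_at M x" and d: "?d \<in> charts_at N (f x)" and e: "?e \<in> charts_at L (g (f x))"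
    using some_chart_in[OF M x] some_chart_in[OF N fx] some_chart_in[OF L gfx] by auto
  note gf = smooth_map_compose[OF M N L f g]
  note ft = pushforward_tangent[OF M N f x t]
  show ?thesis
  proof (rule tangent_space_eqI[OF _ _ e])
    show "pushforward M L (\<lambda>x. g (f x)) x t \<in> tangent_space L (g (f x))"
      using pushforward_tangent[OF M L gf x t] .
    show "pushforward N L g (f x) (pushforward M N f x t) \<in> tangent_space L (g (f x))"
      using pushforward_tangent[OF N L g fx ft] .
    show "pushforward M L (\<lambda>x. g (f x)) x t ?e = pushforward N L g (f x) (pushforward M N f x t) ?e"
      unfolding pushforward_chart[OF M L gf x t c e] pushforward_chart[OF N L g fx ft d e]
        pushforward_chart[OF M N f x t c d]
      using chart_chain_rule[OF M N L f g c d e tangent_space_model[OF t c]] .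
  qed
qed

lemma pushforward_id:
  assumes M: "smooth_atlas M" and x: "x \<in> points M" and t: "t \<in> tangent_space M x"
  shows "pushforward M M (\<lambda>x. x) x t = t"
proof -
  have c: "some_chart M x \<in> charts_at M x" using some_chart_in[OF M x] .
  show ?thesis
    using pushforward_chart[OF M M smooth_map_id[OF M] x t c c] deriv_in_chart_self[OF M c tangent_space_model[OF t c]]
    by (intro tangent_space_eqI[OF pushforward_tangent[OF M M smooth_map_id[OF M] x t] t c]) simp
qed

lemma pushforward_cong:
  assumes M: "smooth_atlas M" and N: "smooth_atlas N" and f: "smooth_map M N f" "smooth_map M N g"
    and x: "x \<in> points M" and t: "t \<in> tangent_space M x"
    and eq: "\<And>z. z \<in> points M \<Longrightarrow> f z = g z"
  shows "pushforward M N f x t = pushforward M N g x t"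
proof -
  let ?c = "some_chart M x" and ?d = "some_chart N (f x)"
  have c: "?c \<in> charts_at M x" and d: "?d \<in> charts_at N (f x)"
    using some_chart_in[OF M x] some_chart_in[OF N smooth_map_points[OF f(1) x]] by auto
  have d': "?d \<in> charts_at N (g x)" using d eq[OF x] by simp
  have "deriv_in (model M) (\<lambda>y. snd ?d (f (chart_inv ?c y))) (snd ?c x) (t ?c) = deriv_in (model M) (\<lambda>y. snd ?d (g (chart_inv ?c y))) (snd ?c x) (t ?c)"
  proof (rule deriv_in_cong[OF chart_rel_open[OF M charts_atD(1)[OF c]]])
    show "snd ?c x \<in> snd ?c ` fst ?c" using charts_atD(2)[OF c] by (rule imageI)
    fix y assume "y \<in> snd ?c ` fst ?c"
    then have "chart_inv ?c y \<in> points M"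
      using chart_inv_in[OF _ order_refl M charts_atD(1)[OF c]] chart_subset[OF M charts_atD(1)[OF c]] by blast
    then show "snd ?d (f (chart_inv ?c y)) = snd ?d (g (chart_inv ?c y))" by (simp add: eq)
  qed
  then show ?thesis
    using pushforward_chart[OF M N f(1) x t c d] pushforward_chart[OF M N f(2) x t c d']
      pushforward_tangent[OF M N f(1) x t] pushforward_tangent[OF M N f(2) x t] eq[OF x]
    by (intro tangent_space_eqI[OF _ _ d]) auto
qed

section \<open>Open pieces of a subspace as manifolds\<close>

text \<open>Parameter domains and the base are all of this form. With the identity as the single
  chart, tangent vectors become elements of A through \<open>flat_vec\<close>, and statements about
  forms become statements about functions of a point and a vector.\<close>

definition flat :: "'a::euclidean_space set \<Rightarrow> 'a set \<Rightarrow> ('a, 'a) manifold" where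
  "flat A S = \<lparr>mtop = top_of_set S, model = A, atlas = {(S, \<lambda>x. x)}\<rparr>"

definition flat_vec :: "'a::euclidean_space set \<Rightarrow> 'a \<Rightarrow> ('a, 'a) tvec" where
  "flat_vec S v = (\<lambda>d. if d = (S, \<lambda>x. x) then v else 0)"

lemma flat_simps [simp]:
  "mtop (flat A S) = top_of_set S" "model (flat A S) = A" "atlas (flat A S) = {(S, \<lambda>x. x)}"
  by (simp_all add: flat_def)

lemma chart_inv_flat: "y \<in> S \<Longrightarrow> chart_inv (S, \<lambda>x. x) y = y"
  using f_inv_into_f[of y "\<lambda>x. x" S] by (simp add: chart_inv_def)

lemma second_countable_euclidean: "second_countable (euclidean :: 'a::second_countable_topology topology)"
proof -
  obtain B :: "'a set set" where B: "countable B" "topological_basis B"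
    using ex_countable_basis by metis
  have basis: "\<exists>V\<in>B. x \<in> V \<and> V \<subseteq> U" if U: "open U" "x \<in> U" for U x
  proof (rule topological_basisE[OF B(2) U])
    fix V assume "V \<in> B" "x \<in> V" "V \<subseteq> U"
    then show ?thesis by blast
  qed
  show ?thesis unfolding second_countable_def open_openin[symmetric]
    using B(1) topological_basis_open[OF B(2)] basis by (intro exI[of _ B] conjI ballI allI impI) blast+
qed

lemma smooth_manifold_flat:
  assumes "rel_open A S" shows "smooth_manifold (flat A S)"
  unfolding smooth_manifold_def
proof (intro conjI ballI)
  show "Hausdorff_space (mtop (flat A S))" by (simp add: Hausdorff_space_subtopology)
  show "second_countable (mtop (flat A S))"
    by (simp add: second_countable_subtopology second_countable_euclidean)
  show "subspace (model (flat A S))" using rel_openD(1)[OF assms] by simp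
  show "(\<Union>c\<in>atlas (flat A S). fst c) = points (flat A S)" by simp
  fix c assume c: "c \<in> atlas (flat A S)"
  show "openin (mtop (flat A S)) (fst c)" using c by simp
  show "openin (top_of_set (model (flat A S))) (snd c ` fst c)"
    using c rel_openD(2)[OF assms] by simp
  show "homeomorphic_map (subtopology (mtop (flat A S)) (fst c)) (top_of_set (snd c ` fst c)) (snd c)"
    using c by (simp add: subtopology_subtopology homeomorphic_map_id[unfolded id_def])
  fix d assume d: "d \<in> atlas (flat A S)"
  have "smooth_in A (\<lambda>y. chart_inv (S, \<lambda>x. x) y) S"
    by (rule smooth_in_congI[OF assms smooth_in_id[OF assms] chart_inv_flat])
  then show "smooth_in (model (flat A S)) (snd d \<circ> chart_inv c) (snd c ` (fst c \<inter> fst d))"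
    using c d by (simp add: comp_def)
qed

lemma smooth_atlas_flat: "rel_open A S \<Longrightarrow> smooth_atlas (flat A S)"
  by (simp add: smooth_manifold_flat smooth_manifold_atlas)

lemma charts_at_flat: "x \<in> S \<Longrightarrow> charts_at (flat A S) x = {(S, \<lambda>x. x)}"
  by (auto simp: charts_at_def)

lemma some_chart_flat: "x \<in> S \<Longrightarrow> some_chart (flat A S) x = (S, \<lambda>x. x)"
  by (simp add: some_chart_def charts_at_flat)

lemma flat_vec_self [simp]: "flat_vec S v (S, \<lambda>x. x) = v"
  by (simp add: flat_vec_def)

lemma tangent_space_flat:
  assumes "rel_open A S" "x \<in> S"
  shows "tangent_space (flat A S) x = flat_vec S ` A"
proof -
  have self: "deriv_in A (\<lambda>y. chart_inv (S, \<lambda>x. x) y) x v = v" if "v \<in> A" for v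
    using deriv_in_chart_self[OF smooth_atlas_flat[OF assms(1)], of "(S, \<lambda>x. x)" x v] assms(2) that
    by (simp add: charts_at_flat)
  show ?thesis
  proof
    show "tangent_space (flat A S) x \<subseteq> flat_vec S ` A"
    proof
      fix t assume t: "t \<in> tangent_space (flat A S) x"
      have "t (S, \<lambda>x. x) \<in> A" using tangent_space_model[OF t] assms(2) by (simp add: charts_at_flat)
      moreover have "t = flat_vec S (t (S, \<lambda>x. x))"
      proof
        fix d
        have "t d = 0" if "d \<noteq> (S, \<lambda>x. x)"
          by (rule tangent_space_outside[OF t]) (simp add: charts_at_flat[OF assms(2)] that)
        then show "t d = flat_vec S (t (S, \<lambda>x. x)) d" by (simp add: flat_vec_def)
      qed
      ultimately show "t \<in> flat_vec S ` A" by blast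
    qed
    show "flat_vec S ` A \<subseteq> tangent_space (flat A S) x"
    proof
      fix t assume "t \<in> flat_vec S ` A"
      then obtain v where v: "v \<in> A" "t = flat_vec S v" by blast
      show "t \<in> tangent_space (flat A S) x"
        by (rule tangent_spaceI) (use v assms(2) self in \<open>auto simp: charts_at_flat flat_vec_def\<close>)
    qed
  qed
qed

lemma flat_vec_eq_iff [simp]: "flat_vec S u = flat_vec S v \<longleftrightarrow> u = v"
  by (metis flat_vec_self)

lemma flat_vec_add: "(\<lambda>c. flat_vec S u c + flat_vec S v c) = flat_vec S (u + v)"
  by (auto simp: flat_vec_def)

lemma flat_vec_scale: "(\<lambda>c. r *\<^sub>R flat_vec S u c) = flat_vec S (r *\<^sub>R u)"
  by (auto simp: flat_vec_def)

lemma tvec_of_flat: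
  assumes "rel_open A S" "x \<in> S" "v \<in> A"
  shows "tvec_of (flat A S) x (S, \<lambda>x. x) v = flat_vec S v"
proof -
  note M = smooth_atlas_flat[OF assms(1)]
  have c: "(S, \<lambda>x. x) \<in> charts_at (flat A S) x" using assms(2) by (simp add: charts_at_flat)
  show ?thesis
  proof (rule tangent_space_eqI[OF _ _ c])
    show "tvec_of (flat A S) x (S, \<lambda>x. x) v \<in> tangent_space (flat A S) x"
      using tvec_of_tangent[OF M c] assms(3) by simp
    show "flat_vec S v \<in> tangent_space (flat A S) x" using tangent_space_flat[OF assms(1,2)] assms(3) by blast
    show "tvec_of (flat A S) x (S, \<lambda>x. x) v (S, \<lambda>x. x) = flat_vec S v (S, \<lambda>x. x)"
      using tvec_of_self[OF M c] assms(3) by simp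
  qed
qed

text \<open>Continuity is a consequence of smoothness in charts: the preimage of an open set is the
  union of its parts in the charts, each of which is open.\<close>

lemma smooth_map_flatI:
  assumes M: "smooth_atlas M" and S: "rel_open A S" and f: "\<And>x. x \<in> points M \<Longrightarrow> f x \<in> S"
    and sm: "\<And>c. c \<in> atlas M \<Longrightarrow> smooth_in (model M) (\<lambda>y. f (chart_inv c y)) (snd c ` fst c)"
  shows "smooth_map M (flat A S) f"
proof -
  have "openin (mtop M) {x \<in> points M. f x \<in> T}" if T: "open T" for T
  proof -
    have "openin (mtop M) {x \<in> fst c. snd c x \<in> {y \<in> snd c ` fst c. f (chart_inv c y) \<in> T}}" if c: "c \<in> atlas M" for c
      using rel_open_preimage_open[OF chart_rel_open[OF M c] smooth_in_continuous[OF sm[OF c]] T]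
      by (intro chart_preimage_openin[OF M c]) (simp add: rel_open_def)
    then have "openin (mtop M) (\<Union>c\<in>atlas M. {x \<in> fst c. snd c x \<in> {y \<in> snd c ` fst c. f (chart_inv c y) \<in> T}})"
      by blast
    moreover have "(\<Union>c\<in>atlas M. {x \<in> fst c. snd c x \<in> {y \<in> snd c ` fst c. f (chart_inv c y) \<in> T}}) = {x \<in> points M. f x \<in> T}"
    proof -
      have "{x \<in> fst c. snd c x \<in> {y \<in> snd c ` fst c. f (chart_inv c y) \<in> T}} = {x \<in> fst c. f x \<in> T}" if "c \<in> atlas M" for c
      proof (rule Collect_cong, rule conj_cong[OF refl])
        fix x assume x: "x \<in> fst c"
        show "(snd c x \<in> {y \<in> snd c ` fst c. f (chart_inv c y) \<in> T}) = (f x \<in> T)"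
          unfolding mem_Collect_eq chart_inv_eq[OF M that x] using imageI[OF x, of "snd c"] by simp
      qed
      then have "(\<Union>c\<in>atlas M. {x \<in> fst c. snd c x \<in> {y \<in> snd c ` fst c. f (chart_inv c y) \<in> T}}) = (\<Union>c\<in>atlas M. {x \<in> fst c. f x \<in> T})"
        by (rule SUP_cong[OF refl])
      also have "\<dots> = {x \<in> (\<Union>c\<in>atlas M. fst c). f x \<in> T}" by blast
      also have "(\<Union>c\<in>atlas M. fst c) = points M" using M unfolding smooth_atlas_def by blast
      finally show ?thesis .
    qed
    ultimately show ?thesis by simp
  qed
  then have "continuous_map (mtop M) euclidean f" by (auto simp: continuous_map_def)
  then have "continuous_map (mtop M) (top_of_set S) f"
    using f by (auto simp: continuous_map_in_subtopology)
  moreover have "smooth_in (model M) (\<lambda>y. f (chart_inv c y)) (snd c ` (fst c \<inter> f -` S))" if "c \<in> atlas M" for c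
    by (rule smooth_in_subset[OF sm[OF that]]) auto
  ultimately show ?thesis by (auto simp: smooth_map_def comp_def)
qed

lemma smooth_map_flatD:
  assumes "smooth_atlas M" "smooth_map M (flat A S) f" "c \<in> atlas M"
  shows "smooth_in (model M) (\<lambda>y. f (chart_inv c y)) (snd c ` fst c)"
proof -
  have "fst c \<inter> f -` S = fst c"
    using smooth_map_points[OF assms(2)] chart_subset[OF assms(1,3)] by auto
  moreover have "smooth_in (model M) (\<lambda>y. f (chart_inv c y)) (snd c ` (fst c \<inter> f -` S))"
    using assms(2,3) by (simp add: smooth_map_def comp_def)
  ultimately show ?thesis by simp
qed

lemma smooth_map_from_flatI:
  assumes N: "smooth_atlas N" and S: "rel_open A S" and cont: "continuous_map (top_of_set S) (mtop N) f"
    and loc: "\<And>x. x \<in> S \<Longrightarrow> \<exists>d\<in>charts_at N (f x). \<exists>W. rel_open A W \<and> x \<in> W \<and>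
      W \<subseteq> {x \<in> S. f x \<in> fst d} \<and> smooth_in A (\<lambda>y. snd d (f y)) W"
  shows "smooth_map (flat A S) N f"
proof (rule smooth_mapI[OF smooth_atlas_flat[OF S] N])
  show "continuous_map (mtop (flat A S)) (mtop N) f" using cont by simp
  fix x assume "x \<in> points (flat A S)"
  then have x: "x \<in> S" by simp
  from loc[OF this] obtain d W where d: "d \<in> charts_at N (f x)" and W: "rel_open A W" "x \<in> W"
    "W \<subseteq> {x \<in> S. f x \<in> fst d}" "smooth_in A (\<lambda>y. snd d (f y)) W" by blast
  have "openin (top_of_set S) W"
    using W(3) rel_openD(3)[OF S] by (intro openin_subset_trans[OF rel_openD(2)[OF W(1)]]) auto
  moreover have "smooth_in A (\<lambda>y. snd d (f (chart_inv (S, \<lambda>x. x) y))) W"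
    using W(3) by (intro smooth_in_congI[OF W(1,4)]) (auto simp: chart_inv_flat)
  ultimately show "\<exists>c\<in>charts_at (flat A S) x. \<exists>d\<in>charts_at N (f x). \<exists>W. openin (mtop (flat A S)) W \<and> x \<in> W \<and>
      W \<subseteq> {x \<in> fst c. f x \<in> fst d} \<and> smooth_in (model (flat A S)) (\<lambda>y. snd d (f (chart_inv c y))) (snd c ` W)"
    using W(2,3) x by (intro bexI[OF _ d] bexI[of _ "(S, \<lambda>x. x)"] exI[of _ W]) (simp_all add: charts_at_flat)
qed

lemma smooth_map_from_flatD:
  assumes "smooth_atlas N" "rel_open A S" "smooth_map (flat A S) N f" "d \<in> atlas N"
  shows "rel_open A {x \<in> S. f x \<in> fst d}" "smooth_in A (\<lambda>y. snd d (f y)) {x \<in> S. f x \<in> fst d}"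
proof -
  note sd = smooth_map_dom[OF assms(3) smooth_atlas_flat[OF assms(2)] assms(1), of "(S, \<lambda>x. x)" d]
  show ro: "rel_open A {x \<in> S. f x \<in> fst d}" using sd(1) assms(4) by simp
  have "smooth_in A (\<lambda>y. snd d (f (chart_inv (S, \<lambda>x. x) y))) {x \<in> S. f x \<in> fst d}"
    using sd(2) assms(4) by simp
  then show "smooth_in A (\<lambda>y. snd d (f y)) {x \<in> S. f x \<in> fst d}"
    by (rule smooth_in_congI[OF ro]) (simp add: chart_inv_flat)
qed

lemma smooth_map_flat_flat:
  assumes S: "rel_open A S" and T: "rel_open B T"
  shows "smooth_map (flat A S) (flat B T) f \<longleftrightarrow> smooth_in A f S \<and> f ` S \<subseteq> T"
proof
  assume f: "smooth_map (flat A S) (flat B T) f"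
  then have "f ` S \<subseteq> T" using smooth_map_points[OF f] by auto
  moreover have "smooth_in A f S"
    using smooth_map_from_flatD(2)[OF smooth_atlas_flat[OF T] S f, of "(T, \<lambda>x. x)"] smooth_map_points[OF f]
    by (auto simp: Collect_conj_eq Int_absorb2 subset_iff)
  ultimately show "smooth_in A f S \<and> f ` S \<subseteq> T" by simp
next
  assume f: "smooth_in A f S \<and> f ` S \<subseteq> T"
  then have f': "smooth_in A f S" by simp
  show "smooth_map (flat A S) (flat B T) f"
  proof (rule smooth_map_flatI[OF smooth_atlas_flat[OF S] T])
    show "f x \<in> T" if "x \<in> points (flat A S)" for x using that f by auto
    fix c assume c: "c \<in> atlas (flat A S)"
    have "smooth_in A (\<lambda>y. f (chart_inv (S, \<lambda>x. x) y)) S"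
      by (rule smooth_in_congI[OF S f']) (simp add: chart_inv_flat)
    then show "smooth_in (model (flat A S)) (\<lambda>y. f (chart_inv c y)) (snd c ` fst c)"
      using c by simp
  qed
qed

lemma pushforward_from_flat:
  assumes N: "smooth_atlas N" and S: "rel_open A S" and f: "smooth_map (flat A S) N f"
    and x: "x \<in> S" and v: "v \<in> A" and d: "d \<in> charts_at N (f x)"
  shows "pushforward (flat A S) N f x (flat_vec S v) d = deriv_in A (\<lambda>y. snd d (f y)) x v"
proof -
  have "pushforward (flat A S) N f x (flat_vec S v) d =
      deriv_in A (\<lambda>y. snd d (f (chart_inv (S, \<lambda>x. x) y))) x v"
    using pushforward_chart[OF smooth_atlas_flat[OF S] N f, of x "flat_vec S v" "(S, \<lambda>x. x)" d] x v d
      tangent_space_flat[OF S x] by (simp add: charts_at_flat)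
  also have "\<dots> = deriv_in A (\<lambda>y. snd d (f y)) x v"
    by (rule deriv_in_cong[OF S x]) (simp add: chart_inv_flat)
  finally show ?thesis .
qed

lemma pushforward_to_flat:
  assumes M: "smooth_atlas M" and S: "rel_open A S" and f: "smooth_map M (flat A S) f"
    and x: "x \<in> points M" and t: "t \<in> tangent_space M x" and c: "c \<in> charts_at M x"
  shows "pushforward M (flat A S) f x t = flat_vec S (deriv_in (model M) (\<lambda>y. f (chart_inv c y)) (snd c x) (t c))"
    "deriv_in (model M) (\<lambda>y. f (chart_inv c y)) (snd c x) (t c) \<in> A"
proof -
  have fx: "f x \<in> S" using smooth_map_points[OF f x] by simp
  have d: "(S, \<lambda>x. x) \<in> charts_at (flat A S) (f x)" using fx by (simp add: charts_at_flat)
  have eq: "pushforward M (flat A S) f x t (S, \<lambda>x. x) = deriv_in (model M) (\<lambda>y. f (chart_inv c y)) (snd c x) (t c)"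
    using pushforward_chart[OF M smooth_atlas_flat[OF S] f x t c d] by simp
  have "pushforward M (flat A S) f x t \<in> tangent_space (flat A S) (f x)"
    by (rule pushforward_tangent[OF M smooth_atlas_flat[OF S] f x t])
  then obtain v where v: "v \<in> A" "pushforward M (flat A S) f x t = flat_vec S v"
    using tangent_space_flat[OF S fx] by auto
  then show "pushforward M (flat A S) f x t = flat_vec S (deriv_in (model M) (\<lambda>y. f (chart_inv c y)) (snd c x) (t c))"
    "deriv_in (model M) (\<lambda>y. f (chart_inv c y)) (snd c x) (t c) \<in> A"
    using eq by auto
qed

lemma pushforward_flat_flat:
  assumes S: "rel_open A S" and T: "rel_open B T" and f: "smooth_in A f S" "f ` S \<subseteq> T" and x: "x \<in> S" and v: "v \<in> A"
  shows "pushforward (flat A S) (flat B T) f x (flat_vec S v) = flat_vec T (deriv_in A f x v)"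
proof -
  have sm: "smooth_map (flat A S) (flat B T) f" using smooth_map_flat_flat[OF S T] f by blast
  have fx: "f x \<in> T" using f(2) x by blast
  have d: "(T, \<lambda>x. x) \<in> charts_at (flat B T) (f x)" using fx by (simp add: charts_at_flat)
  have "flat_vec S v \<in> tangent_space (flat A S) x" using tangent_space_flat[OF S x] v by blast
  then have "pushforward (flat A S) (flat B T) f x (flat_vec S v) \<in> tangent_space (flat B T) (f x)"
    using x by (intro pushforward_tangent[OF smooth_atlas_flat[OF S] smooth_atlas_flat[OF T] sm]) auto
  then obtain w where "pushforward (flat A S) (flat B T) f x (flat_vec S v) = flat_vec T w"
    using tangent_space_flat[OF T fx] by auto
  then show ?thesis using pushforward_from_flat[OF smooth_atlas_flat[OF T] S sm x v d] by simp
qed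

section \<open>Products and open submanifolds\<close>

lemma prod_manifold_simps [simp]:
  "mtop (prod_manifold M N) = prod_topology (mtop M) (mtop N)"
  "model (prod_manifold M N) = model M \<times> model N"
  "atlas (prod_manifold M N) = {(fst c \<times> fst d, map_prod (snd c) (snd d)) | c d. c \<in> atlas M \<and> d \<in> atlas N}"
  by (simp_all add: prod_manifold_def)

lemma chart_inv_prod:
  assumes "smooth_atlas M" "c \<in> atlas M" "smooth_atlas N" "d \<in> atlas N"
    and "y \<in> snd c ` fst c" "z \<in> snd d ` fst d"
  shows "chart_inv (fst c \<times> fst d, map_prod (snd c) (snd d)) (y, z) = (chart_inv c y, chart_inv d z)"
proof -
  have inj: "inj_on (map_prod (snd c) (snd d)) (fst c \<times> fst d)"
    by (rule map_prod_inj_on[OF chart_inj[OF assms(1,2)] chart_inj[OF assms(3,4)]])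
  have mem: "(chart_inv c y, chart_inv d z) \<in> fst c \<times> fst d"
    using chart_inv_in[OF assms(5) order_refl assms(1,2)] chart_inv_in[OF assms(6) order_refl assms(3,4)] by simp
  show ?thesis unfolding chart_inv_def[of "(fst c \<times> fst d, map_prod (snd c) (snd d))"] fst_conv snd_conv
    by (rule inv_into_f_eq[OF inj mem]) (simp add: chart_chart_inv[OF assms(5)] chart_chart_inv[OF assms(6)])
qed

lemma smooth_atlas_prod:
  assumes M: "smooth_atlas M" and N: "smooth_atlas N"
  shows "smooth_atlas (prod_manifold M N)"
  unfolding smooth_atlas_def
proof (intro conjI ballI)
  show "subspace (model (prod_manifold M N))"
    using M N by (simp add: subspace_Times smooth_atlas_subspace)
  have un: "(\<Union>c\<in>atlas M. fst c) = points M" "(\<Union>c\<in>atlas N. fst c) = points N"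
    using M N by (simp_all add: smooth_atlas_def)
  show "(\<Union>c\<in>atlas (prod_manifold M N). fst c) = points (prod_manifold M N)"
  proof (rule Set.set_eqI)
    fix x :: "'a \<times> 'c"
    have "x \<in> (\<Union>c\<in>atlas (prod_manifold M N). fst c) \<longleftrightarrow> (\<exists>c\<in>atlas M. \<exists>d\<in>atlas N. x \<in> fst c \<times> fst d)"
    proof
      assume "x \<in> (\<Union>c\<in>atlas (prod_manifold M N). fst c)"
      then obtain e where e: "e \<in> atlas (prod_manifold M N)" "x \<in> fst e" by blast
      from e(1) obtain c d where cd: "e = (fst c \<times> fst d, map_prod (snd c) (snd d))" "c \<in> atlas M" "d \<in> atlas N"
        unfolding prod_manifold_simps by blast
      show "\<exists>c\<in>atlas M. \<exists>d\<in>atlas N. x \<in> fst c \<times> fst d"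
        using e(2) cd by (intro bexI[of _ c] bexI[of _ d]) simp_all
    next
      assume "\<exists>c\<in>atlas M. \<exists>d\<in>atlas N. x \<in> fst c \<times> fst d"
      then obtain c d where cd: "c \<in> atlas M" "d \<in> atlas N" "x \<in> fst c \<times> fst d" by blast
      then have "(fst c \<times> fst d, map_prod (snd c) (snd d)) \<in> atlas (prod_manifold M N)"
        unfolding prod_manifold_simps by blast
      then show "x \<in> (\<Union>c\<in>atlas (prod_manifold M N). fst c)" by (rule UN_I) (simp add: cd(3))
    qed
    also have "\<dots> \<longleftrightarrow> fst x \<in> (\<Union>c\<in>atlas M. fst c) \<and> snd x \<in> (\<Union>c\<in>atlas N. fst c)"
      by (simp add: mem_Times_iff)
    also have "\<dots> \<longleftrightarrow> x \<in> points (prod_manifold M N)" unfolding un by (simp add: mem_Times_iff)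
    finally show "x \<in> (\<Union>c\<in>atlas (prod_manifold M N). fst c) \<longleftrightarrow> x \<in> points (prod_manifold M N)" .
  qed
  fix e assume "e \<in> atlas (prod_manifold M N)"
  then obtain c d where e: "e = (fst c \<times> fst d, map_prod (snd c) (snd d))" and c: "c \<in> atlas M" and d: "d \<in> atlas N"
    by auto
  show "openin (mtop (prod_manifold M N)) (fst e)"
    using chart_openin[OF M c] chart_openin[OF N d] by (simp add: e openin_prod_Times_iff)
  have img: "snd e ` fst e = snd c ` fst c \<times> snd d ` fst d" by (simp add: e map_prod_surj_on)
  show "openin (top_of_set (model (prod_manifold M N))) (snd e ` fst e)"
    using rel_open_Times[OF chart_rel_open[OF M c] chart_rel_open[OF N d]] by (simp add: img rel_open_def)
  obtain c' where c': "homeomorphic_maps (subtopology (mtop M) (fst c)) (top_of_set (snd c ` fst c)) (snd c) c'"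
    using M c by (auto simp: smooth_atlas_def homeomorphic_map_maps)
  obtain d' where d': "homeomorphic_maps (subtopology (mtop N) (fst d)) (top_of_set (snd d ` fst d)) (snd d) d'"
    using N d by (auto simp: smooth_atlas_def homeomorphic_map_maps)
  have "homeomorphic_maps
    (prod_topology (subtopology (mtop M) (fst c)) (subtopology (mtop N) (fst d)))
    (prod_topology (top_of_set (snd c ` fst c)) (top_of_set (snd d ` fst d)))
    (\<lambda>(x, y). (snd c x, snd d y)) (\<lambda>(x, y). (c' x, d' y))"
    using c' d' homeomorphic_maps_prod by blast
  then show "homeomorphic_map (subtopology (mtop (prod_manifold M N)) (fst e)) (top_of_set (snd e ` fst e)) (snd e)"
    unfolding img
    by (auto simp: e homeomorphic_map_maps subtopology_Times euclidean_product_topology[symmetric] map_prod_def)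
  fix e' assume "e' \<in> atlas (prod_manifold M N)"
  then obtain c2 d2 where e': "e' = (fst c2 \<times> fst d2, map_prod (snd c2) (snd d2))" and c2: "c2 \<in> atlas M" and d2: "d2 \<in> atlas N"
    by auto
  define A where "A = snd c ` (fst c \<inter> fst c2)"
  define B where "B = snd d ` (fst d \<inter> fst d2)"
  have A: "rel_open (model M) A" and B: "rel_open (model N) B"
    unfolding A_def B_def using chart_image_rel_open[OF M c chart_openin[OF M c2]]
      chart_image_rel_open[OF N d chart_openin[OF N d2]] by auto
  note AB = rel_open_Times[OF A B]
  have dom: "snd e ` (fst e \<inter> fst e') = A \<times> B"
    by (simp add: e e' A_def B_def Times_Int_Times map_prod_surj_on)
  have tr: "smooth_in (model M) (\<lambda>y. snd c2 (chart_inv c y)) A" "smooth_in (model N) (\<lambda>y. snd d2 (chart_inv d y)) B"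
    using M N c d c2 d2 unfolding A_def B_def smooth_atlas_def comp_def by blast+
  have "smooth_in (model M \<times> model N) (\<lambda>p. (snd c2 (chart_inv c (fst p)), snd d2 (chart_inv d (snd p)))) (A \<times> B)"
    by (intro smooth_in_Pair[OF AB] smooth_in_compose[OF AB A _ smooth_in_bounded_linear[OF AB bounded_linear_fst] tr(1)]
        smooth_in_compose[OF AB B _ smooth_in_bounded_linear[OF AB bounded_linear_snd] tr(2)]) auto
  then show "smooth_in (model (prod_manifold M N)) (snd e' \<circ> chart_inv e) (snd e ` (fst e \<inter> fst e'))"
    unfolding dom prod_manifold_simps
  proof (rule smooth_in_congI[OF AB])
    fix p assume "p \<in> A \<times> B"
    then have "fst p \<in> snd c ` fst c" "snd p \<in> snd d ` fst d" by (auto simp: A_def B_def)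
    then show "(snd e' \<circ> chart_inv e) p = (snd c2 (chart_inv c (fst p)), snd d2 (chart_inv d (snd p)))"
      using chart_inv_prod[OF M c N d, of "fst p" "snd p"] by (simp add: e e')
  qed
qed

lemma smooth_map_Pair:
  assumes L: "smooth_atlas L" and M: "smooth_atlas M" and N: "smooth_atlas N"
    and f: "smooth_map L M f" and g: "smooth_map L N g"
  shows "smooth_map L (prod_manifold M N) (\<lambda>x. (f x, g x))"
proof (rule smooth_mapI[OF L smooth_atlas_prod[OF M N]])
  show "continuous_map (mtop L) (mtop (prod_manifold M N)) (\<lambda>x. (f x, g x))"
    using smooth_map_continuous[OF f] smooth_map_continuous[OF g]
    by (simp add: continuous_map_pairwise comp_def)
  fix x assume x: "x \<in> points L"
  let ?c = "some_chart L x" and ?d = "some_chart M (f x)" and ?e = "some_chart N (g x)"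
  have cc: "?c \<in> charts_at L x" "?d \<in> charts_at M (f x)" "?e \<in> charts_at N (g x)"
    using some_chart_in[OF L x] some_chart_in[OF M smooth_map_points[OF f x]] some_chart_in[OF N smooth_map_points[OF g x]] by auto
  define W where "W = fst ?c \<inter> ({x \<in> points L. f x \<in> fst ?d} \<inter> {x \<in> points L. g x \<in> fst ?e})"
  note ca = charts_atD(1)[OF cc(1)] and da = charts_atD(1)[OF cc(2)] and ea = charts_atD(1)[OF cc(3)]
  have Wo: "openin (mtop L) W"
    unfolding W_def by (intro openin_Int chart_openin[OF L ca] smooth_map_preimage_openin[OF f M da] smooth_map_preimage_openin[OF g N ea])
  have ro: "rel_open (model L) (snd ?c ` W)"
    using chart_image_rel_open[OF L ca Wo] by (simp add: W_def)
  have sf: "smooth_in (model L) (\<lambda>y. snd ?d (f (chart_inv ?c y))) (snd ?c ` W)"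
    by (rule smooth_in_subset[OF smooth_map_dom(2)[OF f L M ca da]]) (auto simp: W_def)
  have sg: "smooth_in (model L) (\<lambda>y. snd ?e (g (chart_inv ?c y))) (snd ?c ` W)"
    by (rule smooth_in_subset[OF smooth_map_dom(2)[OF g L N ca ea]]) (auto simp: W_def)
  let ?p = "(fst ?d \<times> fst ?e, map_prod (snd ?d) (snd ?e))"
  have p: "?p \<in> charts_at (prod_manifold M N) (f x, g x)"
  proof -
    have "?p \<in> atlas (prod_manifold M N)" unfolding prod_manifold_simps using da ea by blast
    then show ?thesis using charts_atD(2)[OF cc(2)] charts_atD(2)[OF cc(3)] by (simp only: charts_at_def mem_Collect_eq fst_conv mem_Sigma_iff)
  qed
  show "\<exists>c\<in>charts_at L x. \<exists>d\<in>charts_at (prod_manifold M N) (f x, g x). \<exists>W. openin (mtop L) W \<and> x \<in> W \<and>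
      W \<subseteq> {x \<in> fst c. (f x, g x) \<in> fst d} \<and>
      smooth_in (model L) (\<lambda>y. snd d (f (chart_inv c y), g (chart_inv c y))) (snd c ` W)"
  proof (intro bexI[OF _ p] bexI[OF _ cc(1)] exI[of _ W] conjI Wo)
    show "x \<in> W" using x charts_atD(2)[OF cc(1)] charts_atD(2)[OF cc(2)] charts_atD(2)[OF cc(3)] by (simp add: W_def)
    show "W \<subseteq> {x \<in> fst ?c. (f x, g x) \<in> fst ?p}" by (auto simp: W_def)
    show "smooth_in (model L) (\<lambda>y. snd ?p (f (chart_inv ?c y), g (chart_inv ?c y))) (snd ?c ` W)"
      using smooth_in_Pair[OF ro sf sg] by simp
  qed
qed

lemma open_submanifold_simps [simp]:
  "mtop (open_submanifold M U) = subtopology (mtop M) U"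
  "model (open_submanifold M U) = model M"
  "atlas (open_submanifold M U) = {(fst c \<inter> U, snd c) | c. c \<in> atlas M}"
  by (simp_all add: open_submanifold_def)

lemma chart_inv_restrict:
  assumes "smooth_atlas M" "c \<in> atlas M" "y \<in> snd c ` (fst c \<inter> U)"
  shows "chart_inv (fst c \<inter> U, snd c) y = chart_inv c y"
proof -
  obtain x where x: "x \<in> fst c \<inter> U" "y = snd c x" using assms(3) by blast
  have "inj_on (snd c) (fst c \<inter> U)" using chart_inj[OF assms(1,2)] inj_on_subset by blast
  then have "chart_inv (fst c \<inter> U, snd c) y = x" using x by (simp add: chart_inv_def inv_into_f_f)
  then show ?thesis using chart_inv_eq[OF assms(1,2)] x by auto
qed

lemma smooth_atlas_open_submanifold:
  assumes M: "smooth_atlas M" and U: "openin (mtop M) U"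
  shows "smooth_atlas (open_submanifold M U)"
  unfolding smooth_atlas_def
proof (intro conjI ballI)
  show "subspace (model (open_submanifold M U))" using M by (simp add: smooth_atlas_subspace)
  have un: "(\<Union>c\<in>atlas M. fst c) = points M" using M unfolding smooth_atlas_def by blast
  have "(\<Union>c\<in>atlas (open_submanifold M U). fst c) = (\<Union>c\<in>atlas M. fst c \<inter> U)"
    unfolding open_submanifold_simps Setcompr_eq_image by simp
  also have "\<dots> = (\<Union>c\<in>atlas M. fst c) \<inter> U" by blast
  finally show "(\<Union>c\<in>atlas (open_submanifold M U). fst c) = points (open_submanifold M U)"
    unfolding un by simp
  fix e assume "e \<in> atlas (open_submanifold M U)"
  then obtain c where e: "e = (fst c \<inter> U, snd c)" and c: "c \<in> atlas M" by auto
  show "openin (mtop (open_submanifold M U)) (fst e)"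
    using chart_openin[OF M c] by (auto simp: e openin_subtopology)
  show "openin (top_of_set (model (open_submanifold M U))) (snd e ` fst e)"
    using chart_image_rel_open[OF M c U] by (simp add: e rel_open_def)
  have "homeomorphic_map (subtopology (mtop M) (fst c)) (top_of_set (snd c ` fst c)) (snd c)"
    using M c by (simp add: smooth_atlas_def)
  from homeomorphic_map_subtopologies[OF this, of U "snd c ` (fst c \<inter> U)"]
  have "homeomorphic_map (subtopology (subtopology (mtop M) (fst c)) U)
      (subtopology (top_of_set (snd c ` fst c)) (snd c ` (fst c \<inter> U))) (snd c)"
    using chart_subset[OF M c] by (auto simp: Int_absorb1)
  moreover have "subtopology (top_of_set (snd c ` fst c)) (snd c ` (fst c \<inter> U)) = top_of_set (snd c ` (fst c \<inter> U))"
    by (simp add: subtopology_subtopology Int_absorb1 image_mono)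
  moreover have "subtopology (subtopology (mtop M) (fst c)) U = subtopology (subtopology (mtop M) U) (fst c \<inter> U)"
    by (simp add: subtopology_subtopology Int_ac)
  ultimately show "homeomorphic_map (subtopology (mtop (open_submanifold M U)) (fst e)) (top_of_set (snd e ` fst e)) (snd e)"
    by (simp add: e)
  fix e' assume "e' \<in> atlas (open_submanifold M U)"
  then obtain d where e': "e' = (fst d \<inter> U, snd d)" and d: "d \<in> atlas M" by auto
  have "openin (mtop M) (fst d \<inter> U)" using chart_openin[OF M d] U by auto
  then have ro: "rel_open (model M) (snd c ` (fst c \<inter> (fst d \<inter> U)))" by (rule chart_image_rel_open[OF M c])
  have "smooth_in (model M) (snd d \<circ> chart_inv c) (snd c ` (fst c \<inter> fst d))"
    using M c d by (simp add: smooth_atlas_def)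
  then have sm: "smooth_in (model M) (snd d \<circ> chart_inv c) (snd c ` (fst c \<inter> (fst d \<inter> U)))"
    by (rule smooth_in_subset) auto
  have "smooth_in (model M) (snd d \<circ> chart_inv (fst c \<inter> U, snd c)) (snd c ` (fst c \<inter> (fst d \<inter> U)))"
  proof (rule smooth_in_congI[OF ro sm])
    fix z assume "z \<in> snd c ` (fst c \<inter> (fst d \<inter> U))"
    then have "z \<in> snd c ` (fst c \<inter> U)" by auto
    then show "(snd d \<circ> chart_inv (fst c \<inter> U, snd c)) z = (snd d \<circ> chart_inv c) z"
      by (simp add: chart_inv_restrict[OF M c])
  qed
  moreover have "fst c \<inter> U \<inter> (fst d \<inter> U) = fst c \<inter> (fst d \<inter> U)" by auto
  ultimately show "smooth_in (model (open_submanifold M U)) (snd e' \<circ> chart_inv e) (snd e ` (fst e \<inter> fst e'))"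
    by (simp add: e e')
qed

lemma charts_at_restrict:
  assumes "c \<in> charts_at M x" "x \<in> U"
  shows "(fst c \<inter> U, snd c) \<in> charts_at (open_submanifold M U) x"
proof -
  have "(fst c \<inter> U, snd c) \<in> atlas (open_submanifold M U)"
    unfolding open_submanifold_simps using charts_atD(1)[OF assms(1)] by blast
  then show ?thesis using charts_atD(2)[OF assms(1)] assms(2)
    by (simp only: charts_at_def mem_Collect_eq fst_conv Int_iff simp_thms)
qed

lemma smooth_map_open_submanifold_incl:
  assumes M: "smooth_atlas M" and U: "openin (mtop M) U"
  shows "smooth_map (open_submanifold M U) M (\<lambda>x. x)"
proof (rule smooth_mapI[OF smooth_atlas_open_submanifold[OF M U] M])
  show "continuous_map (mtop (open_submanifold M U)) (mtop M) (\<lambda>x. x)"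
    by (simp add: continuous_map_from_subtopology)
  fix x assume "x \<in> points (open_submanifold M U)"
  then have x: "x \<in> U" "x \<in> points M" by auto
  have c: "some_chart M x \<in> charts_at M x" using some_chart_in[OF M x(2)] .
  let ?c = "some_chart M x"
  note cc = charts_atD[OF c]
  have "openin (mtop (open_submanifold M U)) (fst ?c \<inter> U)"
    using chart_openin[OF M cc(1)] by (auto simp: openin_subtopology)
  moreover have ro: "rel_open (model M) (snd ?c ` (fst ?c \<inter> U))" by (rule chart_image_rel_open[OF M cc(1) U])
  have "smooth_in (model M) (\<lambda>y. snd ?c (chart_inv (fst ?c \<inter> U, snd ?c) y)) (snd ?c ` (fst ?c \<inter> U))"
    by (rule smooth_in_congI[OF ro smooth_in_id[OF ro]]) (auto simp: chart_inv_restrict[OF M cc(1)] chart_inv_eq[OF M cc(1)])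
  ultimately show "\<exists>c\<in>charts_at (open_submanifold M U) x. \<exists>d\<in>charts_at M x. \<exists>W. openin (mtop (open_submanifold M U)) W \<and> x \<in> W \<and>
      W \<subseteq> {x \<in> fst c. x \<in> fst d} \<and> smooth_in (model (open_submanifold M U)) (\<lambda>y. snd d (chart_inv c y)) (snd c ` W)"
    by (intro bexI[OF _ c] bexI[OF _ charts_at_restrict[OF c x(1)]] exI[of _ "fst ?c \<inter> U"] conjI)
      (simp_all add: x cc subset_iff)
qed

lemma smooth_map_into_open_submanifold:
  assumes M: "smooth_atlas M" and N: "smooth_atlas N" and U: "openin (mtop M) U"
    and f: "smooth_map N M f" "\<And>x. x \<in> points N \<Longrightarrow> f x \<in> U"
  shows "smooth_map N (open_submanifold M U) f"
proof (rule smooth_mapI[OF N smooth_atlas_open_submanifold[OF M U]])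
  show "continuous_map (mtop N) (mtop (open_submanifold M U)) f"
    using smooth_map_continuous[OF f(1)] f(2) by (auto simp: continuous_map_in_subtopology)
  fix x assume x: "x \<in> points N"
  let ?c = "some_chart N x" and ?d = "some_chart M (f x)"
  have c: "?c \<in> charts_at N x" and d: "?d \<in> charts_at M (f x)"
    using some_chart_in[OF N x] some_chart_in[OF M smooth_map_points[OF f(1) x]] by auto
  note cc = charts_atD[OF c] and dd = charts_atD[OF d]
  define W where "W = fst ?c \<inter> {x \<in> points N. f x \<in> fst ?d}"
  have "openin (mtop N) W"
    unfolding W_def using chart_openin[OF N cc(1)] smooth_map_preimage_openin[OF f(1) M dd(1)] by auto
  moreover have "smooth_in (model N) (\<lambda>y. snd ?d (f (chart_inv ?c y))) (snd ?c ` W)"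
    by (rule smooth_in_subset[OF smooth_map_dom(2)[OF f(1) N M cc(1) dd(1)]]) (auto simp: W_def)
  moreover have "W \<subseteq> {x \<in> fst ?c. f x \<in> fst ?d \<inter> U}" using f(2) by (auto simp: W_def)
  moreover have "x \<in> W" using x cc dd by (simp add: W_def)
  ultimately show "\<exists>c\<in>charts_at N x. \<exists>d\<in>charts_at (open_submanifold M U) (f x). \<exists>W. openin (mtop N) W \<and> x \<in> W \<and>
      W \<subseteq> {x \<in> fst c. f x \<in> fst d} \<and> smooth_in (model N) (\<lambda>y. snd d (f (chart_inv c y))) (snd c ` W)"
    by (intro bexI[OF _ c] bexI[OF _ charts_at_restrict[OF d f(2)[OF x]]] exI[of _ W] conjI) simp_all
qed

lemma pushforward_inverse:
  assumes M: "smooth_atlas M" and N: "smooth_atlas N" and f: "smooth_map M N f" and g: "smooth_map N M g"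
    and gf: "\<And>x. x \<in> points M \<Longrightarrow> g (f x) = x" and x: "x \<in> points M" and t: "t \<in> tangent_space M x"
  shows "pushforward N M g (f x) (pushforward M N f x t) = t"
  using pushforward_compose[OF M N M f g x t] pushforward_id[OF M x t]
    pushforward_cong[OF M M smooth_map_compose[OF M N M f g] smooth_map_id[OF M] x t gf] by simp

lemma smooth_map_const:
  assumes M: "smooth_atlas M" and N: "smooth_atlas N" and a: "a \<in> points N"
  shows "smooth_map M N (\<lambda>x. a)"
proof (rule smooth_mapI[OF M N])
  show "continuous_map (mtop M) (mtop N) (\<lambda>x. a)" using a by simp
  fix x assume x: "x \<in> points M"
  note c = some_chart_in[OF M x] and d = some_chart_in[OF N a]
  have ro: "rel_open (model M) (snd (some_chart M x) ` fst (some_chart M x))"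
    by (rule chart_rel_open[OF M charts_atD(1)[OF c]])
  show "\<exists>c\<in>charts_at M x. \<exists>d\<in>charts_at N a. \<exists>W. openin (mtop M) W \<and> x \<in> W \<and>
      W \<subseteq> {x \<in> fst c. a \<in> fst d} \<and> smooth_in (model M) (\<lambda>y. snd d a) (snd c ` W)"
    using chart_openin[OF M charts_atD(1)[OF c]] charts_atD(2)[OF c] charts_atD(2)[OF d]
    by (intro bexI[OF _ c] bexI[OF _ d] exI[of _ "fst (some_chart M x)"] conjI smooth_in_const[OF ro]) auto
qed

lemma smooth_map_chart_inv:
  assumes M: "smooth_atlas M" and c: "c \<in> atlas M"
  shows "smooth_map (flat (model M) (snd c ` fst c)) M (chart_inv c)"
proof (rule smooth_map_from_flatI[OF M chart_rel_open[OF M c] chart_inv_continuous[OF M c]])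
  fix y assume y: "y \<in> snd c ` fst c"
  have inv: "chart_inv c z \<in> fst c" if "z \<in> snd c ` fst c" for z
    by (rule chart_inv_in[OF that order_refl M c])
  have d: "c \<in> charts_at M (chart_inv c y)" unfolding charts_at_def using c inv[OF y] by simp
  have "smooth_in (model M) (\<lambda>y. snd c (chart_inv c y)) (snd c ` fst c)"
    by (rule smooth_in_congI[OF chart_rel_open[OF M c] smooth_in_id[OF chart_rel_open[OF M c]] chart_chart_inv])
  then show "\<exists>d\<in>charts_at M (chart_inv c y). \<exists>W. rel_open (model M) W \<and> y \<in> W \<and>
      W \<subseteq> {x \<in> snd c ` fst c. chart_inv c x \<in> fst d} \<and> smooth_in (model M) (\<lambda>y. snd d (chart_inv c y)) W"
    using inv y chart_rel_open[OF M c]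
    by (intro bexI[OF _ d] exI[of _ "snd c ` fst c"]) blast
qed

section \<open>Lie groups and logarithmic derivatives\<close>

locale lie_grp =
  fixes G :: "'g monoid" (structure) and MG :: "('g, 'e::euclidean_space) manifold"
  assumes lie_group: "lie_group G MG"
begin

sublocale group G using lie_group by (simp add: lie_group_def)

abbreviation "E \<equiv> model MG"
text \<open>One chart at the identity, fixed from here on; its coordinates at the identity identify
  the Lie algebra with the vector space E.\<close>

definition "c0 = some_chart MG \<one>"
definition "org = snd c0 \<one>"

lemma atl: "smooth_atlas MG" and points_MG: "points MG = carrier G"
  and mult_smooth: "smooth_map (prod_manifold MG MG) MG (\<lambda>(x, y). x \<otimes> y)"
  and inv_smooth: "smooth_map MG MG (\<lambda>x. inv x)"
  using lie_group smooth_manifold_atlas[of MG] by (simp_all add: lie_group_def)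

lemma subE: "subspace E"
  by (rule smooth_atlas_subspace[OF atl])

lemma c0_at: "c0 \<in> charts_at MG \<one>"
  unfolding c0_def by (rule some_chart_in[OF atl]) (simp add: points_MG)

lemmas c0D = charts_atD[OF c0_at]

lemma C0_open: "rel_open E (snd c0 ` fst c0)"
  by (rule chart_rel_open[OF atl c0D(1)])

lemma org_in: "org \<in> snd c0 ` fst c0" "org \<in> E" "chart_inv c0 org = \<one>"
  unfolding org_def using c0D chart_in_model[OF atl c0D] chart_inv_eq[OF atl c0D] by auto

lemma smooth_mult:
  assumes "smooth_atlas L" "smooth_map L MG f" "smooth_map L MG g"
  shows "smooth_map L MG (\<lambda>x. f x \<otimes> g x)"
  using smooth_map_compose[OF assms(1) smooth_atlas_prod[OF atl atl] atl
      smooth_map_Pair[OF assms(1) atl atl assms(2,3)] mult_smooth] by simp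

lemma smooth_minv:
  assumes "smooth_atlas L" "smooth_map L MG f"
  shows "smooth_map L MG (\<lambda>x. inv (f x))"
  using smooth_map_compose[OF assms(1) atl atl assms(2) inv_smooth] .

lemma smooth_lmult:
  assumes "smooth_atlas L" "smooth_map L MG f" "a \<in> carrier G"
  shows "smooth_map L MG (\<lambda>x. a \<otimes> f x)"
  using smooth_mult[OF assms(1) smooth_map_const[OF assms(1) atl] assms(2)] assms(3) by (simp add: points_MG)

lemma smooth_in_carrier: "smooth_map L MG f \<Longrightarrow> x \<in> points L \<Longrightarrow> f x \<in> carrier G"
  using smooth_map_points[of L MG f x] by (simp add: points_MG)

lemma flat_in_carrier: "smooth_map (flat A S) MG f \<Longrightarrow> x \<in> S \<Longrightarrow> f x \<in> carrier G"
  using smooth_in_carrier[of "flat A S" f x] by simp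

text \<open>The pullback of the Maurer--Cartan form by h: the value of h at y is moved to the
  identity by a left translation, and the derivative there is read off in the chart
  \<open>c0\<close>.\<close>

definition logd :: "'a::euclidean_space set \<Rightarrow> ('a \<Rightarrow> 'g) \<Rightarrow> 'a \<Rightarrow> 'a \<Rightarrow> 'e" where
  "logd A h y v = deriv_in A (\<lambda>z. snd c0 (inv (h y) \<otimes> h z)) y v"

text \<open>Left invariance of the Maurer--Cartan form: the constant factor a cancels against its
  inverse.\<close>

lemma logd_lmult:
  assumes S: "rel_open A S" and h: "smooth_map (flat A S) MG h" and y: "y \<in> S" and a: "a \<in> carrier G"
  shows "logd A (\<lambda>z. a \<otimes> h z) y v = logd A h y v"
  unfolding logd_def
proof (rule deriv_in_cong[OF S y])
  fix z assume z: "z \<in> S"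
  have "h y \<in> carrier G" "h z \<in> carrier G" using flat_in_carrier[OF h] y z by auto
  moreover have "inv a \<otimes> (a \<otimes> h z) = h z"
    using a \<open>h z \<in> carrier G\<close> by (simp add: m_assoc[symmetric])
  ultimately show "snd c0 (inv (a \<otimes> h y) \<otimes> (a \<otimes> h z)) = snd c0 (inv (h y) \<otimes> h z)"
    using a by (simp add: inv_mult_group m_assoc)
qed

lemma translate_smooth:
  assumes S: "rel_open A S" and h: "smooth_map (flat A S) MG h" and y: "y \<in> S"
  shows "smooth_map (flat A S) MG (\<lambda>z. inv (h y) \<otimes> h z)"
    "rel_open A {z \<in> S. inv (h y) \<otimes> h z \<in> fst c0}" "y \<in> {z \<in> S. inv (h y) \<otimes> h z \<in> fst c0}"
    "smooth_in A (\<lambda>z. snd c0 (inv (h y) \<otimes> h z)) {z \<in> S. inv (h y) \<otimes> h z \<in> fst c0}"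
proof -
  have hy: "h y \<in> carrier G" by (rule flat_in_carrier[OF h y])
  then have "inv (h y) \<in> carrier G" by simp
  from smooth_lmult[OF smooth_atlas_flat[OF S] h this]
  show sm: "smooth_map (flat A S) MG (\<lambda>z. inv (h y) \<otimes> h z)" .
  show "rel_open A {z \<in> S. inv (h y) \<otimes> h z \<in> fst c0}"
    "smooth_in A (\<lambda>z. snd c0 (inv (h y) \<otimes> h z)) {z \<in> S. inv (h y) \<otimes> h z \<in> fst c0}"
    using smooth_map_from_flatD[OF atl S sm c0D(1)] by simp_all
  show "y \<in> {z \<in> S. inv (h y) \<otimes> h z \<in> fst c0}"
    using hy y c0D(2) by simp
qed

lemma logd_differentiable:
  assumes S: "rel_open A S" and h: "smooth_map (flat A S) MG h" and y: "y \<in> S"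
  shows "(\<lambda>z. snd c0 (inv (h y) \<otimes> h z)) differentiable at y within A"
  by (rule smooth_in_differentiable[OF translate_smooth(4,3)[OF assms]])

lemma logd_linear:
  assumes S: "rel_open A S" and h: "smooth_map (flat A S) MG h" and y: "y \<in> S"
  shows "linear (logd A h y)"
proof -
  have "logd A h y = deriv_in A (\<lambda>z. snd c0 (inv (h y) \<otimes> h z)) y"
    by (simp add: logd_def fun_eq_iff)
  then show ?thesis using deriv_in_linear[OF logd_differentiable[OF assms]] by simp
qed

lemma logd_in_model:
  assumes S: "rel_open A S" and h: "smooth_map (flat A S) MG h" and y: "y \<in> S" and v: "v \<in> A"
  shows "logd A h y v \<in> E"
  unfolding logd_def
  by (rule deriv_in_closed[OF translate_smooth(2,3)[OF S h y] logd_differentiable[OF S h y] subE _ v])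
    (auto intro: chart_in_model[OF atl c0D(1)])

text \<open>In \<open>logd A h y v\<close> the point y occurs twice, as the point of differentiation
  and inside the differentiated function. The function \<open>Lam\<close> of two variables separates
  the two roles; its partial derivative is then restricted to the diagonal.\<close>

lemma smooth_logd:
  assumes S: "rel_open A S" and h: "smooth_map (flat A S) MG h" and v: "v \<in> A"
  shows "smooth_in A (\<lambda>y. logd A h y v) S"
proof -
  note SS = rel_open_Times[OF S S]
  note fl = smooth_atlas_flat[OF SS]
  have p: "smooth_map (flat (A \<times> A) (S \<times> S)) (flat A S) fst" "smooth_map (flat (A \<times> A) (S \<times> S)) (flat A S) snd"
    unfolding smooth_map_flat_flat[OF SS S]
    using smooth_in_bounded_linear[OF SS bounded_linear_fst] smooth_in_bounded_linear[OF SS bounded_linear_snd] by auto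
  have hp: "smooth_map (flat (A \<times> A) (S \<times> S)) MG (\<lambda>p. h (fst p))" "smooth_map (flat (A \<times> A) (S \<times> S)) MG (\<lambda>p. h (snd p))"
    using smooth_map_compose[OF fl smooth_atlas_flat[OF S] atl p(1) h] smooth_map_compose[OF fl smooth_atlas_flat[OF S] atl p(2) h] .
  have q: "smooth_map (flat (A \<times> A) (S \<times> S)) MG (\<lambda>p. inv (h (fst p)) \<otimes> h (snd p))"
    by (rule smooth_mult[OF fl smooth_minv[OF fl hp(1)] hp(2)])
  define D where "D = {p \<in> S \<times> S. inv (h (fst p)) \<otimes> h (snd p) \<in> fst c0}"
  define Lam where "Lam p = snd c0 (inv (h (fst p)) \<otimes> h (snd p))" for p
  have D: "rel_open (A \<times> A) D" and L: "smooth_in (A \<times> A) Lam D"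
    using smooth_map_from_flatD[OF atl SS q c0D(1)] by (simp_all add: D_def Lam_def[abs_def])
  have diag: "(y, y) \<in> D" if "y \<in> S" for y
    using flat_in_carrier[OF h that] that c0D(2) by (simp add: D_def)
  have eq: "logd A h y v = deriv_in (A \<times> A) Lam (y, y) (0, v)" if y: "y \<in> S" for y
  proof -
    define S1 where "S1 = {z \<in> S. inv (h y) \<otimes> h z \<in> fst c0}"
    have S1: "rel_open A S1" "y \<in> S1" using translate_smooth(2,3)[OF S h y] by (simp_all add: S1_def)
    have d: "((\<lambda>z. (y, z)) has_derivative (\<lambda>v. (0, v))) (at y within A)"
      by (intro has_derivative_Pair has_derivative_const has_derivative_ident)
    have sm: "smooth_in A (\<lambda>z. (y, z)) S1" by (intro smooth_in_Pair[OF S1(1)] smooth_in_const[OF S1(1)] smooth_in_id[OF S1(1)])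
    have "logd A h y v = deriv_in A (\<lambda>z. Lam (y, z)) y v" by (simp add: logd_def Lam_def)
    also have "\<dots> = deriv_in (A \<times> A) Lam (y, y) (deriv_in A (\<lambda>z. (y, z)) y v)"
      using y by (intro smooth_in_deriv_chain[OF S1(1) D _ sm L S1(2) v]) (auto simp: S1_def D_def)
    also have "deriv_in A (\<lambda>z. (y, z)) y v = (0, v)"
      using rel_openD[OF S] y v by (intro deriv_in_eq[OF _ _ v d]) auto
    finally show ?thesis .
  qed
  have "smooth_in A (\<lambda>y. deriv_in (A \<times> A) Lam (y, y) ((\<lambda>_. (0, v)) y)) S"
    using diag v rel_openD(1)[OF S]
    by (intro smooth_in_deriv_apply[OF S D _ _ L] smooth_in_const[OF S] smooth_in_Pair[OF S smooth_in_id[OF S] smooth_in_id[OF S]])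
      (auto simp: subspace_0)
  then have sm: "smooth_in A (\<lambda>y. deriv_in (A \<times> A) Lam (y, y) (0, v)) S" by simp
  show ?thesis by (rule smooth_in_congI[OF S sm eq])
qed

text \<open>The derivative in the direction w depends only on the curve s \<mapsto> inv (h x) h (x +
  s w). Maps defined on different spaces can thus be compared, for instance a product containing a
  one-parameter group with that group itself.\<close>

lemma logd_line:
  assumes S: "rel_open A S" and h: "smooth_map (flat A S) MG h" and x: "x \<in> S" and w: "w \<in> A"
    and S': "rel_open A' S'" and h': "smooth_map (flat A' S') MG h'" and x': "x' \<in> S'" and w': "w' \<in> A'"
    and \<delta>: "\<delta> > 0" "\<And>s::real. \<bar>s\<bar> < \<delta> \<Longrightarrow> inv (h x) \<otimes> h (x + s *\<^sub>R w) = inv (h' x') \<otimes> h' (x' + s *\<^sub>R w')"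
  shows "logd A h x w = logd A' h' x' w'"
proof -
  have line: "((\<lambda>s. snd c0 (inv (k y) \<otimes> k (y + s *\<^sub>R u))) has_vector_derivative logd B k y u) (at 0)"
    if T: "rel_open B T" and k: "smooth_map (flat B T) MG k" and y: "y \<in> T" and u: "u \<in> B"
    for B T k u and y :: "'z::euclidean_space"
    using has_vector_derivative_line[OF rel_openD(1)[OF T] _ u, of y "\<lambda>z. snd c0 (inv (k y) \<otimes> k z)" 0]
      logd_differentiable[OF T k y] rel_openD(3)[OF T] y by (auto simp: logd_def)
  have "((\<lambda>s. snd c0 (inv (h x) \<otimes> h (x + s *\<^sub>R w))) has_vector_derivative logd A' h' x' w') (at 0)"
    by (rule has_vector_derivative_transform_within_open[OF line[OF S' h' x' w'], of "{-\<delta><..<\<delta>}"])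
      (use \<delta> in \<open>auto simp: abs_less_iff\<close>)
  from vector_derivative_unique_at[OF line[OF S h x w] this] show ?thesis .
qed

definition lfield :: "'e \<Rightarrow> 'g \<Rightarrow> ('g, 'e) tvec" where
  "lfield v = left_invariant_field G MG (tvec_of MG \<one> c0 v)"

lemma smooth_left: "a \<in> carrier G \<Longrightarrow> smooth_map MG MG (\<lambda>x. a \<otimes> x)"
  by (rule smooth_lmult[OF atl smooth_map_id[OF atl]])

lemma tvec_one: "v \<in> E \<Longrightarrow> tvec_of MG \<one> c0 v \<in> tangent_space MG \<one>"
  by (rule tvec_of_tangent[OF atl c0_at])

lemma pushforward_translate:
  assumes S: "rel_open A S" and h: "smooth_map (flat A S) MG h" and y: "y \<in> S" and v: "v \<in> A"
  shows "pushforward (flat A S) MG (\<lambda>z. inv (h y) \<otimes> h z) y (flat_vec S v) = tvec_of MG \<one> c0 (logd A h y v)"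
proof -
  note sm = translate_smooth(1)[OF S h y]
  have one: "inv (h y) \<otimes> h y = \<one>" using flat_in_carrier[OF h y] by simp
  have fv: "flat_vec S v \<in> tangent_space (flat A S) y" using tangent_space_flat[OF S y] v by blast
  have t: "pushforward (flat A S) MG (\<lambda>z. inv (h y) \<otimes> h z) y (flat_vec S v) \<in> tangent_space MG \<one>"
    using pushforward_tangent[OF smooth_atlas_flat[OF S] atl sm _ fv] y one by simp
  have "pushforward (flat A S) MG (\<lambda>z. inv (h y) \<otimes> h z) y (flat_vec S v) c0 = logd A h y v"
    unfolding logd_def by (rule pushforward_from_flat[OF atl S sm y v]) (simp add: one c0_at)
  then show ?thesis using tvec_of_chart[OF atl t c0_at] by simp
qed

text \<open>Factor h z as h y times inv (h y) h z: the first factor is constant and acts by left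
  translation, the second passes through the identity at z = y.\<close>

lemma pushforward_logd:
  assumes S: "rel_open A S" and h: "smooth_map (flat A S) MG h" and y: "y \<in> S" and v: "v \<in> A"
  shows "pushforward (flat A S) MG h y (flat_vec S v) = lfield (logd A h y v) (h y)"
proof -
  note sm = translate_smooth(1)[OF S h y]
  have hy: "h y \<in> carrier G" by (rule flat_in_carrier[OF h y])
  have fv: "flat_vec S v \<in> tangent_space (flat A S) y" using tangent_space_flat[OF S y] v by blast
  have one: "inv (h y) \<otimes> h y = \<one>" using hy by simp
  note c = smooth_map_compose[OF smooth_atlas_flat[OF S] atl atl sm smooth_left[OF hy]]
  have yp: "y \<in> points (flat A S)" using y by simp
  have "pushforward (flat A S) MG h y (flat_vec S v)
      = pushforward (flat A S) MG (\<lambda>z. h y \<otimes> (inv (h y) \<otimes> h z)) y (flat_vec S v)"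
  proof (rule pushforward_cong[OF smooth_atlas_flat[OF S] atl h c yp fv])
    fix z assume "z \<in> points (flat A S)"
    then have "h z \<in> carrier G" using flat_in_carrier[OF h] by simp
    then show "h z = h y \<otimes> (inv (h y) \<otimes> h z)" using hy by (simp add: m_assoc[symmetric])
  qed
  also have "\<dots> = pushforward MG MG (\<lambda>x. h y \<otimes> x) (inv (h y) \<otimes> h y)
      (pushforward (flat A S) MG (\<lambda>z. inv (h y) \<otimes> h z) y (flat_vec S v))"
    by (rule pushforward_compose[OF smooth_atlas_flat[OF S] atl atl sm smooth_left[OF hy] yp fv])
  finally show ?thesis
    by (simp add: one pushforward_translate[OF S h y v] lfield_def left_invariant_field_def)
qed

lemma lfield_tangent:
  assumes "g \<in> carrier G" "v \<in> E"
  shows "lfield v g \<in> tangent_space MG g"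
  using pushforward_tangent[OF atl atl smooth_left[OF assms(1)] _ tvec_one[OF assms(2)]] assms(1)
  by (simp add: lfield_def left_invariant_field_def points_MG)

lemma pushforward_inv_lfield:
  assumes g: "g \<in> carrier G" and v: "v \<in> E"
  shows "pushforward MG MG (\<lambda>x. inv g \<otimes> x) g (lfield v g) = tvec_of MG \<one> c0 v"
proof -
  have "pushforward MG MG (\<lambda>x. inv g \<otimes> x) (g \<otimes> \<one>)
      (pushforward MG MG (\<lambda>x. g \<otimes> x) \<one> (tvec_of MG \<one> c0 v)) = tvec_of MG \<one> c0 v"
    using g by (intro pushforward_inverse[OF atl atl smooth_left smooth_left _ _ tvec_one[OF v]])
      (simp_all add: points_MG m_assoc[symmetric])
  then show ?thesis using g by (simp add: lfield_def left_invariant_field_def)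
qed

lemma lfield_inj:
  assumes "g \<in> carrier G" "u \<in> E" "v \<in> E" "lfield u g = lfield v g"
  shows "u = v"
  using pushforward_inv_lfield[OF assms(1,2)] pushforward_inv_lfield[OF assms(1,3)] assms(4)
    tvec_of_self[OF atl c0_at assms(2)] tvec_of_self[OF atl c0_at assms(3)] by metis

lemma lfield_inj_chart:
  assumes "g \<in> carrier G" "u \<in> E" "v \<in> E" "d \<in> charts_at MG g" "lfield u g d = lfield v g d"
  shows "u = v"
  by (rule lfield_inj[OF assms(1-3)
      tangent_space_eqI[OF lfield_tangent[OF assms(1,2)] lfield_tangent[OF assms(1,3)] assms(4,5)]])

lemma deriv_chart_logd:
  assumes S: "rel_open A S" and h: "smooth_map (flat A S) MG h" and y: "y \<in> S" and v: "v \<in> A" and d: "d \<in> charts_at MG (h y)"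
  shows "deriv_in A (\<lambda>z. snd d (h z)) y v = lfield (logd A h y v) (h y) d"
  using pushforward_from_flat[OF atl S h y v d] pushforward_logd[OF S h y v] by simp

end

text \<open>For maps that are additive and homogeneous only on a subspace, such as the bracket
  \<open>cbr\<close> with a fixed vector and the endomorphisms of W.\<close>

lemma linear_on_expansion:
  fixes f :: "'a::real_vector \<Rightarrow> 'b::real_vector"
  assumes "subspace E" "\<And>x y. x \<in> E \<Longrightarrow> y \<in> E \<Longrightarrow> f (x + y) = f x + f y"
    "\<And>r x. x \<in> E \<Longrightarrow> f (r *\<^sub>R x) = r *\<^sub>R f x" "finite B" "B \<subseteq> E"
  shows "f (\<Sum>b\<in>B. c b *\<^sub>R b) = (\<Sum>b\<in>B. c b *\<^sub>R f b)"
proof -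
  have f0: "f 0 = 0" using assms(3)[of 0 0] subspace_0[OF assms(1)] by simp
  show ?thesis using assms(4,5)
  proof (induction B rule: finite_induct)
    case (insert b B)
    then have "(\<Sum>b\<in>B. c b *\<^sub>R b) \<in> E" "c b *\<^sub>R b \<in> E" "b \<in> E"
      using assms(1) by (auto intro!: subspace_sum subspace_scale)
    then show ?case using insert by (simp add: assms(2,3))
  qed (simp add: f0)
qed

section \<open>Left invariant fields in the chart at the identity\<close>

context lie_grp begin

text \<open>The left invariant field with value v at the identity, as a vector valued function on
  the chart \<open>c0\<close>. Since its value at \<open>org\<close> is v, the commutator formula at
  the identity turns into \<open>cbr\<close>.\<close>

definition lcoord :: "'e \<Rightarrow> 'e \<Rightarrow> 'e" where
  "lcoord v a = lfield v (chart_inv c0 a) c0"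

definition cbr :: "'e \<Rightarrow> 'e \<Rightarrow> 'e" where
  "cbr u v = deriv_in E (lcoord v) org u - deriv_in E (lcoord u) org v"

lemma chart_inv_c0:
  assumes "a \<in> snd c0 ` fst c0"
  shows "chart_inv c0 a \<in> fst c0" "chart_inv c0 a \<in> carrier G" "c0 \<in> charts_at MG (chart_inv c0 a)"
    "snd c0 (chart_inv c0 a) = a"
proof -
  show 1: "chart_inv c0 a \<in> fst c0" by (rule chart_inv_in[OF assms order_refl atl c0D(1)])
  then show "chart_inv c0 a \<in> carrier G" using chart_subset[OF atl c0D(1)] points_MG by blast
  show "c0 \<in> charts_at MG (chart_inv c0 a)" unfolding charts_at_def using c0D(1) 1 by simp
  show "snd c0 (chart_inv c0 a) = a" by (rule chart_chart_inv[OF assms])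
qed

lemma lcoord_chart_inv:
  assumes a: "a \<in> snd c0 ` fst c0" and v: "v \<in> E"
  shows "lcoord v a = deriv_in E (\<lambda>b. snd c0 (chart_inv c0 a \<otimes> chart_inv c0 b)) org v"
proof -
  note g = chart_inv_c0[OF a]
  have 1: "\<one> \<in> points MG" by (simp add: points_MG)
  have d: "c0 \<in> charts_at MG (chart_inv c0 a \<otimes> \<one>)" using g by simp
  show ?thesis
    unfolding lcoord_def lfield_def left_invariant_field_def
      pushforward_chart[OF atl atl smooth_left[OF g(2)] 1 tvec_one[OF v] c0_at d]
    using tvec_of_self[OF atl c0_at v] by (simp add: org_def)
qed

text \<open>A left translation differentiated at the identity is the partial derivative of the
  multiplication \<mu> in its second argument at \<open>org\<close>, so it depends smoothly on the
  first argument.\<close>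

lemma smooth_lcoord:
  assumes v: "v \<in> E"
  shows "smooth_in E (lcoord v) (snd c0 ` fst c0)" "lcoord v ` (snd c0 ` fst c0) \<subseteq> E"
proof -
  define S where "S = snd c0 ` fst c0"
  have S: "rel_open E S" using C0_open by (simp add: S_def)
  note SS = rel_open_Times[OF S S]
  note fl = smooth_atlas_flat[OF SS]
  have ci: "smooth_map (flat E S) MG (chart_inv c0)"
    unfolding S_def by (rule smooth_map_chart_inv[OF atl c0D(1)])
  have p: "smooth_map (flat (E \<times> E) (S \<times> S)) (flat E S) fst" "smooth_map (flat (E \<times> E) (S \<times> S)) (flat E S) snd"
    unfolding smooth_map_flat_flat[OF SS S]
    using smooth_in_bounded_linear[OF SS bounded_linear_fst] smooth_in_bounded_linear[OF SS bounded_linear_snd] by auto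
  have hp: "smooth_map (flat (E \<times> E) (S \<times> S)) MG (\<lambda>p. chart_inv c0 (fst p))" "smooth_map (flat (E \<times> E) (S \<times> S)) MG (\<lambda>p. chart_inv c0 (snd p))"
    using smooth_map_compose[OF fl smooth_atlas_flat[OF S] atl p(1) ci] smooth_map_compose[OF fl smooth_atlas_flat[OF S] atl p(2) ci] .
  note q = smooth_mult[OF fl hp]
  define D where "D = {p \<in> S \<times> S. chart_inv c0 (fst p) \<otimes> chart_inv c0 (snd p) \<in> fst c0}"
  define \<mu> where "\<mu> p = snd c0 (chart_inv c0 (fst p) \<otimes> chart_inv c0 (snd p))" for p
  have D: "rel_open (E \<times> E) D" and L: "smooth_in (E \<times> E) \<mu> D"
    using smooth_map_from_flatD[OF atl SS q c0D(1)] by (simp_all add: D_def \<mu>_def[abs_def])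
  have diag: "(a, org) \<in> D" if "a \<in> S" for a
    using chart_inv_c0(1,2)[of a] that org_in by (simp add: D_def S_def)
  have eq: "lcoord v a = deriv_in (E \<times> E) \<mu> (a, org) (0, v)" if a: "a \<in> S" for a
  proof -
    define S1 where "S1 = {b \<in> S. (a, b) \<in> D}"
    have cont: "continuous_on S (\<lambda>b. (a, b))" by (intro continuous_intros)
    have aE: "a \<in> E" using a rel_openD(3)[OF S] by blast
    have S1: "rel_open E S1"
      unfolding S1_def using aE rel_openD(3)[OF S]
      by (intro rel_open_preimage[OF S cont rel_openD(2)[OF D]]) auto
    have org1: "org \<in> S1" using diag[OF a] org_in by (simp add: S1_def S_def)
    have d: "((\<lambda>z. (a, z)) has_derivative (\<lambda>v. (0, v))) (at org within E)"
      by (intro has_derivative_Pair has_derivative_const has_derivative_ident)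
    have sm: "smooth_in E (\<lambda>z. (a, z)) S1" by (intro smooth_in_Pair[OF S1(1)] smooth_in_const[OF S1(1)] smooth_in_id[OF S1(1)])
    have "lcoord v a = deriv_in E (\<lambda>b. \<mu> (a, b)) org v"
      using lcoord_chart_inv[of a v] a v by (simp add: \<mu>_def S_def)
    also have "\<dots> = deriv_in (E \<times> E) \<mu> (a, org) (deriv_in E (\<lambda>z. (a, z)) org v)"
      by (intro smooth_in_deriv_chain[OF S1(1) D _ sm L org1 v]) (auto simp: S1_def)
    also have "deriv_in E (\<lambda>z. (a, z)) org v = (0, v)"
      by (rule deriv_in_eq[OF subE org_in(2) v d])
    finally show ?thesis .
  qed
  have "smooth_in E (\<lambda>a. deriv_in (E \<times> E) \<mu> (a, org) ((\<lambda>_. (0, v)) a)) S"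
    using diag v subspace_0[OF subE]
    by (intro smooth_in_deriv_apply[OF S D _ _ L] smooth_in_const[OF S] smooth_in_Pair[OF S smooth_in_id[OF S] smooth_in_const[OF S]]) auto
  then have sm: "smooth_in E (\<lambda>a. deriv_in (E \<times> E) \<mu> (a, org) (0, v)) S" by simp
  show "smooth_in E (lcoord v) (snd c0 ` fst c0)"
    unfolding S_def[symmetric] by (rule smooth_in_congI[OF S sm eq])
  show "lcoord v ` (snd c0 ` fst c0) \<subseteq> E"
    using tangent_space_model[OF lfield_tangent[OF chart_inv_c0(2) v] chart_inv_c0(3)]
    unfolding lcoord_def by blast
qed

lemma lcoord_linear:
  assumes a: "a \<in> snd c0 ` fst c0" and B: "finite B" "B \<subseteq> E"
  shows "lcoord (\<Sum>b\<in>B. c b *\<^sub>R b) a = (\<Sum>b\<in>B. c b *\<^sub>R lcoord b a)"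
proof -
  note g = chart_inv_c0[OF a]
  have 1: "\<one> \<in> points MG" by (simp add: points_MG)
  have d: "c0 \<in> charts_at MG (chart_inv c0 a \<otimes> \<one>)" using g by simp
  have lin: "linear (deriv_in E (\<lambda>b. snd c0 (chart_inv c0 a \<otimes> chart_inv c0 b)) org)"
    unfolding org_def by (rule deriv_in_chart_linear[OF atl atl smooth_left[OF g(2)] c0_at d])
  have "(\<Sum>b\<in>B. c b *\<^sub>R b) \<in> E" using B subE by (auto intro!: subspace_sum subspace_scale)
  then have "lcoord (\<Sum>b\<in>B. c b *\<^sub>R b) a =
      deriv_in E (\<lambda>b. snd c0 (chart_inv c0 a \<otimes> chart_inv c0 b)) org (\<Sum>b\<in>B. c b *\<^sub>R b)"
    by (rule lcoord_chart_inv[OF a])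
  also have "\<dots> = (\<Sum>b\<in>B. c b *\<^sub>R deriv_in E (\<lambda>b. snd c0 (chart_inv c0 a \<otimes> chart_inv c0 b)) org b)"
    by (rule linear_expansion[OF lin refl])
  also have "\<dots> = (\<Sum>b\<in>B. c b *\<^sub>R lcoord b a)"
    using B(2) lcoord_chart_inv[OF a] by (intro sum.cong) auto
  finally show ?thesis .
qed

lemma lcoord_org:
  assumes v: "v \<in> E" shows "lcoord v org = v"
proof -
  have "lcoord v org = deriv_in E (\<lambda>b. b) org v"
    unfolding lcoord_chart_inv[OF org_in(1) v]
  proof (rule deriv_in_cong[OF C0_open org_in(1)])
    fix z assume "z \<in> snd c0 ` fst c0"
    from chart_inv_c0(2,4)[OF this] show "snd c0 (chart_inv c0 org \<otimes> chart_inv c0 z) = z"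
      by (simp add: org_in)
  qed
  also have "\<dots> = v" by (rule deriv_in_eq[OF subE org_in(2) v has_derivative_ident])
  finally show ?thesis .
qed

lemma lie_bracket_left_invariant:
  assumes u: "u \<in> E" and v: "v \<in> E"
  shows "lie_bracket MG (left_invariant_field G MG (tvec_of MG \<one> c0 u))
      (left_invariant_field G MG (tvec_of MG \<one> c0 v)) \<one> = tvec_of MG \<one> c0 (cbr u v)"
proof -
  have one: "lfield w \<one> c0 = w" if "w \<in> E" for w
    using lcoord_org[OF that] by (simp add: lcoord_def org_in)
  show ?thesis
    unfolding lie_bracket_def Let_def c0_def[symmetric] lfield_def[symmetric] one[OF u] one[OF v] org_def[symmetric]
      cbr_def lcoord_def[abs_def] ..
qed

lemma cbr_in_model:
  assumes u: "u \<in> E" and v: "v \<in> E"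
  shows "cbr u v \<in> E"
  unfolding cbr_def
  by (intro subspace_diff[OF subE] smooth_in_deriv_closed[OF C0_open smooth_lcoord(1) org_in(1) subE smooth_lcoord(2)] u v)

text \<open>The structure equation of the Maurer--Cartan form, pulled back along a smooth map.  After a left
  translation the map sends the point in question to the identity, where the equation is the symmetry of
  the second derivative.\<close>

lemma structure_equation:
  assumes S: "rel_open A S" and h: "smooth_map (flat A S) MG h" and y: "y \<in> S" and u: "u \<in> A" and v: "v \<in> A"
  shows "deriv_in A (\<lambda>z. logd A h z v) y u - deriv_in A (\<lambda>z. logd A h z u) y v = - cbr (logd A h y u) (logd A h y v)"
proof -
  define k where "k z = inv (h y) \<otimes> h z" for z
  define S1 where "S1 = {z \<in> S. k z \<in> fst c0}"
  have k: "smooth_map (flat A S) MG k" and S1: "rel_open A S1" "y \<in> S1" and H: "smooth_in A (\<lambda>z. snd c0 (k z)) S1"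
    using translate_smooth[OF S h y] by (simp_all add: k_def[abs_def] S1_def)
  define H where "H z = snd c0 (k z)" for z
  have Hsm: "smooth_in A H S1" using H by (simp add: H_def[abs_def])
  define \<beta> where "\<beta> z w = logd A h z w" for z w
  have hy: "h y \<in> carrier G" by (rule flat_in_carrier[OF h y])
  have kb: "logd A k z w = \<beta> z w" if "z \<in> S" for z w
    unfolding k_def \<beta>_def using logd_lmult[OF S h that] hy by simp
  have ky: "k y = \<one>" using hy by (simp add: k_def)
  have Hy: "H y = org" by (simp add: H_def ky org_def)
  obtain B where B: "finite B" "B \<subseteq> E" "\<And>v. v \<in> E \<Longrightarrow> (\<Sum>b\<in>B. (v \<bullet> b) *\<^sub>R b) = v"
    using orthonormal_expansion[OF subE] by blast
  have HC: "H ` S1 \<subseteq> snd c0 ` fst c0" by (auto simp: H_def S1_def)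
  have \<beta>E: "\<beta> z w \<in> E" if "z \<in> S" "w \<in> A" for z w
    unfolding \<beta>_def by (rule logd_in_model[OF S h that])
  have S1S: "z \<in> S" if "z \<in> S1" for z using that by (simp add: S1_def)
  \<comment> \<open>The derivative of H is the left invariant field with coefficient \<beta> at the
    point H z. The expansion in B separates the coefficients, which depend on z directly, from the
    fields, which depend on z through H.\<close>
  have DH: "deriv_in A H z w = (\<Sum>b\<in>B. (\<beta> z w \<bullet> b) *\<^sub>R lcoord b (H z))" if z: "z \<in> S1" and w: "w \<in> A" for z w
  proof -
    have kz: "k z \<in> fst c0" "z \<in> S" using z by (auto simp: S1_def)
    have ci: "chart_inv c0 (H z) = k z" unfolding H_def by (rule chart_inv_eq[OF atl c0D(1) kz(1)])
    have d: "c0 \<in> charts_at MG (k z)" unfolding charts_at_def using c0D(1) kz(1) by simp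
    have "deriv_in A H z w = lfield (logd A k z w) (k z) c0"
      using deriv_chart_logd[OF S k kz(2) w d] by (simp add: H_def[abs_def])
    also have "\<dots> = lcoord (\<beta> z w) (H z)" by (simp add: lcoord_def ci kb[OF kz(2)])
    also have "\<dots> = lcoord (\<Sum>b\<in>B. (\<beta> z w \<bullet> b) *\<^sub>R b) (H z)" by (simp add: B(3) \<beta>E[OF kz(2) w])
    also have "\<dots> = (\<Sum>b\<in>B. (\<beta> z w \<bullet> b) *\<^sub>R lcoord b (H z))"
      using HC z by (intro lcoord_linear[OF _ B(1,2)]) auto
    finally show ?thesis .
  qed
  have DHy: "deriv_in A H y w = \<beta> y w" if "w \<in> A" for w
    unfolding DH[OF S1(2) that] Hy using B(2) lcoord_org B(3)[OF \<beta>E[OF y that]] by (simp add: subset_iff)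
  have Bb: "deriv_in E (lcoord w) org x = (\<Sum>b\<in>B. (w \<bullet> b) *\<^sub>R deriv_in E (lcoord b) org x)" if w: "w \<in> E" and x: "x \<in> E" for w x
  proof -
    have "((\<lambda>a. \<Sum>b\<in>B. (w \<bullet> b) *\<^sub>R lcoord b a) has_derivative (\<lambda>x. \<Sum>b\<in>B. (w \<bullet> b) *\<^sub>R deriv_in E (lcoord b) org x)) (at org within E)"
      using B(2) by (intro has_derivative_sum has_derivative_scaleR_right
          smooth_in_has_deriv[OF smooth_lcoord(1) org_in(1)]) auto
    from has_derivative_rel_open_congI[OF C0_open org_in(1) this, of "lcoord w"]
    have "(lcoord w has_derivative (\<lambda>x. \<Sum>b\<in>B. (w \<bullet> b) *\<^sub>R deriv_in E (lcoord b) org x)) (at org within E)"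
      using lcoord_linear[OF _ B(1,2), of _ "\<lambda>b. w \<bullet> b"] B(3)[OF w] by simp
    from deriv_in_eq[OF subE org_in(2) x this] show ?thesis .
  qed
  \<comment> \<open>At y the fields take the values of their coefficients. A second derivative of H
    is therefore a derivative of \<beta> plus a derivative of a left invariant field, and
    antisymmetrising the latter produces \<open>cbr\<close>.\<close>
  have DDH: "deriv_in A (\<lambda>z. deriv_in A H z w) y x = deriv_in A (\<lambda>z. \<beta> z w) y x + deriv_in E (lcoord (\<beta> y w)) org (\<beta> y x)"
    if w: "w \<in> A" and x: "x \<in> A" for w x
  proof -
    have b1: "((\<lambda>z. \<beta> z w) has_derivative deriv_in A (\<lambda>z. \<beta> z w) y) (at y within A)"
      unfolding \<beta>_def by (rule smooth_in_has_deriv[OF smooth_logd[OF S h w] y])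
    have l1: "((\<lambda>z. lcoord b (H z)) has_derivative (\<lambda>x. deriv_in E (lcoord b) org (deriv_in A H y x))) (at y within A)"
      if "b \<in> B" for b
      unfolding Hy[symmetric] using B(2) that Hy org_in(1)
      by (intro deriv_in_chain[OF S1 C0_open HC] smooth_in_differentiable[OF smooth_lcoord(1)] smooth_in_differentiable[OF Hsm S1(2)]) auto
    have "((\<lambda>z. \<Sum>b\<in>B. (\<beta> z w \<bullet> b) *\<^sub>R lcoord b (H z)) has_derivative
       (\<lambda>x. \<Sum>b\<in>B. (\<beta> y w \<bullet> b) *\<^sub>R deriv_in E (lcoord b) org (deriv_in A H y x) + (deriv_in A (\<lambda>z. \<beta> z w) y x \<bullet> b) *\<^sub>R lcoord b (H y))) (at y within A)"
      by (intro has_derivative_sum has_derivative_scaleR has_derivative_inner_left b1 l1)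
    from has_derivative_rel_open_congI[OF S1 this DH[OF _ w]]
    have "deriv_in A (\<lambda>z. deriv_in A H z w) y x = (\<Sum>b\<in>B. (\<beta> y w \<bullet> b) *\<^sub>R deriv_in E (lcoord b) org (deriv_in A H y x) + (deriv_in A (\<lambda>z. \<beta> z w) y x \<bullet> b) *\<^sub>R lcoord b (H y))"
      using rel_openD[OF S] y x by (intro deriv_in_eq) auto
    also have "\<dots> = (\<Sum>b\<in>B. (\<beta> y w \<bullet> b) *\<^sub>R deriv_in E (lcoord b) org (\<beta> y x)) + (\<Sum>b\<in>B. (deriv_in A (\<lambda>z. \<beta> z w) y x \<bullet> b) *\<^sub>R lcoord b org)"
      by (simp add: sum.distrib DHy[OF x] Hy)
    also have "(\<Sum>b\<in>B. (\<beta> y w \<bullet> b) *\<^sub>R deriv_in E (lcoord b) org (\<beta> y x)) = deriv_in E (lcoord (\<beta> y w)) org (\<beta> y x)"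
      using Bb[OF \<beta>E[OF y w] \<beta>E[OF y x]] by simp
    also have "(\<Sum>b\<in>B. (deriv_in A (\<lambda>z. \<beta> z w) y x \<bullet> b) *\<^sub>R lcoord b org) = (\<Sum>b\<in>B. (deriv_in A (\<lambda>z. \<beta> z w) y x \<bullet> b) *\<^sub>R b)"
      using B(2) lcoord_org by (intro sum.cong) auto
    also have "\<dots> = deriv_in A (\<lambda>z. \<beta> z w) y x"
      unfolding \<beta>_def using logd_in_model[OF S h _ w]
      by (intro B(3) smooth_in_deriv_closed[OF S smooth_logd[OF S h w] y subE _ x]) auto
    finally show ?thesis by simp
  qed
  have "deriv_in A (\<lambda>z. deriv_in A H z v) y u = deriv_in A (\<lambda>z. deriv_in A H z u) y v"
    by (rule deriv_in_commute[OF S1(1) Hsm S1(2) v u])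
  then show ?thesis
    unfolding DDH[OF u v] DDH[OF v u] cbr_def \<beta>_def by (simp add: algebra_simps)
qed

lemma logd_const:
  assumes S: "rel_open A S" and a: "a \<in> carrier G" and y: "y \<in> S" and v: "v \<in> A"
  shows "logd A (\<lambda>x. a) y v = 0"
proof -
  have "logd A (\<lambda>x. a) y v = deriv_in A (\<lambda>z. snd c0 (inv a \<otimes> a)) y v" by (simp add: logd_def)
  also have "\<dots> = 0" using rel_openD[OF S] y v by (intro deriv_in_eq) auto
  finally show ?thesis .
qed

text \<open>The integral curve of \<open>lcoord u\<close> through \<open>org\<close>, carried to the
  group. Its velocity at each point is the left invariant field there, and this is what a constant
  logarithmic derivative means.\<close>

lemma integral_curve:
  assumes u: "u \<in> E"
  obtains \<epsilon> \<gamma> where "\<epsilon> > 0" "smooth_map (flat UNIV {-\<epsilon><..<\<epsilon>}) MG \<gamma>" "\<gamma> 0 = \<one>"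
    "\<And>s::real. \<bar>s\<bar> < \<epsilon> \<Longrightarrow> logd UNIV \<gamma> s 1 = u"
proof -
  obtain \<epsilon> \<Gamma> where e: "\<epsilon> > 0" "\<Gamma> 0 = org" "\<Gamma> ` {-\<epsilon><..<\<epsilon>} \<subseteq> snd c0 ` fst c0" "smooth_in UNIV \<Gamma> {-\<epsilon><..<\<epsilon>}"
    "\<And>t::real. \<bar>t\<bar> < \<epsilon> \<Longrightarrow> (\<Gamma> has_vector_derivative lcoord u (\<Gamma> t)) (at t)"
    using smooth_integral_curve[OF C0_open smooth_lcoord[OF u] org_in(1)] by metis
  have I: "rel_open UNIV {-\<epsilon><..<\<epsilon>}" by (simp add: rel_open_UNIV)
  define \<gamma> where "\<gamma> s = chart_inv c0 (\<Gamma> s)" for s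
  have sm: "smooth_map (flat UNIV {-\<epsilon><..<\<epsilon>}) MG \<gamma>"
    unfolding \<gamma>_def
    using smooth_map_flat_flat[OF I C0_open] e(3,4)
    by (intro smooth_map_compose[OF smooth_atlas_flat[OF I] smooth_atlas_flat[OF C0_open] atl _ smooth_map_chart_inv[OF atl c0D(1)]]) blast
  have "logd UNIV \<gamma> s 1 = u" if s: "\<bar>s\<bar> < \<epsilon>" for s
  proof -
    have sI: "s \<in> {-\<epsilon><..<\<epsilon>}" using s by auto
    then have G: "\<Gamma> s \<in> snd c0 ` fst c0" using e(3) by blast
    note g = chart_inv_c0[OF G]
    have "lfield (logd UNIV \<gamma> s 1) (\<gamma> s) c0 = deriv_in UNIV (\<lambda>z. snd c0 (\<gamma> z)) s 1"
      using deriv_chart_logd[OF I sm sI, of 1 c0] g(3) by (simp add: \<gamma>_def)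
    also have "\<dots> = deriv_in UNIV \<Gamma> s 1"
    proof (rule deriv_in_cong[OF I sI])
      fix z assume "z \<in> {-\<epsilon><..<\<epsilon>}"
      then have "\<Gamma> z \<in> snd c0 ` fst c0" using e(3) by blast
      then show "snd c0 (\<gamma> z) = \<Gamma> z" unfolding \<gamma>_def by (rule chart_inv_c0(4))
    qed
    also have "\<dots> = 1 *\<^sub>R lcoord u (\<Gamma> s)"
      using e(5)[OF s] by (intro deriv_in_eq) (auto simp: has_vector_derivative_def)
    also have "\<dots> = lfield u (\<gamma> s) c0" by (simp add: lcoord_def \<gamma>_def)
    finally have eq: "lfield (logd UNIV \<gamma> s 1) (\<gamma> s) c0 = lfield u (\<gamma> s) c0" .
    have gs: "\<gamma> s \<in> carrier G" "c0 \<in> charts_at MG (\<gamma> s)" using g by (simp_all add: \<gamma>_def)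
    show ?thesis
      by (rule lfield_inj_chart[OF gs(1) logd_in_model[OF I sm sI UNIV_I] u gs(2) eq])
  qed
  moreover have "\<gamma> 0 = \<one>" by (simp add: \<gamma>_def e(2) org_in)
  ultimately show thesis using that[OF e(1) sm] by blast
qed

end

section \<open>Straightening the left translates of the subalgebra\<close>

context lie_grp begin

lemma restrict_flat:
  assumes S: "rel_open A S" and S': "rel_open A S'" "S' \<subseteq> S" and h: "smooth_map (flat A S) MG h"
  shows "smooth_map (flat A S') MG h"
proof -
  have "smooth_map (flat A S') (flat A S) (\<lambda>x. x)"
    unfolding smooth_map_flat_flat[OF S'(1) S] using smooth_in_id[OF S'(1)] S'(2) by auto
  from smooth_map_compose[OF smooth_atlas_flat[OF S'(1)] smooth_atlas_flat[OF S] atl this h] show ?thesis .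
qed

text \<open>The transverse submanifold through the identity: q will be the projection with kernel
  E0, and F depends on q x only. Constancy along the kernel leaves these directions free for the
  one-parameter groups.\<close>

lemma leaf_chart_base:
  assumes q: "bounded_linear q" "\<And>x. x \<in> E \<Longrightarrow> q x \<in> E"
  obtains r F where "r > 0" "smooth_map (flat E (E \<inter> ball 0 r)) MG F" "F 0 = \<one>"
    "\<And>v. v \<in> E \<Longrightarrow> logd E F 0 v = q v" "\<And>x v. q v = 0 \<Longrightarrow> F (x + v) = F x"
proof -
  have q0: "q 0 = 0" by (rule linear_0[OF bounded_linear.linear[OF q(1)]])
  have qadd: "q (x + v) = q x + q v" for x v by (rule linear_add[OF bounded_linear.linear[OF q(1)]])
  define S where "S = {x \<in> E. org + q x \<in> snd c0 ` fst c0}"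
  have EE: "rel_open E E" by (rule rel_open_space[OF subE])
  have cont: "continuous_on E (\<lambda>x. org + q x)"
    by (intro continuous_intros linear_continuous_on q(1))
  have "(\<lambda>x. org + q x) ` E \<subseteq> E" using q(2) org_in(2) subE by (auto intro: subspace_add)
  then have S: "rel_open E S" unfolding S_def by (rule rel_open_preimage[OF EE cont rel_openD(2)[OF C0_open]])
  have "0 \<in> S" using org_in subspace_0[OF subE] by (simp add: S_def q0)
  then obtain r where r: "r > 0" "E \<inter> ball 0 r \<subseteq> S" using rel_open_ballE[OF S] by blast
  define B where "B = E \<inter> ball 0 r"
  have B: "rel_open E B" "0 \<in> B" using rel_open_ball[OF subE] r subspace_0[OF subE] by (auto simp: B_def)
  define F where "F x = chart_inv c0 (org + q x)" for x
  have sm: "smooth_in E (\<lambda>x. org + q x) B"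
    by (intro smooth_in_add[OF B(1)] smooth_in_const[OF B(1)] smooth_in_bounded_linear[OF B(1) q(1)])
  have BC: "(\<lambda>x. org + q x) ` B \<subseteq> snd c0 ` fst c0" using r(2) by (auto simp: B_def S_def)
  have "smooth_map (flat E B) (flat E (snd c0 ` fst c0)) (\<lambda>x. org + q x)"
    unfolding smooth_map_flat_flat[OF B(1) C0_open] using sm BC by blast
  from smooth_map_compose[OF smooth_atlas_flat[OF B(1)] smooth_atlas_flat[OF C0_open] atl this smooth_map_chart_inv[OF atl c0D(1)]]
  have F: "smooth_map (flat E B) MG F" unfolding F_def .
  have F0: "F 0 = \<one>" by (simp add: F_def q0 org_in)
  have "logd E F 0 v = q v" if v: "v \<in> E" for v
  proof -
    have "deriv_in E (\<lambda>z. snd c0 (F z)) 0 v = lfield (logd E F 0 v) (F 0) c0"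
      by (rule deriv_chart_logd[OF B(1) F B(2) v]) (simp add: F0 c0_at)
    also have "\<dots> = logd E F 0 v"
      using lcoord_org[OF logd_in_model[OF B(1) F B(2) v]] by (simp add: lcoord_def org_in F0)
    finally have "logd E F 0 v = deriv_in E (\<lambda>z. snd c0 (F z)) 0 v" by simp
    also have "\<dots> = deriv_in E (\<lambda>x. org + q x) 0 v"
    proof (rule deriv_in_cong[OF B])
      fix z assume "z \<in> B"
      then have "org + q z \<in> snd c0 ` fst c0" using BC by blast
      then show "snd c0 (F z) = org + q z" unfolding F_def by (rule chart_inv_c0(4))
    qed
    also have "\<dots> = 0 + q v"
      by (intro deriv_in_eq[OF subE subspace_0[OF subE] v] has_derivative_add has_derivative_const
          bounded_linear_imp_has_derivative q(1))
    finally show ?thesis by simp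
  qed
  moreover have "F (x + v) = F x" if "q v = 0" for x v by (simp add: F_def qadd that)
  ultimately show thesis using that[OF r(1) F[unfolded B_def] F0] by blast
qed

text \<open>One more one-parameter group is multiplied on from the right.  The derivative of the new map in
  the direction \<open>b\<close> is the constant \<open>b\<close>, so that along the lines in this direction the other derivatives
  satisfy a linear differential equation whose coefficients preserve the subalgebra.\<close>

lemma leaf_chart_step:
  assumes E0: "subspace E0" "E0 \<subseteq> E" and q: "bounded_linear q" "\<And>x. x \<in> E0 \<Longrightarrow> q x = 0"
      "\<And>x. x \<in> E \<Longrightarrow> x - q x \<in> E0"
    and cl: "\<And>u v. u \<in> E0 \<Longrightarrow> v \<in> E0 \<Longrightarrow> cbr u v \<in> E0"
    and cadd: "\<And>u v w. u \<in> E \<Longrightarrow> v \<in> E \<Longrightarrow> w \<in> E \<Longrightarrow> cbr u (v + w) = cbr u v + cbr u w"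
    and cscale: "\<And>r u v. u \<in> E \<Longrightarrow> v \<in> E \<Longrightarrow> cbr u (r *\<^sub>R v) = r *\<^sub>R cbr u v"
    and b: "b \<in> E0" "norm b = 1"
    and r: "r > 0" and F: "smooth_map (flat E (E \<inter> ball 0 r)) MG F" and F0: "F 0 = \<one>"
    and Fb: "\<And>x s. x \<in> E \<inter> ball 0 r \<Longrightarrow> x + s *\<^sub>R b \<in> ball 0 r \<Longrightarrow> F (x + s *\<^sub>R b) = F x"
    and FE0: "\<And>x v. x \<in> E \<inter> ball 0 r \<Longrightarrow> v \<in> E0 \<Longrightarrow> logd E F x v \<in> E0"
  obtains r' \<gamma> where "0 < r'" "r' \<le> r"
    "smooth_map (flat E (E \<inter> ball 0 r')) MG (\<lambda>x. F x \<otimes> \<gamma> (x \<bullet> b))" "\<gamma> 0 = \<one>"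
    "\<And>v. v \<in> E \<Longrightarrow> logd E (\<lambda>x. F x \<otimes> \<gamma> (x \<bullet> b)) 0 v = logd E F 0 (v - (v \<bullet> b) *\<^sub>R b) + (v \<bullet> b) *\<^sub>R b"
    "\<And>x v. x \<in> E \<inter> ball 0 r' \<Longrightarrow> v \<in> E0 \<Longrightarrow> logd E (\<lambda>x. F x \<otimes> \<gamma> (x \<bullet> b)) x v \<in> E0"
proof -
  have bE: "b \<in> E" and bb: "b \<bullet> b = 1" using b E0 by (auto simp: norm_eq_1)
  obtain \<epsilon> \<gamma> where e: "\<epsilon> > 0" and gsm: "smooth_map (flat UNIV {-\<epsilon><..<\<epsilon>}) MG \<gamma>" and g0: "\<gamma> 0 = \<one>"
    and glog: "\<And>s::real. \<bar>s\<bar> < \<epsilon> \<Longrightarrow> logd UNIV \<gamma> s 1 = b"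
    by (rule integral_curve[OF bE]) (rule that)
  have I: "rel_open UNIV {-\<epsilon><..<\<epsilon>}" by (simp add: rel_open_UNIV)
  \<comment> \<open>As b is a unit vector, x \<bullet> b is at most norm x in absolute value, so for
    x in the smaller ball it lies in the domain of \<gamma>.\<close>
  define r' where "r' = min r \<epsilon>"
  have r': "0 < r'" "r' \<le> r" "r' \<le> \<epsilon>" using r e by (auto simp: r'_def)
  define S where "S = E \<inter> ball 0 r'"
  have S: "rel_open E S" "S \<subseteq> E \<inter> ball 0 r" "0 \<in> S"
    using rel_open_ball[OF subE] r' subspace_0[OF subE] by (auto simp: S_def)
  have F': "smooth_map (flat E S) MG F" by (rule restrict_flat[OF rel_open_ball[OF subE] S(1,2) F])
  define h where "h x = F x \<otimes> \<gamma> (x \<bullet> b)" for x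
  have xb: "\<bar>x \<bullet> b\<bar> \<le> norm x" for x using Cauchy_Schwarz_ineq2[of x b] b by simp
  have lI: "x \<bullet> b \<in> {-\<epsilon><..<\<epsilon>}" if "x \<in> S" for x
    using xb[of x] that r' by (auto simp: S_def)
  have "smooth_map (flat E S) (flat UNIV {-\<epsilon><..<\<epsilon>}) (\<lambda>x. x \<bullet> b)"
    unfolding smooth_map_flat_flat[OF S(1) I]
    using lI smooth_in_bounded_linear[OF S(1) bounded_linear_inner_left] by blast
  note gl = smooth_map_compose[OF smooth_atlas_flat[OF S(1)] smooth_atlas_flat[OF I] atl this gsm]
  have h: "smooth_map (flat E S) MG h"
    unfolding h_def by (rule smooth_mult[OF smooth_atlas_flat[OF S(1)] F' gl])
  have gc: "\<gamma> s \<in> carrier G" if "\<bar>s\<bar> < \<epsilon>" for s using flat_in_carrier[OF gsm, of s] that by (simp add: abs_less_iff)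
  have Fc: "F x \<in> carrier G" if "x \<in> S" for x by (rule flat_in_carrier[OF F' that])
  have near: "x + s *\<^sub>R v \<in> S" if x: "x \<in> S" and v: "v \<in> E" and s: "\<bar>s\<bar> < (r' - norm x) / (norm v + 1)" for x v s
  proof -
    have "\<bar>s\<bar> * (norm v + 1) < r' - norm x" using s by (simp add: pos_less_divide_eq add_nonneg_pos)
    then have "norm (s *\<^sub>R v) < r' - norm x" by (simp add: algebra_simps)
    then have "norm (x + s *\<^sub>R v) < r'" using norm_triangle_ineq[of x "s *\<^sub>R v"] by linarith
    moreover have "x + s *\<^sub>R v \<in> E" using x v subE by (auto simp: S_def intro: subspace_add subspace_scale)
    ultimately show ?thesis by (simp add: S_def)
  qed
  have dpos: "(r' - norm x) / (norm v + 1) > 0" if "x \<in> S" for x and v :: 'e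
    using that by (auto simp: S_def intro!: divide_pos_pos add_nonneg_pos)
  \<comment> \<open>In the direction b only the last factor moves, because F is constant along b;
    hence the logarithmic derivative is that of \<gamma>.\<close>
  have hb: "logd E h x b = b" if x: "x \<in> S" for x
  proof -
    have xl: "\<bar>x \<bullet> b\<bar> < \<epsilon>" using lI[OF x] by auto
    have "logd E h x b = logd UNIV \<gamma> (x \<bullet> b) 1"
    proof (rule logd_line[OF S(1) h x bE I gsm lI[OF x] UNIV_I dpos[OF x, of b]])
      fix s :: real assume s: "\<bar>s\<bar> < (r' - norm x) / (norm b + 1)"
      have xs: "x + s *\<^sub>R b \<in> S" by (rule near[OF x bE s])
      have "F (x + s *\<^sub>R b) = F x" using xs x S(2) by (intro Fb) auto
      moreover have "(x + s *\<^sub>R b) \<bullet> b = x \<bullet> b + s" by (simp add: inner_add_left bb)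
      moreover have "\<gamma> (x \<bullet> b) \<in> carrier G" "\<gamma> (x \<bullet> b + s) \<in> carrier G" "F x \<in> carrier G"
        using gc[OF xl] gc[of "x \<bullet> b + s"] lI[OF xs] Fc[OF x] by (auto simp: inner_add_left bb)
      moreover from this have "inv (F x) \<otimes> (F x \<otimes> \<gamma> (x \<bullet> b + s)) = \<gamma> (x \<bullet> b + s)"
        by (simp add: m_assoc[symmetric])
      ultimately show "inv (h x) \<otimes> h (x + s *\<^sub>R b) = inv (\<gamma> (x \<bullet> b)) \<otimes> \<gamma> (x \<bullet> b + s *\<^sub>R 1)"
        by (simp add: h_def inv_mult_group m_assoc)
    qed
    then show ?thesis using glog[OF xl] by simp
  qed
  \<comment> \<open>On the hyperplane orthogonal to b the factor \<gamma> is the identity, so h and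
    F agree along it.\<close>
  have hperp: "logd E h x v = logd E F x v" if x: "x \<in> S" "x \<bullet> b = 0" and v: "v \<in> E" "v \<bullet> b = 0" for x v
  proof (rule logd_line[OF S(1) h x(1) v(1) S(1) F' x(1) v(1) dpos[OF x(1), of v]])
    fix s :: real assume s: "\<bar>s\<bar> < (r' - norm x) / (norm v + 1)"
    have "x + s *\<^sub>R v \<in> S" by (rule near[OF x(1) v(1) s])
    moreover have "(x + s *\<^sub>R v) \<bullet> b = 0" using x v by (simp add: inner_add_left)
    ultimately show "inv (h x) \<otimes> h (x + s *\<^sub>R v) = inv (F x) \<otimes> F (x + s *\<^sub>R v)"
      using Fc x by (simp add: h_def g0)
  qed
  have hsplit: "logd E h x v = logd E F x (v - (v \<bullet> b) *\<^sub>R b) + (v \<bullet> b) *\<^sub>R b"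
    if x: "x \<in> S" "x \<bullet> b = 0" and v: "v \<in> E" for x v
  proof -
    note lin = logd_linear[OF S(1) h x(1)]
    have vE: "v - (v \<bullet> b) *\<^sub>R b \<in> E" using v bE subE by (auto intro: subspace_diff subspace_scale)
    have "logd E h x ((v - (v \<bullet> b) *\<^sub>R b) + (v \<bullet> b) *\<^sub>R b) = logd E h x (v - (v \<bullet> b) *\<^sub>R b) + (v \<bullet> b) *\<^sub>R logd E h x b"
      by (simp only: linear_add[OF lin] linear_scale[OF lin])
    also have "logd E h x (v - (v \<bullet> b) *\<^sub>R b) = logd E F x (v - (v \<bullet> b) *\<^sub>R b)"
      by (rule hperp[OF x vE]) (simp add: inner_diff_left bb)
    finally show ?thesis by (simp add: hb[OF x(1)])
  qed
  have qadd: "q (x + y) = q x + q y" and qdiff: "q (x - y) = q x - q y" and qscale: "q (c *\<^sub>R x) = c *\<^sub>R q x" and qneg: "q (- x) = - q x" for x y c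
    using linear_add[OF bounded_linear.linear[OF q(1)]] linear_diff[OF bounded_linear.linear[OF q(1)]]
      linear_scale[OF bounded_linear.linear[OF q(1)]] linear_neg[OF bounded_linear.linear[OF q(1)]] by auto
  have qE: "q x \<in> E" if "x \<in> E" for x
    using subspace_diff[OF subE that subsetD[OF E0(2) q(3)[OF that]]] by simp
  have qE0: "x \<in> E0" if "x \<in> E" "q x = 0" for x using q(3)[OF that(1)] that(2) by simp
  \<comment> \<open>A bound for the operator m \<mapsto> q (cbr b m) on E, the growth constant of
    the differential equation below.\<close>
  obtain K where K: "\<And>m. m \<in> E \<Longrightarrow> norm (q (cbr b m)) \<le> K * norm m"
  proof -
    obtain B where B: "finite B" "B \<subseteq> E" "\<And>v. v \<in> E \<Longrightarrow> (\<Sum>b\<in>B. (v \<bullet> b) *\<^sub>R b) = v"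
      using orthonormal_expansion[OF subE] by blast
    have "norm (q (cbr b m)) \<le> (\<Sum>e\<in>B. norm e * norm (q (cbr b e))) * norm m" if m: "m \<in> E" for m
    proof -
      have "cbr b m = (\<Sum>e\<in>B. (m \<bullet> e) *\<^sub>R cbr b e)"
        using linear_on_expansion[OF subE cadd[OF bE] cscale[OF bE] B(1,2), of "\<lambda>e. m \<bullet> e"] B(3)[OF m] by simp
      then have "q (cbr b m) = (\<Sum>e\<in>B. (m \<bullet> e) *\<^sub>R q (cbr b e))"
        by (simp add: linear_sum[OF bounded_linear.linear[OF q(1)]] qscale)
      also have "norm \<dots> \<le> (\<Sum>e\<in>B. norm ((m \<bullet> e) *\<^sub>R q (cbr b e)))" by (rule norm_sum)
      also have "\<dots> \<le> (\<Sum>e\<in>B. (norm m * norm e) * norm (q (cbr b e)))"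
        unfolding norm_scaleR by (intro sum_mono mult_right_mono Cauchy_Schwarz_ineq2) auto
      also have "\<dots> = (\<Sum>e\<in>B. norm e * norm (q (cbr b e))) * norm m"
        by (simp add: sum_distrib_left mult_ac)
      finally show ?thesis .
    qed
    then show thesis by (rule that)
  qed
  have hE0: "logd E h x v \<in> E0" if x: "x \<in> S" and v: "v \<in> E0" for x v
  proof -
    have vE: "v \<in> E" using v E0 by blast
    \<comment> \<open>The point x is reached from its projection x0 to the hyperplane along b or -
      b. The sign \<sigma> and the length T make the time run upwards from 0, as
      \<open>linear_growth_zero\<close> requires.\<close>
    define x0 where "x0 = x - (x \<bullet> b) *\<^sub>R b"
    define \<sigma> where "\<sigma> = sgn (x \<bullet> b)"
    define T where "T = \<bar>x \<bullet> b\<bar>"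
    have x0b: "x0 \<bullet> b = 0" by (simp add: x0_def inner_diff_left bb)
    have xE: "x \<in> E" using x by (simp add: S_def)
    have x0E: "x0 \<in> E" using xE bE subE by (auto simp: x0_def intro: subspace_diff subspace_scale)
    have sbE: "\<sigma> *\<^sub>R b \<in> E" using bE subE by (auto intro: subspace_scale)
    have nrm: "(norm (x0 + c *\<^sub>R b))\<^sup>2 = (norm x0)\<^sup>2 + c\<^sup>2" for c
      unfolding power2_norm_eq_inner using x0b bb
      by (simp add: inner_add_left inner_add_right inner_commute power2_eq_square)
    have sT: "\<sigma> * T = x \<bullet> b" by (simp add: \<sigma>_def T_def sgn_mult_abs)
    have xx: "x0 + (x \<bullet> b) *\<^sub>R b = x" by (simp add: x0_def)
    have nx: "(norm x)\<^sup>2 = (norm x0)\<^sup>2 + (x \<bullet> b)\<^sup>2" using nrm[of "x \<bullet> b"] unfolding xx .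
    \<comment> \<open>Along the path the component x0 is fixed and the component along b is no
      larger than that of x, so by Pythagoras the path does not leave the ball.\<close>
    have inS: "x0 + t *\<^sub>R (\<sigma> *\<^sub>R b) \<in> S" if t: "0 \<le> t" "t \<le> T" for t
    proof -
      have "(t * \<sigma>)\<^sup>2 \<le> (x \<bullet> b)\<^sup>2"
      proof -
        have "\<bar>\<sigma>\<bar> \<le> 1" by (simp add: \<sigma>_def abs_sgn_eq)
        then have "\<bar>t * \<sigma>\<bar> \<le> t * 1" unfolding abs_mult using t by (intro mult_mono) auto
        also have "\<dots> \<le> \<bar>x \<bullet> b\<bar>" using t by (simp add: T_def)
        finally show ?thesis by (simp add: abs_le_square_iff)
      qed
      then have "(norm (x0 + (t * \<sigma>) *\<^sub>R b))\<^sup>2 \<le> (norm x)\<^sup>2" using nrm[of "t * \<sigma>"] nx by linarith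
      then have "norm (x0 + (t * \<sigma>) *\<^sub>R b) \<le> norm x" by (rule power2_le_imp_le) simp
      moreover have "x0 + t *\<^sub>R (\<sigma> *\<^sub>R b) \<in> E"
        by (intro subspace_add[OF subE] subspace_scale[OF subE] x0E bE)
      ultimately show ?thesis using x by (simp add: S_def)
    qed
    define f where "f t = q (logd E h (x0 + t *\<^sub>R (\<sigma> *\<^sub>R b)) v)" for t
    define f' where "f' t = deriv_in E (\<lambda>z. q (logd E h z v)) (x0 + t *\<^sub>R (\<sigma> *\<^sub>R b)) (\<sigma> *\<^sub>R b)" for t
    have "f T = 0"
    proof (rule linear_growth_zero[where f=f and f'=f' and K=K])
      show "0 \<le> T" by (simp add: T_def)
      have x0S: "x0 \<in> S" using inS[of 0] \<open>0 \<le> T\<close> by simp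
      have "v - (v \<bullet> b) *\<^sub>R b \<in> E0" using v b(1) E0(1) by (auto intro: subspace_diff subspace_scale)
      then have "logd E F x0 (v - (v \<bullet> b) *\<^sub>R b) + (v \<bullet> b) *\<^sub>R b \<in> E0"
        using FE0[of x0] x0S S(2) b(1) E0(1) by (blast intro: subspace_add subspace_scale)
      then show "f 0 = 0" using hsplit[OF x0S x0b vE] q(2) by (simp add: f_def)
      fix t assume t: "0 \<le> t" "t \<le> T"
      define z where "z = x0 + t *\<^sub>R (\<sigma> *\<^sub>R b)"
      have zS: "z \<in> S" unfolding z_def by (rule inS[OF t])
      have sml: "smooth_in E (\<lambda>z. logd E h z v) S" by (rule smooth_logd[OF S(1) h vE])
      have dl: "((\<lambda>z. logd E h z v) has_derivative deriv_in E (\<lambda>z. logd E h z v) z) (at z within E)"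
        by (rule smooth_in_has_deriv[OF sml zS])
      have dq: "((\<lambda>z. q (logd E h z v)) has_derivative (\<lambda>w. q (deriv_in E (\<lambda>z. logd E h z v) z w))) (at z within E)"
        by (rule bounded_linear.has_derivative[OF q(1) dl])
      then have "(\<lambda>z. q (logd E h z v)) differentiable at z within E" unfolding differentiable_def by blast
      then show "(f has_vector_derivative f' t) (at t)"
        unfolding f_def f'_def z_def by (rule has_vector_derivative_line[OF subE x0E sbE])
      have zE: "z \<in> E" using zS by (simp add: S_def)
      define \<beta> where "\<beta> = logd E h z v"
      have \<beta>E: "\<beta> \<in> E" unfolding \<beta>_def by (rule logd_in_model[OF S(1) h zS vE])
      \<comment> \<open>Since the logarithmic derivative along b is the constant b, one of the two
        derivatives in the structure equation vanishes. What remains is the linear equation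
        \<open>Db\<close> for the change of \<beta> along b.\<close>
      have "deriv_in E (\<lambda>z. logd E h z b) z v = deriv_in E (\<lambda>z. b) z v"
        by (rule deriv_in_cong[OF S(1) zS hb])
      also have "\<dots> = 0" by (rule deriv_in_eq[OF subE zE vE has_derivative_const])
      finally have Db: "deriv_in E (\<lambda>z. logd E h z v) z b = - cbr b \<beta>"
        using structure_equation[OF S(1) h zS bE vE] hb[OF zS] by (simp add: \<beta>_def)
      \<comment> \<open>The bracket with b preserves E0, on which q vanishes, so the equation
        descends to a linear one for q \<beta> alone.\<close>
      have "cbr b \<beta> = cbr b (q \<beta>) + cbr b (\<beta> - q \<beta>)"
        using cadd[OF bE qE[OF \<beta>E], of "\<beta> - q \<beta>"] q(3)[OF \<beta>E] E0(2) by auto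
      then have qc: "q (cbr b \<beta>) = q (cbr b (q \<beta>))"
        using q(2)[OF cl[OF b(1) q(3)[OF \<beta>E]]] by (simp add: qadd)
      have "f' t = q (deriv_in E (\<lambda>z. logd E h z v) z (\<sigma> *\<^sub>R b))"
        unfolding f'_def z_def[symmetric] by (rule deriv_in_eq[OF subE zE sbE dq])
      also have "deriv_in E (\<lambda>z. logd E h z v) z (\<sigma> *\<^sub>R b) = \<sigma> *\<^sub>R (- cbr b \<beta>)"
        by (simp add: linear_scale[OF deriv_in_linear[OF smooth_in_differentiable[OF sml zS]]] Db)
      finally have "f' t = - (\<sigma> *\<^sub>R q (cbr b (q \<beta>)))" by (simp add: qneg qscale qc)
      then have "norm (f' t) = \<bar>\<sigma>\<bar> * norm (q (cbr b (q \<beta>)))" by simp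
      also have "\<dots> \<le> 1 * norm (q (cbr b (q \<beta>)))"
        by (intro mult_right_mono) (auto simp: \<sigma>_def abs_sgn_eq)
      also have "\<dots> \<le> K * norm (q \<beta>)" using K[OF qE[OF \<beta>E]] by simp
      finally show "norm (f' t) \<le> K * norm (f t)" by (simp add: f_def \<beta>_def z_def)
    qed
    then have "q (logd E h x v) = 0"
      using xx sT by (simp add: f_def mult.commute)
    then show ?thesis using qE0[OF logd_in_model[OF S(1) h x vE]] by blast
  qed
  show thesis
  proof (rule that[of r' \<gamma>, OF r'(1,2) _ g0])
    show "smooth_map (flat E (E \<inter> ball 0 r')) MG (\<lambda>x. F x \<otimes> \<gamma> (x \<bullet> b))"
      using h by (simp add: h_def[abs_def] S_def)
    show "logd E (\<lambda>x. F x \<otimes> \<gamma> (x \<bullet> b)) 0 v = logd E F 0 (v - (v \<bullet> b) *\<^sub>R b) + (v \<bullet> b) *\<^sub>R b" if "v \<in> E" for v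
      using hsplit[OF S(3) _ that] by (simp add: h_def[abs_def])
    show "logd E (\<lambda>x. F x \<otimes> \<gamma> (x \<bullet> b)) x v \<in> E0" if "x \<in> E \<inter> ball 0 r'" "v \<in> E0" for x v
      using hE0[of x v] that by (simp add: h_def[abs_def] S_def)
  qed
qed


text \<open>The factors are multiplied on for one vector of an orthonormal basis of E0 after
  another. At the origin q and the components along the basis add up to the identity; elsewhere the
  invariance of E0 is what is recorded.\<close>

lemma leaf_chart:
  assumes E0: "subspace E0" "E0 \<subseteq> E"
    and cl: "\<And>u v. u \<in> E0 \<Longrightarrow> v \<in> E0 \<Longrightarrow> cbr u v \<in> E0"
    and cadd: "\<And>u v w. u \<in> E \<Longrightarrow> v \<in> E \<Longrightarrow> w \<in> E \<Longrightarrow> cbr u (v + w) = cbr u v + cbr u w"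
    and cscale: "\<And>r u v. u \<in> E \<Longrightarrow> v \<in> E \<Longrightarrow> cbr u (r *\<^sub>R v) = r *\<^sub>R cbr u v"
  obtains r F where "r > 0" "smooth_map (flat E (E \<inter> ball 0 r)) MG F"
    "\<And>v. v \<in> E \<Longrightarrow> logd E F 0 v = v"
    "\<And>x v. x \<in> E \<inter> ball 0 r \<Longrightarrow> v \<in> E0 \<Longrightarrow> logd E F x v \<in> E0"
proof -
  obtain B where B: "B \<subseteq> E0" "pairwise orthogonal B" "\<And>x. x \<in> B \<Longrightarrow> norm x = 1"
      "independent B" "span B = E0"
    using orthonormal_basis_subspace[OF E0(1)] by metis
  have fin: "finite B" using B(4) by (rule independent_imp_finite)
  have bb: "b \<bullet> b' = (if b = b' then 1 else 0)" if "b \<in> B" "b' \<in> B" for b b'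
    using B(2) B(3)[OF that(1)] that by (auto simp: norm_eq_1 pairwise_def orthogonal_def)
  define q where "q x = x - (\<Sum>b\<in>B. (x \<bullet> b) *\<^sub>R b)" for x
  have bq: "bounded_linear q"
    unfolding q_def by (intro bounded_linear_sub bounded_linear_ident bounded_linear_sum
        bounded_linear_scaleR_const bounded_linear_inner_left)
  have sE0: "(\<Sum>b\<in>B. c b *\<^sub>R b) \<in> E0" for c
    using B(1) E0(1) by (intro subspace_sum subspace_scale) auto
  have q0: "q x = 0" if "x \<in> E0" for x
    using orthonormal_basis_expand[of B x] B that fin by (simp add: q_def inner_commute)
  have q1: "x - q x \<in> E0" for x by (simp add: q_def sE0)
  have qE: "q x \<in> E" if "x \<in> E" for x
    using subspace_diff[OF subE that subsetD[OF E0(2) q1[of x]]] by simp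
  have qsub: "q (x - c *\<^sub>R b) = q x" if "b \<in> B" for x c b
    using that B(1) q0[of b] linear_diff[OF bounded_linear.linear[OF bq]] linear_scale[OF bounded_linear.linear[OF bq]] by auto
  \<comment> \<open>The constancy of F in the directions outside B' is what the next step consumes.
    It survives a step because the new factor depends only on the component along b, and B is
    orthogonal.\<close>
  define good where "good B' r F \<longleftrightarrow> r > 0 \<and> smooth_map (flat E (E \<inter> ball 0 r)) MG F \<and> F 0 = \<one> \<and>
      (\<forall>v\<in>E. logd E F 0 v = q v + (\<Sum>b\<in>B'. (v \<bullet> b) *\<^sub>R b)) \<and>
      (\<forall>b\<in>B - B'. \<forall>x s. x \<in> E \<inter> ball 0 r \<longrightarrow> x + s *\<^sub>R b \<in> ball 0 r \<longrightarrow> F (x + s *\<^sub>R b) = F x) \<and>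
      (\<forall>x\<in>E \<inter> ball 0 r. \<forall>v\<in>E0. logd E F x v \<in> E0)" for B' r F
  have "\<exists>r F. good B' r F" if "finite B'" "B' \<subseteq> B" for B'
    using that
  proof (induction B' rule: finite_induct)
    case empty
    obtain r F where r: "r > 0" and F: "smooth_map (flat E (E \<inter> ball 0 r)) MG F" "F 0 = \<one>"
      and log: "\<And>v. v \<in> E \<Longrightarrow> logd E F 0 v = q v" and inv: "\<And>x v. q v = 0 \<Longrightarrow> F (x + v) = F x"
      by (rule leaf_chart_base[OF bq qE]) (assumption, rule that)
    have S: "rel_open E (E \<inter> ball 0 r)" by (rule rel_open_ball[OF subE])
    have qs: "q (s *\<^sub>R v) = 0" if "v \<in> E0" for s v using that E0(1) by (intro q0 subspace_scale)
    have "logd E F x v \<in> E0" if x: "x \<in> E \<inter> ball 0 r" and v: "v \<in> E0" for x v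
    proof -
      have vE: "v \<in> E" using v E0 by blast
      have "logd E F x v = logd E (\<lambda>_. \<one>) x v"
      proof (rule logd_line[OF S F(1) x vE S _ x vE zero_less_one])
        show "smooth_map (flat E (E \<inter> ball 0 r)) MG (\<lambda>_. \<one>)"
          by (rule smooth_map_const[OF smooth_atlas_flat[OF S] atl]) (simp add: points_MG)
        fix s :: real
        show "inv (F x) \<otimes> F (x + s *\<^sub>R v) = inv \<one> \<otimes> \<one>"
          using inv[OF qs[OF v]] flat_in_carrier[OF F(1) x] by simp
      qed
      also have "\<dots> = 0" by (rule logd_const[OF S _ x vE]) simp
      finally show ?thesis using subspace_0[OF E0(1)] by simp
    qed
    moreover have "F (x + s *\<^sub>R b) = F x" if "b \<in> B" for x s b
      using inv[OF qs] that B(1) by blast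
    ultimately have "good {} r F" using r F log by (simp add: good_def)
    then show ?case by blast
  next
    case (insert b B')
    then obtain r F where "good B' r F" by blast
    then have r: "r > 0" and F: "smooth_map (flat E (E \<inter> ball 0 r)) MG F" "F 0 = \<one>"
      and log: "\<And>v. v \<in> E \<Longrightarrow> logd E F 0 v = q v + (\<Sum>b\<in>B'. (v \<bullet> b) *\<^sub>R b)"
      and inv: "\<And>b x s. b \<in> B - B' \<Longrightarrow> x \<in> E \<inter> ball 0 r \<Longrightarrow> x + s *\<^sub>R b \<in> ball 0 r \<Longrightarrow> F (x + s *\<^sub>R b) = F x"
      and lE0: "\<And>x v. x \<in> E \<inter> ball 0 r \<Longrightarrow> v \<in> E0 \<Longrightarrow> logd E F x v \<in> E0"
      unfolding good_def by blast+
    have b: "b \<in> B" "b \<in> B - B'" "b \<in> E0" "norm b = 1" using insert B by auto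
    have bE: "b \<in> E" using b(3) E0 by blast
    obtain r' \<gamma> where r': "0 < r'" "r' \<le> r"
      and h: "smooth_map (flat E (E \<inter> ball 0 r')) MG (\<lambda>x. F x \<otimes> \<gamma> (x \<bullet> b))" and g0: "\<gamma> 0 = \<one>"
      and hlog: "\<And>v. v \<in> E \<Longrightarrow> logd E (\<lambda>x. F x \<otimes> \<gamma> (x \<bullet> b)) 0 v = logd E F 0 (v - (v \<bullet> b) *\<^sub>R b) + (v \<bullet> b) *\<^sub>R b"
      and hE0: "\<And>x v. x \<in> E \<inter> ball 0 r' \<Longrightarrow> v \<in> E0 \<Longrightarrow> logd E (\<lambda>x. F x \<otimes> \<gamma> (x \<bullet> b)) x v \<in> E0"
      by (rule leaf_chart_step[OF E0 bq q0 q1 cl cadd cscale b(3,4) r F inv[OF b(2)] lE0]) (assumption+, rule that)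
    have "good (insert b B') r' (\<lambda>x. F x \<otimes> \<gamma> (x \<bullet> b))"
      unfolding good_def
    proof (intro conjI ballI allI impI)
      show "0 < r'" by (rule r')
      show "smooth_map (flat E (E \<inter> ball 0 r')) MG (\<lambda>x. F x \<otimes> \<gamma> (x \<bullet> b))" by (rule h)
      show "F 0 \<otimes> \<gamma> (0 \<bullet> b) = \<one>" by (simp add: F(2) g0)
      show "logd E (\<lambda>x. F x \<otimes> \<gamma> (x \<bullet> b)) x v \<in> E0" if "x \<in> E \<inter> ball 0 r'" "v \<in> E0" for x v
        using hE0 that by blast
      show "F (x + s *\<^sub>R c) \<otimes> \<gamma> ((x + s *\<^sub>R c) \<bullet> b) = F x \<otimes> \<gamma> (x \<bullet> b)"
        if c: "c \<in> B - insert b B'" and x: "x \<in> E \<inter> ball 0 r'" "x + s *\<^sub>R c \<in> ball 0 r'" for c x s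
      proof -
        have "F (x + s *\<^sub>R c) = F x" using c x r'(2) by (intro inv) auto
        moreover have "c \<bullet> b = 0" using bb[of c b] c b(1) by auto
        ultimately show ?thesis by (simp add: inner_add_left)
      qed
      show "logd E (\<lambda>x. F x \<otimes> \<gamma> (x \<bullet> b)) 0 v = q v + (\<Sum>b\<in>insert b B'. (v \<bullet> b) *\<^sub>R b)" if v: "v \<in> E" for v
      proof -
        have vE: "v - (v \<bullet> b) *\<^sub>R b \<in> E" using v bE subE by (auto intro: subspace_diff subspace_scale)
        have "(v - (v \<bullet> b) *\<^sub>R b) \<bullet> c = v \<bullet> c" if "c \<in> B'" for c
        proof -
          have "b \<bullet> c = 0" using bb[of b c] b(1) that insert.hyps insert.prems by auto
          then show ?thesis by (simp add: inner_diff_left)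
        qed
        then show ?thesis
          unfolding hlog[OF v] log[OF vE] qsub[OF b(1)] using insert.hyps by simp
      qed
    qed
    then show ?case by blast
  qed
  from this[OF fin order_refl] obtain r F where "good B r F" by blast
  then show thesis
    by (intro that[of r F]) (auto simp: good_def q_def)
qed

text \<open>A left translation brings the chart to g without changing logarithmic derivatives, and
  the inverse function theorem makes it a diffeomorphism near 0. The domain is a ball so that its
  slices in the directions of E0 are convex.\<close>

lemma foliated_chart:
  assumes E0: "subspace E0" "E0 \<subseteq> E"
    and cl: "\<And>u v. u \<in> E0 \<Longrightarrow> v \<in> E0 \<Longrightarrow> cbr u v \<in> E0"
    and cadd: "\<And>u v w. u \<in> E \<Longrightarrow> v \<in> E \<Longrightarrow> w \<in> E \<Longrightarrow> cbr u (v + w) = cbr u v + cbr u w"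
    and cscale: "\<And>r u v. u \<in> E \<Longrightarrow> v \<in> E \<Longrightarrow> cbr u (r *\<^sub>R v) = r *\<^sub>R cbr u v"
    and g: "g \<in> carrier G"
  obtains r \<Phi> \<Psi> U where "r > 0" "openin (mtop MG) U" "g \<in> U"
    "smooth_map (flat E (E \<inter> ball 0 r)) (open_submanifold MG U) \<Phi>"
    "smooth_map (open_submanifold MG U) (flat E (E \<inter> ball 0 r)) \<Psi>"
    "\<And>x. x \<in> E \<inter> ball 0 r \<Longrightarrow> \<Psi> (\<Phi> x) = x" "\<And>p. p \<in> U \<Longrightarrow> \<Phi> (\<Psi> p) = p"
    "\<And>x v. x \<in> E \<inter> ball 0 r \<Longrightarrow> v \<in> E \<Longrightarrow> logd E \<Phi> x v \<in> E0 \<longleftrightarrow> v \<in> E0"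
    "\<And>x v. x \<in> E \<inter> ball 0 r \<Longrightarrow> v \<in> E \<Longrightarrow> logd E \<Phi> x v = 0 \<Longrightarrow> v = 0"
proof -
  obtain r0 F where r0: "r0 > 0" and F: "smooth_map (flat E (E \<inter> ball 0 r0)) MG F"
    and log0: "\<And>v. v \<in> E \<Longrightarrow> logd E F 0 v = v"
    and lE0: "\<And>x v. x \<in> E \<inter> ball 0 r0 \<Longrightarrow> v \<in> E0 \<Longrightarrow> logd E F x v \<in> E0"
    by (rule leaf_chart[OF E0 cl cadd cscale]) (assumption+, rule that)
  define S0 where "S0 = E \<inter> ball 0 r0"
  have S0: "rel_open E S0" "0 \<in> S0" using rel_open_ball[OF subE] r0 subspace_0[OF subE] by (auto simp: S0_def)
  have F': "smooth_map (flat E S0) MG F" using F by (simp add: S0_def)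
  define a where "a = g \<otimes> inv (F 0)"
  have Fc: "F 0 \<in> carrier G" by (rule flat_in_carrier[OF F' S0(2)])
  have a: "a \<in> carrier G" using g Fc by (simp add: a_def)
  define \<Phi> where "\<Phi> x = a \<otimes> F x" for x
  have \<Phi>0: "\<Phi> 0 = g" using g Fc by (simp add: \<Phi>_def a_def m_assoc)
  have \<Phi>: "smooth_map (flat E S0) MG \<Phi>" unfolding \<Phi>_def by (rule smooth_lmult[OF smooth_atlas_flat[OF S0(1)] F' a])
  have log\<Phi>: "logd E \<Phi> x v = logd E F x v" if "x \<in> S0" for x v
    unfolding \<Phi>_def by (rule logd_lmult[OF S0(1) F' that a])
  define d where "d = some_chart MG g"
  have dg: "d \<in> charts_at MG g" unfolding d_def by (rule some_chart_in[OF atl]) (simp add: points_MG g)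
  note dD = charts_atD[OF dg]
  define S1 where "S1 = {x \<in> S0. \<Phi> x \<in> fst d}"
  define f where "f x = snd d (\<Phi> x)" for x
  have S1: "rel_open E S1" and f: "smooth_in E f S1"
    using smooth_map_from_flatD[OF atl S0(1) \<Phi> dD(1)] by (simp_all add: S1_def f_def[abs_def])
  have S1_0: "0 \<in> S1" using S0(2) dD(2) by (simp add: S1_def \<Phi>0)
  have fE: "f ` S1 \<subseteq> E" using chart_in_model[OF atl dD(1)] by (auto simp: f_def S1_def)
  have df: "deriv_in E f x v = lfield (logd E \<Phi> x v) (\<Phi> x) d" if "x \<in> S1" "v \<in> E" for x v
    unfolding f_def
    by (rule deriv_chart_logd[OF S0(1) \<Phi> _ that(2)]) (use that(1) dD(1) in \<open>simp_all add: S1_def charts_at_def\<close>)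
  \<comment> \<open>The left invariant field of the vector 0 vanishes; this is read off from the
    derivative of a constant map.\<close>
  have l0: "lfield 0 p d = 0" if "d \<in> charts_at MG p" "p \<in> carrier G" for p
  proof -
    have "logd E (\<lambda>_. p) 0 0 = 0" by (rule logd_const[OF S0(1) that(2) S0(2) subspace_0[OF subE]])
    then have "lfield 0 p d = deriv_in E (\<lambda>z. snd d p) 0 0"
      using deriv_chart_logd[OF S0(1) smooth_map_const[OF smooth_atlas_flat[OF S0(1)] atl] S0(2) subspace_0[OF subE] that(1)] that(2)
      by (simp add: points_MG)
    also have "\<dots> = 0" by (rule deriv_in_eq[OF subE subspace_0[OF subE] subspace_0[OF subE] has_derivative_const])
    finally show ?thesis .
  qed
  have inj0: "v = 0" if v: "v \<in> E" "deriv_in E f 0 v = 0" for v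
  proof -
    have "lfield v g d = lfield 0 g d"
      using df[OF S1_0 v(1)] v(2) log\<Phi>[OF S0(2)] log0[OF v(1)] l0[OF dg g] by (simp add: \<Phi>0)
    then show ?thesis by (rule lfield_inj_chart[OF g v(1) subspace_0[OF subE] dg])
  qed
  obtain S2 H where S2: "rel_open E S2" "0 \<in> S2" "S2 \<subseteq> S1" "rel_open E (f ` S2)"
    and H: "smooth_in E H (f ` S2)" "\<And>x. x \<in> S2 \<Longrightarrow> H (f x) = x"
    and injf: "\<And>x v. x \<in> S2 \<Longrightarrow> v \<in> E \<Longrightarrow> deriv_in E f x v = 0 \<Longrightarrow> v = 0"
    by (rule smooth_in_inverse[OF S1 f fE S1_0 inj0]) (assumption+, rule that)
  obtain r where r: "r > 0" "E \<inter> ball 0 r \<subseteq> S2" using rel_open_ballE[OF S2(1,2)] by blast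
  define S where "S = E \<inter> ball 0 r"
  have S: "rel_open E S" "0 \<in> S" "S \<subseteq> S2" "S \<subseteq> S1" "S \<subseteq> S0"
    using rel_open_ball[OF subE] r subspace_0[OF subE] S2(3) by (auto simp: S_def S1_def)
  \<comment> \<open>Written as a preimage under H, the image of the smaller ball is seen to be
    open.\<close>
  have HfS: "f ` S = {y \<in> f ` S2. H y \<in> S}" using H(2) S(3) by force
  have fS: "rel_open E (f ` S)"
    unfolding HfS
  proof (rule rel_open_preimage[OF S2(4) smooth_in_continuous[OF H(1)] rel_openD(2)[OF S(1)]])
    show "H ` (f ` S2) \<subseteq> E" using H(2) rel_openD(3)[OF S2(1)] by auto
  qed
  define U where "U = \<Phi> ` S"
  have Ud: "U \<subseteq> fst d" using S(4) by (auto simp: U_def S1_def)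
  have "U = {p \<in> fst d. snd d p \<in> f ` S}"
  proof
    show "U \<subseteq> {p \<in> fst d. snd d p \<in> f ` S}" using Ud by (auto simp: U_def f_def)
    show "{p \<in> fst d. snd d p \<in> f ` S} \<subseteq> U"
    proof
      fix p assume "p \<in> {p \<in> fst d. snd d p \<in> f ` S}"
      then obtain x where x: "p \<in> fst d" "x \<in> S" "snd d p = snd d (\<Phi> x)" by (auto simp: f_def)
      have "\<Phi> x \<in> fst d" using x(2) S(4) by (auto simp: S1_def)
      then have "p = \<Phi> x" using inj_onD[OF chart_inj[OF atl dD(1)] x(3,1)] by blast
      then show "p \<in> U" using x(2) by (simp add: U_def)
    qed
  qed
  then have Uo: "openin (mtop MG) U"
    using chart_preimage_openin[OF atl dD(1) rel_openD(2)[OF fS]] by simp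
  note atU = smooth_atlas_open_submanifold[OF atl Uo]
  have ptU: "points (open_submanifold MG U) = U" using openin_subset[OF Uo] by auto
  define \<Psi> where "\<Psi> p = H (snd d p)" for p
  have \<Psi>\<Phi>: "\<Psi> (\<Phi> x) = x" if "x \<in> S" for x using H(2)[of x] that S(3) by (auto simp: \<Psi>_def f_def)
  have \<Phi>\<Psi>: "\<Phi> (\<Psi> p) = p" if "p \<in> U" for p using that \<Psi>\<Phi> by (auto simp: U_def)
  have \<Phi>S: "smooth_map (flat E S) MG \<Phi>" by (rule restrict_flat[OF S0(1) S(1,5) \<Phi>])
  have sm\<Phi>: "smooth_map (flat E S) (open_submanifold MG U) \<Phi>"
    by (rule smooth_map_into_open_submanifold[OF atl smooth_atlas_flat[OF S(1)] Uo \<Phi>S]) (simp add: U_def)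
  have sm\<Psi>: "smooth_map (open_submanifold MG U) (flat E S) \<Psi>"
  proof (rule smooth_map_flatI[OF atU S(1)])
    show "\<Psi> p \<in> S" if "p \<in> points (open_submanifold MG U)" for p
      using that \<Psi>\<Phi> unfolding ptU by (auto simp: U_def)
    fix e' assume "e' \<in> atlas (open_submanifold MG U)"
    then obtain e where e': "e' = (fst e \<inter> U, snd e)" and e: "e \<in> atlas MG" by auto
    have ro: "rel_open E (snd e ` (fst e \<inter> U))" by (rule chart_image_rel_open[OF atl e Uo])
    have tr: "smooth_in E (\<lambda>y. snd d (chart_inv e y)) (snd e ` (fst e \<inter> U))"
    proof (rule smooth_in_subset)
      show "smooth_in E (\<lambda>y. snd d (chart_inv e y)) (snd e ` {x \<in> fst e. x \<in> fst d})"
        by (rule smooth_map_dom(2)[OF smooth_map_id[OF atl] atl atl e dD(1)])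
      show "snd e ` (fst e \<inter> U) \<subseteq> snd e ` {x \<in> fst e. x \<in> fst d}" using Ud by auto
    qed
    have ci: "chart_inv e y \<in> fst e \<inter> U" if "y \<in> snd e ` (fst e \<inter> U)" for y
      by (rule chart_inv_in[OF that _ atl e]) simp
    have im: "(\<lambda>y. snd d (chart_inv e y)) ` (snd e ` (fst e \<inter> U)) \<subseteq> f ` S"
    proof (rule image_subsetI)
      fix y assume "y \<in> snd e ` (fst e \<inter> U)"
      from ci[OF this] obtain x where "x \<in> S" "chart_inv e y = \<Phi> x" by (auto simp: U_def)
      then show "snd d (chart_inv e y) \<in> f ` S" by (auto simp: f_def)
    qed
    have HS: "smooth_in E H (f ` S)" using smooth_in_subset[OF H(1)] S(3) by blast
    have sm: "smooth_in E (\<lambda>y. \<Psi> (chart_inv e y)) (snd e ` (fst e \<inter> U))"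
      unfolding \<Psi>_def by (rule smooth_in_compose[OF ro fS im tr HS])
    have "smooth_in E (\<lambda>y. \<Psi> (chart_inv (fst e \<inter> U, snd e) y)) (snd e ` (fst e \<inter> U))"
      by (rule smooth_in_congI[OF ro sm]) (simp add: chart_inv_restrict[OF atl e])
    then show "smooth_in (model (open_submanifold MG U)) (\<lambda>y. \<Psi> (chart_inv e' y)) (snd e' ` fst e')"
      by (simp add: e')
  qed
  have inj: "v = 0" if x: "x \<in> S" and v: "v \<in> E" and z: "logd E \<Phi> x v = 0" for x v
  proof -
    have xx: "x \<in> S1" "x \<in> S2" using x S by auto
    have "d \<in> charts_at MG (\<Phi> x)" using xx(1) dD(1) by (simp add: S1_def charts_at_def)
    then have "deriv_in E f x v = 0"
      using df[OF xx(1) v] l0 flat_in_carrier[OF \<Phi>S x] by (simp add: z)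
    then show ?thesis by (rule injf[OF xx(2) v])
  qed
  \<comment> \<open>One direction is the leaf property. For the other, the logarithmic derivative
    maps E0 injectively into E0, hence onto E0 by dimension, and it is injective on E.\<close>
  have iff: "logd E \<Phi> x v \<in> E0 \<longleftrightarrow> v \<in> E0" if x: "x \<in> S" and v: "v \<in> E" for x v
  proof
    have xS0: "x \<in> S0" using x S(5) by blast
    have into: "logd E \<Phi> x w \<in> E0" if "w \<in> E0" for w
      using lE0[of x w] xS0 that log\<Phi>[OF xS0] by (simp add: S0_def)
    then show "v \<in> E0 \<Longrightarrow> logd E \<Phi> x v \<in> E0" .
    assume l: "logd E \<Phi> x v \<in> E0"
    note lin = logd_linear[OF S(1) \<Phi>S x]
    have injE0: "inj_on (logd E \<Phi> x) (span E0)"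
    proof (rule inj_onI)
      fix s t assume "s \<in> span E0" "t \<in> span E0" and eq: "logd E \<Phi> x s = logd E \<Phi> x t"
      moreover have "span E0 = E0" using E0(1) span_eq_iff by blast
      ultimately have "s \<in> E" "t \<in> E" using E0(2) by auto
      then have "s - t \<in> E" using subE subspace_diff by blast
      moreover have "logd E \<Phi> x (s - t) = 0" using eq by (simp add: linear_diff[OF lin])
      ultimately show "s = t" using inj[OF x] by force
    qed
    have sub: "logd E \<Phi> x ` E0 \<subseteq> E0" using into by blast
    have "dim (logd E \<Phi> x ` E0) = dim E0" by (rule dim_image_eq[OF lin injE0])
    then have "logd E \<Phi> x ` E0 = E0"
      using subspace_dim_equal[OF linear_subspace_image[OF lin E0(1)] E0(1) sub] by simp
    then obtain w where w: "w \<in> E0" "logd E \<Phi> x w = logd E \<Phi> x v" using l by (metis imageE)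
    have "v - w \<in> E" using v w(1) E0 subE by (auto intro: subspace_diff)
    moreover have "logd E \<Phi> x (v - w) = 0" using w(2) by (simp add: linear_diff[OF lin])
    ultimately have "v - w = 0" by (rule inj[OF x])
    then show "v \<in> E0" using w(1) by simp
  qed
  have "g \<in> U" using S(2) \<Phi>0 by (force simp: U_def)
  then show thesis
    using that[OF r(1) Uo _ sm\<Phi>[unfolded S_def] sm\<Psi>[unfolded S_def]] \<Psi>\<Phi> \<Phi>\<Psi> iff inj by (simp add: S_def)
qed

end

section \<open>The spaces \<open>W\<^sub>k\<^sup>0\<close> and their endomorphisms\<close>

locale jet =
  fixes k :: nat and V :: "int \<Rightarrow> 'w::euclidean_space set" and app :: "'w \<Rightarrow> 'w \<Rightarrow> 'w"
  assumes jet_space: "jet_space k V app"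
begin

abbreviation "K \<equiv> int k"
abbreviation "I \<equiv> {-1..int k}"
abbreviation "W \<equiv> jet_carrier k V"
abbreviation "cmp \<equiv> jet_comp k V"

lemma k1: "k \<ge> 1" using jet_space by (simp add: jet_space_def)

lemma V_subspace: "p \<in> I \<Longrightarrow> subspace (V p)"
  using jet_space by (simp add: jet_space_def)

lemma V_direct:
  assumes "\<And>p. p \<in> I \<Longrightarrow> f p \<in> V p" "(\<Sum>p\<in>I. f p) = 0" "p \<in> I" shows "f p = 0"
proof -
  have "\<forall>f. (\<forall>p\<in>I. f p \<in> V p) \<and> (\<Sum>p\<in>I. f p) = 0 \<longrightarrow> (\<forall>p\<in>I. f p = 0)"
    using jet_space unfolding jet_space_def by (elim conjE)
  from spec[OF this, of f] have "\<forall>p\<in>I. f p = 0" using assms(1,2) by (elim mp) (intro conjI ballI)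
  then show ?thesis using assms(3) by (rule bspec)
qed

lemma app_linear:
  assumes "p \<in> {1..K}" "u \<in> V (-1)" "X \<in> V p"
  shows "Y \<in> V p \<Longrightarrow> app (X + Y) u = app X u + app Y u" "app (r *\<^sub>R X) u = r *\<^sub>R app X u"
proof -
  have "\<forall>p\<in>{1..K}. \<forall>u\<in>V (-1). \<forall>X\<in>V p. \<forall>Y\<in>V p. \<forall>r.
        app (X + Y) u = app X u + app Y u \<and> app (r *\<^sub>R X) u = r *\<^sub>R app X u"
    using jet_space unfolding jet_space_def by (elim conjE)
  from bspec[OF bspec[OF bspec[OF this assms(1)] assms(2)] assms(3)]
  have *: "\<forall>Y\<in>V p. \<forall>r. app (X + Y) u = app X u + app Y u \<and> app (r *\<^sub>R X) u = r *\<^sub>R app X u" .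
  show "Y \<in> V p \<Longrightarrow> app (X + Y) u = app X u + app Y u" using * by blast
  show "app (r *\<^sub>R X) u = r *\<^sub>R app X u" using * assms(3) by blast
qed

lemma app_jet_hom:
  assumes "p \<in> {1..K}" "X \<in> V p"
  shows "restrict (app X) (V (-1)) \<in> Hom_set (V (-1)) (V (p - 1))"
proof (cases "p = K")
  case True
  have "(\<lambda>X. restrict (app X) (V (-1))) ` V K \<subseteq> jet_hom V app K"
    using jet_space by (simp add: jet_space_def)
  then show ?thesis using True assms(2) by (auto simp: jet_hom_def)
next
  case False
  then have "p \<in> {1..<K}" using assms(1) by auto
  then have "bij_betw (\<lambda>X. restrict (app X) (V (-1))) (V p) (jet_hom V app p)"
    using jet_space by (simp add: jet_space_def)
  then have "restrict (app X) (V (-1)) \<in> jet_hom V app p" using assms(2) bij_betwE by blast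
  then show ?thesis by (simp add: jet_hom_def)
qed

lemma Hom_setD:
  assumes "f \<in> Hom_set A B"
  shows "u \<in> A \<Longrightarrow> f u \<in> B" "u \<in> A \<Longrightarrow> v \<in> A \<Longrightarrow> f (u + v) = f u + f v" "u \<in> A \<Longrightarrow> f (r *\<^sub>R u) = r *\<^sub>R f u"
  using assms by (auto simp: Hom_set_def)

lemma minus1_in: "-1 \<in> I" by simp

lemma app_in: "p \<in> {1..K} \<Longrightarrow> X \<in> V p \<Longrightarrow> u \<in> V (-1) \<Longrightarrow> app X u \<in> V (p - 1)"
  using Hom_setD(1)[OF app_jet_hom, of p X u] by simp

lemma app_add2: "p \<in> {1..K} \<Longrightarrow> X \<in> V p \<Longrightarrow> u \<in> V (-1) \<Longrightarrow> v \<in> V (-1) \<Longrightarrow> app X (u + v) = app X u + app X v"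
  using Hom_setD(2)[OF app_jet_hom, of p X u v] V_subspace[OF minus1_in] by (simp add: subspace_add)

lemma app_scale2: "p \<in> {1..K} \<Longrightarrow> X \<in> V p \<Longrightarrow> u \<in> V (-1) \<Longrightarrow> app X (r *\<^sub>R u) = r *\<^sub>R app X u"
  using Hom_setD(3)[OF app_jet_hom, of p X u r] V_subspace[OF minus1_in] by (simp add: subspace_scale)

lemma app_zero: "u \<in> V (-1) \<Longrightarrow> app 0 u = 0"
  using app_linear(2)[of 1 u 0 0] k1 V_subspace[of 1] by (simp add: subspace_0)

lemma app_faithful:
  assumes "X \<in> V K" "\<And>u. u \<in> V (-1) \<Longrightarrow> app X u = 0"
  shows "X = 0"
proof -
  have "inj_on (\<lambda>X. restrict (app X) (V (-1))) (V K)" using jet_space by (simp add: jet_space_def)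
  moreover have "restrict (app X) (V (-1)) = restrict (app 0) (V (-1))"
    using assms(2) app_zero by (auto simp: restrict_def fun_eq_iff)
  moreover have "0 \<in> V K" using V_subspace[of K] by (simp add: subspace_0)
  ultimately show ?thesis using assms(1) by (simp add: inj_on_def)
qed

lemma W_subspace: "subspace W" by (simp add: jet_carrier_def)

lemma V_W: "p \<in> I \<Longrightarrow> V p \<subseteq> W"
  unfolding jet_carrier_def by (meson UN_upper span_superset subset_trans)

lemma comp_exists:
  assumes "X \<in> W"
  shows "\<exists>f. (\<forall>q\<in>I. f q \<in> V q) \<and> (\<Sum>q\<in>I. f q) = X"
  using assms unfolding jet_carrier_def
proof (induction rule: span_induct_alt)
  case base
  show ?case by (intro exI[of _ "\<lambda>_. 0"]) (simp add: V_subspace subspace_0)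
next
  case (step c x y)
  then obtain f where f: "\<forall>q\<in>I. f q \<in> V q" "(\<Sum>q\<in>I. f q) = y" by blast
  obtain p where p: "p \<in> I" "x \<in> V p" using step by blast
  define g where "g q = (if q = p then c *\<^sub>R x else 0) + f q" for q
  have "\<forall>q\<in>I. g q \<in> V q"
    using f(1) p by (auto simp: g_def intro!: subspace_add[OF V_subspace] subspace_scale[OF V_subspace])
  moreover have "(\<Sum>q\<in>I. g q) = c *\<^sub>R x + y"
    unfolding g_def sum.distrib f(2) using p(1) by simp
  ultimately show ?case by blast
qed

text \<open>Directness of the sum makes the choice in \<open>jet_comp\<close> immaterial: the
  difference of two decompositions of X is a decomposition of 0.\<close>

lemma comp_unique:
  assumes "\<And>q. q \<in> I \<Longrightarrow> f q \<in> V q" "(\<Sum>q\<in>I. f q) = X" "p \<in> I"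
  shows "cmp p X = f p"
proof -
  define g where "g = (SOME f. (\<forall>q\<in>I. f q \<in> V q) \<and> (\<Sum>q\<in>I. f q) = X)"
  have g: "(\<forall>q\<in>I. g q \<in> V q) \<and> (\<Sum>q\<in>I. g q) = X"
    unfolding g_def by (rule someI[of _ f]) (use assms in blast)
  have "(\<Sum>q\<in>I. g q - f q) = 0" unfolding sum_subtractf using g assms(2) by simp
  moreover have "g q - f q \<in> V q" if "q \<in> I" for q
    using g assms(1)[OF that] that by (intro subspace_diff[OF V_subspace]) blast+
  ultimately have "g p - f p = 0" using V_direct[of "\<lambda>q. g q - f q" p] assms(3) by blast
  then show ?thesis by (simp add: jet_comp_def g_def)
qed

lemma comp_in: "X \<in> W \<Longrightarrow> p \<in> I \<Longrightarrow> cmp p X \<in> V p"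
  and comp_sum: "X \<in> W \<Longrightarrow> (\<Sum>q\<in>I. cmp q X) = X"
proof -
  assume X: "X \<in> W"
  then obtain f where f: "\<forall>q\<in>I. f q \<in> V q" "(\<Sum>q\<in>I. f q) = X" using comp_exists by blast
  have c: "cmp q X = f q" if "q \<in> I" for q by (rule comp_unique[OF _ f(2) that]) (use f(1) in blast)
  show "p \<in> I \<Longrightarrow> cmp p X \<in> V p" using c f(1) by simp
  have "(\<Sum>q\<in>I. cmp q X) = (\<Sum>q\<in>I. f q)" by (rule sum.cong[OF refl c])
  then show "(\<Sum>q\<in>I. cmp q X) = X" unfolding f(2) .
qed

lemma comp_add:
  assumes "X \<in> W" "Y \<in> W" "p \<in> I" shows "cmp p (X + Y) = cmp p X + cmp p Y"
proof (rule comp_unique[of "\<lambda>p. cmp p X + cmp p Y"])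
  show "cmp q X + cmp q Y \<in> V q" if "q \<in> I" for q
    by (rule subspace_add[OF V_subspace[OF that] comp_in[OF assms(1) that] comp_in[OF assms(2) that]])
  show "(\<Sum>q\<in>I. cmp q X + cmp q Y) = X + Y"
    unfolding sum.distrib comp_sum[OF assms(1)] comp_sum[OF assms(2)] ..
qed (rule assms(3))

lemma comp_scale:
  assumes "X \<in> W" "p \<in> I" shows "cmp p (r *\<^sub>R X) = r *\<^sub>R cmp p X"
proof (rule comp_unique[of "\<lambda>p. r *\<^sub>R cmp p X"])
  show "r *\<^sub>R cmp q X \<in> V q" if "q \<in> I" for q
    by (rule subspace_scale[OF V_subspace[OF that] comp_in[OF assms(1) that]])
  show "(\<Sum>q\<in>I. r *\<^sub>R cmp q X) = r *\<^sub>R X"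
    unfolding scaleR_sum_right[symmetric] comp_sum[OF assms(1)] ..
qed (rule assms(2))

lemma comp_V:
  assumes "X \<in> V r" "r \<in> I" "p \<in> I"
  shows "cmp p X = (if p = r then X else 0)"
proof (rule comp_unique[of "\<lambda>p. if p = r then X else 0"])
  show "(if q = r then X else 0) \<in> V q" if "q \<in> I" for q
    using assms(1) subspace_0[OF V_subspace[OF that]] by simp
  show "(\<Sum>q\<in>I. if q = r then X else 0) = X" using assms(2) by simp
qed (rule assms(3))

lemma comp_sum_in:
  "finite A \<Longrightarrow> (\<And>a. a \<in> A \<Longrightarrow> g a \<in> W) \<Longrightarrow> p \<in> I \<Longrightarrow> cmp p (\<Sum>a\<in>A. g a) = (\<Sum>a\<in>A. cmp p (g a))"
proof (induction A rule: finite_induct)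
  case empty
  have "cmp p 0 = 0" using comp_scale[of 0 p 0] subspace_0[OF W_subspace] empty by simp
  then show ?case by simp
next
  case (insert a A)
  then show ?case using subspace_sum[OF W_subspace, of A g] by (simp add: comp_add)
qed

text \<open>\<open>jet_comp\<close> is known to be linear on W only. A bounded linear extension,
  obtained through a projection to W, makes the components available for differentiation.\<close>

lemma comp_ext:
  assumes "p \<in> I"
  obtains c where "bounded_linear c" "\<And>X. X \<in> W \<Longrightarrow> c X = cmp p X" "\<And>X. c X \<in> V p"
proof -
  obtain P where P: "bounded_linear P" "\<And>x. P x \<in> W" "\<And>x. x \<in> W \<Longrightarrow> P x = x"
    using obtain_projection[OF W_subspace] by metis
  note lP = bounded_linear.linear[OF P(1)]
  have "linear (\<lambda>x. cmp p (P x))"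
    by (rule linearI) (simp_all add: linear_add[OF lP] linear_scale[OF lP] comp_add[OF _ _ assms] comp_scale[OF _ assms] P(2))
  then have "bounded_linear (\<lambda>x. cmp p (P x))" by (simp add: linear_conv_bounded_linear)
  then show thesis using that[of "\<lambda>x. cmp p (P x)"] P comp_in[OF _ assms] by simp
qed

lemma comp_span:
  assumes "X \<in> span (\<Union>q\<in>Q. V q)" "Q \<subseteq> I" "p \<in> I" "p \<notin> Q"
  shows "cmp p X = 0"
proof -
  obtain c where c: "bounded_linear c" "\<And>X. X \<in> W \<Longrightarrow> c X = cmp p X"
    using comp_ext[OF assms(3)] by metis
  have XW: "X \<in> W" using assms(1,2) span_mono[of "\<Union>q\<in>Q. V q" "\<Union>q\<in>I. V q"] by (auto simp: jet_carrier_def)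
  have "c x = 0" if x: "x \<in> (\<Union>q\<in>Q. V q)" for x
  proof -
    obtain q where q: "q \<in> Q" "x \<in> V q" using x by blast
    then have qI: "q \<in> I" "p \<noteq> q" using assms(2,4) by auto
    then have "x \<in> W" using V_W[OF qI(1)] q(2) by blast
    then show ?thesis using comp_V[OF q(2) qI(1) assms(3)] qI(2) by (simp add: c(2))
  qed
  then have "c X = 0" using linear_eq_0_on_span[OF bounded_linear.linear[OF c(1)] _ assms(1)] by blast
  then show ?thesis using c(2)[OF XW] by simp
qed

text \<open>The degrees r from which an endomorphism in the sense of \<open>endo\<close> can reach a
  degree p < k. They are also the degrees of the 1-forms that generate the ideals in the
  congruences.\<close>

definition below :: "int \<Rightarrow> int set" where
  "below p = (if p = -1 then {-1} else {0..p})"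

text \<open>The conditions of \<open>jet_endos\<close> without extensionality, which sums and maps
  assembled from linear extensions may violate.\<close>

definition endo :: "('w \<Rightarrow> 'w) \<Rightarrow> bool" where
  "endo A \<longleftrightarrow> (\<forall>X\<in>W. A X \<in> W) \<and> (\<forall>X\<in>W. \<forall>Y\<in>W. A (X + Y) = A X + A Y) \<and> (\<forall>r. \<forall>X\<in>W. A (r *\<^sub>R X) = r *\<^sub>R A X) \<and>
     A ` span (V (-1) \<union> V K) \<subseteq> span (V (-1) \<union> V K) \<and> (\<forall>p\<in>{0..K}. A ` jet_filt k V p \<subseteq> jet_filt k V p)"

lemma jet_endos_endo: "A \<in> jet_endos k V \<Longrightarrow> endo A"
  by (auto simp: jet_endos_def endo_def Hom_set_def)

lemma endo_cong:
  assumes "endo A" "\<And>X. X \<in> W \<Longrightarrow> A' X = A X" shows "endo A'"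
proof -
  have 1: "span (V (-1) \<union> V K) \<subseteq> W"
    using V_W[of "-1"] V_W[of K] by (intro span_minimal W_subspace) auto
  have 2: "jet_filt k V p \<subseteq> W" if "p \<in> {0..K}" for p
    unfolding jet_filt_def jet_carrier_def using that by (intro span_mono UN_mono) auto
  have im: "A' ` S = A ` S" if "S \<subseteq> W" for S using that assms(2) by (intro image_cong) auto
  show ?thesis
    using assms(1) im[OF 1] im[OF 2] unfolding endo_def
    by (simp add: assms(2) subspace_add[OF W_subspace] subspace_scale[OF W_subspace])
qed

lemma endo_add:
  assumes "endo A" "endo B" shows "endo (\<lambda>X. A X + B X)"
  using assms unfolding endo_def image_subset_iff jet_filt_def
  by (simp add: subspace_add[OF W_subspace] span_add algebra_simps)

text \<open>The component of degree -1 is sent into V (-1) + V k, so below degree k it contributes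
  to degree -1 only. A component of degree r \<ge> 0 is sent into the span of the degrees from r on,
  so it contributes to degree p only if r \<le> p.\<close>

lemma comp_endo:
  assumes A: "endo A" and X: "X \<in> W" and p: "p \<in> {-1..K - 1}"
  shows "cmp p (A X) = (\<Sum>r\<in>below p. cmp p (A (cmp r X)))"
proof -
  have pI: "p \<in> I" using p by auto
  have cW: "cmp r X \<in> W" if "r \<in> I" for r using comp_in[OF X that] V_W[OF that] by blast
  have AW: "A Y \<in> W" if "Y \<in> W" for Y using A that by (simp add: endo_def)
  have "A X = A (\<Sum>r\<in>I. cmp r X)" by (simp add: comp_sum[OF X])
  also have "\<dots> = (\<Sum>r\<in>I. A (cmp r X))"
  proof -
    have "A (\<Sum>r\<in>Q. cmp r X) = (\<Sum>r\<in>Q. A (cmp r X))" if "finite Q" "Q \<subseteq> I" for Q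
      using that
    proof (induction Q rule: finite_induct)
      case empty
      have "A (0 *\<^sub>R 0) = 0 *\<^sub>R A 0" using A subspace_0[OF W_subspace] unfolding endo_def by blast
      then show ?case by simp
    next
      case (insert r Q)
      then have "cmp r X \<in> W" "(\<Sum>r\<in>Q. cmp r X) \<in> W" using cW by (auto intro!: subspace_sum[OF W_subspace])
      then have "A (cmp r X + (\<Sum>r\<in>Q. cmp r X)) = A (cmp r X) + A (\<Sum>r\<in>Q. cmp r X)"
        using A unfolding endo_def by blast
      then show ?case using insert by simp
    qed
    then show ?thesis by simp
  qed
  finally have "cmp p (A X) = (\<Sum>r\<in>I. cmp p (A (cmp r X)))"
    using comp_sum_in[of I "\<lambda>r. A (cmp r X)" p] AW cW pI by simp
  also have "\<dots> = (\<Sum>r\<in>below p. cmp p (A (cmp r X)))"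
  proof (rule sum.mono_neutral_right)
    show "below p \<subseteq> I" using p by (auto simp: below_def)
    show "\<forall>r\<in>I - below p. cmp p (A (cmp r X)) = 0"
    proof
      fix r assume r: "r \<in> I - below p"
      have c: "cmp r X \<in> V r" using comp_in[OF X] r by blast
      show "cmp p (A (cmp r X)) = 0"
      proof (cases "r = -1")
        case True
        have "cmp r X \<in> span (V (-1) \<union> V K)" using c True by (simp add: span_base)
        then have "A (cmp r X) \<in> span (\<Union>q\<in>{-1, K}. V q)" using A unfolding endo_def by auto
        then show ?thesis by (rule comp_span) (use p r True in \<open>auto simp: below_def split: if_splits\<close>)
      next
        case False
        have "cmp r X \<in> jet_filt k V r" unfolding jet_filt_def using c r by (intro span_base) auto
        moreover have "r \<in> {0..K}" using r False by auto
        ultimately have "A (cmp r X) \<in> jet_filt k V r" using A unfolding endo_def by blast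
        then show ?thesis unfolding jet_filt_def
          by (rule comp_span) (use p r False in \<open>auto simp: below_def split: if_splits\<close>)
      qed
    qed
  qed simp
  finally show ?thesis .
qed

lemma bracket0_homogeneous:
  assumes u: "u \<in> V (-1)" and X: "X \<in> V r" and r: "r \<in> {1..K}"
  shows "bracket0 k V app u X = - app X u"
proof -
  have rI: "r \<in> I" using r by auto
  have "app (cmp p u) (cmp (-1) X) - app (cmp p X) (cmp (-1) u) = (if p = r then - app X u else 0)"
    if "p \<in> {1..K}" for p
  proof -
    have pI: "p \<in> I" using that by auto
    have "cmp p u = 0" "cmp (-1) X = 0" "cmp (-1) u = u" "cmp p X = (if p = r then X else 0)"
      using that r comp_V[OF u minus1_in pI] comp_V[OF X rI minus1_in] comp_V[OF u minus1_in minus1_in] comp_V[OF X rI pI] by auto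
    moreover have "app 0 0 = 0" using app_zero[of 0] V_subspace[OF minus1_in] by (simp add: subspace_0)
    ultimately show ?thesis using app_zero[OF u] by simp
  qed
  then have "bracket0 k V app u X = (\<Sum>p\<in>{1..K}. if p = r then - app X u else 0)"
    unfolding bracket0_def by (intro sum.cong) auto
  then show ?thesis using r by simp
qed

text \<open>Evaluation lowers the degree by one, so degree p is fed from degree p + 1. Degree -1
  would be fed from degree 0, whose elements are not homomorphisms, and degree k from degree k + 1,
  which is absent.\<close>

lemma bracket0_comp:
  assumes X: "X \<in> W" and Y: "Y \<in> W" and p: "p \<in> I"
  shows "cmp p (bracket0 k V app X Y) =
    (if p = -1 \<or> p = K then 0 else app (cmp (p + 1) X) (cmp (-1) Y) - app (cmp (p + 1) Y) (cmp (-1) X))"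
    and bracket0_in: "bracket0 k V app X Y \<in> W"
proof -
  define f where "f p = (if p = -1 \<or> p = K then 0 else app (cmp (p + 1) X) (cmp (-1) Y) - app (cmp (p + 1) Y) (cmp (-1) X))" for p
  have fV: "f q \<in> V q" if "q \<in> I" for q
  proof (cases "q = -1 \<or> q = K")
    case True
    then show ?thesis using subspace_0[OF V_subspace[OF that]] by (simp add: f_def)
  next
    case False
    then have q: "q + 1 \<in> {1..K}" "q + 1 \<in> I" using that by auto
    then have "app (cmp (q + 1) X) (cmp (-1) Y) \<in> V q" "app (cmp (q + 1) Y) (cmp (-1) X) \<in> V q"
      using app_in[OF q(1) comp_in[OF X q(2)] comp_in[OF Y minus1_in]] app_in[OF q(1) comp_in[OF Y q(2)] comp_in[OF X minus1_in]] by simp_all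
    then show ?thesis using False subspace_diff[OF V_subspace[OF that]] by (simp add: f_def)
  qed
  have "(\<Sum>q\<in>I. f q) = (\<Sum>q\<in>{0..K - 1}. f q)"
    by (rule sum.mono_neutral_right) (auto simp: f_def)
  also have "\<dots> = (\<Sum>p\<in>{1..K}. f (p - 1))"
    by (rule sum.reindex_bij_witness[of _ "\<lambda>p. p - 1" "\<lambda>q. q + 1"]) auto
  also have "\<dots> = bracket0 k V app X Y"
    unfolding bracket0_def by (rule sum.cong) (auto simp: f_def)
  finally have s: "(\<Sum>q\<in>I. f q) = bracket0 k V app X Y" .
  have "cmp p (bracket0 k V app X Y) = f p" by (rule comp_unique[OF fV s p])
  then show "cmp p (bracket0 k V app X Y) =
    (if p = -1 \<or> p = K then 0 else app (cmp (p + 1) X) (cmp (-1) Y) - app (cmp (p + 1) Y) (cmp (-1) X))"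
    by (simp add: f_def)
  show "bracket0 k V app X Y \<in> W"
    unfolding s[symmetric] using fV V_W by (intro subspace_sum[OF W_subspace]) auto
qed

end

section \<open>Local differential equations on an open piece of \<open>W\<^sub>k\<^sup>0\<close>\<close>

lemma ideal2_sum:
  "finite A \<Longrightarrow> (\<And>a. a \<in> A \<Longrightarrow> f a \<in> ideal2 M P Q) \<Longrightarrow> (\<lambda>x s t. \<Sum>a\<in>A. f a x s t) \<in> ideal2 M P Q"
proof (induction A rule: finite_induct)
  case empty
  show ?case using ideal2.zero by simp
next
  case (insert a A)
  then have "(\<lambda>x s t. f a x s t + (\<lambda>x s t. \<Sum>a\<in>A. f a x s t) x s t) \<in> ideal2 M P Q"
    by (intro ideal2.add) auto
  then show ?case using insert.hyps by simp
qed

lemma smooth_in_linear_minus: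
  assumes "rel_open E S" "smooth_in E f S" shows "smooth_in E (\<lambda>x. - f x) S"
  using smooth_in_linear_image[OF assms(1) bounded_linear_minus[OF bounded_linear_ident] assms(2)] by simp

lemma smooth_form1_flatI:
  assumes S: "rel_open A S"
    and add: "\<And>x u v. x \<in> S \<Longrightarrow> u \<in> A \<Longrightarrow> v \<in> A \<Longrightarrow> \<beta> x (flat_vec S (u + v)) = \<beta> x (flat_vec S u) + \<beta> x (flat_vec S v)"
    and scale: "\<And>x r v. x \<in> S \<Longrightarrow> v \<in> A \<Longrightarrow> \<beta> x (flat_vec S (r *\<^sub>R v)) = r *\<^sub>R \<beta> x (flat_vec S v)"
    and sm: "\<And>v. v \<in> A \<Longrightarrow> smooth_in A (\<lambda>y. \<beta> y (flat_vec S v)) S"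
  shows "smooth_form1 (flat A S) \<beta>"
  unfolding smooth_form1_def
proof (intro conjI ballI)
  fix x assume "x \<in> points (flat A S)"
  then have x: "x \<in> S" by simp
  show "linear_on_tangent (flat A S) x (\<beta> x)"
    unfolding linear_on_tangent_def tangent_space_flat[OF S x]
    using add[OF x] scale[OF x] by (auto simp: flat_vec_add flat_vec_scale)
next
  fix c v assume "c \<in> atlas (flat A S)" "v \<in> model (flat A S)"
  then have c: "c = (S, \<lambda>x. x)" and v: "v \<in> A" by simp_all
  have "smooth_in A (\<lambda>y. \<beta> (chart_inv (S, \<lambda>x. x) y) (tvec_of (flat A S) (chart_inv (S, \<lambda>x. x) y) (S, \<lambda>x. x) v)) S"
    by (rule smooth_in_congI[OF S sm[OF v]]) (simp add: chart_inv_flat tvec_of_flat[OF S _ v])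
  then show "smooth_in (model (flat A S)) (\<lambda>y. \<beta> (chart_inv c y) (tvec_of (flat A S) (chart_inv c y) c v)) (snd c ` fst c)"
    by (simp add: c)
qed

lemma ext_deriv_flat:
  assumes S: "rel_open A S" and x: "x \<in> S" and u: "u \<in> A" and v: "v \<in> A"
  shows "ext_deriv (flat A S) \<omega> x (flat_vec S u) (flat_vec S v) =
    deriv_in A (\<lambda>z. \<omega> z (flat_vec S v)) x u - deriv_in A (\<lambda>z. \<omega> z (flat_vec S u)) x v"
proof -
  have "deriv_in A (\<lambda>z. \<omega> (chart_inv (S, \<lambda>x. x) z) (tvec_of (flat A S) (chart_inv (S, \<lambda>x. x) z) (S, \<lambda>x. x) w)) x w'
      = deriv_in A (\<lambda>z. \<omega> z (flat_vec S w)) x w'" if "w \<in> A" for w w'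
    by (rule deriv_in_cong[OF S x]) (simp add: chart_inv_flat tvec_of_flat[OF S _ that])
  then show ?thesis using u v by (simp add: ext_deriv_def Let_def some_chart_flat[OF x])
qed

section \<open>Congruences derived from a structure equation\<close>

context jet begin

text \<open>The factors cmp r X \<bullet> e will be scalar components of \<omega> with r in
  \<open>below p\<close>, and the other factors will be 1-forms multiplying them; this places the
  correction terms in the ideal.\<close>

lemma endo_expand:
  assumes A: "endo A" and X: "X \<in> W" and p: "p \<in> {-1..K - 1}" and l: "linear l"
    and B: "\<And>r. r \<in> I \<Longrightarrow> finite (B r) \<and> B r \<subseteq> V r \<and> (\<forall>v\<in>V r. (\<Sum>b\<in>B r. (v \<bullet> b) *\<^sub>R b) = v)"
  shows "l (cmp p (A X)) = (\<Sum>r\<in>below p. \<Sum>e\<in>B r. (cmp r X \<bullet> e) *\<^sub>R l (cmp p (A e)))"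
proof -
  have pI: "p \<in> I" using p by auto
  have "l (cmp p (A (cmp r X))) = (\<Sum>e\<in>B r. (cmp r X \<bullet> e) *\<^sub>R l (cmp p (A e)))" if "r \<in> below p" for r
  proof -
    have rI: "r \<in> I" using that p by (auto simp: below_def split: if_splits)
    note Br = B[OF rI]
    have BW: "B r \<subseteq> W" using Br V_W[OF rI] by blast
    have AW: "A e \<in> W" if "e \<in> B r" for e using A BW that by (auto simp: endo_def)
    have "A (\<Sum>e\<in>B r. (cmp r X \<bullet> e) *\<^sub>R e) = (\<Sum>e\<in>B r. (cmp r X \<bullet> e) *\<^sub>R A e)"
      using A Br BW by (intro linear_on_expansion[OF W_subspace]) (auto simp: endo_def)
    then have "A (cmp r X) = (\<Sum>e\<in>B r. (cmp r X \<bullet> e) *\<^sub>R A e)"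
      using Br comp_in[OF X rI] by simp
    then have "cmp p (A (cmp r X)) = (\<Sum>e\<in>B r. cmp p ((cmp r X \<bullet> e) *\<^sub>R A e))"
      using Br AW comp_sum_in[of "B r" "\<lambda>e. (cmp r X \<bullet> e) *\<^sub>R A e", OF _ _ pI] subspace_scale[OF W_subspace] by simp
    also have "\<dots> = (\<Sum>e\<in>B r. (cmp r X \<bullet> e) *\<^sub>R cmp p (A e))"
      by (rule sum.cong[OF refl]) (rule comp_scale[OF AW pI])
    finally show ?thesis by (simp add: linear_sum[OF l] linear_scale[OF l])
  qed
  then show ?thesis unfolding comp_endo[OF A X p] linear_sum[OF l] by (rule sum.cong[OF refl])
qed

text \<open>Separates the congruences from the group: the input about \<omega> is a structure
  equation with a correction \<Phi> whose values are endomorphisms. Linearity and smoothness of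
  \<Phi> turn its matrix entries into smooth 1-forms.\<close>

lemma flat_local_differential_equation:
  assumes S: "rel_open W S"
    and om: "\<And>y v. y \<in> S \<Longrightarrow> v \<in> W \<Longrightarrow> om y (flat_vec S v) = w y v"
    and w_in: "\<And>y v. y \<in> S \<Longrightarrow> v \<in> W \<Longrightarrow> w y v \<in> W"
    and w_lin: "\<And>y. y \<in> S \<Longrightarrow> linear (w y)"
    and w_smooth: "\<And>v. v \<in> W \<Longrightarrow> smooth_in W (\<lambda>y. w y v) S"
    and w_bij: "\<And>y. y \<in> S \<Longrightarrow> bij_betw (w y) W W"
    and endo: "\<And>y u. y \<in> S \<Longrightarrow> u \<in> W \<Longrightarrow> endo (\<Phi> y u)"
    and \<Phi>_lin: "\<And>y m. y \<in> S \<Longrightarrow> m \<in> W \<Longrightarrow> linear (\<lambda>u. \<Phi> y u m)"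
    and \<Phi>_smooth: "\<And>u m. u \<in> W \<Longrightarrow> m \<in> W \<Longrightarrow> smooth_in W (\<lambda>y. \<Phi> y u m) S"
    and struct: "\<And>y u v. y \<in> S \<Longrightarrow> u \<in> W \<Longrightarrow> v \<in> W \<Longrightarrow>
      deriv_in W (\<lambda>z. w z v) y u - deriv_in W (\<lambda>z. w z u) y v =
        - (bracket0 k V app (w y u) (w y v) + \<Phi> y u (w y v) - \<Phi> y v (w y u))"
  shows "\<exists>T. local_differential_equation k V app (flat W S) T om"
proof -
  obtain B where B: "\<And>r. r \<in> I \<Longrightarrow> finite (B r) \<and> B r \<subseteq> V r \<and> (\<forall>v\<in>V r. (\<Sum>b\<in>B r. (v \<bullet> b) *\<^sub>R b) = v)"
  proof -
    have "\<forall>r\<in>I. \<exists>Br. finite Br \<and> Br \<subseteq> V r \<and> (\<forall>v\<in>V r. (\<Sum>b\<in>Br. (v \<bullet> b) *\<^sub>R b) = v)"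
      using orthonormal_expansion[OF V_subspace] by metis
    from bchoice[OF this] show thesis using that by blast
  qed
  have \<Phi>W: "\<Phi> y u m \<in> W" if "y \<in> S" "u \<in> W" "m \<in> W" for y u m
    using endo[OF that(1,2)] that(3) by (simp add: endo_def)
  have form: "\<exists>\<Omega>\<in>ideal2 (flat W S) (scalar_comps k V om (below p)) Q. \<forall>x\<in>S. \<forall>u\<in>W. \<forall>v\<in>W.
      l (cmp p (\<Phi> x v (w x u)) - cmp p (\<Phi> x u (w x v))) = \<Omega> x (flat_vec S u) (flat_vec S v)"
    if p: "p \<in> {-1..K - 1}" and l: "linear l" for p Q and l :: "'w \<Rightarrow> real"
  proof -
    have pI: "p \<in> I" using p by auto
    obtain c where c: "bounded_linear c" "\<And>X. X \<in> W \<Longrightarrow> c X = cmp p X" using comp_ext[OF pI] by metis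
    have bl: "bounded_linear l" using l linear_conv_bounded_linear by blast
    \<comment> \<open>The sign compensates the order of arguments: in the positive term of
      \<open>wedge11\<close> the form \<beta> takes the first vector, while in the positive
      correction term \<Phi> takes the second one.\<close>
    define \<beta> where "\<beta> e x t = - l (cmp p (\<Phi> x (t (S, \<lambda>x. x)) e))" for e x and t :: "('w, 'w) tvec"
    define \<alpha> where "\<alpha> r e x t = cmp r (om x t) \<bullet> e" for r e x and t :: "('w, 'w) tvec"
    define \<Omega> where "\<Omega> = (\<lambda>x s t. \<Sum>r\<in>below p. \<Sum>e\<in>B r. wedge11 (\<beta> e) (\<alpha> r e) x s t)"
    have rI: "r \<in> I" if "r \<in> below p" for r using that p by (auto simp: below_def split: if_splits)
    have BW: "e \<in> W" if "r \<in> below p" "e \<in> B r" for r e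
      using B[OF rI[OF that(1)]] V_W[OF rI[OF that(1)]] that(2) by blast
    have b_eq: "\<beta> e x (flat_vec S u) = - l (c (\<Phi> x u e))" if "x \<in> S" "u \<in> W" "e \<in> W" for e x u
      using c(2)[OF \<Phi>W[OF that]] by (simp add: \<beta>_def)
    have sb: "smooth_form1 (flat W S) (\<beta> e)" if e: "e \<in> W" for e
    proof (rule smooth_form1_flatI[OF S])
      note lc = linear_compose[OF bounded_linear.linear[OF c(1)] l, unfolded comp_def]
      show "\<beta> e x (flat_vec S (u + v)) = \<beta> e x (flat_vec S u) + \<beta> e x (flat_vec S v)"
        if "x \<in> S" "u \<in> W" "v \<in> W" for x u v
        using b_eq[OF that(1) _ e] that subspace_add[OF W_subspace]
        by (simp add: linear_add[OF \<Phi>_lin[OF that(1) e]] linear_add[OF lc])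
      show "\<beta> e x (flat_vec S (r *\<^sub>R v)) = r *\<^sub>R \<beta> e x (flat_vec S v)"
        if "x \<in> S" "v \<in> W" for x r v
        using b_eq[OF that(1) _ e] that subspace_scale[OF W_subspace]
        by (simp add: linear_scale[OF \<Phi>_lin[OF that(1) e]] linear_scale[OF lc])
      fix v assume v: "v \<in> W"
      have sm: "smooth_in W (\<lambda>y. - l (c (\<Phi> y v e))) S"
        by (intro smooth_in_linear_minus[OF S] smooth_in_linear_image[OF S bl] smooth_in_linear_image[OF S c(1)] \<Phi>_smooth v e)
      show "smooth_in W (\<lambda>y. \<beta> e y (flat_vec S v)) S"
        by (rule smooth_in_congI[OF S sm]) (rule b_eq[OF _ v e])
    qed
    have "\<Omega> \<in> ideal2 (flat W S) (scalar_comps k V om (below p)) Q"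
      unfolding \<Omega>_def
    proof (intro ideal2_sum)
      show "finite (below p)" by (simp add: below_def)
      fix r assume r: "r \<in> below p"
      show "finite (B r)" using B[OF rI[OF r]] by blast
      fix e assume e: "e \<in> B r"
      have "linear (\<lambda>z. z \<bullet> e)" using bounded_linear.linear[OF bounded_linear_inner_left] .
      then have "\<alpha> r e \<in> scalar_comps k V om (below p)"
        unfolding scalar_comps_def \<alpha>_def[abs_def] mem_Collect_eq using r
        by (intro exI[of _ "\<lambda>z. z \<bullet> e"] exI[of _ r]) simp
      then show "(\<lambda>x s t. wedge11 (\<beta> e) (\<alpha> r e) x s t) \<in> ideal2 (flat W S) (scalar_comps k V om (below p)) Q"
        using ideal2.gen1[OF sb[OF BW[OF r e]]] by simp
    qed
    moreover have "l (cmp p (\<Phi> x v (w x u)) - cmp p (\<Phi> x u (w x v))) = \<Omega> x (flat_vec S u) (flat_vec S v)"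
      if x: "x \<in> S" and u: "u \<in> W" and v: "v \<in> W" for x u v
    proof -
      have e: "l (cmp p (\<Phi> x b (w x a))) = (\<Sum>r\<in>below p. \<Sum>e\<in>B r. (cmp r (w x a) \<bullet> e) *\<^sub>R l (cmp p (\<Phi> x b e)))"
        if "a \<in> W" "b \<in> W" for a b
        by (rule endo_expand[where A="\<Phi> x b" and X="w x a", OF endo[OF x that(2)] w_in[OF x that(1)] p l B])
      have "l (cmp p (\<Phi> x v (w x u)) - cmp p (\<Phi> x u (w x v))) =
          (\<Sum>r\<in>below p. \<Sum>e\<in>B r. (cmp r (w x u) \<bullet> e) *\<^sub>R l (cmp p (\<Phi> x v e))) -
          (\<Sum>r\<in>below p. \<Sum>e\<in>B r. (cmp r (w x v) \<bullet> e) *\<^sub>R l (cmp p (\<Phi> x u e)))"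
        unfolding linear_diff[OF l] e[OF u v] e[OF v u] ..
      also have "\<dots> = (\<Sum>r\<in>below p. \<Sum>e\<in>B r. (cmp r (w x u) \<bullet> e) *\<^sub>R l (cmp p (\<Phi> x v e)) - (cmp r (w x v) \<bullet> e) *\<^sub>R l (cmp p (\<Phi> x u e)))"
        by (simp only: sum_subtractf)
      also have "\<dots> = \<Omega> x (flat_vec S u) (flat_vec S v)"
        unfolding \<Omega>_def by (simp add: wedge11_def \<alpha>_def \<beta>_def om[OF x] u v mult.commute)
      finally show ?thesis .
    qed
    ultimately show ?thesis by (intro bexI[of _ \<Omega>]) auto
  qed
  have ext: "ext_deriv (flat W S) (\<lambda>x t. cmp p (om x t)) x (flat_vec S u) (flat_vec S v) =
      - cmp p (bracket0 k V app (w x u) (w x v)) + (cmp p (\<Phi> x v (w x u)) - cmp p (\<Phi> x u (w x v)))"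
    if p: "p \<in> I" and x: "x \<in> S" and u: "u \<in> W" and v: "v \<in> W" for p x u v
  proof -
    obtain c where c: "bounded_linear c" "\<And>X. X \<in> W \<Longrightarrow> c X = cmp p X" using comp_ext[OF p] by metis
    note lc = bounded_linear.linear[OF c(1)]
    have d: "deriv_in W (\<lambda>z. cmp p (om z (flat_vec S a))) x b = c (deriv_in W (\<lambda>z. w z a) x b)"
      if a: "a \<in> W" and b: "b \<in> W" for a b
    proof -
      have "deriv_in W (\<lambda>z. cmp p (om z (flat_vec S a))) x b = deriv_in W (\<lambda>z. c (w z a)) x b"
        by (rule deriv_in_cong[OF S x]) (simp add: om a c(2) w_in)
      also have "\<dots> = c (deriv_in W (\<lambda>z. w z a) x b)"
        using rel_openD(3)[OF S] x
        by (intro deriv_in_eq[OF W_subspace _ b] bounded_linear.has_derivative[OF c(1)]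
            smooth_in_has_deriv[OF w_smooth[OF a]]) auto
      finally show ?thesis .
    qed
    have "ext_deriv (flat W S) (\<lambda>x t. cmp p (om x t)) x (flat_vec S u) (flat_vec S v) =
        c (deriv_in W (\<lambda>z. w z v) x u - deriv_in W (\<lambda>z. w z u) x v)"
      unfolding ext_deriv_flat[OF S x u v] d[OF v u] d[OF u v] by (simp add: linear_diff[OF lc])
    also have "\<dots> = - c (bracket0 k V app (w x u) (w x v)) + (c (\<Phi> x v (w x u)) - c (\<Phi> x u (w x v)))"
      unfolding struct[OF x u v]
      by (simp add: linear_neg[OF lc] linear_diff[OF lc] linear_add[OF lc])
    finally show ?thesis
      by (simp add: c(2) bracket0_in[OF w_in[OF x u] w_in[OF x v] p] \<Phi>W x u v w_in)
  qed
  \<comment> \<open>The set Q of generators of degree two stays arbitrary, so that one argument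
    serves all three congruences.\<close>
  have cong: "cong_zero (flat W S) \<tau> (scalar_comps k V om (below p)) Q"
    if p: "p \<in> {-1..K - 1}" and \<tau>: "\<And>x u v. x \<in> S \<Longrightarrow> u \<in> W \<Longrightarrow> v \<in> W \<Longrightarrow>
       \<tau> x (flat_vec S u) (flat_vec S v) = cmp p (\<Phi> x v (w x u)) - cmp p (\<Phi> x u (w x v))" for p Q \<tau>
    unfolding cong_zero_def
  proof (intro allI impI)
    fix l :: "'w \<Rightarrow> real" assume l: "linear l"
    obtain \<Omega> where \<Omega>: "\<Omega> \<in> ideal2 (flat W S) (scalar_comps k V om (below p)) Q"
      "\<forall>x\<in>S. \<forall>u\<in>W. \<forall>v\<in>W. l (cmp p (\<Phi> x v (w x u)) - cmp p (\<Phi> x u (w x v))) = \<Omega> x (flat_vec S u) (flat_vec S v)"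
      using form[OF p l] by blast
    show "\<exists>\<Omega>\<in>ideal2 (flat W S) (scalar_comps k V om (below p)) Q.
        \<forall>x\<in>points (flat W S). \<forall>s\<in>tangent_space (flat W S) x. \<forall>t\<in>tangent_space (flat W S) x. l (\<tau> x s t) = \<Omega> x s t"
    proof (intro bexI[OF _ \<Omega>(1)] ballI)
      fix x s t assume "x \<in> points (flat W S)" and st: "s \<in> tangent_space (flat W S) x" "t \<in> tangent_space (flat W S) x"
      then have x: "x \<in> S" by simp
      obtain u v where "u \<in> W" "v \<in> W" "s = flat_vec S u" "t = flat_vec S v"
        using st unfolding tangent_space_flat[OF S x] by blast
      then show "l (\<tau> x s t) = \<Omega> x s t" using \<tau>[OF x] \<Omega>(2) x by simp
    qed
  qed
  \<comment> \<open>The bracket of u and X, which is minus the evaluation of X at u. Its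
    nondegeneracy is the faithfulness of the evaluation on V k.\<close>
  define T where "T x u X = - app X u" for x :: 'w and u X
  have bracket: "- cmp p (bracket0 k V app X Y) - app (cmp (p + 1) Y) (cmp (-1) X) + app (cmp (p + 1) X) (cmp (-1) Y) = 0"
    if "p \<in> {0..K - 1}" "X \<in> W" "Y \<in> W" for p X Y
    using bracket0_comp[OF that(2,3), of p] that(1) by auto
  have "local_differential_equation k V app (flat W S) T om"
    unfolding local_differential_equation_def Let_def
  proof (intro conjI ballI allI impI)
    show "jet_space k V app" by (rule jet_space)
    show "smooth_manifold (flat W S)" by (rule smooth_manifold_flat[OF S])
    show "mdim (flat W S) = dim W" by (simp add: mdim_def)
    show "absolute_parallelism (flat W S) W om"
      unfolding absolute_parallelism_def
    proof (intro conjI ballI)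
      show "smooth_form1 (flat W S) om"
      proof (rule smooth_form1_flatI[OF S])
        show "om x (flat_vec S (u + v)) = om x (flat_vec S u) + om x (flat_vec S v)" if "x \<in> S" "u \<in> W" "v \<in> W" for x u v
          using that om subspace_add[OF W_subspace] by (simp add: linear_add[OF w_lin])
        show "om x (flat_vec S (r *\<^sub>R v)) = r *\<^sub>R om x (flat_vec S v)" if "x \<in> S" "v \<in> W" for x r v
          using that om subspace_scale[OF W_subspace] by (simp add: linear_scale[OF w_lin])
        show "smooth_in W (\<lambda>y. om y (flat_vec S v)) S" if "v \<in> W" for v
          by (rule smooth_in_congI[OF S w_smooth[OF that]]) (rule om[OF _ that])
      qed
      fix x assume "x \<in> points (flat W S)"
      then have x: "x \<in> S" by simp
      have inj: "inj_on (flat_vec S) W" by (simp add: inj_on_def)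
      have "bij_betw (om x \<circ> flat_vec S) W W"
        using w_bij[OF x] by (subst bij_betw_cong[of W _ "w x"]) (simp_all add: om[OF x])
      then have "bij_betw (om x) (flat_vec S ` W) W"
        using bij_betw_comp_iff[OF inj_on_imp_bij_betw[OF inj]] by blast
      then show "bij_betw (om x) (tangent_space (flat W S) x) W" by (simp only: tangent_space_flat[OF S x])
    qed
    have K1: "K \<in> {1..K}" "K \<in> I" "K - 1 \<in> I" using k1 by auto
    fix x assume "x \<in> points (flat W S)"
    fix u assume u: "u \<in> V (-1)"
    show "restrict (T x u) (V K) \<in> Hom_set (V K) (V (K - 1))"
      unfolding Hom_set_def T_def
      using app_in[OF K1(1) _ u] app_linear[OF K1(1) u] subspace_add[OF V_subspace[OF K1(2)]] subspace_scale[OF V_subspace[OF K1(2)]]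
        subspace_neg[OF V_subspace[OF K1(3)]]
      by (auto simp: PiE_iff)
  next
    have K1: "K \<in> {1..K}" "K \<in> I" "K - 1 \<in> I" using k1 by auto
    fix x assume "x \<in> points (flat W S)"
    fix X assume X: "X \<in> V K"
    show "(\<lambda>u\<in>V (-1). T x u X) \<in> Hom_set (V (-1)) (V (K - 1))"
      unfolding Hom_set_def T_def
      using app_in[OF K1(1) X] app_add2[OF K1(1) X] app_scale2[OF K1(1) X] subspace_add[OF V_subspace[OF minus1_in]] subspace_scale[OF V_subspace[OF minus1_in]]
        subspace_neg[OF V_subspace[OF K1(3)]]
      by (auto simp: PiE_iff)
  next
    fix u X assume "u \<in> V (-1)" "X \<in> V K"
    have "smooth_in W (\<lambda>y. - app X u) S" by (rule smooth_in_const[OF S])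
    then show "smooth_fun (flat W S) (\<lambda>x. T x u X)" by (simp add: smooth_fun_def T_def comp_def)
  next
    fix x X assume "x \<in> points (flat W S)" and X: "X \<in> V K" and "\<forall>u\<in>V (-1). T x u X = 0"
    then have "app X u = 0" if "u \<in> V (-1)" for u using that by (simp add: T_def)
    then show "X = 0" by (rule app_faithful[OF X])
  next
    have below1: "{-1} = below (-1)" by (simp add: below_def)
    show "cong_zero (flat W S) (ext_deriv (flat W S) (\<lambda>x t. cmp (-1) (om x t))) (scalar_comps k V om {-1}) {}"
      unfolding below1
    proof (rule cong)
      show "-1 \<in> {-1..K - 1}" by simp
      fix x u v assume x: "x \<in> S" and u: "u \<in> W" and v: "v \<in> W"
      show "ext_deriv (flat W S) (\<lambda>x t. cmp (-1) (om x t)) x (flat_vec S u) (flat_vec S v)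
          = cmp (-1) (\<Phi> x v (w x u)) - cmp (-1) (\<Phi> x u (w x v))"
        unfolding ext[OF minus1_in x u v] bracket0_comp[OF w_in[OF x u] w_in[OF x v] minus1_in] by simp
    qed
  next
    fix p :: int assume p: "0 \<le> p \<and> p \<le> K - 2"
    have bp: "{0..p} = below p" using p by (simp add: below_def)
    show "cong_zero (flat W S) (\<lambda>x s t. ext_deriv (flat W S) (\<lambda>x t. cmp p (om x t)) x s t +
           wedge_pair (\<lambda>x. bracket0 k V app) (\<lambda>x t. cmp (-1) (om x t)) (\<lambda>x t. cmp (p + 1) (om x t)) x s t)
         (scalar_comps k V om {0..p}) {}"
      unfolding bp
    proof (rule cong)
      show "p \<in> {-1..K - 1}" using p by auto
      have pI: "p \<in> I" and p1: "p + 1 \<in> {1..K}" "p + 1 \<in> I" and p0: "p \<in> {0..K - 1}" using p by auto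
      fix x u v assume x: "x \<in> S" and u: "u \<in> W" and v: "v \<in> W"
      note wu = w_in[OF x u] and wv = w_in[OF x v]
      show "ext_deriv (flat W S) (\<lambda>x t. cmp p (om x t)) x (flat_vec S u) (flat_vec S v) +
           wedge_pair (\<lambda>x. bracket0 k V app) (\<lambda>x t. cmp (-1) (om x t)) (\<lambda>x t. cmp (p + 1) (om x t)) x (flat_vec S u) (flat_vec S v)
        = cmp p (\<Phi> x v (w x u)) - cmp p (\<Phi> x u (w x v))"
        using bracket[OF p0 wu wv]
        by (simp add: ext[OF pI x u v] wedge_pair_def om[OF x] u v
            bracket0_homogeneous[OF comp_in[OF wu minus1_in] comp_in[OF wv p1(2)] p1(1)]
            bracket0_homogeneous[OF comp_in[OF wv minus1_in] comp_in[OF wu p1(2)] p1(1)] del: add_uminus_conv_diff) (simp add: algebra_simps)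
    qed
  next
    have bp: "{0..K - 1} = below (K - 1)" using k1 by (simp add: below_def)
    show "cong_zero (flat W S) (\<lambda>x s t. ext_deriv (flat W S) (\<lambda>x t. cmp (K - 1) (om x t)) x s t +
           wedge_pair T (\<lambda>x t. cmp (-1) (om x t)) (\<lambda>x t. cmp K (om x t)) x s t)
         (scalar_comps k V om {0..K - 1})
         {wedge11 \<alpha> \<beta> | \<alpha> \<beta>. \<alpha> \<in> scalar_comps k V om {-1} \<and> \<beta> \<in> scalar_comps k V om {-1}}"
      unfolding bp
    proof (rule cong)
      show "K - 1 \<in> {-1..K - 1}" by auto
      have pI: "K - 1 \<in> I" and p0: "K - 1 \<in> {0..K - 1}" using k1 by auto
      fix x u v assume x: "x \<in> S" and u: "u \<in> W" and v: "v \<in> W"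
      show "ext_deriv (flat W S) (\<lambda>x t. cmp (K - 1) (om x t)) x (flat_vec S u) (flat_vec S v) +
           wedge_pair T (\<lambda>x t. cmp (-1) (om x t)) (\<lambda>x t. cmp K (om x t)) x (flat_vec S u) (flat_vec S v)
        = cmp (K - 1) (\<Phi> x v (w x u)) - cmp (K - 1) (\<Phi> x u (w x v))"
        using bracket[OF p0 w_in[OF x u] w_in[OF x v]]
        by (simp add: ext[OF pI x u v] wedge_pair_def om[OF x] u v T_def) (simp add: algebra_simps)
    qed
  qed
  then show ?thesis by blast
qed

end

section \<open>The fibering by the maximal integral manifolds\<close>

lemma smooth_map_cong:
  assumes M: "smooth_atlas M" and N: "smooth_atlas N" and f: "smooth_map M N f"
    and eq: "\<And>x. x \<in> points M \<Longrightarrow> f x = g x"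
  shows "smooth_map M N g"
proof (rule smooth_mapI[OF M N])
  show "continuous_map (mtop M) (mtop N) g"
    using smooth_map_continuous[OF f] by (rule continuous_map_eq) (rule eq)
  fix x assume x: "x \<in> points M"
  let ?c = "some_chart M x" and ?d = "some_chart N (f x)"
  have c: "?c \<in> charts_at M x" and d: "?d \<in> charts_at N (f x)"
    using some_chart_in[OF M x] some_chart_in[OF N smooth_map_points[OF f x]] by auto
  have d': "?d \<in> charts_at N (g x)" using d eq[OF x] by simp
  note cc = charts_atD[OF c] and dd = charts_atD[OF d]
  define W where "W = fst ?c \<inter> {x \<in> points M. f x \<in> fst ?d}"
  have Wo: "openin (mtop M) W"
    unfolding W_def by (intro openin_Int chart_openin[OF M cc(1)] smooth_map_preimage_openin[OF f N dd(1)])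
  have ro: "rel_open (model M) (snd ?c ` W)" using chart_image_rel_open[OF M cc(1) Wo] by (simp add: W_def)
  have sf: "smooth_in (model M) (\<lambda>y. snd ?d (f (chart_inv ?c y))) (snd ?c ` W)"
    by (rule smooth_in_subset[OF smooth_map_dom(2)[OF f M N cc(1) dd(1)]]) (auto simp: W_def)
  have sg: "smooth_in (model M) (\<lambda>y. snd ?d (g (chart_inv ?c y))) (snd ?c ` W)"
  proof (rule smooth_in_congI[OF ro sf])
    fix z assume "z \<in> snd ?c ` W"
    then have "chart_inv ?c z \<in> W" by (rule chart_inv_in[OF _ _ M cc(1)]) (auto simp: W_def)
    then show "snd ?d (g (chart_inv ?c z)) = snd ?d (f (chart_inv ?c z))" using eq by (simp add: W_def)
  qed
  have sub: "W \<subseteq> {x \<in> fst ?c. g x \<in> fst ?d}" using eq by (auto simp: W_def)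
  have xW: "x \<in> W" using x cc dd by (simp add: W_def)
  show "\<exists>c\<in>charts_at M x. \<exists>d\<in>charts_at N (g x). \<exists>W. openin (mtop M) W \<and> x \<in> W \<and>
      W \<subseteq> {x \<in> fst c. g x \<in> fst d} \<and> smooth_in (model M) (\<lambda>y. snd d (g (chart_inv c y))) (snd c ` W)"
    by (intro bexI[OF _ c] bexI[OF _ d'] exI[of _ W] conjI Wo xW sub sg)
qed

text \<open>In a chart the derivative vanishes along segments of a small ball, so f is locally
  constant; \<open>linear_growth_zero\<close> with K = 0 plays the part of the mean value theorem.
  Connectedness excludes a second value, since \<open>P1\<close> and \<open>P2\<close> are both
  open.\<close>

lemma constant_if_pushforward_zero:
  assumes N: "smooth_atlas N" and S: "rel_open A S" and f: "smooth_map N (flat A S) f"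
    and zero: "\<And>x t. x \<in> points N \<Longrightarrow> t \<in> tangent_space N x \<Longrightarrow> pushforward N (flat A S) f x t = flat_vec S 0"
    and conn: "connected_space (mtop N)" and xy: "x \<in> points N" "y \<in> points N"
  shows "f y = f x"
proof -
  have loc: "\<exists>Z. openin (mtop N) Z \<and> z \<in> Z \<and> (\<forall>p\<in>Z. f p = f z)" if z: "z \<in> points N" for z
  proof -
    let ?c = "some_chart N z"
    note c = some_chart_in[OF N z]
    note cc = charts_atD[OF c]
    define F where "F y = f (chart_inv ?c y)" for y
    have D: "rel_open (model N) (snd ?c ` fst ?c)" by (rule chart_rel_open[OF N cc(1)])
    have F: "smooth_in (model N) F (snd ?c ` fst ?c)"
      unfolding F_def by (rule smooth_map_flatD[OF N f cc(1)])
    obtain \<rho> where \<rho>: "\<rho> > 0" "model N \<inter> ball (snd ?c z) \<rho> \<subseteq> snd ?c ` fst ?c"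
      using rel_open_ballE[OF D] cc(2) by blast
    define Z where "Z = {p \<in> fst ?c. snd ?c p \<in> model N \<inter> ball (snd ?c z) \<rho>}"
    have "openin (mtop N) Z"
      unfolding Z_def by (rule chart_preimage_openin[OF N cc(1)]) (use rel_open_ball[OF smooth_atlas_subspace[OF N]] rel_openD(2) in blast)
    moreover have "z \<in> Z" using cc(2) chart_in_model[OF N cc] \<rho>(1) by (simp add: Z_def)
    moreover have "f p = f z" if p: "p \<in> Z" for p
    proof -
      define a where "a = snd ?c z"
      define w where "w = snd ?c p - a"
      have aE: "a \<in> model N" using chart_in_model[OF N cc] by (simp add: a_def)
      have pE: "snd ?c p \<in> model N" "snd ?c p \<in> ball a \<rho>" "p \<in> fst ?c" using p by (auto simp: Z_def a_def)
      have wE: "w \<in> model N" unfolding w_def by (rule subspace_diff[OF smooth_atlas_subspace[OF N] pE(1) aE])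
      have seg: "a + s *\<^sub>R w \<in> snd ?c ` fst ?c" if s: "0 \<le> s" "s \<le> 1" for s
      proof -
        have "norm (s *\<^sub>R w) \<le> 1 * norm w" unfolding norm_scaleR using s by (intro mult_right_mono) auto
        also have "\<dots> < \<rho>" using pE(2) by (simp add: w_def dist_norm norm_minus_commute)
        finally have "a + s *\<^sub>R w \<in> ball a \<rho>" by (simp add: dist_norm)
        moreover have "a + s *\<^sub>R w \<in> model N"
          by (intro subspace_add[OF smooth_atlas_subspace[OF N]] subspace_scale[OF smooth_atlas_subspace[OF N]] aE wE)
        ultimately show ?thesis using \<rho>(2) by (auto simp: a_def)
      qed
      have "(\<lambda>s. F (a + s *\<^sub>R w) - F a) 1 = 0"
      proof (rule linear_growth_zero[where f'="\<lambda>_. 0" and K=0])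
        fix s :: real assume s: "0 \<le> s" "s \<le> 1"
        define b where "b = a + s *\<^sub>R w"
        have b: "b \<in> snd ?c ` fst ?c" using seg[OF s] by (simp add: b_def)
        define q where "q = chart_inv ?c b"
        have q: "q \<in> fst ?c" unfolding q_def by (rule chart_inv_in[OF b order_refl N cc(1)])
        have qN: "q \<in> points N" using q chart_subset[OF N cc(1)] by blast
        have cq: "?c \<in> charts_at N q" unfolding charts_at_def using cc(1) q by simp
        have bq: "snd ?c q = b" unfolding q_def by (rule chart_chart_inv[OF b])
        note t = tvec_of_tangent[OF N cq wE]
        have "flat_vec S (deriv_in (model N) F b w) = flat_vec S 0"
          using pushforward_to_flat(1)[OF N S f qN t cq] zero[OF qN t] tvec_of_self[OF N cq wE]
          by (simp add: bq F_def[abs_def])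
        then have "deriv_in (model N) F b w = 0" by simp
        moreover have "((\<lambda>s. F (a + s *\<^sub>R w)) has_vector_derivative deriv_in (model N) F b w) (at s)"
          unfolding b_def using seg[OF s]
          by (intro has_vector_derivative_line[OF smooth_atlas_subspace[OF N] aE wE] smooth_in_differentiable[OF F])
        ultimately show "((\<lambda>s. F (a + s *\<^sub>R w) - F a) has_vector_derivative 0) (at s)"
          by (auto intro!: derivative_eq_intros)
      qed auto
      then have "F (snd ?c p) = F a" by (simp add: w_def)
      then show ?thesis by (simp add: F_def a_def chart_inv_eq[OF N cc(1)] pE(3) cc(2))
    qed
    ultimately show ?thesis by blast
  qed
  define P1 where "P1 = {z \<in> points N. f z = f x}"
  define P2 where "P2 = {z \<in> points N. f z \<noteq> f x}"
  have op: "openin (mtop N) {z \<in> points N. Q (f z)}" for Q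
  proof (rule iffD2[OF openin_subopen], rule ballI)
    fix z assume z: "z \<in> {z \<in> points N. Q (f z)}"
    then obtain Z where Z: "openin (mtop N) Z" "z \<in> Z" "\<forall>p\<in>Z. f p = f z" using loc[of z] by blast
    have "Z \<subseteq> {z \<in> points N. Q (f z)}" using openin_subset[OF Z(1)] Z(3) z by auto
    then show "\<exists>T. openin (mtop N) T \<and> z \<in> T \<and> T \<subseteq> {z \<in> points N. Q (f z)}" using Z by blast
  qed
  have "openin (mtop N) P1" "openin (mtop N) P2" unfolding P1_def P2_def by (rule op)+
  moreover have "P1 \<noteq> {}" "P1 \<inter> P2 = {}" "points N \<subseteq> P1 \<union> P2" using xy by (auto simp: P1_def P2_def)
  ultimately have "P2 = {}" using conn unfolding connected_space_def by blast
  then show ?thesis using xy(2) unfolding P2_def by blast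
qed

section \<open>The projection in a foliated chart\<close>

locale foliated = lie_grp G MG
  for G :: "'g monoid" (structure) and MG :: "('g, 'e::euclidean_space) manifold" +
  fixes E0 :: "'e set" and r :: real and \<Phi> :: "'e \<Rightarrow> 'g" and \<Psi> :: "'g \<Rightarrow> 'e" and U :: "'g set"
    and L :: "'e \<Rightarrow> 'j::euclidean_space" and gg :: "'j \<Rightarrow> 'e" and M :: "'j set" and om :: "('g, 'e, 'j) form1"
  assumes manG: "smooth_manifold MG"
    and E0: "subspace E0" "E0 \<subseteq> E" and r: "r > 0" and Uo: "openin (mtop MG) U"
    and sm\<Phi>: "smooth_map (flat E (E \<inter> ball 0 r)) (open_submanifold MG U) \<Phi>"
    and sm\<Psi>: "smooth_map (open_submanifold MG U) (flat E (E \<inter> ball 0 r)) \<Psi>"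
    and \<Psi>\<Phi>: "\<And>x. x \<in> E \<inter> ball 0 r \<Longrightarrow> \<Psi> (\<Phi> x) = x" and \<Phi>\<Psi>: "\<And>p. p \<in> U \<Longrightarrow> \<Phi> (\<Psi> p) = p"
    and log_iff: "\<And>x v. x \<in> E \<inter> ball 0 r \<Longrightarrow> v \<in> E \<Longrightarrow> logd E \<Phi> x v \<in> E0 \<longleftrightarrow> v \<in> E0"
    and subM: "subspace M" and L: "bounded_linear L" "\<And>x. x \<in> E \<Longrightarrow> L x \<in> M"
    and gg: "bounded_linear gg" "\<And>y. y \<in> M \<Longrightarrow> gg y \<in> E" "\<And>y. y \<in> M \<Longrightarrow> L (gg y) = y"
    and gg_norm: "\<And>x. x \<in> E \<Longrightarrow> norm (gg (L x)) \<le> norm x"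
    and ker: "\<And>x. x \<in> E \<Longrightarrow> L x = 0 \<longleftrightarrow> x \<in> E0"
    and om: "\<And>g v. g \<in> carrier G \<Longrightarrow> v \<in> E \<Longrightarrow> om g (lfield v g) = L v"
begin

definition "Br = E \<inter> ball 0 r"
text \<open>The image of the ball \<open>Br\<close> under L: since gg (L x) is not longer than x, a
  point y of M has a preimage in the ball exactly if gg y is one. Continuity of \<open>gg\<close>
  makes it open in M.\<close>

definition "Om = {y \<in> M. norm (gg y) < r}"
definition "pr p = L (\<Psi> p)"
abbreviation "MGU \<equiv> open_submanifold MG U"
abbreviation "R \<equiv> flat M Om"
abbreviation "omU \<equiv> pullback MGU MG (\<lambda>x. x) om"
definition "dPhi z v = pushforward (flat E Br) MGU \<Phi> z (flat_vec Br v)"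

lemma Br: "rel_open E Br" and smooth_\<Phi>: "smooth_map (flat E Br) MGU \<Phi>" and smooth_\<Psi>: "smooth_map MGU (flat E Br) \<Psi>"
  using rel_open_ball[OF subE] sm\<Phi> sm\<Psi> by (simp_all add: Br_def)

lemma Om: "rel_open M Om"
proof -
  have "rel_open M {y \<in> M. gg y \<in> ball 0 r}"
    by (intro rel_open_preimage_open rel_open_space subM linear_continuous_on gg(1)) simp
  then show ?thesis by (simp add: Om_def)
qed

lemmas aBr = smooth_atlas_flat[OF Br] and aR = smooth_atlas_flat[OF Om]

lemma aU: "smooth_atlas MGU"
  by (rule smooth_atlas_open_submanifold[OF atl Uo])

lemma pU: "points MGU = U"
  using openin_subset[OF Uo] by auto

lemma incl: "smooth_map MGU MG (\<lambda>x. x)"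
  by (rule smooth_map_open_submanifold_incl[OF atl Uo])

lemma \<Phi>G: "smooth_map (flat E Br) MG \<Phi>"
  using smooth_map_compose[OF aBr aU atl smooth_\<Phi> incl] .

lemma \<Phi>U: "z \<in> Br \<Longrightarrow> \<Phi> z \<in> U"
  using smooth_map_points[OF smooth_\<Phi>, of z] pU by simp

lemma \<Psi>Br: "p \<in> U \<Longrightarrow> \<Psi> p \<in> Br"
  using smooth_map_points[OF smooth_\<Psi>, of p] unfolding pU by simp

lemma L_Om: "L ` Br \<subseteq> Om"
  using L(2) le_less_trans[OF gg_norm] by (auto simp: Br_def Om_def)

lemma gg_Br: "y \<in> Om \<Longrightarrow> gg y \<in> Br"
  using gg(2) by (auto simp: Br_def Om_def)

lemma smooth_L: "smooth_map (flat E Br) R L"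
  unfolding smooth_map_flat_flat[OF Br Om] using smooth_in_bounded_linear[OF Br L(1)] L_Om by blast

lemma smooth_pr: "smooth_map MGU R pr"
  unfolding pr_def by (rule smooth_map_compose[OF aU aBr aR smooth_\<Psi> smooth_L])

lemma pr_\<Phi>: "z \<in> Br \<Longrightarrow> pr (\<Phi> z) = L z"
  using \<Psi>\<Phi> by (simp add: pr_def Br_def)

lemma flat_vec_tangent: "z \<in> Br \<Longrightarrow> v \<in> E \<Longrightarrow> flat_vec Br v \<in> tangent_space (flat E Br) z"
  using tangent_space_flat[OF Br] by blast

lemma dPhi_inv:
  assumes z: "z \<in> Br" and v: "v \<in> E"
  shows "pushforward MGU (flat E Br) \<Psi> (\<Phi> z) (dPhi z v) = flat_vec Br v"
  unfolding dPhi_def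
proof (rule pushforward_inverse[OF aBr aU smooth_\<Phi> smooth_\<Psi> _ _ flat_vec_tangent[OF z v]])
  show "z \<in> points (flat E Br)" using z by simp
  show "\<Psi> (\<Phi> x) = x" if "x \<in> points (flat E Br)" for x by (rule \<Psi>\<Phi>) (use that in \<open>simp add: Br_def\<close>)
qed

lemma dPhi_inj: "z \<in> Br \<Longrightarrow> u \<in> E \<Longrightarrow> v \<in> E \<Longrightarrow> dPhi z u = dPhi z v \<Longrightarrow> u = v"
proof -
  assume z: "z \<in> Br" and u: "u \<in> E" and v: "v \<in> E" and e: "dPhi z u = dPhi z v"
  have "flat_vec Br u = flat_vec Br v" unfolding dPhi_inv[OF z u, symmetric] e by (rule dPhi_inv[OF z v])
  then show "u = v" by (rule iffD1[OF flat_vec_eq_iff])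
qed

lemma tangent_MGU:
  assumes z: "z \<in> Br" shows "tangent_space MGU (\<Phi> z) = dPhi z ` E"
proof
  have zp: "z \<in> points (flat E Br)" using z by simp
  show "dPhi z ` E \<subseteq> tangent_space MGU (\<Phi> z)"
    unfolding dPhi_def using pushforward_tangent[OF aBr aU smooth_\<Phi> zp flat_vec_tangent[OF z]] by blast
  show "tangent_space MGU (\<Phi> z) \<subseteq> dPhi z ` E"
  proof
    fix t assume t: "t \<in> tangent_space MGU (\<Phi> z)"
    have p: "\<Phi> z \<in> points MGU" unfolding pU by (rule \<Phi>U[OF z])
    have zz: "\<Psi> (\<Phi> z) = z" using \<Psi>\<Phi> z by (simp add: Br_def)
    have "pushforward (flat E Br) MGU \<Phi> (\<Psi> (\<Phi> z)) (pushforward MGU (flat E Br) \<Psi> (\<Phi> z) t) = t"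
      by (rule pushforward_inverse[OF aU aBr smooth_\<Psi> smooth_\<Phi> _ p t]) (unfold pU, rule \<Phi>\<Psi>)
    moreover have "pushforward MGU (flat E Br) \<Psi> (\<Phi> z) t \<in> flat_vec Br ` E"
      using pushforward_tangent[OF aU aBr smooth_\<Psi> p t] tangent_space_flat[OF Br z] zz by simp
    ultimately show "t \<in> dPhi z ` E" unfolding zz dPhi_def by force
  qed
qed

lemma omU_dPhi:
  assumes z: "z \<in> Br" and v: "v \<in> E"
  shows "omU (\<Phi> z) (dPhi z v) = L (logd E \<Phi> z v)"
proof -
  have zp: "z \<in> points (flat E Br)" using z by simp
  have "pushforward MGU MG (\<lambda>x. x) (\<Phi> z) (dPhi z v) = pushforward (flat E Br) MG \<Phi> z (flat_vec Br v)"
    unfolding dPhi_def by (rule pushforward_compose[OF aBr aU atl smooth_\<Phi> incl zp flat_vec_tangent[OF z v], symmetric])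
  also have "\<dots> = lfield (logd E \<Phi> z v) (\<Phi> z)" by (rule pushforward_logd[OF Br \<Phi>G z v])
  finally show ?thesis
    unfolding pullback_def using om[OF flat_in_carrier[OF \<Phi>G z] logd_in_model[OF Br \<Phi>G z v]] by simp
qed

text \<open>In the chart the kernel of the form is the constant subspace E0, by \<open>ker\<close>
  and \<open>log_iff\<close>; the description of the integral manifolds rests on this.\<close>

lemma omU_zero:
  assumes z: "z \<in> Br" and v: "v \<in> E"
  shows "omU (\<Phi> z) (dPhi z v) = 0 \<longleftrightarrow> v \<in> E0"
  unfolding omU_dPhi[OF assms] ker[OF logd_in_model[OF Br \<Phi>G z v]]
  by (rule log_iff) (use z v in \<open>simp_all add: Br_def\<close>)

lemma pr_dPhi:
  assumes z: "z \<in> Br" and v: "v \<in> E"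
  shows "pushforward MGU R pr (\<Phi> z) (dPhi z v) = flat_vec Om (L v)"
proof -
  have zp: "z \<in> points (flat E Br)" using z by simp
  note fv = flat_vec_tangent[OF z v]
  have "pushforward MGU R pr (\<Phi> z) (dPhi z v) = pushforward (flat E Br) R (\<lambda>z. pr (\<Phi> z)) z (flat_vec Br v)"
    unfolding dPhi_def by (rule pushforward_compose[OF aBr aU aR smooth_\<Phi> smooth_pr zp fv, symmetric])
  also have "\<dots> = pushforward (flat E Br) R L z (flat_vec Br v)"
    by (rule pushforward_cong[OF aBr aR smooth_map_compose[OF aBr aU aR smooth_\<Phi> smooth_pr] smooth_L zp fv])
      (simp add: pr_\<Phi>)
  also have "\<dots> = flat_vec Om (deriv_in E L z v)"
    by (rule pushforward_flat_flat[OF Br Om smooth_in_bounded_linear[OF Br L(1)] L_Om z v])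
  also have "deriv_in E L z v = L v"
    using z by (intro deriv_in_eq[OF subE _ v] bounded_linear_imp_has_derivative L(1)) (simp add: Br_def)
  finally show ?thesis .
qed

lemma fibering_pr: "fibering MGU R pr"
  unfolding fibering_def
proof (intro conjI ballI)
  show "smooth_map MGU R pr" by (rule smooth_pr)
  show "pr ` points MGU = points R"
  proof
    show "pr ` points MGU \<subseteq> points R" using smooth_map_points[OF smooth_pr] by blast
    show "points R \<subseteq> pr ` points MGU"
    proof
      fix y assume "y \<in> points R"
      then have y: "y \<in> Om" by simp
      then have "pr (\<Phi> (gg y)) = y" using pr_\<Phi>[OF gg_Br[OF y]] gg(3) by (simp add: Om_def)
      moreover have "\<Phi> (gg y) \<in> points MGU" unfolding pU by (rule \<Phi>U[OF gg_Br[OF y]])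
      ultimately show "y \<in> pr ` points MGU" by (metis imageI)
    qed
  qed
  fix x assume x: "x \<in> points MGU"
  then have xU: "x \<in> U" using pU by simp
  define z where "z = \<Psi> x"
  have z: "z \<in> Br" and xz: "x = \<Phi> z" using \<Psi>Br[OF xU] \<Phi>\<Psi>[OF xU] by (simp_all add: z_def)
  have "pr x \<in> Om" using smooth_map_points[OF smooth_pr x] by simp
  then have "tangent_space R (pr x) = flat_vec Om ` M" by (rule tangent_space_flat[OF Om])
  moreover have "pushforward MGU R pr x ` tangent_space MGU x = (\<lambda>v. flat_vec Om (L v)) ` E"
    unfolding xz tangent_MGU[OF z] image_image using pr_dPhi[OF z] by (intro image_cong) auto
  moreover have "L ` E = M" using L(2) gg(2,3) by force
  ultimately show "pushforward MGU R pr x ` tangent_space MGU x = tangent_space R (pr x)"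
    by (metis image_image)
qed

lemma section_exists: "\<exists>\<sigma>. cross_section MGU R pr \<sigma>"
proof -
  have g: "smooth_map R (flat E Br) gg"
    unfolding smooth_map_flat_flat[OF Om Br] using smooth_in_bounded_linear[OF Om gg(1)] gg_Br by blast
  have "cross_section MGU R pr (\<lambda>y. \<Phi> (gg y))"
    unfolding cross_section_def
  proof (intro conjI ballI)
    show "smooth_map R MGU (\<lambda>y. \<Phi> (gg y))" by (rule smooth_map_compose[OF aR aBr aU g smooth_\<Phi>])
    fix y assume "y \<in> points R"
    then show "pr (\<Phi> (gg y)) = y" using pr_\<Phi>[OF gg_Br[of y]] gg(3) by (simp add: Om_def)
  qed
  then show ?thesis by blast
qed

section \<open>The fibres as maximal integral manifolds\<close>

definition "fib y = {p \<in> U. pr p = y}"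
definition "fdom y = {e \<in> E0. gg y + e \<in> Br}"
definition "fmap y p = \<Psi> p - gg y"
definition "fpar y e = \<Phi> (gg y + e)"
text \<open>In the chart the fibre is the slice of the ball by gg y + E0. Subtracting gg y moves it
  into E0, because the model of a manifold has to be a linear subspace and not an affine
  one.\<close>

definition "fman y = \<lparr>mtop = subtopology (mtop MG) (fib y), model = E0, atlas = {(fib y, fmap y)}\<rparr>"

lemma fman_simps [simp]:
  "mtop (fman y) = subtopology (mtop MG) (fib y)" "model (fman y) = E0" "atlas (fman y) = {(fib y, fmap y)}"
  by (simp_all add: fman_def)

lemma fib_subset: "fib y \<subseteq> U" by (auto simp: fib_def)

lemma points_fman: "points (fman y) = fib y"
  using fib_subset openin_subset[OF Uo] by auto

context
  fixes y assumes y: "y \<in> Om"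
begin

lemma yM: "y \<in> M" and ggE: "gg y \<in> E" using y gg(2) by (auto simp: Om_def)

lemma fdom_open: "rel_open E0 (fdom y)"
proof -
  have "rel_open E0 {e \<in> E0. gg y + e \<in> ball 0 r}"
    by (intro rel_open_preimage_open rel_open_space E0(1) continuous_intros) simp
  moreover have "{e \<in> E0. gg y + e \<in> ball 0 r} = fdom y"
    using subspace_add[OF subE ggE] E0(2) by (auto simp: fdom_def Br_def)
  ultimately show ?thesis by simp
qed

lemma fmap_in: "p \<in> fib y \<Longrightarrow> fmap y p \<in> fdom y" and fpar_fmap: "p \<in> fib y \<Longrightarrow> fpar y (fmap y p) = p"
proof -
  assume p: "p \<in> fib y"
  then have pU: "p \<in> U" and L\<Psi>: "L (\<Psi> p) = y" by (auto simp: fib_def pr_def)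
  have \<Psi>E: "\<Psi> p \<in> E" using \<Psi>Br[OF pU] by (simp add: Br_def)
  then have dE: "\<Psi> p - gg y \<in> E" using ggE subspace_diff[OF subE] by blast
  have "L (\<Psi> p - gg y) = 0"
    using L\<Psi> gg(3)[OF yM] by (simp add: linear_diff[OF bounded_linear.linear[OF L(1)]])
  then show "fmap y p \<in> fdom y" using ker[OF dE] \<Psi>Br[OF pU] by (simp add: fdom_def fmap_def)
  show "fpar y (fmap y p) = p" using \<Phi>\<Psi>[OF pU] by (simp add: fpar_def fmap_def)
qed

lemma fpar_in: "e \<in> fdom y \<Longrightarrow> fpar y e \<in> fib y" and fmap_fpar: "e \<in> fdom y \<Longrightarrow> fmap y (fpar y e) = e"
proof -
  assume e: "e \<in> fdom y"
  then have eB: "gg y + e \<in> Br" and eE: "e \<in> E0" by (auto simp: fdom_def)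
  have "L (gg y + e) = y"
    using gg(3)[OF yM] ker[of e] eE E0(2) by (auto simp: linear_add[OF bounded_linear.linear[OF L(1)]])
  then show "fpar y e \<in> fib y" using pr_\<Phi>[OF eB] \<Phi>U[OF eB] by (simp add: fib_def fpar_def)
  show "fmap y (fpar y e) = e" using \<Psi>\<Phi> eB by (simp add: fmap_def fpar_def Br_def)
qed

lemma fmap_image: "fmap y ` fib y = fdom y"
proof (rule equalityI)
  show "fmap y ` fib y \<subseteq> fdom y" by (rule image_subsetI) (rule fmap_in)
  show "fdom y \<subseteq> fmap y ` fib y"
  proof
    fix e assume e: "e \<in> fdom y"
    show "e \<in> fmap y ` fib y" by (rule image_eqI[where x="fpar y e"]) (simp_all add: fmap_fpar[OF e] fpar_in[OF e])
  qed
qed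

lemma smooth_shift: "smooth_map (flat E0 (fdom y)) (flat E Br) (\<lambda>e. gg y + e)"
  unfolding smooth_map_flat_flat[OF fdom_open Br]
  using smooth_in_add[OF fdom_open smooth_in_const[OF fdom_open] smooth_in_id[OF fdom_open]] by (auto simp: fdom_def)

lemma smooth_fpar: "smooth_map (flat E0 (fdom y)) MGU (fpar y)"
  unfolding fpar_def by (rule smooth_map_compose[OF smooth_atlas_flat[OF fdom_open] aBr aU smooth_shift smooth_\<Phi>])

lemma fib_homeo: "homeomorphic_maps (subtopology (mtop MG) (fib y)) (top_of_set (fdom y)) (fmap y) (fpar y)"
  unfolding homeomorphic_maps_def
proof (intro conjI ballI)
  have c: "continuous_map (subtopology (mtop MG) U) euclidean \<Psi>"
    using smooth_map_continuous[OF smooth_\<Psi>] by (auto simp: continuous_map_in_subtopology)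
  have "continuous_map (subtopology (mtop MG) (fib y)) euclidean \<Psi>"
    using continuous_map_from_subtopology_mono[OF c fib_subset] .
  then have "continuous_map (subtopology (mtop MG) (fib y)) euclidean (fmap y)"
    unfolding fmap_def by (intro continuous_map_diff) auto
  then show "continuous_map (subtopology (mtop MG) (fib y)) (top_of_set (fdom y)) (fmap y)"
    using fmap_in by (auto simp: continuous_map_in_subtopology)
  have "continuous_map (top_of_set (fdom y)) (mtop MG) (fpar y)"
    using smooth_map_continuous[OF smooth_fpar] by (auto simp: continuous_map_in_subtopology)
  then show "continuous_map (top_of_set (fdom y)) (subtopology (mtop MG) (fib y)) (fpar y)"
    using fpar_in by (auto simp: continuous_map_in_subtopology)
  show "fpar y (fmap y p) = p" if "p \<in> topspace (subtopology (mtop MG) (fib y))" for p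
    using that fpar_fmap by simp
  show "fmap y (fpar y e) = e" if "e \<in> topspace (top_of_set (fdom y))" for e
    using that fmap_fpar by simp
qed

lemma chart_inv_fib:
  assumes "e \<in> fdom y" shows "chart_inv (fib y, fmap y) e = fpar y e"
proof -
  have "inj_on (fmap y) (fib y)" by (rule inj_on_inverseI[where g="fpar y"]) (rule fpar_fmap)
  then show ?thesis
    unfolding chart_inv_def fst_conv snd_conv by (rule inv_into_f_eq[where x="fpar y e" and f="fmap y" and A="fib y", OF _ fpar_in[OF assms] fmap_fpar[OF assms]])
qed

lemma fman_manifold: "smooth_manifold (fman y)"
  unfolding smooth_manifold_def
proof (intro conjI ballI)
  show "Hausdorff_space (mtop (fman y))" "second_countable (mtop (fman y))"
    using manG by (simp_all add: smooth_manifold_def Hausdorff_space_subtopology second_countable_subtopology)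
  show "subspace (model (fman y))" using E0(1) by simp
  show "(\<Union>c\<in>atlas (fman y). fst c) = points (fman y)" unfolding points_fman by simp
  fix c assume "c \<in> atlas (fman y)"
  then have c: "c = (fib y, fmap y)" by simp
  show "openin (mtop (fman y)) (fst c)" using openin_topspace[of "mtop (fman y)"] unfolding points_fman c by simp
  show "openin (top_of_set (model (fman y))) (snd c ` fst c)"
    using rel_openD(2)[OF fdom_open] by (simp add: c fmap_image)
  show "homeomorphic_map (subtopology (mtop (fman y)) (fst c)) (top_of_set (snd c ` fst c)) (snd c)"
    using fib_homeo by (auto simp: c fmap_image homeomorphic_map_maps subtopology_subtopology)
  fix d assume "d \<in> atlas (fman y)"
  then have d: "d = (fib y, fmap y)" by simp
  have "smooth_in E0 (fmap y \<circ> chart_inv (fib y, fmap y)) (fdom y)"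
    by (rule smooth_in_congI[OF fdom_open smooth_in_id[OF fdom_open]]) (simp add: chart_inv_fib fmap_fpar)
  then show "smooth_in (model (fman y)) (snd d \<circ> chart_inv c) (snd c ` (fst c \<inter> fst d))"
    by (simp add: c d fmap_image)
qed

lemmas aF = smooth_manifold_atlas[OF fman_manifold] and aD = smooth_atlas_flat[OF fdom_open]

lemma smooth_fmap: "smooth_map (fman y) (flat E0 (fdom y)) (fmap y)"
proof (rule smooth_map_flatI[OF aF fdom_open])
  show "fmap y x \<in> fdom y" if "x \<in> points (fman y)" for x using that fmap_in unfolding points_fman by blast
  fix c assume "c \<in> atlas (fman y)"
  then have c: "c = (fib y, fmap y)" by simp
  have "smooth_in E0 (\<lambda>e. fmap y (chart_inv (fib y, fmap y) e)) (fdom y)"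
    by (rule smooth_in_congI[OF fdom_open smooth_in_id[OF fdom_open]]) (simp add: chart_inv_fib fmap_fpar)
  then show "smooth_in (model (fman y)) (\<lambda>y'. fmap y (chart_inv c y')) (snd c ` fst c)"
    by (simp add: c fmap_image)
qed

lemma smooth_fpar': "smooth_map (flat E0 (fdom y)) (fman y) (fpar y)"
proof -
  have "smooth_map (flat E0 (fdom y)) (fman y) (chart_inv (fib y, fmap y))"
    using smooth_map_chart_inv[OF aF, of "(fib y, fmap y)"] by (simp add: fmap_image)
  then show ?thesis by (rule smooth_map_cong[OF aD aF]) (simp add: chart_inv_fib)
qed

text \<open>The inclusion is \<open>fpar y\<close> after \<open>fmap y\<close>, both of which are
  known to be smooth.\<close>

lemma smooth_fib_incl: "smooth_map (fman y) MGU (\<lambda>x. x)"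
  by (rule smooth_map_cong[OF aF aU smooth_map_compose[OF aF aD aU smooth_fmap smooth_fpar]])
    (unfold points_fman, rule fpar_fmap)

text \<open>The inclusion of the fibre is \<Phi> on a shifted piece of E0, so its differential has
  the values \<open>dPhi\<close> at vectors of E0. The last conclusion recovers t from v; with the
  injectivity of \<open>dPhi\<close> this gives the immersion property.\<close>

lemma tangent_fman:
  assumes p: "p \<in> fib y" and t: "t \<in> tangent_space (fman y) p"
  obtains v where "v \<in> E0" "pushforward (fman y) MGU (\<lambda>x. x) p t = dPhi (\<Psi> p) v"
    "t = pushforward (flat E0 (fdom y)) (fman y) (fpar y) (fmap y p) (flat_vec (fdom y) v)"
proof -
  define e where "e = fmap y p"
  have e: "e \<in> fdom y" and pe: "fpar y e = p" using fmap_in[OF p] fpar_fmap[OF p] by (simp_all add: e_def)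
  have pp: "p \<in> points (fman y)" unfolding points_fman by (rule p)
  have ep: "e \<in> points (flat E0 (fdom y))" using e by simp
  have "pushforward (flat E0 (fdom y)) (fman y) (fpar y) (fmap y p) (pushforward (fman y) (flat E0 (fdom y)) (fmap y) p t) = t"
    by (rule pushforward_inverse[OF aF aD smooth_fmap smooth_fpar' _ pp t]) (unfold points_fman, rule fpar_fmap)
  moreover have "pushforward (fman y) (flat E0 (fdom y)) (fmap y) p t \<in> flat_vec (fdom y) ` E0"
    using pushforward_tangent[OF aF aD smooth_fmap pp t] tangent_space_flat[OF fdom_open e] by (simp add: e_def)
  ultimately obtain v where v: "v \<in> E0" "t = pushforward (flat E0 (fdom y)) (fman y) (fpar y) e (flat_vec (fdom y) v)"
    unfolding e_def by auto
  have fv: "flat_vec (fdom y) v \<in> tangent_space (flat E0 (fdom y)) e" using tangent_space_flat[OF fdom_open e] v(1) by blast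
  have eE0: "e \<in> E0" using e by (simp add: fdom_def)
  have shift: "pushforward (flat E0 (fdom y)) (flat E Br) (\<lambda>e. gg y + e) e (flat_vec (fdom y) v) = flat_vec Br v"
  proof -
    have d: "((\<lambda>e. gg y + e) has_derivative (\<lambda>v. 0 + v)) (at e within E0)"
      by (intro has_derivative_add has_derivative_const has_derivative_ident)
    have "smooth_in E0 (\<lambda>e. gg y + e) (fdom y)" "(\<lambda>e. gg y + e) ` fdom y \<subseteq> Br"
      using smooth_shift unfolding smooth_map_flat_flat[OF fdom_open Br] by auto
    from pushforward_flat_flat[OF fdom_open Br this e v(1)] deriv_in_eq[OF E0(1) eE0 v(1) d]
    show ?thesis by simp
  qed
  have \<Psi>p: "gg y + e = \<Psi> p" by (simp add: e_def fmap_def)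
  have "pushforward (fman y) MGU (\<lambda>x. x) p t = pushforward (flat E0 (fdom y)) MGU (fpar y) e (flat_vec (fdom y) v)"
    using pushforward_compose[OF aD aF aU smooth_fpar' smooth_fib_incl ep fv] v(2) pe by simp
  also have "\<dots> = pushforward (flat E Br) MGU \<Phi> (gg y + e) (pushforward (flat E0 (fdom y)) (flat E Br) (\<lambda>e. gg y + e) e (flat_vec (fdom y) v))"
    unfolding fpar_def by (rule pushforward_compose[OF aD aBr aU smooth_shift smooth_\<Phi> ep fv])
  also have "\<dots> = dPhi (\<Psi> p) v" unfolding shift dPhi_def \<Psi>p ..
  finally show thesis using that v unfolding e_def by blast
qed

lemma tangent_fman_exists:
  assumes p: "p \<in> fib y" and v: "v \<in> E0"
  obtains t where "t \<in> tangent_space (fman y) p" "pushforward (fman y) MGU (\<lambda>x. x) p t = dPhi (\<Psi> p) v"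
proof -
  define e where "e = fmap y p"
  have e: "e \<in> fdom y" and pe: "fpar y e = p" using fmap_in[OF p] fpar_fmap[OF p] by (simp_all add: e_def)
  have ep: "e \<in> points (flat E0 (fdom y))" using e by simp
  have fv: "flat_vec (fdom y) v \<in> tangent_space (flat E0 (fdom y)) e" using tangent_space_flat[OF fdom_open e] v by blast
  define t where "t = pushforward (flat E0 (fdom y)) (fman y) (fpar y) e (flat_vec (fdom y) v)"
  have t: "t \<in> tangent_space (fman y) p"
    using pushforward_tangent[OF aD aF smooth_fpar' ep fv] pe by (simp add: t_def)
  obtain v' where v': "v' \<in> E0" "pushforward (fman y) MGU (\<lambda>x. x) p t = dPhi (\<Psi> p) v'"
    "t = pushforward (flat E0 (fdom y)) (fman y) (fpar y) (fmap y p) (flat_vec (fdom y) v')"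
    by (rule tangent_fman[OF p t])
  have inv: "pushforward (fman y) (flat E0 (fdom y)) (fmap y) (fpar y e)
      (pushforward (flat E0 (fdom y)) (fman y) (fpar y) e (flat_vec (fdom y) w)) = flat_vec (fdom y) w" if "w \<in> E0" for w
    using that tangent_space_flat[OF fdom_open e]
    by (intro pushforward_inverse[OF aD aF smooth_fpar' smooth_fmap _ ep]) (auto simp: fmap_fpar)
  have eq: "pushforward (flat E0 (fdom y)) (fman y) (fpar y) e (flat_vec (fdom y) v)
      = pushforward (flat E0 (fdom y)) (fman y) (fpar y) e (flat_vec (fdom y) v')"
    using v'(3) unfolding t_def e_def[symmetric] .
  from inv[OF v'(1)] inv[OF v, unfolded eq] have "v = v'" by simp
  then show thesis using that[OF t] v'(2) by simp
qed

lemma fib_integral: "integral_manifold MGU omU (fman y)"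
  unfolding integral_manifold_def
proof (intro conjI ballI)
  show "smooth_manifold (fman y)" by (rule fman_manifold)
  show "points (fman y) \<subseteq> points MGU" unfolding points_fman pU by (rule fib_subset)
  have "0 \<in> fdom y" using gg_Br[OF y] subspace_0[OF E0(1)] by (simp add: fdom_def)
  then show "points (fman y) \<noteq> {}" using fpar_in unfolding points_fman by blast
  \<comment> \<open>Connectedness of the fibre: in its chart it is E0 intersected with a translate
    of the convex set \<open>Br\<close>.\<close>
  have "convex (fdom y)"
  proof -
    have "e \<in> fdom y \<longleftrightarrow> e \<in> E0 \<inter> (+) (- gg y) ` Br" for e
      by (auto simp: fdom_def image_iff intro: bexI[of _ "gg y + e"])
    then have "fdom y = E0 \<inter> (+) (- gg y) ` Br" by blast
    moreover have "convex ((+) (- gg y) ` Br)"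
      unfolding Br_def using subE by (intro convex_translation convex_Int convex_ball subspace_imp_convex)
    ultimately show ?thesis using E0(1) by (simp add: convex_Int subspace_imp_convex)
  qed
  then have "connected_space (top_of_set (fdom y))"
    by (simp add: convex_connected connected_space_subtopology)
  moreover have "top_of_set (fdom y) homeomorphic_space subtopology (mtop MG) (fib y)"
    using fib_homeo homeomorphic_maps_sym homeomorphic_space_def by blast
  ultimately show "connected_space (mtop (fman y))"
    using homeomorphic_connected_space by auto
  show "smooth_map (fman y) MGU (\<lambda>x. x)" by (rule smooth_fib_incl)
  fix p assume "p \<in> points (fman y)"
  then have p: "p \<in> fib y" unfolding points_fman .
  then have pU': "p \<in> U" using fib_subset by blast
  define z where "z = \<Psi> p"
  have z: "z \<in> Br" and pz: "\<Phi> z = p" using \<Psi>Br[OF pU'] \<Phi>\<Psi>[OF pU'] by (simp_all add: z_def)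
  show "inj_on (pushforward (fman y) MGU (\<lambda>x. x) p) (tangent_space (fman y) p)"
  proof (rule inj_onI)
    fix s t assume s: "s \<in> tangent_space (fman y) p" and t: "t \<in> tangent_space (fman y) p"
      and eq: "pushforward (fman y) MGU (\<lambda>x. x) p s = pushforward (fman y) MGU (\<lambda>x. x) p t"
    obtain v where v: "v \<in> E0" "pushforward (fman y) MGU (\<lambda>x. x) p s = dPhi (\<Psi> p) v"
      "s = pushforward (flat E0 (fdom y)) (fman y) (fpar y) (fmap y p) (flat_vec (fdom y) v)"
      by (rule tangent_fman[OF p s])
    obtain w where w: "w \<in> E0" "pushforward (fman y) MGU (\<lambda>x. x) p t = dPhi (\<Psi> p) w"
      "t = pushforward (flat E0 (fdom y)) (fman y) (fpar y) (fmap y p) (flat_vec (fdom y) w)"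
      by (rule tangent_fman[OF p t])
    have "v = w" using dPhi_inj[OF z, of v w] v w eq E0(2) by (auto simp: z_def)
    then show "s = t" using v(3) w(3) by simp
  qed
  show "pushforward (fman y) MGU (\<lambda>x. x) p ` tangent_space (fman y) p = {t \<in> tangent_space MGU p. omU p t = 0}"
  proof
    show "pushforward (fman y) MGU (\<lambda>x. x) p ` tangent_space (fman y) p \<subseteq> {t \<in> tangent_space MGU p. omU p t = 0}"
    proof
      fix t' assume "t' \<in> pushforward (fman y) MGU (\<lambda>x. x) p ` tangent_space (fman y) p"
      then obtain t where t: "t \<in> tangent_space (fman y) p" "t' = pushforward (fman y) MGU (\<lambda>x. x) p t" by blast
      obtain v where v: "v \<in> E0" "pushforward (fman y) MGU (\<lambda>x. x) p t = dPhi (\<Psi> p) v"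
        by (rule tangent_fman[OF p t(1)])
      have vE: "v \<in> E" using v(1) E0(2) by blast
      have "t' = dPhi z v" using t(2) v(2) by (simp add: z_def)
      then show "t' \<in> {t \<in> tangent_space MGU p. omU p t = 0}"
        using omU_zero[OF z vE] tangent_MGU[OF z] v(1) vE by (simp add: pz)
    qed
    show "{t \<in> tangent_space MGU p. omU p t = 0} \<subseteq> pushforward (fman y) MGU (\<lambda>x. x) p ` tangent_space (fman y) p"
    proof
      fix t' assume t': "t' \<in> {t \<in> tangent_space MGU p. omU p t = 0}"
      then obtain v where v: "v \<in> E" "t' = dPhi z v" using tangent_MGU[OF z] by (auto simp: pz)
      then have v0: "v \<in> E0" using omU_zero[OF z v(1)] t' by (simp add: pz)
      obtain t where "t \<in> tangent_space (fman y) p" "pushforward (fman y) MGU (\<lambda>x. x) p t = dPhi (\<Psi> p) v"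
        by (rule tangent_fman_exists[OF p v0])
      then show "t' \<in> pushforward (fman y) MGU (\<lambda>x. x) p ` tangent_space (fman y) p"
        using v(2) by (force simp: z_def)
    qed
  qed
qed

text \<open>A competitor N' may carry a topology of its own, so \<open>pr\<close> is composed with
  the inclusion of N' and shown to be constant there. As N' contains the fibre over y, the constant
  is y.\<close>

lemma fib_maximal: "maximal_integral_manifold MGU omU (fman y)"
  unfolding maximal_integral_manifold_def
proof (intro conjI allI impI fib_integral)
  fix N' assume N': "integral_manifold MGU omU N' \<and> points (fman y) \<subseteq> points N'"
  then have N: "smooth_atlas N'" "points N' \<subseteq> U" "connected_space (mtop N')" "smooth_map N' MGU (\<lambda>x. x)"
    and ker': "\<And>x. x \<in> points N' \<Longrightarrow> pushforward N' MGU (\<lambda>x. x) x ` tangent_space N' x = {t \<in> tangent_space MGU x. omU x t = 0}"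
    unfolding integral_manifold_def pU by (auto intro: smooth_manifold_atlas)
  note sm = smooth_map_compose[OF N(1) aU aR N(4) smooth_pr]
  have zero: "pushforward N' R (\<lambda>x. pr x) x t = flat_vec Om 0" if x: "x \<in> points N'" and t: "t \<in> tangent_space N' x" for x t
  proof -
    have xU: "x \<in> U" using N(2) x by blast
    define z where "z = \<Psi> x"
    have z: "z \<in> Br" and xz: "\<Phi> z = x" using \<Psi>Br[OF xU] \<Phi>\<Psi>[OF xU] by (simp_all add: z_def)
    have "pushforward N' MGU (\<lambda>x. x) x t \<in> {t \<in> tangent_space MGU x. omU x t = 0}" using ker'[OF x] t by blast
    then obtain v where v: "v \<in> E" "pushforward N' MGU (\<lambda>x. x) x t = dPhi z v" "omU x (dPhi z v) = 0"
      using tangent_MGU[OF z] by (auto simp: xz)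
    then have "L v = 0" using omU_zero[OF z v(1)] ker[OF v(1)] by (simp add: xz)
    then show ?thesis
      using pushforward_compose[OF N(1) aU aR N(4) smooth_pr x t] v(2) pr_dPhi[OF z v(1)] by (simp add: xz)
  qed
  have p0: "fpar y 0 \<in> fib y" using gg_Br[OF y] subspace_0[OF E0(1)] by (intro fpar_in) (simp add: fdom_def)
  then have p0': "fpar y 0 \<in> points N'" using N' unfolding points_fman by blast
  have "points N' \<subseteq> fib y"
  proof
    fix p assume p: "p \<in> points N'"
    have "pr p = pr (fpar y 0)" by (rule constant_if_pushforward_zero[OF N(1) Om sm zero N(3) p0' p])
    then show "p \<in> fib y" using p0 p N(2) by (auto simp: fib_def)
  qed
  then show "points N' = points (fman y)" using N' unfolding points_fman by blast
qed

end

text \<open>For the last claim: if \<omega> annihilates the image of v under \<sigma>, this image is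
  tangent to a fibre, hence killed by the differential of \<open>pr\<close>; but \<open>pr\<close>
  after \<sigma> is the identity, so v = 0.\<close>

lemma cross_section_logd:
  assumes \<sigma>: "cross_section MGU R pr \<sigma>"
  shows "smooth_map R MG \<sigma>"
    and "y \<in> Om \<Longrightarrow> v \<in> M \<Longrightarrow> pullback R MG \<sigma> om y (flat_vec Om v) = L (logd M \<sigma> y v)"
    and "y \<in> Om \<Longrightarrow> v \<in> M \<Longrightarrow> L (logd M \<sigma> y v) = 0 \<Longrightarrow> v = 0"
proof -
  have \<sigma>U: "smooth_map R MGU \<sigma>" using \<sigma> unfolding cross_section_def by (rule conjunct1)
  have sec: "pr (\<sigma> y) = y" if "y \<in> Om" for y
    using conjunct2[OF \<sigma>[unfolded cross_section_def]] that by simp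
  show \<sigma>G: "smooth_map R MG \<sigma>" using smooth_map_compose[OF aR aU atl \<sigma>U incl] .
  show "pullback R MG \<sigma> om y (flat_vec Om v) = L (logd M \<sigma> y v)" if y: "y \<in> Om" and v: "v \<in> M"
    unfolding pullback_def pushforward_logd[OF Om \<sigma>G y v]
    by (rule om[OF flat_in_carrier[OF \<sigma>G y] logd_in_model[OF Om \<sigma>G y v]])
  assume y: "y \<in> Om" and v: "v \<in> M" and zero: "L (logd M \<sigma> y v) = 0"
  have yp: "y \<in> points R" using y by simp
  have fv: "flat_vec Om v \<in> tangent_space R y" using tangent_space_flat[OF Om y] v by blast
  have \<sigma>y: "\<sigma> y \<in> U" using smooth_map_points[OF \<sigma>U yp] pU by simp
  define z where "z = \<Psi> (\<sigma> y)"
  have z: "z \<in> Br" and \<sigma>z: "\<Phi> z = \<sigma> y" using \<Psi>Br[OF \<sigma>y] \<Phi>\<Psi>[OF \<sigma>y] by (simp_all add: z_def)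
  have "pushforward R MGU \<sigma> y (flat_vec Om v) \<in> tangent_space MGU (\<sigma> y)"
    by (rule pushforward_tangent[OF aR aU \<sigma>U yp fv])
  then obtain u where u: "u \<in> E" "pushforward R MGU \<sigma> y (flat_vec Om v) = dPhi z u"
    using tangent_MGU[OF z] by (auto simp: \<sigma>z)
  have "omU (\<sigma> y) (dPhi z u) = om (\<sigma> y) (pushforward R MG \<sigma> y (flat_vec Om v))"
    unfolding pullback_def u(2)[symmetric] using pushforward_compose[OF aR aU atl \<sigma>U incl yp fv] by simp
  also have "\<dots> = L (logd M \<sigma> y v)"
    unfolding pushforward_logd[OF Om \<sigma>G y v]
    by (rule om[OF flat_in_carrier[OF \<sigma>G y] logd_in_model[OF Om \<sigma>G y v]])
  finally have "u \<in> E0" using omU_zero[OF z u(1)] zero by (simp add: \<sigma>z)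
  then have Lu: "L u = 0" using ker[OF u(1)] by simp
  have "pushforward R R (\<lambda>y. pr (\<sigma> y)) y (flat_vec Om v) = flat_vec Om (L u)"
    using pushforward_compose[OF aR aU aR \<sigma>U smooth_pr yp fv] u(2) pr_dPhi[OF z u(1)] by (simp add: \<sigma>z)
  moreover have "pushforward R R (\<lambda>y. pr (\<sigma> y)) y (flat_vec Om v) = flat_vec Om v"
    using pushforward_cong[OF aR aR smooth_map_compose[OF aR aU aR \<sigma>U smooth_pr] smooth_map_id[OF aR] yp fv]
      pushforward_id[OF aR yp fv] sec by simp
  ultimately show "v = 0" using Lu by simp
qed

end

section \<open>Differential Lie algebras\<close>

text \<open>Some bounded linear extension of a map that is linear on A. The identification \<kappa>,
  the projection to M and the maps built from S and the bracket are given on subspaces, but smooth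
  functions have to be composed with them.\<close>

definition linext :: "'a::euclidean_space set \<Rightarrow> ('a \<Rightarrow> 'b::euclidean_space) \<Rightarrow> 'a \<Rightarrow> 'b" where
  "linext A f = (SOME g. bounded_linear g \<and> (\<forall>x\<in>A. g x = f x))"

lemma linext:
  assumes A: "subspace A" and add: "\<And>x y. x \<in> A \<Longrightarrow> y \<in> A \<Longrightarrow> f (x + y) = f x + f y"
    and scale: "\<And>r x. x \<in> A \<Longrightarrow> f (r *\<^sub>R x) = r *\<^sub>R f x"
  shows "bounded_linear (linext A f)" and "x \<in> A \<Longrightarrow> linext A f x = f x"
proof -
  obtain P where P: "bounded_linear P" "\<And>x. P x \<in> A" "\<And>x. x \<in> A \<Longrightarrow> P x = x"
    by (rule obtain_projection[OF A]) (rule that)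
  interpret P: bounded_linear P by (rule P(1))
  have "linear (\<lambda>x. f (P x))"
    by (rule linearI) (simp_all add: P.add P.scaleR add scale P(2))
  then have "\<exists>g. bounded_linear g \<and> (\<forall>x\<in>A. g x = f x)"
    using P(3) linear_conv_bounded_linear by (intro exI[of _ "\<lambda>x. f (P x)"]) auto
  from someI_ex[OF this] show "bounded_linear (linext A f)" "x \<in> A \<Longrightarrow> linext A f x = f x"
    unfolding linext_def by blast+
qed

text \<open>Here \<open>g (L x)\<close> is the component of \<open>x\<close> orthogonal to the kernel.\<close>

lemma obtain_contracting_inverse:
  fixes L :: "'a::euclidean_space \<Rightarrow> 'b::euclidean_space"
  assumes L: "bounded_linear L" and E: "subspace E" and E0: "subspace E0" "E0 \<subseteq> E"
    and ker: "\<And>x. x \<in> E \<Longrightarrow> L x = 0 \<longleftrightarrow> x \<in> E0"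
  obtains g where "bounded_linear g" "\<And>x. x \<in> E \<Longrightarrow> g (L x) \<in> E" "\<And>x. x \<in> E \<Longrightarrow> L (g (L x)) = L x"
    "\<And>x. x \<in> E \<Longrightarrow> norm (g (L x)) \<le> norm x"
proof -
  interpret L: bounded_linear L by (rule L)
  obtain P where P: "bounded_linear P" "\<And>x. P x \<in> E0" "\<And>x y. y \<in> E0 \<Longrightarrow> (x - P x) \<bullet> y = 0"
    by (rule obtain_projection[OF E0(1)]) (rule that)
  interpret P: bounded_linear P by (rule P(1))
  define Q where "Q x = x - P x" for x
  have Q: "linear Q" by (rule linearI) (simp_all add: Q_def P.add P.scaleR scaleR_diff_right)
  have QE: "Q x \<in> E" if "x \<in> E" for x
    unfolding Q_def using P(2)[of x] E0(2) by (intro subspace_diff[OF E that]) blast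
  have LP: "L (P x) = 0" for x using ker[of "P x"] P(2)[of x] E0(2) by blast
  have LQ: "L (Q x) = L x" for x by (simp add: Q_def L.diff LP)
  have inj: "inj_on L (Q ` E)"
  proof (rule inj_onI)
    fix a b assume ab: "a \<in> Q ` E" "b \<in> Q ` E" "L a = L b"
    then obtain x x' where x: "x \<in> E" "x' \<in> E" "a = Q x" "b = Q x'" by blast
    define d where "d = x - x'"
    have d: "a - b = Q d" by (simp add: x d_def linear_diff[OF Q])
    have "L (Q d) = 0" using ab(3) by (simp add: d[symmetric] L.diff)
    then have "Q d \<in> E0" using ker[OF QE[of d]] subspace_diff[OF E x(1,2)] by (simp add: d_def)
    \<comment> \<open>Q d lies in E0 and is orthogonal to E0, hence to itself.\<close>
    from P(3)[OF this, of d] have "Q d = 0" by (simp add: Q_def)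
    then show "a = b" using d by simp
  qed
  obtain g where g: "linear g" "\<And>v. v \<in> Q ` E \<Longrightarrow> g (L v) = v"
    using linear_exists_left_inverse_on[OF L.linear linear_subspace_image[OF Q E] inj] by blast
  have gL: "g (L x) = Q x" if "x \<in> E" for x
    using g(2)[of "Q x"] that by (simp add: LQ)
  have nQ: "norm (Q x) \<le> norm x" for x
  proof -
    have o: "Q x \<bullet> P x = 0" using P(3)[OF P(2)] by (simp add: Q_def)
    have "x = Q x + P x" by (simp add: Q_def)
    then have "norm x ^ 2 = norm (Q x) ^ 2 + norm (P x) ^ 2"
      using norm_add_Pythagorean[of "Q x" "P x"] o by (simp add: orthogonal_def)
    then have "norm (Q x) ^ 2 \<le> norm x ^ 2" by simp
    then show ?thesis by (rule power2_le_imp_le) simp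
  qed
  show thesis
    by (rule that[of g]) (use g(1) gL QE LQ nQ in \<open>simp_all add: linear_conv_bounded_linear\<close>)
qed

lemma bij_betw_linear_self:
  fixes f :: "'a::euclidean_space \<Rightarrow> 'a"
  assumes f: "linear f" and M: "subspace M" and im: "\<And>v. v \<in> M \<Longrightarrow> f v \<in> M"
    and inj: "\<And>v. v \<in> M \<Longrightarrow> f v = 0 \<Longrightarrow> v = 0"
  shows "bij_betw f M M"
proof -
  have i: "inj_on f M"
    using linear_injective_on_subspace_0[OF f M] inj by blast
  then have "dim (f ` M) = dim M" by (intro dim_image_eq[OF f] inj_on_subset[OF i span_minimal[OF order_refl M]])
  then have "f ` M = M" using im by (intro subspace_dim_equal linear_subspace_image[OF f] M) auto
  then show ?thesis using i by (simp add: bij_betw_def)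
qed

section \<open>A differential Lie algebra in the coordinates of the group\<close>

locale differential_lie_group = lie_grp G MG
  for G :: "'g monoid" (structure) and MG :: "('g, 'e::euclidean_space) manifold" +
  fixes J M J0 :: "'j::euclidean_space set" and br :: "'j \<Rightarrow> 'j \<Rightarrow> 'j"
    and k :: nat and V :: "int \<Rightarrow> 'j set" and app :: "'j \<Rightarrow> 'j \<Rightarrow> 'j" and \<kappa> :: "('g, 'e) tvec \<Rightarrow> 'j"
  assumes dla: "differential_lie_algebra k V app J br M J0"
    and ident: "lie_algebra_identification G MG J br \<kappa>"
begin

lemma lie_J: "lie_algebra J br" and J0: "subspace J0" "\<And>x y. x \<in> J0 \<Longrightarrow> y \<in> J0 \<Longrightarrow> br x y \<in> J0"
  and M: "subspace M" and sum_J: "{m + a | m a. m \<in> M \<and> a \<in> J0} = J" and M_Int_J0: "M \<inter> J0 = {0}"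
  and jet_space: "jet_space k V app" and M_jet: "M = jet_carrier k V"
  and \<rho>: "\<And>a. a \<in> J0 \<Longrightarrow> (\<lambda>x\<in>M. proj_along M J0 (br a x)) \<in> jet_endos k V"
proof -
  have d: "lie_algebra J br" "subspace J0" "\<forall>x\<in>J0. \<forall>y\<in>J0. br x y \<in> J0"
    "subspace M" "{m + a | m a. m \<in> M \<and> a \<in> J0} = J" "M \<inter> J0 = {0}"
    "jet_space k V app" "M = jet_carrier k V"
    "\<forall>a\<in>J0. (\<lambda>x\<in>M. proj_along M J0 (br a x)) \<in> jet_endos k V"
    using dla unfolding differential_lie_algebra_def by - (elim conjE, assumption)+
  show "lie_algebra J br" "subspace J0" "subspace M" "{m + a | m a. m \<in> M \<and> a \<in> J0} = J" "M \<inter> J0 = {0}"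
    "jet_space k V app" "M = jet_carrier k V" by (fact d)+
  show "x \<in> J0 \<Longrightarrow> y \<in> J0 \<Longrightarrow> br x y \<in> J0" for x y by (rule bspec[OF bspec[OF d(3)]])
  show "a \<in> J0 \<Longrightarrow> (\<lambda>x\<in>M. proj_along M J0 (br a x)) \<in> jet_endos k V" for a by (rule bspec[OF d(9)])
qed

sublocale jet k V app by (unfold_locales) (rule jet_space)

definition "S = (SOME S. (\<forall>x\<in>M. S x \<in> jet_endos k V) \<and>
          (\<forall>x\<in>M. \<forall>y\<in>M. \<forall>z\<in>M. S (x + y) z = S x z + S y z) \<and>
          (\<forall>r. \<forall>x\<in>M. \<forall>z\<in>M. S (r *\<^sub>R x) z = r *\<^sub>R S x z) \<and>
          (\<forall>x\<in>M. \<forall>y\<in>M.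
             proj_along M J0 (br x y) = bracket0 k V app x y + (S x y - S y x)))"

lemma S: "x \<in> M \<Longrightarrow> S x \<in> jet_endos k V"
  "x \<in> M \<Longrightarrow> y \<in> M \<Longrightarrow> z \<in> M \<Longrightarrow> S (x + y) z = S x z + S y z"
  "x \<in> M \<Longrightarrow> z \<in> M \<Longrightarrow> S (r *\<^sub>R x) z = r *\<^sub>R S x z"
  "x \<in> M \<Longrightarrow> y \<in> M \<Longrightarrow> proj_along M J0 (br x y) = bracket0 k V app x y + (S x y - S y x)"
proof -
  have "\<exists>S. (\<forall>x\<in>M. S x \<in> jet_endos k V) \<and>
          (\<forall>x\<in>M. \<forall>y\<in>M. \<forall>z\<in>M. S (x + y) z = S x z + S y z) \<and>
          (\<forall>r. \<forall>x\<in>M. \<forall>z\<in>M. S (r *\<^sub>R x) z = r *\<^sub>R S x z) \<and>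
          (\<forall>x\<in>M. \<forall>y\<in>M.
             proj_along M J0 (br x y) = bracket0 k V app x y + (S x y - S y x))"
    using dla unfolding differential_lie_algebra_def by (elim conjE)
  note s = someI_ex[OF this, folded S_def]
  note s1 = conjunct1[OF s] and s2 = conjunct1[OF conjunct2[OF s]]
    and s3 = conjunct1[OF conjunct2[OF conjunct2[OF s]]] and s4 = conjunct2[OF conjunct2[OF conjunct2[OF s]]]
  show "x \<in> M \<Longrightarrow> S x \<in> jet_endos k V" by (rule bspec[OF s1])
  show "x \<in> M \<Longrightarrow> y \<in> M \<Longrightarrow> z \<in> M \<Longrightarrow> S (x + y) z = S x z + S y z" by (rule bspec[OF bspec[OF bspec[OF s2]]])
  show "x \<in> M \<Longrightarrow> z \<in> M \<Longrightarrow> S (r *\<^sub>R x) z = r *\<^sub>R S x z" by (rule bspec[OF bspec[OF spec[OF s3]]])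
  show "x \<in> M \<Longrightarrow> y \<in> M \<Longrightarrow> proj_along M J0 (br x y) = bracket0 k V app x y + (S x y - S y x)"
    by (rule bspec[OF bspec[OF s4]])
qed

lemma J: "subspace J" and br_in: "x \<in> J \<Longrightarrow> y \<in> J \<Longrightarrow> br x y \<in> J"
  and br_add1: "x \<in> J \<Longrightarrow> y \<in> J \<Longrightarrow> z \<in> J \<Longrightarrow> br (x + y) z = br x z + br y z"
  and br_add2: "x \<in> J \<Longrightarrow> y \<in> J \<Longrightarrow> z \<in> J \<Longrightarrow> br z (x + y) = br z x + br z y"
  and br_scale1: "x \<in> J \<Longrightarrow> y \<in> J \<Longrightarrow> br (r *\<^sub>R x) y = r *\<^sub>R br x y"
  and br_scale2: "x \<in> J \<Longrightarrow> y \<in> J \<Longrightarrow> br x (r *\<^sub>R y) = r *\<^sub>R br x y"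
  and br_self: "x \<in> J \<Longrightarrow> br x x = 0"
  using lie_J unfolding lie_algebra_def by (elim conjE; blast)+

lemma br_skew: "x \<in> J \<Longrightarrow> y \<in> J \<Longrightarrow> br y x = - br x y"
proof -
  assume x: "x \<in> J" and y: "y \<in> J"
  have "br (x + y) (x + y) = br x x + br x y + (br y x + br y y)"
    by (simp add: br_add1[OF x y subspace_add[OF J x y]] br_add2[OF x y x] br_add2[OF x y y])
  then have "br x y + br y x = 0" using br_self x y subspace_add[OF J x y] by simp
  then show "br y x = - br x y" by (simp add: eq_neg_iff_add_eq_0 add.commute)
qed

abbreviation "prM \<equiv> proj_along M J0"

lemma M_J: "m \<in> M \<Longrightarrow> m \<in> J" and J0_J: "a \<in> J0 \<Longrightarrow> a \<in> J"
  unfolding sum_J[symmetric] using subspace_0[OF M] subspace_0[OF J0(1)] by force+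

lemma prM_eq:
  assumes m: "m \<in> M" and a: "a \<in> J0" shows "prM (m + a) = m"
  unfolding proj_along_def
proof (rule the_equality)
  show "m \<in> M \<and> (\<exists>a'\<in>J0. m + a = m + a')" using m a by blast
  fix m' assume "m' \<in> M \<and> (\<exists>a'\<in>J0. m + a = m' + a')"
  then obtain a' where a': "m' \<in> M" "a' \<in> J0" "m + a = m' + a'" by blast
  have e: "m' - m = a - a'" using a'(3) by (simp add: algebra_simps)
  have "m' - m \<in> M" by (rule subspace_diff[OF M a'(1) m])
  moreover have "m' - m \<in> J0" unfolding e by (rule subspace_diff[OF J0(1) a a'(2)])
  ultimately have "m' - m = 0" using M_Int_J0 by blast
  then show "m' = m" by simp
qed

lemma J_cases:
  assumes "x \<in> J" obtains m a where "m \<in> M" "a \<in> J0" "x = m + a"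
  using assms unfolding sum_J[symmetric] by blast

lemma prM_M: "m \<in> M \<Longrightarrow> prM m = m" and prM_J0: "a \<in> J0 \<Longrightarrow> prM a = 0"
  using prM_eq[of m 0] prM_eq[of 0 a] subspace_0[OF M] subspace_0[OF J0(1)] by simp_all

lemma prM_in: "x \<in> J \<Longrightarrow> prM x \<in> M" and diff_prM: "x \<in> J \<Longrightarrow> x - prM x \<in> J0"
proof -
  assume "x \<in> J"
  then obtain m a where "m \<in> M" "a \<in> J0" "x = m + a" by (rule J_cases)
  then show "prM x \<in> M" "x - prM x \<in> J0" by (simp_all add: prM_eq)
qed

lemma prM_add: "x \<in> J \<Longrightarrow> y \<in> J \<Longrightarrow> prM (x + y) = prM x + prM y"
  using prM_eq[OF subspace_add[OF M prM_in[of x] prM_in[of y]] subspace_add[OF J0(1) diff_prM[of x] diff_prM[of y]]]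
  by (simp add: algebra_simps)

lemma prM_scale: "x \<in> J \<Longrightarrow> prM (r *\<^sub>R x) = r *\<^sub>R prM x"
  using prM_eq[OF subspace_scale[OF M prM_in[of x], of r] subspace_scale[OF J0(1) diff_prM[of x], of r]]
  by (simp add: algebra_simps)

lemma prM_zero_iff: "x \<in> J \<Longrightarrow> prM x = 0 \<longleftrightarrow> x \<in> J0"
  using diff_prM[of x] prM_J0[of x] by force

text \<open>The identification of the Lie algebra with J, read in the coordinates of
  \<open>c0\<close>, so that logarithmic derivatives can be inserted.\<close>

definition "\<kappa>E v = \<kappa> (tvec_of MG \<one> c0 v)"

lemma \<kappa>_linear: "linear_on_tangent MG \<one> \<kappa>" and \<kappa>_bij: "bij_betw \<kappa> (tangent_space MG \<one>) J"
  and \<kappa>_br: "s \<in> tangent_space MG \<one> \<Longrightarrow> t \<in> tangent_space MG \<one> \<Longrightarrow>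
     \<kappa> (lie_bracket MG (left_invariant_field G MG s) (left_invariant_field G MG t) \<one>) = br (\<kappa> s) (\<kappa> t)"
  using ident unfolding lie_algebra_identification_def by blast+

lemma \<kappa>E_add:
  assumes "u \<in> E" "v \<in> E" shows "\<kappa>E (u + v) = \<kappa>E u + \<kappa>E v"
proof -
  note t = tvec_one[OF assms(1)] tvec_one[OF assms(2)] and uv = subspace_add[OF subE assms]
  have "tvec_of MG \<one> c0 (u + v) = (\<lambda>c. tvec_of MG \<one> c0 u c + tvec_of MG \<one> c0 v c)"
    by (rule tangent_space_eqI[OF tvec_one[OF uv] tangent_space_add[OF atl t] c0_at])
      (simp add: tvec_of_self[OF atl c0_at] assms uv)
  then show ?thesis using \<kappa>_linear t unfolding linear_on_tangent_def \<kappa>E_def by simp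
qed

lemma \<kappa>E_scale:
  assumes "v \<in> E" shows "\<kappa>E (r *\<^sub>R v) = r *\<^sub>R \<kappa>E v"
proof -
  note t = tvec_one[OF assms] and rv = subspace_scale[OF subE assms]
  have "tvec_of MG \<one> c0 (r *\<^sub>R v) = (\<lambda>c. r *\<^sub>R tvec_of MG \<one> c0 v c)"
    by (rule tangent_space_eqI[OF tvec_one[OF rv] tangent_space_scale[OF atl t] c0_at])
      (simp add: tvec_of_self[OF atl c0_at] assms rv)
  then show ?thesis using \<kappa>_linear t unfolding linear_on_tangent_def \<kappa>E_def by simp
qed

lemma \<kappa>E_in: "v \<in> E \<Longrightarrow> \<kappa>E v \<in> J"
  unfolding \<kappa>E_def using bij_betwE[OF \<kappa>_bij] tvec_one by blast

lemma \<kappa>E_inj: "u \<in> E \<Longrightarrow> v \<in> E \<Longrightarrow> \<kappa>E u = \<kappa>E v \<Longrightarrow> u = v"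
proof -
  assume u: "u \<in> E" and v: "v \<in> E" and e: "\<kappa>E u = \<kappa>E v"
  have "tvec_of MG \<one> c0 u = tvec_of MG \<one> c0 v"
    by (rule inj_onD[OF bij_betw_imp_inj_on[OF \<kappa>_bij] e[unfolded \<kappa>E_def] tvec_one[OF u] tvec_one[OF v]])
  from arg_cong[OF this, of "\<lambda>t. t c0"] show "u = v" by (simp add: tvec_of_self[OF atl c0_at] u v)
qed

lemma \<kappa>E_surj:
  assumes "x \<in> J" obtains v where "v \<in> E" "\<kappa>E v = x"
proof -
  have "x \<in> \<kappa> ` tangent_space MG \<one>" using assms bij_betw_imp_surj_on[OF \<kappa>_bij] by simp
  then obtain t where t: "t \<in> tangent_space MG \<one>" "\<kappa> t = x" by blast
  have tE: "t c0 \<in> E" using t(1) c0_at unfolding tangent_space_def by blast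
  have "tvec_of MG \<one> c0 (t c0) = t"
    by (rule tangent_space_eqI[OF tvec_one[OF tE] t(1) c0_at]) (rule tvec_of_self[OF atl c0_at tE])
  then show thesis using that[OF tE] t(2) by (simp add: \<kappa>E_def)
qed

lemma \<kappa>E_cbr: "u \<in> E \<Longrightarrow> v \<in> E \<Longrightarrow> \<kappa>E (cbr u v) = br (\<kappa>E u) (\<kappa>E v)"
  using \<kappa>_br[OF tvec_one tvec_one, of u v] unfolding \<kappa>E_def by (simp add: lie_bracket_left_invariant)

definition "E0 = {e \<in> E. \<kappa>E e \<in> J0}"

lemma E0: "subspace E0" "E0 \<subseteq> E"
proof -
  have "\<kappa>E 0 = 0" using \<kappa>E_scale[of 0 0] subspace_0[OF subE] by simp
  then show "subspace E0"
    unfolding E0_def subspace_def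
    by (auto simp: \<kappa>E_add \<kappa>E_scale subspace_0[OF subE] subspace_0[OF J0(1)]
        intro: subspace_add[OF subE] subspace_add[OF J0(1)] subspace_scale[OF subE] subspace_scale[OF J0(1)])
  show "E0 \<subseteq> E" by (auto simp: E0_def)
qed

lemma cbr_E0: "u \<in> E0 \<Longrightarrow> v \<in> E0 \<Longrightarrow> cbr u v \<in> E0"
  by (simp add: E0_def \<kappa>E_cbr cbr_in_model J0(2))

text \<open>Linearity is inherited from \<open>br\<close>, as \<kappa>E is injective, linear on E
  and compatible with the brackets.\<close>

lemma cbr_add: "u \<in> E \<Longrightarrow> v \<in> E \<Longrightarrow> w \<in> E \<Longrightarrow> cbr u (v + w) = cbr u v + cbr u w"
  by (rule \<kappa>E_inj) (simp_all add: subspace_add[OF subE] cbr_in_model \<kappa>E_cbr \<kappa>E_add \<kappa>E_in br_add2)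

lemma cbr_scale: "u \<in> E \<Longrightarrow> v \<in> E \<Longrightarrow> cbr u (r *\<^sub>R v) = r *\<^sub>R cbr u v"
  by (rule \<kappa>E_inj) (simp_all add: subspace_scale[OF subE] cbr_in_model \<kappa>E_cbr \<kappa>E_scale \<kappa>E_in br_scale2)

definition "\<kappa>_ext = linext E \<kappa>E"
definition "prM_ext = linext J prM"
definition "L x = prM_ext (\<kappa>_ext x)"

lemma \<kappa>_ext: "bounded_linear \<kappa>_ext" "x \<in> E \<Longrightarrow> \<kappa>_ext x = \<kappa>E x"
  unfolding \<kappa>_ext_def by (rule linext[OF subE \<kappa>E_add \<kappa>E_scale]; assumption)+

lemma prM_ext: "bounded_linear prM_ext" "x \<in> J \<Longrightarrow> prM_ext x = prM x"
  unfolding prM_ext_def by (rule linext[OF J prM_add prM_scale]; assumption)+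

lemma L_bl: "bounded_linear L"
  unfolding L_def[abs_def] by (rule bounded_linear_compose[OF prM_ext(1) \<kappa>_ext(1)])

lemma L_eq: "x \<in> E \<Longrightarrow> L x = prM (\<kappa>E x)"
  by (simp add: L_def \<kappa>_ext prM_ext \<kappa>E_in)

lemma L_in: "x \<in> E \<Longrightarrow> L x \<in> M"
  by (simp add: L_eq prM_in \<kappa>E_in)

lemma L_ker: "x \<in> E \<Longrightarrow> L x = 0 \<longleftrightarrow> x \<in> E0"
  by (simp add: L_eq prM_zero_iff \<kappa>E_in E0_def)

lemma L_surj:
  assumes "y \<in> M" obtains x where "x \<in> E" "L x = y"
proof -
  obtain x where "x \<in> E" "\<kappa>E x = y" by (rule \<kappa>E_surj[OF M_J[OF assms]])
  then show thesis using that[of x] by (simp add: L_eq prM_M assms)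
qed

lemma maurer_cartan_lfield:
  assumes "g \<in> carrier G" "v \<in> E"
  shows "prM (maurer_cartan G MG \<kappa> g (lfield v g)) = L v"
  unfolding maurer_cartan_def pushforward_inv_lfield[OF assms] L_eq[OF assms(2)] \<kappa>E_def ..

text \<open>Write both elements as sums of an M-part and a J0-part. The bracket of the J0-parts has
  no M-component, the mixed brackets give the action of J0 on M, and the bracket of the M-parts
  gives \<open>bracket0\<close> and the terms with S. The grouping shows one endomorphism depending
  on j1 applied to the M-part of j2, minus the same with j1 and j2 exchanged.\<close>

lemma prM_br:
  assumes j: "j1 \<in> J" "j2 \<in> J"
  shows "prM (br j1 j2) = bracket0 k V app (prM j1) (prM j2) +
    (S (prM j1) (prM j2) + prM (br (j1 - prM j1) (prM j2))) -
    (S (prM j2) (prM j1) + prM (br (j2 - prM j2) (prM j1)))"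
proof -
  define m1 a1 m2 a2 where ma: "m1 = prM j1" "a1 = j1 - prM j1" "m2 = prM j2" "a2 = j2 - prM j2"
  have m: "m1 \<in> M" "m2 \<in> M" and a: "a1 \<in> J0" "a2 \<in> J0" using j by (simp_all add: ma prM_in diff_prM)
  note i = M_J[OF m(1)] M_J[OF m(2)] J0_J[OF a(1)] J0_J[OF a(2)]
  have e: "j1 = m1 + a1" "j2 = m2 + a2" by (simp_all add: ma)
  have "br j1 j2 = br m1 m2 + br m1 a2 + (br a1 m2 + br a1 a2)"
    unfolding e using i by (simp add: br_add1 br_add2 subspace_add[OF J])
  also have "br m1 a2 = - br a2 m1" by (rule br_skew[OF i(4,1)])
  also have "\<dots> = (-1) *\<^sub>R br a2 m1" by simp
  finally have "br j1 j2 = br m1 m2 + (-1) *\<^sub>R br a2 m1 + (br a1 m2 + br a1 a2)" .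
  then have "prM (br j1 j2) = prM (br m1 m2) + (-1) *\<^sub>R prM (br a2 m1) + (prM (br a1 m2) + prM (br a1 a2))"
    using i by (simp only: prM_add prM_scale br_in subspace_add[OF J] subspace_scale[OF J])
  also have "prM (br a1 a2) = 0" by (rule prM_J0[OF J0(2)[OF a]])
  finally show ?thesis unfolding S(4)[OF m] by (simp add: ma)
qed

lemma section_local_differential_equation:
  assumes Q: "rel_open M Q" and \<sigma>: "smooth_map (flat M Q) MG \<sigma>"
    and om: "\<And>y v. y \<in> Q \<Longrightarrow> v \<in> M \<Longrightarrow> om y (flat_vec Q v) = L (logd M \<sigma> y v)"
    and inj: "\<And>y v. y \<in> Q \<Longrightarrow> v \<in> M \<Longrightarrow> L (logd M \<sigma> y v) = 0 \<Longrightarrow> v = 0"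
  shows "\<exists>T. local_differential_equation k V app (flat M Q) T om"
proof -
  define j where "j y u = \<kappa>_ext (logd M \<sigma> y u)" for y u
  define w where "w y u = L (logd M \<sigma> y u)" for y u
  define SS where "SS m = linext M (\<lambda>x. S x m)" for m
  define BB where "BB m = linext J (\<lambda>a. prM (br a m))" for m
  \<comment> \<open>The correction in the structure equation: S at the M-part w of the logarithmic
    derivative plus the action of its J0-part j - w. Written with the bounded linear maps
    \<open>SS m\<close> and \<open>BB m\<close>, its linearity in u and smoothness in y are
    immediate.\<close>
  define F where "F y u m = SS m (w y u) + BB m (j y u - w y u)" for y u m
  have SS: "bounded_linear (SS m)" "x \<in> M \<Longrightarrow> SS m x = S x m" if "m \<in> M" for m x
    unfolding SS_def using linext[OF M, of "\<lambda>x. S x m"] S(2,3) that by auto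
  have BB: "bounded_linear (BB m)" "a \<in> J \<Longrightarrow> BB m a = prM (br a m)" if m: "m \<in> M" for m a
  proof -
    note mJ = M_J[OF m]
    have 1: "prM (br (x + y) m) = prM (br x m) + prM (br y m)" if "x \<in> J" "y \<in> J" for x y
      using that mJ by (simp add: br_add1 prM_add br_in)
    have 2: "prM (br (r *\<^sub>R x) m) = r *\<^sub>R prM (br x m)" if "x \<in> J" for r x
      using that mJ by (simp add: br_scale1 prM_scale br_in)
    show "bounded_linear (BB m)" "a \<in> J \<Longrightarrow> BB m a = prM (br a m)"
      unfolding BB_def using linext[OF J, of "\<lambda>a. prM (br a m)"] 1 2 by auto
  qed
  have logE: "logd M \<sigma> y u \<in> E" if "y \<in> Q" "u \<in> M" for y u by (rule logd_in_model[OF Q \<sigma> that])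
  have jJ: "j y u \<in> J" and wj: "w y u = prM (j y u)" if "y \<in> Q" "u \<in> M" for y u
    using logE[OF that] by (simp_all add: j_def w_def \<kappa>_ext \<kappa>E_in L_eq)
  have wM: "w y u \<in> M" if "y \<in> Q" "u \<in> M" for y u unfolding w_def by (rule L_in[OF logE[OF that]])
  have F_eq: "F y u m = S (w y u) m + prM (br (j y u - w y u) m)" if "y \<in> Q" "u \<in> M" "m \<in> M" for y u m
    using SS(2)[OF that(3) wM[OF that(1,2)]] BB(2)[OF that(3) subspace_diff[OF J jJ[OF that(1,2)] M_J[OF wM[OF that(1,2)]]]]
    by (simp add: F_def)
  have log_lin: "linear (logd M \<sigma> y)" if "y \<in> Q" for y by (rule logd_linear[OF Q \<sigma> that])
  have w_lin: "linear (w y)" if "y \<in> Q" for y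
    using linear_compose[OF log_lin[OF that] bounded_linear.linear[OF L_bl]] by (simp add: w_def[abs_def] comp_def)
  have j_lin: "linear (j y)" if "y \<in> Q" for y
    using linear_compose[OF log_lin[OF that] bounded_linear.linear[OF \<kappa>_ext(1)]] by (simp add: j_def[abs_def] comp_def)
  have log_smooth: "smooth_in M (\<lambda>y. logd M \<sigma> y v) Q" if "v \<in> M" for v by (rule smooth_logd[OF Q \<sigma> that])
  have w_smooth: "smooth_in M (\<lambda>y. w y v) Q" if "v \<in> M" for v
    unfolding w_def by (rule smooth_in_linear_image[OF Q L_bl log_smooth[OF that]])
  have j_smooth: "smooth_in M (\<lambda>y. j y v) Q" if "v \<in> M" for v
    unfolding j_def by (rule smooth_in_linear_image[OF Q \<kappa>_ext(1) log_smooth[OF that]])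
  have dL: "deriv_in M (\<lambda>z. w z v) y u = L (deriv_in M (\<lambda>z. logd M \<sigma> z v) y u)" if y: "y \<in> Q" and u: "u \<in> M" and v: "v \<in> M" for y u v
  proof (rule deriv_in_eq[OF M _ u])
    show "y \<in> M" using Q y openin_imp_subset unfolding rel_open_def by blast
    show "((\<lambda>z. w z v) has_derivative (\<lambda>u. L (deriv_in M (\<lambda>z. logd M \<sigma> z v) y u))) (at y within M)"
      unfolding w_def
      by (rule bounded_linear.has_derivative[OF L_bl deriv_in_works[OF smooth_in_differentiable[OF log_smooth[OF v] y]]])
  qed
  have "\<exists>T. local_differential_equation k V app (flat W Q) T om"
  proof (rule flat_local_differential_equation[where w=w and \<Phi>=F])
    show "rel_open W Q" using Q unfolding M_jet .
  next
    fix y v assume "y \<in> Q" "v \<in> W"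
    then show "om y (flat_vec Q v) = w y v" unfolding M_jet[symmetric] w_def by (rule om)
  next
    fix y v assume "y \<in> Q" "v \<in> W"
    then show "w y v \<in> W" unfolding M_jet[symmetric] by (rule wM)
  next
    fix y assume "y \<in> Q"
    then show "linear (w y)" by (rule w_lin)
  next
    fix v assume "v \<in> W"
    then show "smooth_in W (\<lambda>y. w y v) Q" unfolding M_jet[symmetric] by (rule w_smooth)
  next
    fix y assume y: "y \<in> Q"
    show "bij_betw (w y) W W" unfolding M_jet[symmetric]
    proof (rule bij_betw_linear_self[OF w_lin[OF y] M])
      fix v assume v: "v \<in> M"
      show "w y v \<in> M" by (rule wM[OF y v])
      show "w y v = 0 \<Longrightarrow> v = 0" unfolding w_def by (rule inj[OF y v])
    qed
  next
    fix y u assume yu: "y \<in> Q" "u \<in> W"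
    note yu' = yu[folded M_jet]
    have "j y u - w y u \<in> J0" unfolding wj[OF yu'] by (rule diff_prM[OF jJ[OF yu']])
    note en = endo_add[OF jet_endos_endo[OF S(1)[OF wM[OF yu']]] jet_endos_endo[OF \<rho>[OF this]]]
    show "endo (F y u)"
      by (rule endo_cong[OF en]) (use F_eq[OF yu'] in \<open>simp add: M_jet\<close>)
  next
    fix y m assume y: "y \<in> Q" and m: "m \<in> W"
    note mM = m[folded M_jet]
    interpret SS: bounded_linear "SS m" by (rule SS(1)[OF mM])
    interpret BB: bounded_linear "BB m" by (rule BB(1)[OF mM])
    show "linear (\<lambda>u. F y u m)"
      unfolding F_def
      by (intro linear_compose_add linear_compose[OF w_lin[OF y] SS.linear, unfolded comp_def]
          linear_compose[OF linear_compose_sub[OF j_lin[OF y] w_lin[OF y]] BB.linear, unfolded comp_def])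
  next
    fix u m assume u: "u \<in> W" and m: "m \<in> W"
    note mM = m[folded M_jet] and uM = u[folded M_jet]
    have "smooth_in M (\<lambda>y. j y u + - w y u) Q"
      by (rule smooth_in_add[OF Q j_smooth[OF uM] smooth_in_linear_minus[OF Q w_smooth[OF uM]]])
    then have d: "smooth_in M (\<lambda>y. j y u - w y u) Q" by simp
    show "smooth_in W (\<lambda>y. F y u m) Q"
      unfolding M_jet[symmetric] F_def
      by (rule smooth_in_add[OF Q smooth_in_linear_image[OF Q SS(1)[OF mM] w_smooth[OF uM]]
          smooth_in_linear_image[OF Q BB(1)[OF mM] d]])
  next
    fix y u v assume y: "y \<in> Q" and u: "u \<in> W" and v: "v \<in> W"
    note uM = u[folded M_jet] and vM = v[folded M_jet]
    interpret L: bounded_linear L by (rule L_bl)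
    \<comment> \<open>L is bounded linear, so it commutes with the derivatives and carries the
      structure equation of the group over to w.\<close>
    have "deriv_in M (\<lambda>z. w z v) y u - deriv_in M (\<lambda>z. w z u) y v = - L (cbr (logd M \<sigma> y u) (logd M \<sigma> y v))"
      unfolding dL[OF y uM vM] dL[OF y vM uM] L.diff[symmetric] structure_equation[OF Q \<sigma> y uM vM] by (rule L.neg)
    also have "L (cbr (logd M \<sigma> y u) (logd M \<sigma> y v)) = prM (br (j y u) (j y v))"
      using logE[OF y uM] logE[OF y vM] by (simp add: L_eq cbr_in_model \<kappa>E_cbr j_def \<kappa>_ext)
    also have "\<dots> = bracket0 k V app (w y u) (w y v) + F y u (w y v) - F y v (w y u)"
      unfolding prM_br[OF jJ[OF y uM] jJ[OF y vM]] F_eq[OF y uM wM[OF y vM]] F_eq[OF y vM wM[OF y uM]]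
      by (simp only: wj[OF y uM] wj[OF y vM])
    finally show "deriv_in W (\<lambda>z. w z v) y u - deriv_in W (\<lambda>z. w z u) y v =
        - (bracket0 k V app (w y u) (w y v) + F y u (w y v) - F y v (w y u))"
      unfolding M_jet .
  qed
  then show ?thesis unfolding M_jet .
qed

lemma local_structure:
  assumes g: "g \<in> carrier G"
  defines "om \<equiv> \<lambda>g t. prM (maurer_cartan G MG \<kappa> g t)"
  shows "\<exists>U (R :: ('j, 'j) manifold) \<pi>.
    openin (mtop MG) U \<and> g \<in> U \<and>
    smooth_manifold R \<and> mdim R = dim (jet_carrier k V) \<and>
    fibering (open_submanifold MG U) R \<pi> \<and>
    (\<exists>\<sigma>. cross_section (open_submanifold MG U) R \<pi> \<sigma>) \<and>
    (\<forall>y\<in>points R. \<exists>N.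
       mtop N = subtopology (mtop MG) {x \<in> U. \<pi> x = y} \<and>
       maximal_integral_manifold (open_submanifold MG U)
         (pullback (open_submanifold MG U) MG (\<lambda>x. x) om) N) \<and>
    (\<forall>\<sigma>. cross_section (open_submanifold MG U) R \<pi> \<sigma> \<longrightarrow>
       (\<exists>T. local_differential_equation k V app R T (pullback R MG \<sigma> om)))"
proof -
  obtain r \<Phi> \<Psi> U where c: "r > 0" "openin (mtop MG) U" "g \<in> U"
    "smooth_map (flat E (E \<inter> ball 0 r)) (open_submanifold MG U) \<Phi>"
    "smooth_map (open_submanifold MG U) (flat E (E \<inter> ball 0 r)) \<Psi>"
    "\<And>x. x \<in> E \<inter> ball 0 r \<Longrightarrow> \<Psi> (\<Phi> x) = x" "\<And>p. p \<in> U \<Longrightarrow> \<Phi> (\<Psi> p) = p"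
    "\<And>x v. x \<in> E \<inter> ball 0 r \<Longrightarrow> v \<in> E \<Longrightarrow> logd E \<Phi> x v \<in> E0 \<longleftrightarrow> v \<in> E0"
    by (rule foliated_chart[OF E0 cbr_E0 cbr_add cbr_scale g]) (assumption+, rule that)
  obtain gg where gg: "bounded_linear gg" "\<And>x. x \<in> E \<Longrightarrow> gg (L x) \<in> E" "\<And>x. x \<in> E \<Longrightarrow> L (gg (L x)) = L x"
    "\<And>x. x \<in> E \<Longrightarrow> norm (gg (L x)) \<le> norm x"
    by (rule obtain_contracting_inverse[OF L_bl subE E0 L_ker]) (assumption, rule that)
  have gM: "gg y \<in> E" "L (gg y) = y" if y: "y \<in> M" for y
  proof -
    obtain x where x: "x \<in> E" "L x = y" by (rule L_surj[OF y])
    show "gg y \<in> E" "L (gg y) = y" using gg(2,3)[OF x(1)] by (simp_all add: x(2))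
  qed
  interpret F: foliated G MG E0 r \<Phi> \<Psi> U L gg M om
  proof (intro foliated.intro lie_grp_axioms foliated_axioms.intro)
    show "smooth_manifold MG" using lie_group by (simp add: lie_group_def)
    fix g v assume "g \<in> carrier G" "v \<in> E"
    then show "om g (lfield v g) = L v" unfolding om_def by (rule maurer_cartan_lfield)
  qed (fact E0 c M L_bl gg(1,4) gM L_in L_ker)+
  show ?thesis
  proof (intro exI[of _ U] exI[of _ F.R] exI[of _ F.pr] conjI ballI allI impI)
    show "openin (mtop MG) U" "g \<in> U" by (fact c)+
    show "smooth_manifold F.R" by (rule smooth_manifold_flat[OF F.Om])
    show "mdim F.R = dim (jet_carrier k V)" by (simp add: mdim_def M_jet)
    show "fibering (open_submanifold MG U) F.R F.pr" by (rule F.fibering_pr)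
    show "\<exists>\<sigma>. cross_section (open_submanifold MG U) F.R F.pr \<sigma>" by (rule F.section_exists)
  next
    fix y assume "y \<in> points F.R"
    then have y: "y \<in> F.Om" by simp
    have "mtop (F.fman y) = subtopology (mtop MG) {x \<in> U. F.pr x = y}" by (simp add: F.fib_def)
    with F.fib_maximal[OF y] show "\<exists>N. mtop N = subtopology (mtop MG) {x \<in> U. F.pr x = y} \<and>
       maximal_integral_manifold (open_submanifold MG U)
         (pullback (open_submanifold MG U) MG (\<lambda>x. x) om) N" by blast
  next
    fix \<sigma> assume \<sigma>: "cross_section (open_submanifold MG U) F.R F.pr \<sigma>"
    show "\<exists>T. local_differential_equation k V app F.R T (pullback F.R MG \<sigma> om)"
      by (rule section_local_differential_equation[OF F.Om F.cross_section_logd[OF \<sigma>]])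
  qed
qed

end

theorem theorem6p1:
  fixes J M J0 :: "'j::euclidean_space set"
    and br :: "'j \<Rightarrow> 'j \<Rightarrow> 'j"
    and k :: nat
    and V :: "int \<Rightarrow> 'j set"
    and app :: "'j \<Rightarrow> 'j \<Rightarrow> 'j"
    and G :: "'g monoid"
    and MG :: "('g, 'e::euclidean_space) manifold"
    and \<kappa> :: "('g, 'e) tvec \<Rightarrow> 'j"
    and \<theta> \<omega> :: "('g, 'e, 'j) form1"
  assumes "differential_lie_algebra k V app J br M J0"
    and "lie_group G MG"
    and "lie_algebra_identification G MG J br \<kappa>"
    and "\<theta> = maurer_cartan G MG \<kappa>"
    and "\<omega> = (\<lambda>g t. proj_along M J0 (\<theta> g t))"
  shows "\<forall>g\<in>carrier G. \<exists>U (R :: ('j, 'j) manifold) \<pi>.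
    openin (mtop MG) U \<and> g \<in> U \<and>
    smooth_manifold R \<and> mdim R = dim (jet_carrier k V) \<and>
    fibering (open_submanifold MG U) R \<pi> \<and>
    (\<exists>\<sigma>. cross_section (open_submanifold MG U) R \<pi> \<sigma>) \<and>
    (\<forall>y\<in>points R. \<exists>N.
       mtop N = subtopology (mtop MG) {x \<in> U. \<pi> x = y} \<and>
       maximal_integral_manifold (open_submanifold MG U)
         (pullback (open_submanifold MG U) MG (\<lambda>x. x) \<omega>) N) \<and>
    (\<forall>\<sigma>. cross_section (open_submanifold MG U) R \<pi> \<sigma> \<longrightarrow>
       (\<exists>T. local_differential_equation k V app R T (pullback R MG \<sigma> \<omega>)))"
proof
  fix g assume g: "g \<in> carrier G"
  interpret differential_lie_group G MG J M J0 br k V app \<kappa>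
    by (intro differential_lie_group.intro lie_grp.intro differential_lie_group_axioms.intro assms(1-3))
  show "\<exists>U (R :: ('j, 'j) manifold) \<pi>.
    openin (mtop MG) U \<and> g \<in> U \<and>
    smooth_manifold R \<and> mdim R = dim (jet_carrier k V) \<and>
    fibering (open_submanifold MG U) R \<pi> \<and>
    (\<exists>\<sigma>. cross_section (open_submanifold MG U) R \<pi> \<sigma>) \<and>
    (\<forall>y\<in>points R. \<exists>N.
       mtop N = subtopology (mtop MG) {x \<in> U. \<pi> x = y} \<and>
       maximal_integral_manifold (open_submanifold MG U)
         (pullback (open_submanifold MG U) MG (\<lambda>x. x) \<omega>) N) \<and>
    (\<forall>\<sigma>. cross_section (open_submanifold MG U) R \<pi> \<sigma> \<longrightarrow>
       (\<exists>T. local_differential_equation k V app R T (pullback R MG \<sigma> \<omega>)))"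
    unfolding assms(4,5) by (rule local_structure[OF g])
qed

end
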